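(* Let $T$ be a consistent primitive recursively axiomatized $\mathcal{L}_A$-theory containing $\mathsf{PA}$. Then there exists a Rosser's provability predicate $\mathrm{Pr}^{\mathrm{R}}_T(x)$ of $T$ such that (1) for any modal formula $A$ and any arithmetical interpretation $f$ based on $\mathrm{Pr}^{\mathrm{R}}_T(x)$, if $\mathbf{NR4} \vdash A$, then $\mathsf{PA} \vdash f(A)$; and (2) there exists an arithmetical interpretation $f$ based on $\mathrm{Pr}^{\mathrm{R}}_T(x)$ such that for any modal formula $A$, $\mathbf{NR4} \vdash A$ if and only if $T \vdash f(A)$.
   Context: $\mathcal{L}_A$ is the language of first-order arithmetic. Let $\mathrm{Proof}_T(x,y)$ be the standard primitive recursive proof predicate of $T$, $\mathrm{Prov}_T(x) :\equiv \exists y\,\mathrm{Proof}_T(x,y)$, $\mathrm{Fml}(x)$ a primitive recursive formula expressing "$x$ codes an $\mathcal{L}_A$-formula", and $\dot\neg(x)$ a primitive recursive term computing the code of $\neg\varphi$ from that of $\varphi$. A $\Sigma_1$ formula $\mathrm{Pr}^{\mathrm{R}}_T(x)$ is a Rosser's provability predicate of $T$ if there is a primitive recursive formula $\mathrm{Prf}_T(x,y)$ such that: (i) for every $\mathcal{L}_A$-formula $\varphi$ and $n\in\omega$, $\mathsf{PA} \vdash \mathrm{Proof}_T(\ulcorner\varphi\urcorner,\bar n) \leftrightarrow \mathrm{Prf}_T(\ulcorner\varphi\urcorner,\bar n)$; (ii) $\mathsf{PA} \vdash \forall x(\mathrm{Fml}(x) \to (\mathrm{Prov}_T(x) \leftrightarrow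 \exists y\,\mathrm{Prf}_T(x,y)))$; (iii) $\mathrm{Pr}^{\mathrm{R}}_T(x)$ is $\exists y(\mathrm{Fml}(x) \land \mathrm{Prf}_T(x,y) \land \forall z<y\, \neg \mathrm{Prf}_T(\dot\neg(x),z))$. Modal formulas are built from propositional variables and $\bot$ using $\neg,\land,\lor,\to$ and $\Box$. An arithmetical interpretation based on $\mathrm{Pr}(x)$ is a map $f$ from modal formulas to $\mathcal{L}_A$-sentences with $f(p)$ arbitrary for variables, $f(\bot)$ being $0=1$, $f$ commuting with Boolean connectives, and $f(\Box A)$ being $\mathrm{Pr}(\ulcorner f(A)\urcorner)$. $\mathbf{N}$ has all propositional tautologies as axioms and Modus Ponens and Necessitation $A/\Box A$ as rules; $\mathbf{NR}$ is $\mathbf{N}$ plus the rule $\neg B/\neg\Box B$; $\mathbf{NR4}$ is $\mathbf{NR}$ plus the axiom scheme $\Box B \to \Box\Box B$. *)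

theory Defs
  imports "HOL-Library.Nat_Bijection" "HOL-Number_Theory.Cong"
begin

section \<open>First-order arithmetic\<close>

text \<open>
  The language is \<open>{0, S, +, \<times>, <, =}\<close> with de Bruijn indices. All of \<open>\<not>, \<and>, \<or>, \<rightarrow>, \<forall>, \<exists>\<close> are
  primitive. This matters: the modal logics below are not closed under replacement of equivalents,
  so no connective may be an abbreviation that makes two different modal formulas have the same
  arithmetical translation.
\<close>

datatype tm = Var nat | Zero | Succ tm | Plus tm tm | Times tm tm

datatype fm =
    Eq tm tm | Less tm tm
  | Neg fm | Conj fm fm | Disj fm fm | Imp fm fm
  | Forall fm | Exists fm

abbreviation Iff :: "fm \<Rightarrow> fm \<Rightarrow> fm" where
  "Iff \<phi> \<psi> \<equiv> Conj (Imp \<phi> \<psi>) (Imp \<psi> \<phi>)"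

primrec tsubst :: "(nat \<Rightarrow> tm) \<Rightarrow> tm \<Rightarrow> tm" where
  "tsubst \<sigma> (Var i) = \<sigma> i"
| "tsubst \<sigma> Zero = Zero"
| "tsubst \<sigma> (Succ t) = Succ (tsubst \<sigma> t)"
| "tsubst \<sigma> (Plus s t) = Plus (tsubst \<sigma> s) (tsubst \<sigma> t)"
| "tsubst \<sigma> (Times s t) = Times (tsubst \<sigma> s) (tsubst \<sigma> t)"

definition tlift :: "nat \<Rightarrow> tm \<Rightarrow> tm" where
  "tlift k = tsubst (\<lambda>i. Var (i + k))"

definition up :: "(nat \<Rightarrow> tm) \<Rightarrow> nat \<Rightarrow> tm" where
  "up \<sigma> = case_nat (Var 0) (\<lambda>i. tlift 1 (\<sigma> i))"

primrec fsubst :: "(nat \<Rightarrow> tm) \<Rightarrow> fm \<Rightarrow> fm" where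
  "fsubst \<sigma> (Eq s t) = Eq (tsubst \<sigma> s) (tsubst \<sigma> t)"
| "fsubst \<sigma> (Less s t) = Less (tsubst \<sigma> s) (tsubst \<sigma> t)"
| "fsubst \<sigma> (Neg \<phi>) = Neg (fsubst \<sigma> \<phi>)"
| "fsubst \<sigma> (Conj \<phi> \<psi>) = Conj (fsubst \<sigma> \<phi>) (fsubst \<sigma> \<psi>)"
| "fsubst \<sigma> (Disj \<phi> \<psi>) = Disj (fsubst \<sigma> \<phi>) (fsubst \<sigma> \<psi>)"
| "fsubst \<sigma> (Imp \<phi> \<psi>) = Imp (fsubst \<sigma> \<phi>) (fsubst \<sigma> \<psi>)"
| "fsubst \<sigma> (Forall \<phi>) = Forall (fsubst (up \<sigma>) \<phi>)"
| "fsubst \<sigma> (Exists \<phi>) = Exists (fsubst (up \<sigma>) \<phi>)"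

text \<open>\<open>inst \<phi> t\<close> is the body of a quantifier instantiated with \<open>t\<close>; \<open>app \<phi> ts\<close> is \<open>\<phi>(t\<^sub>0,\<dots>,t\<^sub>n)\<close>,
  for a formula \<open>\<phi>\<close> whose free variables are among the first \<open>n + 1\<close> ones.\<close>

definition inst :: "fm \<Rightarrow> tm \<Rightarrow> fm" where
  "inst \<phi> t = fsubst (case_nat t Var) \<phi>"

definition fshift :: "fm \<Rightarrow> fm" where
  "fshift = fsubst (\<lambda>i. Var (Suc i))"

definition app :: "fm \<Rightarrow> tm list \<Rightarrow> fm" where
  "app \<phi> ts = fsubst (\<lambda>i. if i < length ts then ts ! i else Var i) \<phi>"

primrec tm_below :: "nat \<Rightarrow> tm \<Rightarrow> bool" where
  "tm_below n (Var i) = (i < n)"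
| "tm_below n Zero = True"
| "tm_below n (Succ t) = tm_below n t"
| "tm_below n (Plus s t) = (tm_below n s \<and> tm_below n t)"
| "tm_below n (Times s t) = (tm_below n s \<and> tm_below n t)"

primrec fm_below :: "nat \<Rightarrow> fm \<Rightarrow> bool" where
  "fm_below n (Eq s t) = (tm_below n s \<and> tm_below n t)"
| "fm_below n (Less s t) = (tm_below n s \<and> tm_below n t)"
| "fm_below n (Neg \<phi>) = fm_below n \<phi>"
| "fm_below n (Conj \<phi> \<psi>) = (fm_below n \<phi> \<and> fm_below n \<psi>)"
| "fm_below n (Disj \<phi> \<psi>) = (fm_below n \<phi> \<and> fm_below n \<psi>)"
| "fm_below n (Imp \<phi> \<psi>) = (fm_below n \<phi> \<and> fm_below n \<psi>)"
| "fm_below n (Forall \<phi>) = fm_below (Suc n) \<phi>"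
| "fm_below n (Exists \<phi>) = fm_below (Suc n) \<phi>"

definition sentence :: "fm \<Rightarrow> bool" where
  "sentence \<phi> \<longleftrightarrow> fm_below 0 \<phi>"

primrec numeral_tm :: "nat \<Rightarrow> tm" where
  "numeral_tm 0 = Zero"
| "numeral_tm (Suc n) = Succ (numeral_tm n)"


section \<open>Derivability\<close>

inductive logical_axiom :: "fm \<Rightarrow> bool" where
  imp1: "logical_axiom (Imp A (Imp B A))"
| imp2: "logical_axiom (Imp (Imp A (Imp B C)) (Imp (Imp A B) (Imp A C)))"
| conj1: "logical_axiom (Imp (Conj A B) A)"
| conj2: "logical_axiom (Imp (Conj A B) B)"
| conj3: "logical_axiom (Imp A (Imp B (Conj A B)))"
| disj1: "logical_axiom (Imp A (Disj A B))"
| disj2: "logical_axiom (Imp A (Disj B A))"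
| disj3: "logical_axiom (Imp (Imp A C) (Imp (Imp B C) (Imp (Disj A B) C)))"
| neg1: "logical_axiom (Imp (Imp A B) (Imp (Imp A (Neg B)) (Neg A)))"
| neg2: "logical_axiom (Imp (Neg (Neg A)) A)"
| all1: "logical_axiom (Imp (Forall A) (inst A t))"
| all2: "logical_axiom (Imp (Forall (Imp (fshift B) A)) (Imp B (Forall A)))"
| ex1: "logical_axiom (Imp (inst A t) (Exists A))"
| ex2: "logical_axiom (Imp (Forall (Imp A (fshift B))) (Imp (Exists A) B))"
| eq1: "logical_axiom (Eq s s)"
| eq2: "logical_axiom (Imp (Eq s t) (Imp (Eq s u) (Eq t u)))"
| eq_Succ: "logical_axiom (Imp (Eq s t) (Eq (Succ s) (Succ t)))"
| eq_Plus: "logical_axiom (Imp (Eq s t) (Imp (Eq u v) (Eq (Plus s u) (Plus t v))))"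
| eq_Times: "logical_axiom (Imp (Eq s t) (Imp (Eq u v) (Eq (Times s u) (Times t v))))"
| eq_Less: "logical_axiom (Imp (Eq s t) (Imp (Eq u v) (Imp (Less s u) (Less t v))))"

inductive derivable :: "fm set \<Rightarrow> fm \<Rightarrow> bool" (infix \<open>\<turnstile>\<close> 50) for T where
  logical: "logical_axiom \<phi> \<Longrightarrow> T \<turnstile> \<phi>"
| nonlogical: "\<phi> \<in> T \<Longrightarrow> T \<turnstile> \<phi>"
| mp: "T \<turnstile> Imp \<psi> \<phi> \<Longrightarrow> T \<turnstile> \<psi> \<Longrightarrow> T \<turnstile> \<phi>"
| gen: "T \<turnstile> \<phi> \<Longrightarrow> T \<turnstile> Forall \<phi>"

definition consistent :: "fm set \<Rightarrow> bool" where
  "consistent T \<longleftrightarrow> \<not> (\<exists>\<phi>. T \<turnstile> \<phi> \<and> T \<turnstile> Neg \<phi>)"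

text \<open>Hilbert-style proofs as sequences of formulas, the last line of the proof being the head
  of the list.\<close>

primrec is_proof :: "fm set \<Rightarrow> fm list \<Rightarrow> bool" where
  "is_proof T [] \<longleftrightarrow> True"
| "is_proof T (\<phi> # L) \<longleftrightarrow> is_proof T L \<and>
    (logical_axiom \<phi> \<or> \<phi> \<in> T \<or> (\<exists>\<psi>\<in>set L. Imp \<psi> \<phi> \<in> set L) \<or> (\<exists>\<psi>\<in>set L. \<phi> = Forall \<psi>))"

definition induction_fm :: "fm \<Rightarrow> fm" where
  "induction_fm \<phi> =
    Imp (Conj (inst \<phi> Zero)
              (Forall (Imp \<phi> (fsubst (case_nat (Succ (Var 0)) (\<lambda>i. Var (Suc i))) \<phi>))))
        (Forall \<phi>)"

inductive_set PA :: "fm set" where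
  "Forall (Neg (Eq (Succ (Var 0)) Zero)) \<in> PA"
| "Forall (Forall (Imp (Eq (Succ (Var 1)) (Succ (Var 0))) (Eq (Var 1) (Var 0)))) \<in> PA"
| "Forall (Eq (Plus (Var 0) Zero) (Var 0)) \<in> PA"
| "Forall (Forall (Eq (Plus (Var 1) (Succ (Var 0))) (Succ (Plus (Var 1) (Var 0))))) \<in> PA"
| "Forall (Eq (Times (Var 0) Zero) Zero) \<in> PA"
| "Forall (Forall (Eq (Times (Var 1) (Succ (Var 0))) (Plus (Times (Var 1) (Var 0)) (Var 1)))) \<in> PA"
| "Forall (Neg (Less (Var 0) Zero)) \<in> PA"
| "Forall (Forall (Iff (Less (Var 1) (Succ (Var 0)))
                       (Disj (Less (Var 1) (Var 0)) (Eq (Var 1) (Var 0))))) \<in> PA"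
| "sentence ((Forall ^^ n) (induction_fm \<phi>)) \<Longrightarrow> (Forall ^^ n) (induction_fm \<phi>) \<in> PA"

inductive delta0 :: "fm \<Rightarrow> bool" where
  "delta0 (Eq s t)"
| "delta0 (Less s t)"
| "delta0 \<phi> \<Longrightarrow> delta0 (Neg \<phi>)"
| "delta0 \<phi> \<Longrightarrow> delta0 \<psi> \<Longrightarrow> delta0 (Conj \<phi> \<psi>)"
| "delta0 \<phi> \<Longrightarrow> delta0 \<psi> \<Longrightarrow> delta0 (Disj \<phi> \<psi>)"
| "delta0 \<phi> \<Longrightarrow> delta0 \<psi> \<Longrightarrow> delta0 (Imp \<phi> \<psi>)"
| "delta0 \<phi> \<Longrightarrow> delta0 (Forall (Imp (Less (Var 0) (tlift 1 t)) \<phi>))"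
| "delta0 \<phi> \<Longrightarrow> delta0 (Exists (Conj (Less (Var 0) (tlift 1 t)) \<phi>))"

text \<open>As usual, being \<open>\<Sigma>\<^sub>1\<close> is understood up to equivalence in Peano arithmetic.\<close>

definition Sigma1 :: "fm \<Rightarrow> bool" where
  "Sigma1 \<phi> \<longleftrightarrow> (\<exists>n \<delta>. delta0 \<delta> \<and> PA \<turnstile> Iff \<phi> ((Exists ^^ n) \<delta>))"


section \<open>Primitive recursive functions and formulas\<close>

text \<open>Descriptions of primitive recursive functions. Missing arguments count as \<open>0\<close>,
  so that every description denotes a primitive recursive function of every arity.\<close>

datatype pr = PZero | PSucc | PProj nat | PComp pr "pr list" | PRec pr pr

definition arg :: "'a \<Rightarrow> 'a list \<Rightarrow> nat \<Rightarrow> 'a" where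
  "arg z xs i = (if i < length xs then xs ! i else z)"

fun eval :: "pr \<Rightarrow> nat list \<Rightarrow> nat" where
  "eval PZero xs = 0"
| "eval PSucc xs = Suc (arg 0 xs 0)"
| "eval (PProj i) xs = arg 0 xs i"
| "eval (PComp f gs) xs = eval f (map (\<lambda>g. eval g xs) gs)"
| "eval (PRec f g) [] = 0"
| "eval (PRec f g) (n # xs) = rec_nat (eval f xs) (\<lambda>k r. eval g (k # r # xs)) n"

text \<open>\<open>beta_fm a b i w\<close> says that \<open>w\<close> is the remainder of \<open>a\<close> modulo \<open>1 + (i + 1) b\<close>
  (Goedel's beta function), and \<open>graph f ts t\<close> is the canonical formula \<open>f(ts) = t\<close>.\<close>

definition beta_fm :: "tm \<Rightarrow> tm \<Rightarrow> tm \<Rightarrow> tm \<Rightarrow> fm" where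
  "beta_fm a b i w =
    (let m = Succ (Times (Succ i) b) in
      Conj (Less w m)
        (Exists (Conj (Less (Var 0) (Succ (tlift 1 a)))
                      (Eq (tlift 1 a) (Plus (Times (Var 0) (tlift 1 m)) (tlift 1 w))))))"

function graph :: "pr \<Rightarrow> tm list \<Rightarrow> tm \<Rightarrow> fm" where
  "graph PZero ts t = Eq t Zero"
| "graph PSucc ts t = Eq t (Succ (arg Zero ts 0))"
| "graph (PProj i) ts t = Eq t (arg Zero ts i)"
| "graph (PComp f gs) ts t =
    (let m = length gs in
      (Exists ^^ m)
        (foldr Conj
          (map (\<lambda>(i, g). graph g (map (tlift m) ts) (Var i)) (zip [0..<m] gs))
          (graph f (map Var [0..<m]) (tlift m t))))"
| "graph (PRec f g) [] t = Eq t Zero"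
| "graph (PRec f g) (n # ts) t =
    Exists (Exists
      (Conj (Exists (Conj (graph f (map (tlift 3) ts) (Var 0))
                          (beta_fm (Var 2) (Var 1) Zero (Var 0))))
      (Conj (Forall (Imp (Less (Var 0) (tlift 3 n))
              (Exists (Exists
                (Conj (beta_fm (Var 4) (Var 3) (Var 2) (Var 1))
                (Conj (beta_fm (Var 4) (Var 3) (Succ (Var 2)) (Var 0))
                      (graph g (Var 2 # Var 1 # map (tlift 5) ts) (Var 0))))))))
            (beta_fm (Var 1) (Var 0) (tlift 2 n) (tlift 2 t)))))"
  by pat_completeness auto
termination
  by (relation "measure (\<lambda>(f, _, _). size f)")
     (auto dest!: set_zip_rightD simp: less_Suc_eq_le intro!: trans_le_add1 size_list_estimation'[OF _ order_refl])

definition pr_formula :: "nat \<Rightarrow> fm \<Rightarrow> bool" where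
  "pr_formula n \<phi> \<longleftrightarrow> (\<exists>f. \<phi> = graph f (map Var [0..<n]) (Succ Zero))"


section \<open>Goedel numbers\<close>

text \<open>Formulas are coded so that negation is computed by the term \<open>8 x + 2\<close> of the language.\<close>

primrec gnt :: "tm \<Rightarrow> nat" where
  "gnt (Var i) = 5 * i"
| "gnt Zero = 1"
| "gnt (Succ t) = 5 * gnt t + 2"
| "gnt (Plus s t) = 5 * prod_encode (gnt s, gnt t) + 3"
| "gnt (Times s t) = 5 * prod_encode (gnt s, gnt t) + 4"

primrec gn :: "fm \<Rightarrow> nat" where
  "gn (Eq s t) = 8 * prod_encode (gnt s, gnt t)"
| "gn (Less s t) = 8 * prod_encode (gnt s, gnt t) + 1"
| "gn (Neg \<phi>) = 8 * gn \<phi> + 2"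
| "gn (Conj \<phi> \<psi>) = 8 * prod_encode (gn \<phi>, gn \<psi>) + 3"
| "gn (Disj \<phi> \<psi>) = 8 * prod_encode (gn \<phi>, gn \<psi>) + 4"
| "gn (Imp \<phi> \<psi>) = 8 * prod_encode (gn \<phi>, gn \<psi>) + 5"
| "gn (Forall \<phi>) = 8 * gn \<phi> + 6"
| "gn (Exists \<phi>) = 8 * gn \<phi> + 7"

abbreviation quot :: "fm \<Rightarrow> tm" where
  "quot \<phi> \<equiv> numeral_tm (gn \<phi>)"

definition neg_tm :: "tm \<Rightarrow> tm" where
  "neg_tm t = Plus (Times (numeral_tm 8) t) (numeral_tm 2)"

definition list_gn :: "fm list \<Rightarrow> nat" where
  "list_gn L = list_encode (map gn L)"


section \<open>Arithmetization of syntax\<close>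

text \<open>The combinators below build descriptions from descriptions of the arguments; their values are
  given by the lemmas named \<open>eval_\<dots>\<close> at the end. A Boolean is true if it is nonzero.\<close>

subsection \<open>Arithmetic, pairs and lists\<close>

primrec pnum :: "nat \<Rightarrow> pr" where
  "pnum 0 = PZero"
| "pnum (Suc n) = PComp PSucc [pnum n]"

definition psuc where "psuc a = PComp PSucc [a]"
definition ppred where "ppred a = PComp (PRec PZero (PProj 0)) [a]"
definition padd where "padd a b = PComp (PRec (PProj 0) (psuc (PProj 1))) [a, b]"
definition pmult where "pmult a b = PComp (PRec PZero (padd (PProj 1) (PProj 2))) [a, b]"
definition psub where "psub a b = PComp (PRec (PProj 0) (ppred (PProj 1))) [b, a]"
definition pnot where "pnot a = PComp (PRec (pnum 1) PZero) [a]"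
definition por where "por a b = pnot (pnot (padd a b))"
definition pand where "pand a b = pnot (padd (pnot a) (pnot b))"
definition ple where "ple a b = pnot (psub a b)"
definition peq where "peq a b = pand (ple a b) (ple b a)"
definition pite where "pite c a b = PComp (PRec (PProj 1) (PProj 2)) [c, a, b]"
definition pmod where
  "pmod a k = PComp (PRec PZero (pite (peq (psuc (PProj 1)) (pnum k)) PZero (psuc (PProj 1)))) [a]"
definition pdiv where
  "pdiv a k = PComp (PRec PZero (padd (PProj 1) (pnot (pmod (psuc (PProj 0)) k)))) [a]"
definition pex where  \<comment> \<open>\<open>\<exists>i < a. p i bs\<close>\<close>
  "pex p a bs = PComp (PRec PZero
     (por (PProj 1) (PComp p (PProj 0 # map PProj [2..<2 + length bs])))) (a # bs)"

definition ptriangle where "ptriangle a = PComp (PRec PZero (padd (PProj 1) (psuc (PProj 0)))) [a]"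
definition ppair where "ppair a b = padd (ptriangle (padd a b)) a"
definition pdiag where  \<comment> \<open>largest \<open>d\<close> with \<open>triangle d \<le> a\<close>\<close>
  "pdiag a = PComp (PRec PZero
     (padd (PProj 1) (ple (ptriangle (psuc (PProj 1))) (psuc (PProj 0))))) [a]"
definition pfst where "pfst a = psub a (ptriangle (pdiag a))"
definition psnd where "psnd a = psub (pdiag a) (pfst a)"

definition pcons where "pcons a b = psuc (ppair a b)"
definition phd where "phd a = pfst (ppred a)"
definition ptl where "ptl a = psnd (ppred a)"
definition pdrop where "pdrop i a = PComp (PRec (PProj 0) (ptl (PProj 1))) [i, a]"
definition pmem where
  "pmem x l = pex (pand (pdrop (PProj 0) (PProj 2)) (peq (phd (pdrop (PProj 0) (PProj 2))) (PProj 1)))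
     l [x, l]"

text \<open>Course-of-values recursion: \<open>G\<close> is applied to the current number, the list of the
  previous values (most recent first) and the parameters; \<open>plook m\<close> is the previous value at \<open>m\<close>.\<close>

definition pcov where
  "pcov G a bs = phd (PComp (PRec PZero (pcons G (PProj 1))) (psuc a # bs))"
definition plook where
  "plook m = phd (pdrop (psub (ppred (PProj 0)) m) (PProj 1))"

subsection \<open>Terms and formulas\<close>

definition pcode2 :: "nat \<Rightarrow> nat \<Rightarrow> pr \<Rightarrow> pr \<Rightarrow> pr" where
  "pcode2 k tag a b = padd (pmult (pnum k) (ppair a b)) (pnum tag)"
definition pcode1 :: "nat \<Rightarrow> nat \<Rightarrow> pr \<Rightarrow> pr" where
  "pcode1 k tag a = padd (pmult (pnum k) a) (pnum tag)"

definition pVar where "pVar = pcode1 5 0"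
definition pSucc where "pSucc = pcode1 5 2"
definition pPlus where "pPlus = pcode2 5 3"
definition pTimes where "pTimes = pcode2 5 4"
definition pEq where "pEq = pcode2 8 0"
definition pLess where "pLess = pcode2 8 1"
definition pNeg where "pNeg = pcode1 8 2"
definition pConj where "pConj = pcode2 8 3"
definition pDisj where "pDisj = pcode2 8 4"
definition pImp where "pImp = pcode2 8 5"
definition pForall where "pForall = pcode1 8 6"
definition pExists where "pExists = pcode1 8 7"

definition psel :: "pr \<Rightarrow> pr list \<Rightarrow> pr \<Rightarrow> pr" where
  "psel a cs d = foldr (\<lambda>(i, c) r. pite (peq a (pnum i)) c r) (zip [0..<length cs] cs) d"

definition pis_tm :: "pr \<Rightarrow> pr" where
  "pis_tm a = pcov
    (let x = PProj 0; p = pdiv x 5; l = plook (pfst p); r = plook (psnd p) in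
      psel (pmod x 5) [pnum 1, pnot p, plook p, pand l r] (pand l r)) a []"

definition pis_fm :: "pr \<Rightarrow> pr" where
  "pis_fm a = pcov
    (let x = PProj 0; p = pdiv x 8; l = plook (pfst p); r = plook (psnd p);
         at = pand (pis_tm (pfst p)) (pis_tm (psnd p)) in
      psel (pmod x 8) [at, at, plook p, pand l r, pand l r, pand l r, plook p] (plook p)) a []"

text \<open>\<open>ptsubst \<sigma> t k s\<close> replaces every variable \<open>i\<close> of \<open>t\<close> by \<open>\<sigma>(i, k, s)\<close>;
  \<open>pfsubst \<sigma> x s\<close> does the same for the formula \<open>x\<close>, where \<open>k\<close> counts the quantifiers passed.
  The latter is a recursion on the pair of \<open>x\<close> and \<open>k\<close>.\<close>

definition ptsubst :: "pr \<Rightarrow> pr \<Rightarrow> pr \<Rightarrow> pr \<Rightarrow> pr" where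
  "ptsubst \<sigma> t k s = pcov
    (let x = PProj 0; p = pdiv x 5; l = plook (pfst p); r = plook (psnd p) in
      psel (pmod x 5)
        [PComp \<sigma> [p, PProj 2, PProj 3], pnum 1, pSucc (plook p), pPlus l r] (pTimes l r))
    t [k, s]"

definition pfsubst :: "pr \<Rightarrow> pr \<Rightarrow> pr \<Rightarrow> pr" where
  "pfsubst \<sigma> x s = pcov
    (let x = pfst (PProj 0); k = psnd (PProj 0); s = PProj 2; p = pdiv x 8;
         l = pfst p; r = psnd p;
         tl = ptsubst \<sigma> l k s; tr = ptsubst \<sigma> r k s;
         p0 = plook (ppair p k); p1 = plook (ppair p (psuc k));
         l0 = plook (ppair l k); r0 = plook (ppair r k) in
      psel (pmod x 8)
        [pEq tl tr, pLess tl tr, pNeg p0, pConj l0 r0, pDisj l0 r0, pImp l0 r0, pForall p1]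
        (pExists p1))
    (ppair x PZero) [s]"

definition pfshift :: "pr \<Rightarrow> pr" where
  "pfshift x = pfsubst
    (pVar (pite (ple (PProj 1) (PProj 0)) (psuc (PProj 0)) (PProj 0))) x PZero"

definition ptlift :: "pr \<Rightarrow> pr \<Rightarrow> pr" where
  "ptlift k t = ptsubst (pVar (padd (PProj 0) (PProj 1))) t k PZero"

definition pinst :: "pr \<Rightarrow> pr \<Rightarrow> pr" where
  "pinst x t = pfsubst
    (let i = PProj 0; k = PProj 1; s = PProj 2 in
      pite (peq i k) (ptlift k s) (pVar (pite (ple k i) (ppred i) i))) x t"

subsection \<open>Proofs\<close>

text \<open>For an implication \<open>x\<close>, \<open>L x\<close> and \<open>R x\<close> are its sides (likewise for conjunctions, equations
  etc.), and \<open>U x\<close> is the body of a quantified formula. In the quantifier axioms it is enough to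
  look for terms \<open>t \<le> x\<close>, because otherwise \<open>t\<close> does not occur in the result of the substitution.\<close>

definition plogical_axiom :: "pr \<Rightarrow> pr" where
  "plogical_axiom a = PComp
    (let x = PProj 0; U = (\<lambda>x. pdiv x 8); L = (\<lambda>x. pfst (U x)); R = (\<lambda>x. psnd (U x));
         Q = (\<lambda>c. pex (pand (pis_tm (PProj 0)) (peq (PProj 1) c)) (psuc x) [x]); y = PProj 1 in
     foldr por
      [let A = L x; B = L (R x) in peq x (pImp A (pImp B A)),
       let A = L (L x); B = L (R (L x)); C = R (R (L x)) in
         peq x (pImp (pImp A (pImp B C)) (pImp (pImp A B) (pImp A C))),
       let A = L (L x); B = R (L x) in peq x (pImp (pConj A B) A),
       let A = L (L x); B = R (L x) in peq x (pImp (pConj A B) B),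
       let A = L x; B = L (R x) in peq x (pImp A (pImp B (pConj A B))),
       let A = L x; B = R (R x) in peq x (pImp A (pDisj A B)),
       let A = L x; B = L (R x) in peq x (pImp A (pDisj B A)),
       let A = L (L x); C = R (L x); B = L (L (R x)) in
         peq x (pImp (pImp A C) (pImp (pImp B C) (pImp (pDisj A B) C))),
       let A = L (L x); B = R (L x) in
         peq x (pImp (pImp A B) (pImp (pImp A (pNeg B)) (pNeg A))),
       let A = R x in peq x (pImp (pNeg (pNeg A)) A),
       let A = U (L y) in Q (pImp (pForall A) (pinst A (PProj 0))),
       let B = L (R x); A = U (R (R x)) in
         peq x (pImp (pForall (pImp (pfshift B) A)) (pImp B (pForall A))),
       let A = U (R y) in Q (pImp (pinst A (PProj 0)) (pExists A)),
       let A = U (L (R x)); B = R (R x) in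
         peq x (pImp (pForall (pImp A (pfshift B))) (pImp (pExists A) B)),
       let s = L x in peq x (pEq s s),
       let s = L (L x); t = R (L x); u = R (L (R x)) in
         peq x (pImp (pEq s t) (pImp (pEq s u) (pEq t u))),
       let s = L (L x); t = R (L x) in peq x (pImp (pEq s t) (pEq (pSucc s) (pSucc t))),
       let s = L (L x); t = R (L x); u = L (L (R x)); v = R (L (R x)) in
         peq x (pImp (pEq s t) (pImp (pEq u v) (pEq (pPlus s u) (pPlus t v)))),
       let s = L (L x); t = R (L x); u = L (L (R x)); v = R (L (R x)) in
         peq x (pImp (pEq s t) (pImp (pEq u v) (pEq (pTimes s u) (pTimes t v)))),
       let s = L (L x); t = R (L x); u = L (L (R x)); v = R (L (R x)) in
         peq x (pImp (pEq s t) (pImp (pEq u v) (pImp (pLess s u) (pLess t v))))]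
      PZero) [a]"

text \<open>Here and below, \<open>\<tau>\<close> describes the characteristic function of the set of axioms.\<close>

definition pis_proof :: "pr \<Rightarrow> pr \<Rightarrow> pr" where
  "pis_proof \<tau> a = pcov
    (let y = PProj 0; x = phd y; l = ptl y in
      pite y
        (pand (plook l) (pand (pis_fm x)
          (por (plogical_axiom x) (por (peq (PComp \<tau> [x]) (pnum 1))
          (por (pex (pand (pmem (PProj 0) (PProj 2)) (pmem (pImp (PProj 0) (PProj 1)) (PProj 2)))
                 y [x, l])
               (pex (pand (pmem (PProj 0) (PProj 2)) (peq (PProj 1) (pForall (PProj 0))))
                 y [x, l]))))))
        (pnum 1)) a []"

definition pproof :: "pr \<Rightarrow> pr" where
  "pproof \<tau> = pand (PProj 1) (pand (peq (phd (PProj 1)) (PProj 0)) (pis_proof \<tau> (PProj 1)))"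


section \<open>Provability predicates\<close>

definition Fml :: fm where
  "Fml = graph (pis_fm (PProj 0)) [Var 0] (Succ Zero)"

definition Proof :: "pr \<Rightarrow> fm" where
  "Proof \<tau> = graph (pproof \<tau>) [Var 0, Var 1] (Succ Zero)"

definition Prov :: "pr \<Rightarrow> fm" where
  "Prov \<tau> = Exists (app (Proof \<tau>) [Var 1, Var 0])"

definition pr_axiomatized :: "pr \<Rightarrow> fm set \<Rightarrow> bool" where
  "pr_axiomatized \<tau> T \<longleftrightarrow> (\<forall>\<phi>\<in>T. sentence \<phi>) \<and> (\<forall>n. eval \<tau> [n] = (if n \<in> gn ` T then 1 else 0))"

definition rosser_predicate :: "pr \<Rightarrow> fm \<Rightarrow> bool" where
  "rosser_predicate \<tau> R \<longleftrightarrow> Sigma1 R \<and>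
    (\<exists>Prf. pr_formula 2 Prf \<and>
      (\<forall>\<phi> n. PA \<turnstile> Iff (app (Proof \<tau>) [quot \<phi>, numeral_tm n]) (app Prf [quot \<phi>, numeral_tm n])) \<and>
      PA \<turnstile> Forall (Imp (app Fml [Var 0])
                       (Iff (app (Prov \<tau>) [Var 0]) (Exists (app Prf [Var 1, Var 0])))) \<and>
      R = Exists (Conj (app Fml [Var 1])
                 (Conj (app Prf [Var 1, Var 0])
                       (Forall (Imp (Less (Var 0) (Var 1))
                                    (Neg (app Prf [neg_tm (Var 2), Var 0])))))))"


section \<open>Modal logic\<close>

datatype mfm =
    MVar nat | MBot | MNeg mfm | MConj mfm mfm | MDisj mfm mfm | MImp mfm mfm | Box mfm

primrec meval :: "(nat \<Rightarrow> bool) \<Rightarrow> (mfm \<Rightarrow> bool) \<Rightarrow> mfm \<Rightarrow> bool" where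
  "meval v w (MVar p) = v p"
| "meval v w MBot = False"
| "meval v w (MNeg A) = (\<not> meval v w A)"
| "meval v w (MConj A B) = (meval v w A \<and> meval v w B)"
| "meval v w (MDisj A B) = (meval v w A \<or> meval v w B)"
| "meval v w (MImp A B) = (meval v w A \<longrightarrow> meval v w B)"
| "meval v w (Box A) = w A"

definition tautology :: "mfm \<Rightarrow> bool" where
  "tautology A \<longleftrightarrow> (\<forall>v w. meval v w A)"

inductive NR4 :: "mfm \<Rightarrow> bool" where
  taut: "tautology A \<Longrightarrow> NR4 A"
| four: "NR4 (MImp (Box B) (Box (Box B)))"
| mp: "NR4 (MImp A B) \<Longrightarrow> NR4 A \<Longrightarrow> NR4 B"
| nec: "NR4 A \<Longrightarrow> NR4 (Box A)"
| ros: "NR4 (MNeg B) \<Longrightarrow> NR4 (MNeg (Box B))"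

definition arithmetical_interpretation :: "fm \<Rightarrow> (mfm \<Rightarrow> fm) \<Rightarrow> bool" where
  "arithmetical_interpretation R f \<longleftrightarrow>
    (\<forall>A. sentence (f A)) \<and>
    f MBot = Eq Zero (Succ Zero) \<and>
    (\<forall>A. f (MNeg A) = Neg (f A)) \<and>
    (\<forall>A B. f (MConj A B) = Conj (f A) (f B)) \<and>
    (\<forall>A B. f (MDisj A B) = Disj (f A) (f B)) \<and>
    (\<forall>A B. f (MImp A B) = Imp (f A) (f B)) \<and>
    (\<forall>A. f (Box A) = app R [quot (f A)])"


section \<open>Adequacy\<close>

text \<open>The facts below are not used by any definition. They show that \<open>graph f\<close> defines
  the graph of \<open>f\<close> in the standard model (theorem \<open>sat_graph\<close>) and that the arithmetized syntax is
  correct (theorems \<open>eval_pis_fm\<close>, \<open>pproof_correct\<close> and \<open>derivable_iff\<close>).\<close>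

subsection \<open>Formulas representing primitive recursive functions\<close>

primrec tval :: "(nat \<Rightarrow> nat) \<Rightarrow> tm \<Rightarrow> nat" where
  "tval e (Var i) = e i" | "tval e Zero = 0" | "tval e (Succ t) = Suc (tval e t)"
| "tval e (Plus s t) = tval e s + tval e t" | "tval e (Times s t) = tval e s * tval e t"
primrec sat :: "(nat \<Rightarrow> nat) \<Rightarrow> fm \<Rightarrow> bool" where
  "sat e (Eq s t) = (tval e s = tval e t)"
| "sat e (Less s t) = (tval e s < tval e t)"
| "sat e (Neg a) = (\<not> sat e a)" | "sat e (Conj a b) = (sat e a \<and> sat e b)"
| "sat e (Disj a b) = (sat e a \<or> sat e b)" | "sat e (Imp a b) = (sat e a \<longrightarrow> sat e b)"
| "sat e (Forall a) = (\<forall>x. sat (case_nat x e) a)"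
| "sat e (Exists a) = (\<exists>x. sat (case_nat x e) a)"

lemma tval_tlift [simp]: "tval e (tlift k t) = tval (\<lambda>i. e (i + k)) t"
  by (induction t) (auto simp: tlift_def)
lemma case_nat_num [simp]: "case_nat x e (numeral k) = e (pred_numeral k)" "case_nat x e (i + numeral k) = e (i + pred_numeral k)"
  "case_nat x e (Suc 0) = e 0"
  by (simp_all add: numeral_eq_Suc)

lemma sat_beta [simp]: "sat e (beta_fm a b i w) \<longleftrightarrow> tval e w = tval e a mod Suc (Suc (tval e i) * tval e b)"
proof -
  have "w = a mod m \<longleftrightarrow> w < m \<and> (\<exists>q<Suc a. a = q * m + w)" if "m > 0" for a m w :: nat
  proof
    assume "w = a mod m"
    then show "w < m \<and> (\<exists>q<Suc a. a = q * m + w)" using that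
      by (auto intro!: exI[of _ "a div m"] simp: less_Suc_eq_le)
  qed (use that in \<open>auto\<close>)
  from this[of "Suc (Suc (tval e i) * tval e b)"] show ?thesis by (simp add: beta_fm_def Let_def)
qed

lemma beta_ex: "\<exists>a b. \<forall>i\<le>n. s i = a mod Suc (Suc i * b)" for n :: nat and s :: "nat \<Rightarrow> nat"
proof -
  define M where "M = Suc (n + sum s {..n})"
  define b where "b = fact M * M"
  have sM: "s i < Suc (Suc i * b)" if "i \<le> n" for i
  proof -
    have "s i \<le> sum s {..n}" using that by (intro member_le_sum) auto
    then have "s i \<le> M" by (simp add: M_def)
    also have "M \<le> b" by (simp add: b_def)
    also have "b \<le> Suc i * b" by simp
    finally show ?thesis by simp
  qed
  have cop: "coprime (Suc (Suc i * b)) (Suc (Suc j * b))" if "i < j" "j \<le> n" for i j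
  proof (rule ccontr)
    assume "\<not> ?thesis"
    then obtain p where p: "prime p" "p dvd Suc (Suc i * b)" "p dvd Suc (Suc j * b)"
      by (metis coprime_iff_gcd_eq_1 gcd_greatest_iff prime_factor_nat)
    then have "p dvd Suc (Suc j * b) - Suc (Suc i * b)" using dvd_diff_nat by blast
    also have "Suc (Suc j * b) - Suc (Suc i * b) = (j - i) * b" by (simp add: diff_mult_distrib)
    finally have "p dvd j - i \<or> p dvd b" using p(1) prime_dvd_mult_iff by blast
    moreover have "j - i dvd b" unfolding b_def using that
      by (intro dvd_mult2 dvd_fact) (auto simp: M_def)
    ultimately have "p dvd b" using dvd_trans by blast
    then have "p dvd 1" using p(2) by (metis Suc_eq_plus1 dvd_add_right_iff dvd_mult)
    with p(1) show False by auto
  qed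
  have "\<exists>x. \<forall>i\<in>{..n}. [x = s i] (mod Suc (Suc i * b))"
  proof (rule chinese_remainder_nat, simp, intro ballI impI)
    fix i j assume "i \<in> {..n}" "j \<in> {..n}" "i \<noteq> j"
    then show "coprime (Suc (Suc i * b)) (Suc (Suc j * b))"
      using cop[of i j] cop[of j i] coprime_commute by (cases "i < j") auto
  qed
  then obtain x where "\<forall>i\<le>n. x mod Suc (Suc i * b) = s i mod Suc (Suc i * b)"
    by (auto simp: cong_def)
  then show ?thesis using sM by (metis mod_less)
qed

lemma sat_Exs: "sat e ((Exists ^^ m) a) \<longleftrightarrow> (\<exists>ys. length ys = m \<and> sat (\<lambda>i. if i < m then ys ! i else e (i - m)) a)"
proof (induction m arbitrary: e a)
  case (Suc m)
  have f: "(\<lambda>i. if i < Suc m then (y#ys) ! i else e (i - Suc m)) = case_nat y (\<lambda>i. if i < m then ys ! i else e (i - m))" 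
    for y ys by (auto simp: fun_eq_iff split: nat.split)
  have "sat e ((Exists ^^ Suc m) a) \<longleftrightarrow> sat e ((Exists ^^ m) (Exists a))" by (simp add: funpow_swap1)
  also have "\<dots> \<longleftrightarrow> (\<exists>ys y. length ys = m \<and> sat (\<lambda>i. if i < Suc m then (y#ys) ! i else e (i - Suc m)) a)"
    unfolding Suc f by simp
  also have "\<dots> \<longleftrightarrow> (\<exists>ys. length ys = Suc m \<and> sat (\<lambda>i. if i < Suc m then ys ! i else e (i - Suc m)) a)"
  proof -
    have "(\<exists>ys. length ys = Suc m \<and> P ys) \<longleftrightarrow> (\<exists>ys y. length ys = m \<and> P (y # ys))" for P :: "nat list \<Rightarrow> bool"
      by (auto simp: length_Suc_conv)
    from this[of "\<lambda>ys. sat (\<lambda>i. if i < Suc m then ys ! i else e (i - Suc m)) a"] show ?thesis by blast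
  qed
  finally show ?case .
qed (auto simp: )

lemma sat_conjs: "sat e (foldr Conj As B) \<longleftrightarrow> (\<forall>A\<in>set As. sat e A) \<and> sat e B"
  by (induction As) auto

lemma tval_arg: "tval e (arg Zero ts i) = arg 0 (map (tval e) ts) i" by (auto simp: arg_def)

theorem sat_graph: "sat e (graph f ts t) \<longleftrightarrow> tval e t = eval f (map (tval e) ts)"
proof (induction f ts t arbitrary: e rule: graph.induct)
  case (4 f gs ts t)
  let ?m = "length gs"
  have *: "sat (\<lambda>i. if i < ?m then ys ! i else e (i - ?m)) (foldr Conj
          (map (\<lambda>(i, g). graph g (map (tlift ?m) ts) (Var i)) (zip [0..<?m] gs))
          (graph f (map Var [0..<?m]) (tlift ?m t))) \<longleftrightarrow>
        ys = map (\<lambda>g. eval g (map (tval e) ts)) gs \<and> tval e t = eval f ys" if len: "length ys = ?m" for ys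
  proof -
    let ?e = "\<lambda>i. if i < ?m then ys ! i else e (i - ?m)"
    have 1: "map (tval ?e \<circ> tlift ?m) ts = map (tval e) ts" by simp
    have 2: "sat ?e (graph (gs ! i) (map (tlift ?m) ts) (Var i)) \<longleftrightarrow> ys ! i = eval (gs ! i) (map (tval e) ts)" if "i < ?m" for i
    proof -
      have "(i, gs ! i) \<in> set (zip [0..<?m] gs)" using that by (auto simp: set_zip intro!: exI[of _ i])
      from 4(2)[OF refl this refl] show ?thesis using that by (simp add: comp_def)
    qed
    have 3: "map (tval ?e) (map Var [0..<?m]) = ys" using len by (intro nth_equalityI) auto
    have 4: "sat ?e (graph f (map Var [0..<?m]) (tlift ?m t)) \<longleftrightarrow> tval e t = eval f ys"
      unfolding 4(1)[OF refl] 3 by simp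
    have "(\<forall>A\<in>set (map (\<lambda>(i, g). graph g (map (tlift ?m) ts) (Var i)) (zip [0..<?m] gs)). sat ?e A) \<longleftrightarrow> (\<forall>i<?m. ys ! i = eval (gs ! i) (map (tval e) ts))"
    proof -
      have "set (zip [0..<?m] gs) = (\<lambda>i. (i, gs ! i)) ` {..<?m}" 
        by (auto simp: set_zip image_iff) (metis add_0 nth_upt)
      then show ?thesis using 2 by auto
    qed
    also have "\<dots> \<longleftrightarrow> ys = map (\<lambda>g. eval g (map (tval e) ts)) gs" using len by (auto simp: list_eq_iff_nth_eq)
    finally show ?thesis unfolding sat_conjs 4 by blast
  qed
  show ?case unfolding graph.simps Let_def sat_Exs using * by (auto intro!: exI[of _ "map (\<lambda>g. eval g (map (tval e) ts)) gs"])
next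
  case (6 f g n ts t)
  let ?vs = "map (tval e) ts"
  have m: "map ((tval e') \<circ> tlift k) ts = ?vs" if "\<And>i. e' (i + k) = e i" for e' k using that by simp
  have fg: "sat (case_nat w (case_nat b (case_nat a e))) (graph f (map (tlift 3) ts) (Var 0)) \<longleftrightarrow> w = eval f ?vs" for w a b
    unfolding 6(1) by (simp add: comp_def)
  have gg: "sat (case_nat v (case_nat u (case_nat i (case_nat b (case_nat a e))))) (graph g (Var 2 # Var 1 # map (tlift 5) ts) (Var 0)) \<longleftrightarrow> v = eval g (i # u # ?vs)" for v u i a b
    unfolding 6(2) by (simp add: comp_def)
  let ?N = "tval e n"
  define h where "h k = rec_nat (eval f ?vs) (\<lambda>k r. eval g (k # r # ?vs)) k" for k
  have h_Suc: "h (Suc i) = eval g (i # h i # ?vs)" for i by (simp add: h_def)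
  have "sat e (graph (PRec f g) (n # ts) t) \<longleftrightarrow> (\<exists>a b. 
      a mod Suc b = eval f ?vs \<and> (\<forall>i<?N. a mod Suc (Suc (Suc i) * b) = eval g (i # (a mod Suc (Suc i * b)) # ?vs)) \<and>
      tval e t = a mod Suc (Suc ?N * b))"
    unfolding graph.simps sat.simps fg gg sat_beta
    apply (simp add: comp_def del: mult_Suc)
    apply (intro iff_exI conj_cong refl)
    apply auto
    done
  also have "\<dots> \<longleftrightarrow> tval e t = h ?N"
  proof
    assume "tval e t = h ?N"
    obtain a b where "\<forall>i\<le>?N. h i = a mod Suc (Suc i * b)" using beta_ex[of ?N h] by blast
    note ab = this[rule_format]
    show "\<exists>a b. a mod Suc b = eval f ?vs \<and> (\<forall>i<?N. a mod Suc (Suc (Suc i) * b) = eval g (i # (a mod Suc (Suc i * b)) # ?vs)) \<and>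
      tval e t = a mod Suc (Suc ?N * b)"
    proof (rule exI[of _ a], rule exI[of _ b], intro conjI allI impI)
      show "a mod Suc b = eval f ?vs" using ab[of 0] by (simp add: h_def)
      show "tval e t = a mod Suc (Suc ?N * b)" using ab[of ?N] \<open>tval e t = h ?N\<close> by simp
      fix i assume "i < ?N"
      then show "a mod Suc (Suc (Suc i) * b) = eval g (i # (a mod Suc (Suc i * b)) # ?vs)"
        using ab[of i] ab[of "Suc i"] h_Suc[of i] by simp
    qed
  next
    assume "\<exists>a b. a mod Suc b = eval f ?vs \<and> (\<forall>i<?N. a mod Suc (Suc (Suc i) * b) = eval g (i # (a mod Suc (Suc i * b)) # ?vs)) \<and>
      tval e t = a mod Suc (Suc ?N * b)"
    then obtain a b where ab: "a mod Suc b = eval f ?vs" "\<And>i. i < ?N \<Longrightarrow> a mod Suc (Suc (Suc i) * b) = eval g (i # (a mod Suc (Suc i * b)) # ?vs)"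
      "tval e t = a mod Suc (Suc ?N * b)" by blast
    have "i \<le> ?N \<Longrightarrow> a mod Suc (Suc i * b) = h i" for i
    proof (induction i)
      case 0 then show ?case using ab(1) by (simp add: h_def)
    next
      case (Suc i)
      then show ?case unfolding h_def using ab(2)[of i] by simp
    qed
    with ab(3) show "tval e t = h ?N" by simp
  qed
  finally show ?case unfolding h_def eval.simps list.map .
qed (simp_all add: tval_arg)

subsection \<open>Arithmetic, pairs and lists\<close>

lemma arg_simps [simp]: "arg z (x # xs) 0 = x" "arg z (x # xs) (Suc i) = arg z xs i" "arg z [] i = z"
  by (auto simp: arg_def)
lemma arg_numeral [simp]: "arg z (x # xs) (numeral k) = arg z xs (pred_numeral k)"
  by (simp add: numeral_eq_Suc)
lemma arg_1 [simp]: "arg z (x # xs) 1 = arg z xs 0"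
  by (simp add: arg_def)

lemma eval_pnum [simp]: "eval (pnum n) xs = n"
  by (induction n) auto
lemma eval_psuc [simp]: "eval (psuc a) xs = Suc (eval a xs)"
  by (simp add: psuc_def)
lemma eval_ppred [simp]: "eval (ppred a) xs = eval a xs - 1"
  by (cases "eval a xs") (auto simp: ppred_def)
lemma eval_padd [simp]: "eval (padd a b) xs = eval a xs + eval b xs"
proof -
  have "rec_nat y (\<lambda>k r. Suc r) n = n + y" for n y :: nat by (induction n) auto
  then show ?thesis by (simp add: padd_def)
qed
lemma eval_pmult [simp]: "eval (pmult a b) xs = eval a xs * eval b xs"
proof -
  have "rec_nat 0 (\<lambda>k r. r + y) n = n * y" for n y :: nat by (induction n) auto
  then show ?thesis by (simp add: pmult_def)
qed
lemma eval_psub [simp]: "eval (psub a b) xs = eval a xs - eval b xs"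
proof -
  have "rec_nat y (\<lambda>k r. r - Suc 0) n = y - n" for n y :: nat by (induction n) auto
  then show ?thesis by (simp add: psub_def)
qed
lemma eval_pnot [simp]: "eval (pnot a) xs = of_bool (eval a xs = 0)"
  by (cases "eval a xs") (auto simp: pnot_def)
lemma eval_por [simp]: "eval (por a b) xs = of_bool (eval a xs \<noteq> 0 \<or> eval b xs \<noteq> 0)"
  by (auto simp: por_def)
lemma eval_pand [simp]: "eval (pand a b) xs = of_bool (eval a xs \<noteq> 0 \<and> eval b xs \<noteq> 0)"
  by (auto simp: pand_def)
lemma eval_ple [simp]: "eval (ple a b) xs = of_bool (eval a xs \<le> eval b xs)"
  by (auto simp: ple_def)
lemma eval_peq [simp]: "eval (peq a b) xs = of_bool (eval a xs = eval b xs)"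
  by (auto simp: peq_def)
lemma eval_pite [simp]: "eval (pite c a b) xs = (if eval c xs \<noteq> 0 then eval a xs else eval b xs)"
  by (cases "eval c xs") (auto simp: pite_def)
lemma eval_pmod [simp]: "0 < k \<Longrightarrow> eval (pmod a k) xs = eval a xs mod k"
proof -
  assume "0 < k"
  then have "rec_nat 0 (\<lambda>_ r. if Suc r = k then 0 else Suc r) n = n mod k" for n
    by (induction n) (auto simp: mod_Suc)
  then show ?thesis by (simp add: pmod_def cong: if_cong)
qed
lemma eval_pdiv [simp]: "0 < k \<Longrightarrow> eval (pdiv a k) xs = eval a xs div k"
proof -
  assume k: "0 < k"
  then have "rec_nat 0 (\<lambda>n r. r + of_bool (k dvd Suc n)) n = n div k" for n
    by (induction n) (auto simp: div_Suc dvd_eq_mod_eq_0)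
  with k show ?thesis by (simp add: pdiv_def dvd_eq_mod_eq_0)
qed
lemma map_arg: "map (\<lambda>i. arg z (x # y # xs) i) [2..<2 + length xs] = xs"
  by (rule nth_equalityI) (auto simp: arg_def simp del: upt_Suc)
lemma eval_pex [simp]:
  "eval (pex p a bs) xs = of_bool (\<exists>i<eval a xs. eval p (i # map (\<lambda>b. eval b xs) bs) \<noteq> 0)"
proof -
  let ?ps = "map (\<lambda>b. eval b xs) bs"
  have "map (\<lambda>i. arg 0 (k # r # ?ps) i) [2..<2+length bs] = ?ps" for k r
    using map_arg[of 0 k r ?ps] by simp
  moreover have "rec_nat (0::nat) (\<lambda>k r. of_bool (r \<noteq> 0 \<or> eval p (k # ?ps) \<noteq> 0)) n
     = of_bool (\<exists>i<n. eval p (i # ?ps) \<noteq> 0)" for n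
    by (induction n) (auto simp: less_Suc_eq)
  ultimately show ?thesis by (simp add: pex_def comp_def del: upt_Suc of_bool_or_iff)
qed

lemma eval_ptriangle [simp]: "eval (ptriangle a) xs = triangle (eval a xs)"
proof -
  have "rec_nat 0 (\<lambda>k r. Suc (r + k)) n = triangle n" for n by (induction n) auto
  then show ?thesis by (simp add: ptriangle_def)
qed
lemma eval_ppair [simp]: "eval (ppair a b) xs = prod_encode (eval a xs, eval b xs)"
  by (simp add: ppair_def prod_encode_def)

lemma triangle_mono: "m \<le> n \<Longrightarrow> triangle m \<le> triangle n"
  by (rule lift_Suc_mono_le[of triangle]) auto
lemma eval_pdiag: "\<exists>d. eval (pdiag a) xs = d \<and> triangle d \<le> eval a xs \<and> eval a xs < triangle (Suc d)"
proof -
  define D where "D n = rec_nat 0 (\<lambda>k r. r + of_bool (triangle (Suc r) \<le> Suc k)) n" for n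
  have "triangle (D n) \<le> n \<and> n < triangle (Suc (D n))" for n
    by (induction n) (auto simp: D_def)
  then show ?thesis by (simp add: pdiag_def D_def)
qed
lemma pdiag_aux:
  assumes "eval a xs = prod_encode (m, n)" shows "eval (pdiag a) xs = m + n"
proof -
  obtain d where d: "eval (pdiag a) xs = d" "triangle d \<le> eval a xs" "eval a xs < triangle (Suc d)"
    using eval_pdiag by blast
  have "eval a xs = triangle (m+n) + m" using assms by (simp add: prod_encode_def)
  then have "\<not> d < m + n" "\<not> m + n < d"
    using d triangle_mono[of "Suc d" "m+n"] triangle_mono[of "Suc (m+n)" d] by auto
  with d show ?thesis by simp
qed
lemma eval_pfst [simp]: "eval (pfst a) xs = fst (prod_decode (eval a xs))"
  and eval_psnd [simp]: "eval (psnd a) xs = snd (prod_decode (eval a xs))"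
proof -
  obtain m n where mn: "prod_decode (eval a xs) = (m, n)" by fastforce
  then have e: "eval a xs = prod_encode (m, n)" by (metis prod_decode_inverse)
  then show 1: "eval (pfst a) xs = fst (prod_decode (eval a xs))"
    by (simp add: pfst_def pdiag_aux[OF e]) (simp add: prod_encode_def)
  show "eval (psnd a) xs = snd (prod_decode (eval a xs))"
    by (simp add: psnd_def 1 pdiag_aux[OF e] e)
qed

lemma eval_pcons [simp]: "eval (pcons a b) xs = Suc (prod_encode (eval a xs, eval b xs))"
  by (simp add: pcons_def)
definition lhd where "lhd n = fst (prod_decode (n - 1))"
definition ltl where "ltl n = snd (prod_decode (n - 1))"
lemma eval_phd [simp]: "eval (phd a) xs = lhd (eval a xs)" by (simp add: phd_def lhd_def)
lemma eval_ptl [simp]: "eval (ptl a) xs = ltl (eval a xs)" by (simp add: ptl_def ltl_def)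
lemma lhd_cons [simp]: "lhd (Suc (prod_encode (a, b))) = a" by (simp add: lhd_def)
lemma ltl_cons [simp]: "ltl (Suc (prod_encode (a, b))) = b" by (simp add: ltl_def)
lemma ltl_0 [simp]: "ltl 0 = 0"
  by (simp add: ltl_def prod_decode_def prod_decode_aux.simps)
lemma eval_pdrop [simp]: "eval (pdrop i a) xs = (ltl ^^ eval i xs) (eval a xs)"
proof -
  have "rec_nat y (\<lambda>k. ltl) n = (ltl ^^ n) y" for n y :: nat by (induction n) auto
  then show ?thesis by (simp add: pdrop_def)
qed
lemma ltl_list [simp]: "ltl (list_encode L) = list_encode (tl L)"
  by (cases L) auto
lemma ltl_pow: "(ltl ^^ i) (list_encode L) = list_encode (drop i L)"
  by (induction i arbitrary: L) (auto simp: drop_Suc tl_drop)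
lemma length_le_list_encode: "length L \<le> list_encode L"
  by (induction L) (auto intro: order_trans[OF _ le_prod_encode_2])
lemma eval_pmem [simp]:
  "eval l xs = list_encode L \<Longrightarrow> eval (pmem x l) xs = of_bool (eval x xs \<in> set L)"
proof -
  assume l: "eval l xs = list_encode L"
  have *: "list_encode (drop i L) \<noteq> 0 \<and> lhd (list_encode (drop i L)) = y \<longleftrightarrow> i < length L \<and> L ! i = y" for i y
    by (cases "i < length L") (auto simp: Cons_nth_drop_Suc[symmetric])
  have "(\<exists>i<list_encode L. list_encode (drop i L) \<noteq> 0 \<and> lhd (list_encode (drop i L)) = eval x xs) \<longleftrightarrow> eval x xs \<in> set L"
    unfolding * using length_le_list_encode[of L]
    by (auto simp: in_set_conv_nth intro: order_less_le_trans)
  then show ?thesis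
    by (simp add: pmem_def l ltl_pow)
qed

definition hist where "hist G ps n = eval (PRec PZero (pcons G (PProj 1))) (n # ps)"
definition cov where "cov G ps n = eval G (n # hist G ps n # ps)"
lemma hist_eq: "hist G ps n = list_encode (map (cov G ps) (rev [0..<n]))"
  by (induction n) (auto simp: hist_def cov_def)
lemma eval_pcov: "eval (pcov G a bs) xs = cov G (map (\<lambda>b. eval b xs) bs) (eval a xs)"
  by (simp add: pcov_def) (simp add: cov_def hist_def)
lemma eval_plook:
  assumes "eval m (n # hist G ps n # ps) < n"
  shows "eval (plook m) (n # hist G ps n # ps) = cov G ps (eval m (n # hist G ps n # ps))"
proof -
  let ?m = "eval m (n # hist G ps n # ps)"
  have "eval (plook m) (n # hist G ps n # ps) = lhd (list_encode (drop (n - 1 - ?m) (map (cov G ps) (rev [0..<n]))))"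
    by (simp add: plook_def) (simp add: hist_eq ltl_pow)
  also have "drop (n - 1 - ?m) (map (cov G ps) (rev [0..<n])) = cov G ps ?m # drop (n - ?m) (map (cov G ps) (rev [0..<n]))"
    using assms by (subst Cons_nth_drop_Suc[symmetric]) (auto simp: rev_nth Suc_diff_Suc)
  finally show ?thesis by simp
qed

subsection \<open>Terms and formulas\<close>

lemma eval_psel_aux:
  "eval (foldr (\<lambda>(i, c) r. pite (peq a (pnum i)) c r) (zip [m..<m + length cs] cs) d) xs =
    (if m \<le> eval a xs \<and> eval a xs < m + length cs then eval (cs ! (eval a xs - m)) xs else eval d xs)"
proof (induction cs arbitrary: m)
  case (Cons c cs)
  show ?case using Cons[of "Suc m"]
    by (auto simp: upt_conv_Cons nth_Cons' simp del: upt_Suc)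
qed auto

lemma eval_psel [simp]:
  "eval (psel a cs d) xs = (if eval a xs < length cs then eval (cs ! eval a xs) xs else eval d xs)"
  using eval_psel_aux[of a 0 cs d xs] by (simp add: psel_def)

lemma eval_pcode1 [simp]: "eval (pcode1 k t a) xs = k * eval a xs + t"
  and eval_pcode2 [simp]: "eval (pcode2 k t a b) xs = k * prod_encode (eval a xs, eval b xs) + t"
  by (simp_all add: pcode1_def pcode2_def)

lemmas pcons_defs = pVar_def pSucc_def pPlus_def pTimes_def pEq_def pLess_def pNeg_def pConj_def
  pDisj_def pImp_def pForall_def pExists_def

lemma mod5_cases: obtains "(n::nat) mod 5 = 0" | "n mod 5 = 1" | "n mod 5 = 2" | "n mod 5 = 3" | "n mod 5 = 4"
  by linarith
lemma mod8_cases: obtains "(n::nat) mod 8 = 0" | "n mod 8 = 1" | "n mod 8 = 2" | "n mod 8 = 3" | "n mod 8 = 4"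
   | "n mod 8 = 5" | "n mod 8 = 6" | "n mod 8 = 7"
  by linarith

lemma fst_le: "fst (prod_decode n) \<le> n" and snd_le: "snd (prod_decode n) \<le> n"
  by (metis le_prod_encode_1 le_prod_encode_2 prod.collapse prod_decode_inverse)+

lemma gnt_mod [simp]: 
  "(5 * a + 2) mod 5 = (2::nat)" "(5 * a + 3) mod 5 = (3::nat)" "(5 * a + 4) mod 5 = (4::nat)"
  "(5 * a + 2) div 5 = (a::nat)" "(5 * a + 3) div 5 = (a::nat)" "(5 * a + 4) div 5 = (a::nat)"
  by presburger+
lemma gn_mod [simp]: 
  "(8 * a + 2) mod 8 = (2::nat)" "(8 * a + 3) mod 8 = (3::nat)" "(8 * a + 4) mod 8 = (4::nat)"
  "(8 * a + 5) mod 8 = (5::nat)" "(8 * a + 6) mod 8 = (6::nat)" "(8 * a + 7) mod 8 = (7::nat)"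
  "(8 * a + 2) div 8 = (a::nat)" "(8 * a + 3) div 8 = (a::nat)" "(8 * a + 4) div 8 = (a::nat)"
  "(8 * a + 5) div 8 = (a::nat)" "(8 * a + 6) div 8 = (a::nat)" "(8 * a + 7) div 8 = (a::nat)"
  "Suc (8 * a) mod 8 = (1::nat)" "Suc (8 * a) div 8 = a"
  by presburger+


lemma gnt_eqs:
  "5 * p = gnt t \<longleftrightarrow> t = Var p"
  "Suc (5 * p) = gnt t \<longleftrightarrow> p = 0 \<and> t = Zero"
  "5 * p + 2 = gnt t \<longleftrightarrow> (\<exists>s. t = Succ s \<and> p = gnt s)"
  "5 * p + 3 = gnt t \<longleftrightarrow> (\<exists>s u. t = Plus s u \<and> p = prod_encode (gnt s, gnt u))"
  "5 * p + 4 = gnt t \<longleftrightarrow> (\<exists>s u. t = Times s u \<and> p = prod_encode (gnt s, gnt u))"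
  by (cases t; simp; arith)+

lemma gn_eqs:
  "8 * p = gn t \<longleftrightarrow> (\<exists>s u. t = Eq s u \<and> p = prod_encode (gnt s, gnt u))"
  "Suc (8 * p) = gn t \<longleftrightarrow> (\<exists>s u. t = Less s u \<and> p = prod_encode (gnt s, gnt u))"
  "8 * p + 2 = gn t \<longleftrightarrow> (\<exists>s. t = Neg s \<and> p = gn s)"
  "8 * p + 3 = gn t \<longleftrightarrow> (\<exists>s u. t = Conj s u \<and> p = prod_encode (gn s, gn u))"
  "8 * p + 4 = gn t \<longleftrightarrow> (\<exists>s u. t = Disj s u \<and> p = prod_encode (gn s, gn u))"
  "8 * p + 5 = gn t \<longleftrightarrow> (\<exists>s u. t = Imp s u \<and> p = prod_encode (gn s, gn u))"
  "8 * p + 6 = gn t \<longleftrightarrow> (\<exists>s. t = Forall s \<and> p = gn s)"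
  "8 * p + 7 = gn t \<longleftrightarrow> (\<exists>s. t = Exists s \<and> p = gn s)"
  by (cases t; simp; arith)+

lemma gnt_inj: "gnt s = gnt t \<Longrightarrow> s = t"
  by (induction s arbitrary: t) (auto simp: gnt_eqs[simplified] gnt_eqs(2)[of 0, simplified])
lemma gn_inj: "gn s = gn t \<Longrightarrow> s = t"
  by (induction s arbitrary: t) (auto simp: gn_eqs[simplified] dest: gnt_inj)
lemma gnt_eq [simp]: "gnt s = gnt t \<longleftrightarrow> s = t" and gn_eq [simp]: "gn a = gn b \<longleftrightarrow> a = b"
  using gnt_inj gn_inj by blast+

lemma dm5: obtains p where "n = 5 * p" | p where "n = Suc (5 * p)" | p where "n = 5 * p + 2" | p where "n = 5 * p + 3" | p where "n = 5 * p + 4"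
proof -
  have "n = 5 * (n div 5) + n mod 5" by simp
  then show ?thesis using that by (cases n rule: mod5_cases) (simp; metis Suc_eq_plus1)+
qed
lemma dm8: obtains p where "n = 8 * p" | p where "n = Suc (8 * p)" | p where "n = 8 * p + 2" | p where "n = 8 * p + 3" | p where "n = 8 * p + 4"
   | p where "n = 8 * p + 5" | p where "n = 8 * p + 6" | p where "n = 8 * p + 7"
proof -
  have "n = 8 * (n div 8) + n mod 8" by simp
  then show ?thesis using that by (cases n rule: mod8_cases) (simp; metis Suc_eq_plus1)+
qed

lemma ex_pair: "(\<exists>s u. p = prod_encode (f s, g u)) \<longleftrightarrow> (\<exists>s. fst (prod_decode p) = f s) \<and> (\<exists>s. snd (prod_decode p) = g s)"
  by (metis fst_conv prod.collapse prod_decode_inverse prod_encode_inverse snd_conv)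

lemma fst_lt: "p < n \<Longrightarrow> fst (prod_decode p) < n" and snd_lt: "p < n \<Longrightarrow> snd (prod_decode p) < n"
  using fst_le[of p] snd_le[of p] by auto

lemma covE: "cov G ps n = eval G (n # hist G ps n # ps)" by (simp add: cov_def)

lemma gnt_mod1 [simp]: "Suc (5 * a) mod 5 = (1::nat)" "Suc (5 * a) div 5 = a"
  by presburger+

lemma eval_pis_tm [simp]: "eval (pis_tm a) xs = of_bool (\<exists>t. eval a xs = gnt t)"
proof -
  define G where "G = (let x = PProj 0; p = pdiv x 5; l = plook (pfst p); r = plook (psnd p) in
      psel (pmod x 5) [pnum 1, pnot p, plook p, pand l r] (pand l r))"
  have "cov G [] n = of_bool (\<exists>t. n = gnt t)" for n
  proof (induction n rule: less_induct)
    case (less n)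
    have R: "cov G [] n = eval (let x = PProj 0; p = pdiv x 5; l = plook (pfst p); r = plook (psnd p) in
      psel (pmod x 5) [pnum 1, pnot p, plook p, pand l r] (pand l r)) (n # hist G [] n # [])"
      using covE[of G "[]" n] by (simp add: G_def)
    show ?case
      by (cases n rule: dm5; subst R)
        (simp_all add: Let_def eval_plook less fst_lt snd_lt gnt_eqs[simplified] ex_pair gnt_mod[simplified])
  qed
  then show ?thesis unfolding pis_tm_def G_def[symmetric] eval_pcov by simp
qed

lemma eval_pis_fm [simp]: "eval (pis_fm a) xs = of_bool (\<exists>t. eval a xs = gn t)"
proof -
  let ?G = "(let x = PProj 0; p = pdiv x 8; l = plook (pfst p); r = plook (psnd p);
         at = pand (pis_tm (pfst p)) (pis_tm (psnd p)) in
      psel (pmod x 8) [at, at, plook p, pand l r, pand l r, pand l r, plook p] (plook p))"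
  define G where "G = ?G"
  have "cov G [] n = of_bool (\<exists>t. n = gn t)" for n
  proof (induction n rule: less_induct)
    case (less n)
    have R: "cov G [] n = eval ?G (n # hist G [] n # [])"
      using covE[of G "[]" n] by (simp add: G_def)
    show ?case
      by (cases n rule: dm8; subst R)
        (simp_all add: Let_def eval_plook less fst_lt snd_lt gn_eqs[simplified] ex_pair gn_mod[simplified])
  qed
  then show ?thesis by (simp add: pis_fm_def eval_pcov flip: G_def)
qed

lemma le3: "k > 0 \<Longrightarrow> a < 5 * prod_encode (a, x) + k" "k > 0 \<Longrightarrow> a < 5 * prod_encode (x, a) + k"
  using le_prod_encode_1[of a x] le_prod_encode_2[of a x] by linarith+

lemma eval_ptsubst:
  assumes a: "eval a xs = gnt t" and \<sigma>: "\<And>i. eval \<sigma> [i, eval k xs, eval s xs] = gnt (\<rho> i)"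
  shows "eval (ptsubst \<sigma> a k s) xs = gnt (tsubst \<rho> t)"
proof -
  let ?G = "let x = PProj 0; p = pdiv x 5; l = plook (pfst p); r = plook (psnd p) in
      psel (pmod x 5)
        [PComp \<sigma> [p, PProj 2, PProj 3], pnum 1, pSucc (plook p), pPlus l r] (pTimes l r)"
  define G where "G = ?G"
  let ?ps = "[eval k xs, eval s xs]"
  have R: "cov G ?ps n = eval ?G (n # hist G ?ps n # ?ps)" for n
    using covE[of G "?ps" n] by (simp add: G_def)
  have "cov G ?ps (gnt t) = gnt (tsubst \<rho> t)" for t
    by (induction t; subst R)
     (simp_all add: Let_def eval_plook gnt_mod[simplified] \<sigma> pcons_defs le3)
  then show ?thesis unfolding ptsubst_def G_def[symmetric] eval_pcov using a by simp
qed

lemma prod_encode_less: "a + k < b + l \<Longrightarrow> prod_encode (a, k) < prod_encode (b, l)"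
  using triangle_mono[of "Suc (a + k)" "b + l"] by (simp add: prod_encode_def)

lemma eval_pfsubst:
  assumes a: "eval a xs = gn \<phi>" and \<sigma>: "\<And>i k. eval \<sigma> [i, k, eval s xs] = gnt (\<rho> k i)"
    and up: "\<And>k. up (\<rho> k) = \<rho> (Suc k)"
  shows "eval (pfsubst \<sigma> a s) xs = gn (fsubst (\<rho> 0) \<phi>)"
proof -
  let ?G = "let x = pfst (PProj 0); k = psnd (PProj 0); s = PProj 2; p = pdiv x 8;
         l = pfst p; r = psnd p;
         tl = ptsubst \<sigma> l k s; tr = ptsubst \<sigma> r k s;
         p0 = plook (ppair p k); p1 = plook (ppair p (psuc k));
         l0 = plook (ppair l k); r0 = plook (ppair r k) in
      psel (pmod x 8)
        [pEq tl tr, pLess tl tr, pNeg p0, pConj l0 r0, pDisj l0 r0, pImp l0 r0, pForall p1]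
        (pExists p1)"
  define G where "G = ?G"
  let ?ps = "[eval s xs]"
  have R: "cov G ?ps n = eval ?G (n # hist G ?ps n # ?ps)" for n
    using covE[of G "?ps" n] by (simp add: G_def)
  have lt: "a < 8 * prod_encode (a, b) + c" "b < 8 * prod_encode (a, b) + c" 
    if "c > 0" for a b c
    using that le_prod_encode_1[of a b] le_prod_encode_2[of b a] by linarith+
  have E: "eval (ptsubst \<sigma> a k s') ys = gnt (tsubst (\<rho> (eval k ys)) t)"
    if "eval a ys = gnt t" "eval s' ys = eval s xs" for a k s' ys t
    by (rule eval_ptsubst[OF that(1)]) (simp add: that \<sigma>)
  have "cov G ?ps (prod_encode (gn \<phi>, k)) = gn (fsubst (\<rho> k) \<phi>)" for k
    by (induction \<phi> arbitrary: k; subst R)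
     (simp_all add: Let_def eval_plook gn_mod[simplified] E pcons_defs up prod_encode_less lt)
  then show ?thesis unfolding pfsubst_def G_def[symmetric] eval_pcov using a by simp
qed

lemma tlift_tlift: "tlift 1 (tlift k t) = tlift (Suc k) t"
  by (induction t) (auto simp: tlift_def)

lemma eval_pfshift [simp]: "eval a xs = gn \<phi> \<Longrightarrow> eval (pfshift a) xs = gn (fshift \<phi>)"
proof -
  assume a: "eval a xs = gn \<phi>"
  show ?thesis unfolding pfshift_def
    apply (subst eval_pfsubst[where \<rho> = "\<lambda>k i. Var (if k \<le> i then Suc i else i)", OF a])
      apply (auto simp: pcons_defs up_def fun_eq_iff tlift_def fshift_def split: nat.split)
    done
qed

lemma eval_pinst [simp]: "eval a xs = gn \<phi> \<Longrightarrow> eval b xs = gnt t \<Longrightarrow> eval (pinst a b) xs = gn (inst \<phi> t)"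
proof -
  assume a: "eval a xs = gn \<phi>" and b: "eval b xs = gnt t"
  have L: "eval (ptlift (PProj 1) (PProj 2)) [i, k, gnt t] = gnt (tlift k t)" for i k
    unfolding ptlift_def tlift_def
    by (rule eval_ptsubst) (auto simp: pcons_defs)
  have 0: "case_nat t Var = (\<lambda>i. if i = 0 then tlift 0 t else Var (if 0 \<le> i then i - 1 else i))"
    by (auto simp: fun_eq_iff tlift_def split: nat.split) (induct t; simp)
  show ?thesis unfolding pinst_def inst_def 0
    apply (rule eval_pfsubst[where \<rho> = "\<lambda>k i. if i = k then tlift k t else Var (if k \<le> i then i - 1 else i)", OF a])
     apply (use L b in \<open>simp add: pcons_defs Let_def\<close>)
    using tlift_tlift
    apply (auto simp: up_def fun_eq_iff  split: nat.split)
    apply (auto simp: tlift_def)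
    done
qed

lemma enc_mono: "a \<le> c \<Longrightarrow> b \<le> d \<Longrightarrow> prod_encode (a, b) \<le> prod_encode (c, d)"
  using triangle_mono[of "a + b" "c + d"] by (simp add: prod_encode_def)
lemma gnt_tlift: "gnt t \<le> gnt (tlift k t)"
proof (induction t)
  case (Plus t1 t2) then show ?case
    by (simp add: tlift_def enc_mono)
next case (Times t1 t2) then show ?case
    by (simp add: tlift_def enc_mono)
qed (auto simp: tlift_def)

lemma tsubst_bound:
  assumes "\<And>i. i \<noteq> k \<Longrightarrow> \<rho> i = \<rho>' i"
  shows "tsubst \<rho> s = tsubst \<rho>' s \<or> gnt (\<rho> k) \<le> gnt (tsubst \<rho> s)"
proof (induction s)
  case (Var x) then show ?case using assms by (cases "x = k") auto
next
  case (Plus s1 s2) then show ?case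
    using le_prod_encode_1[of "gnt (tsubst \<rho> s1)" "gnt (tsubst \<rho> s2)"] le_prod_encode_2[of "gnt (tsubst \<rho> s2)" "gnt (tsubst \<rho> s1)"] by auto
next
  case (Times s1 s2) then show ?case
    using le_prod_encode_1[of "gnt (tsubst \<rho> s1)" "gnt (tsubst \<rho> s2)"] le_prod_encode_2[of "gnt (tsubst \<rho> s2)" "gnt (tsubst \<rho> s1)"] by auto
qed auto

lemma fsubst_bound:
  assumes "\<And>i. i \<noteq> k \<Longrightarrow> \<rho> i = \<rho>' i"
  shows "fsubst \<rho> s = fsubst \<rho>' s \<or> gnt (\<rho> k) \<le> gn (fsubst \<rho> s)"
  using assms
proof (induction s arbitrary: \<rho> \<rho>' k)
  case (Eq a b) 
  show ?case using tsubst_bound[of k \<rho> \<rho>' a, OF Eq] tsubst_bound[of k \<rho> \<rho>' b, OF Eq]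
    le_prod_encode_1[of "gnt (tsubst \<rho> a)" "gnt (tsubst \<rho> b)"] le_prod_encode_2[of "gnt (tsubst \<rho> b)" "gnt (tsubst \<rho> a)"] by auto
next
  case (Less a b) 
  show ?case using tsubst_bound[of k \<rho> \<rho>' a, OF Less] tsubst_bound[of k \<rho> \<rho>' b, OF Less]
    le_prod_encode_1[of "gnt (tsubst \<rho> a)" "gnt (tsubst \<rho> b)"] le_prod_encode_2[of "gnt (tsubst \<rho> b)" "gnt (tsubst \<rho> a)"] by auto
next
  case (Neg s) show ?case using Neg.IH[of k \<rho> \<rho>', OF Neg.prems] by auto
next
  case (Conj a b) show ?case using Conj.IH(1)[of k \<rho> \<rho>', OF Conj.prems] Conj.IH(2)[of k \<rho> \<rho>', OF Conj.prems] 
    le_prod_encode_1[of "gn (fsubst \<rho> a)" "gn (fsubst \<rho> b)"] le_prod_encode_2[of "gn (fsubst \<rho> b)" "gn (fsubst \<rho> a)"] by auto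
next
  case (Disj a b) show ?case using Disj.IH(1)[of k \<rho> \<rho>', OF Disj.prems] Disj.IH(2)[of k \<rho> \<rho>', OF Disj.prems] 
    le_prod_encode_1[of "gn (fsubst \<rho> a)" "gn (fsubst \<rho> b)"] le_prod_encode_2[of "gn (fsubst \<rho> b)" "gn (fsubst \<rho> a)"] by auto
next
  case (Imp a b) show ?case using Imp.IH(1)[of k \<rho> \<rho>', OF Imp.prems] Imp.IH(2)[of k \<rho> \<rho>', OF Imp.prems] 
    le_prod_encode_1[of "gn (fsubst \<rho> a)" "gn (fsubst \<rho> b)"] le_prod_encode_2[of "gn (fsubst \<rho> b)" "gn (fsubst \<rho> a)"] by auto
next
  case (Forall s)
  have "up \<rho> i = up \<rho>' i" if "i \<noteq> Suc k" for i using that Forall.prems by (auto simp: up_def split: nat.split)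
  from Forall.IH[of "Suc k" "up \<rho>" "up \<rho>'", OF this] show ?case using gnt_tlift[of "\<rho> k" 1] by (auto simp: up_def)
next
  case (Exists s)
  have "up \<rho> i = up \<rho>' i" if "i \<noteq> Suc k" for i using that Exists.prems by (auto simp: up_def split: nat.split)
  from Exists.IH[of "Suc k" "up \<rho>" "up \<rho>'", OF this] show ?case using gnt_tlift[of "\<rho> k" 1] by (auto simp: up_def)
qed

lemma inst_bound: "\<exists>t'. inst A t = inst A t' \<and> gnt t' \<le> Suc (gn (inst A t))"
proof -
  have "inst A t = inst A Zero \<or> gnt t \<le> gn (inst A t)"
    using fsubst_bound[of 0 "case_nat t Var" "case_nat Zero Var" A] by (auto simp: inst_def split: nat.splits)
  then show ?thesis by (metis One_nat_def Suc_leI gnt.simps(2) le_SucI not_less_eq zero_less_Suc)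
qed

subsection \<open>Proofs\<close>

definition cEq where "cEq a b = 8 * prod_encode (a, b)"
definition cLess where "cLess a b = 8 * prod_encode (a, b) + 1"
definition cNeg where "cNeg a = (8 * a + 2 :: nat)"
definition cConj where "cConj a b = 8 * prod_encode (a, b) + 3"
definition cDisj where "cDisj a b = 8 * prod_encode (a, b) + 4"
definition cImp where "cImp a b = 8 * prod_encode (a, b) + 5"
definition cForall where "cForall a = (8 * a + 6 :: nat)"
definition cExists where "cExists a = (8 * a + 7 :: nat)"
definition cSucc where "cSucc a = (5 * a + 2 :: nat)"
definition cPlus where "cPlus a b = 5 * prod_encode (a, b) + 3"
definition cTimes where "cTimes a b = 5 * prod_encode (a, b) + 4"
definition cU where "cU x = (x div 8 :: nat)"
definition cL where "cL x = fst (prod_decode (cU x))"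
definition cR where "cR x = snd (prod_decode (cU x))"
lemmas cdefs = cEq_def cLess_def cNeg_def cConj_def cDisj_def cImp_def cForall_def cExists_def cSucc_def cPlus_def cTimes_def

lemma cinj0:
  "gn t = cEq a b \<longleftrightarrow> (\<exists>s u. t = Eq s u \<and> a = gnt s \<and> b = gnt u)"
  "gn t = cLess a b \<longleftrightarrow> (\<exists>s u. t = Less s u \<and> a = gnt s \<and> b = gnt u)"
  "gn t = cNeg p \<longleftrightarrow> (\<exists>s. t = Neg s \<and> p = gn s)"
  "gn t = cConj a b \<longleftrightarrow> (\<exists>s u. t = Conj s u \<and> a = gn s \<and> b = gn u)"
  "gn t = cDisj a b \<longleftrightarrow> (\<exists>s u. t = Disj s u \<and> a = gn s \<and> b = gn u)"
  "gn t = cImp a b \<longleftrightarrow> (\<exists>s u. t = Imp s u \<and> a = gn s \<and> b = gn u)"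
  "gn t = cForall p \<longleftrightarrow> (\<exists>s. t = Forall s \<and> p = gn s)"
  "gn t = cExists p \<longleftrightarrow> (\<exists>s. t = Exists s \<and> p = gn s)"
  "gnt w = cSucc p \<longleftrightarrow> (\<exists>s. w = Succ s \<and> p = gnt s)"
  "gnt w = cPlus a b \<longleftrightarrow> (\<exists>s u. w = Plus s u \<and> a = gnt s \<and> b = gnt u)"
  "gnt w = cTimes a b \<longleftrightarrow> (\<exists>s u. w = Times s u \<and> a = gnt s \<and> b = gnt u)"
  unfolding cdefs
  using gn_eqs[of "prod_encode (a, b)" t] gn_eqs[of p t] gnt_eqs[of p w] gnt_eqs[of "prod_encode (a, b)" w]
  by (simp_all add: eq_commute[of "gn t"] eq_commute[of "gnt w"])
lemmas cinj = cinj0 cinj0[THEN trans[OF eq_commute]]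
lemma cinj2: "cImp (gn A) (gn B) = gn (Imp A B)" "cForall (gn A) = gn (Forall A)" "cExists (gn A) = gn (Exists A)"
   "cNeg (gn A) = gn (Neg A)" "cConj (gn A) (gn B) = gn (Conj A B)" "cDisj (gn A) (gn B) = gn (Disj A B)"
   "cEq (gnt s) (gnt t) = gn (Eq s t)" "cLess (gnt s) (gnt t) = gn (Less s t)"
   "cSucc (gnt s) = gnt (Succ s)" "cPlus (gnt s) (gnt t) = gnt (Plus s t)" "cTimes (gnt s) (gnt t) = gnt (Times s t)"
  by (simp_all add: cdefs)
lemma csel: "cL (gn (Imp A B)) = gn A" "cR (gn (Imp A B)) = gn B" "cL (gn (Conj A B)) = gn A" "cR (gn (Conj A B)) = gn B"
   "cL (gn (Disj A B)) = gn A" "cR (gn (Disj A B)) = gn B"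
   "cL (gn (Eq s t)) = gnt s" "cR (gn (Eq s t)) = gnt t"  "cL (gn (Less s t)) = gnt s" "cR (gn (Less s t)) = gnt t"
   "cU (gn (Forall A)) = gn A" "cU (gn (Exists A)) = gn A"  "cU (gn (Neg A)) = gn A"
  by (simp_all add: cL_def cR_def cU_def gn_mod[simplified])
lemma ceval:
  "eval (pEq a b) xs = cEq (eval a xs) (eval b xs)"
  "eval (pLess a b) xs = cLess (eval a xs) (eval b xs)"
  "eval (pNeg a) xs = cNeg (eval a xs)"
  "eval (pConj a b) xs = cConj (eval a xs) (eval b xs)"
  "eval (pDisj a b) xs = cDisj (eval a xs) (eval b xs)"
  "eval (pImp a b) xs = cImp (eval a xs) (eval b xs)"
  "eval (pForall a) xs = cForall (eval a xs)"
  "eval (pExists a) xs = cExists (eval a xs)"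
  "eval (pSucc a) xs = cSucc (eval a xs)"
  "eval (pPlus a b) xs = cPlus (eval a xs) (eval b xs)"
  "eval (pTimes a b) xs = cTimes (eval a xs) (eval b xs)"
  "eval (pdiv a 8) xs = cU (eval a xs)"
  "fst (prod_decode (cU z)) = cL z" "snd (prod_decode (cU z)) = cR z"
  by (simp_all add: cdefs pcons_defs cL_def cR_def cU_def)

lemma por_pos: "(0 < eval (por a b) xs) \<longleftrightarrow> (0 < eval a xs \<or> 0 < eval b xs)"
  by simp
lemma peq_pos: "(0 < eval (peq a b) xs) \<longleftrightarrow> (eval a xs = eval b xs)"
  by simp
lemma pex_pos: "(0 < eval (pex p a bs) xs) \<longleftrightarrow> (\<exists>i<eval a xs. 0 < eval p (i # map (\<lambda>b. eval b xs) bs))"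
  by simp
lemma pand_pos: "(0 < eval (pand a b) xs) \<longleftrightarrow> (0 < eval a xs \<and> 0 < eval b xs)"
  by simp
lemma tm_pos: "(0 < eval (pis_tm a) xs) \<longleftrightarrow> (\<exists>t. eval a xs = gnt t)"
  by simp
lemmas eval_pos = por_pos peq_pos pex_pos pand_pos tm_pos
lemma PZero_pos: "\<not> 0 < eval PZero xs" by simp

lemma logax_eval:
  assumes "eval a xs = x" shows
  "0 < eval (plogical_axiom a) xs \<longleftrightarrow>
   x = cImp (cL x) (cImp (cL (cR x)) (cL x)) \<or>
   x = cImp (cImp (cL (cL x)) (cImp (cL (cR (cL x))) (cR (cR (cL x))))) (cImp (cImp (cL (cL x)) (cL (cR (cL x)))) (cImp (cL (cL x)) (cR (cR (cL x))))) \<or>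
   x = cImp (cConj (cL (cL x)) (cR (cL x))) (cL (cL x)) \<or>
   x = cImp (cConj (cL (cL x)) (cR (cL x))) (cR (cL x)) \<or>
   x = cImp (cL x) (cImp (cL (cR x)) (cConj (cL x) (cL (cR x)))) \<or>
   x = cImp (cL x) (cDisj (cL x) (cR (cR x))) \<or>
   x = cImp (cL x) (cDisj (cL (cR x)) (cL x)) \<or>
   x = cImp (cImp (cL (cL x)) (cR (cL x))) (cImp (cImp (cL (cL (cR x))) (cR (cL x))) (cImp (cDisj (cL (cL x)) (cL (cL (cR x)))) (cR (cL x)))) \<or>
   x = cImp (cImp (cL (cL x)) (cR (cL x))) (cImp (cImp (cL (cL x)) (cNeg (cR (cL x)))) (cNeg (cL (cL x)))) \<or>
   x = cImp (cNeg (cNeg (cR x))) (cR x) \<or>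
   (\<exists>t. gnt t < Suc x \<and> x = cImp (cForall (cU (cL x))) (eval (pinst (pdiv (pfst (pdiv (PProj 1) 8)) 8) (PProj 0)) [gnt t, x])) \<or>
   x = cImp (cForall (cImp (eval (pfshift (pfst (pdiv (psnd (pdiv (PProj 0) 8)) 8))) [x]) (cU (cR (cR x))))) (cImp (cL (cR x)) (cForall (cU (cR (cR x))))) \<or>
   (\<exists>t. gnt t < Suc x \<and> x = cImp (eval (pinst (pdiv (psnd (pdiv (PProj 1) 8)) 8) (PProj 0)) [gnt t, x]) (cExists (cU (cR x)))) \<or>
   x = cImp (cForall (cImp (cU (cL (cR x))) (eval (pfshift (psnd (pdiv (psnd (pdiv (PProj 0) 8)) 8))) [x]))) (cImp (cExists (cU (cL (cR x)))) (cR (cR x))) \<or>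
   x = cEq (cL x) (cL x) \<or>
   x = cImp (cEq (cL (cL x)) (cR (cL x))) (cImp (cEq (cL (cL x)) (cR (cL (cR x)))) (cEq (cR (cL x)) (cR (cL (cR x))))) \<or>
   x = cImp (cEq (cL (cL x)) (cR (cL x))) (cEq (cSucc (cL (cL x))) (cSucc (cR (cL x)))) \<or>
   x = cImp (cEq (cL (cL x)) (cR (cL x))) (cImp (cEq (cL (cL (cR x))) (cR (cL (cR x)))) (cEq (cPlus (cL (cL x)) (cL (cL (cR x)))) (cPlus (cR (cL x)) (cR (cL (cR x)))))) \<or>
   x = cImp (cEq (cL (cL x)) (cR (cL x))) (cImp (cEq (cL (cL (cR x))) (cR (cL (cR x)))) (cEq (cTimes (cL (cL x)) (cL (cL (cR x)))) (cTimes (cR (cL x)) (cR (cL (cR x)))))) \<or>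
   x = cImp (cEq (cL (cL x)) (cR (cL x))) (cImp (cEq (cL (cL (cR x))) (cR (cL (cR x)))) (cImp (cLess (cL (cL x)) (cL (cL (cR x)))) (cLess (cR (cL x)) (cR (cL (cR x))))))"
proof -
  have ex: "(\<exists>i<n. (\<exists>t. i = gnt t) \<and> P i) \<longleftrightarrow> (\<exists>t. gnt t < n \<and> P (gnt t))" for n P by blast
  have A: "eval (PProj 0) (y # ys) = y" "eval (PProj 1) (y # z # ys) = z" "eval (psuc b) ys = Suc (eval b ys)" for y z ys b
    by simp_all
  have C: "0 < eval (PComp f [a]) xs \<longleftrightarrow> 0 < eval f [x]" for f using assms by simp
  show ?thesis
    unfolding plogical_axiom_def Let_def C
    by (simp only: foldr.simps comp_apply id_apply eval_pos PZero_pos ceval eval_pfst eval_psnd A list.map ex simp_thms)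
qed

lemma plogical_axiom_complete:
  assumes "eval a xs = gn \<phi>" "logical_axiom \<phi>" shows "0 < eval (plogical_axiom a) xs"
proof -
  note L = logax_eval[OF assms(1)]
  note [simp del] = gn.simps gnt.simps and [simp] = csel cinj2
  show ?thesis using assms(2) 
  proof cases
    case imp1 then show ?thesis unfolding L by simp
  next case imp2 then show ?thesis unfolding L by simp
  next case conj1 then show ?thesis unfolding L by simp
  next case conj2 then show ?thesis unfolding L by simp
  next case conj3 then show ?thesis unfolding L by simp
  next case disj1 then show ?thesis unfolding L by simp
  next case disj2 then show ?thesis unfolding L by simp
  next case disj3 then show ?thesis unfolding L by simp
  next case neg1 then show ?thesis unfolding L by simp
  next case neg2 then show ?thesis unfolding L by simp
  next case eq1 then show ?thesis unfolding L by simp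
  next case eq2 then show ?thesis unfolding L by simp
  next case eq_Succ then show ?thesis unfolding L by simp
  next case eq_Plus then show ?thesis unfolding L by simp
  next case eq_Times then show ?thesis unfolding L by simp
  next case eq_Less then show ?thesis unfolding L by simp
  next
    case (all1 A t)
    obtain t' where t': "inst A t = inst A t'" "gnt t' \<le> Suc (gn (inst A t))" using inst_bound by blast
    have "gnt t' < Suc (gn \<phi>)" using t'(2) le_prod_encode_2[of "gn (inst A t)" "gn (Forall A)"]
      by (simp add: all1 gn.simps(6))
    then have "\<exists>t. gnt t < Suc (gn \<phi>) \<and> gn \<phi> = cImp (cForall (cU (cL (gn \<phi>)))) (eval (pinst (pdiv (pfst (pdiv (PProj 1) 8)) 8) (PProj 0)) [gnt t, gn \<phi>])"
      by (intro exI[of _ t'] conjI) (auto simp: all1 ceval t'(1)[symmetric] eval_pinst[where \<phi>=A and t=t'])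
    then show ?thesis unfolding L by blast
  next
    case (ex1 A t)
    obtain t' where t': "inst A t = inst A t'" "gnt t' \<le> Suc (gn (inst A t))" using inst_bound by blast
    have "gnt t' < Suc (gn \<phi>)" using t'(2) le_prod_encode_1[of "gn (inst A t)" "gn (Exists A)"]
      by (simp add: ex1 gn.simps(6))
    then have "\<exists>t. gnt t < Suc (gn \<phi>) \<and> gn \<phi> = cImp (eval (pinst (pdiv (psnd (pdiv (PProj 1) 8)) 8) (PProj 0)) [gnt t, gn \<phi>]) (cExists (cU (cR (gn \<phi>))))"
      by (intro exI[of _ t'] conjI) (auto simp: ex1 ceval t'(1)[symmetric] eval_pinst[where \<phi>=A and t=t'])
    then show ?thesis unfolding L by blast
  next
    case (all2 B A)
    have "eval (pfshift (pfst (pdiv (psnd (pdiv (PProj 0) 8)) 8))) [gn \<phi>] = gn (fshift B)"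
      by (rule eval_pfshift) (simp add: all2 ceval)
    then have "gn \<phi> = cImp (cForall (cImp (eval (pfshift (pfst (pdiv (psnd (pdiv (PProj 0) 8)) 8))) [gn \<phi>]) (cU (cR (cR (gn \<phi>)))))) (cImp (cL (cR (gn \<phi>))) (cForall (cU (cR (cR (gn \<phi>))))))"
      by (simp add: all2)
    then show ?thesis unfolding L by blast
  next
    case (ex2 A B)
    have "eval (pfshift (psnd (pdiv (psnd (pdiv (PProj 0) 8)) 8))) [gn \<phi>] = gn (fshift B)"
      by (rule eval_pfshift) (simp add: ex2 ceval)
    then have "gn \<phi> = cImp (cForall (cImp (cU (cL (cR (gn \<phi>)))) (eval (pfshift (psnd (pdiv (psnd (pdiv (PProj 0) 8)) 8))) [gn \<phi>]))) (cImp (cExists (cU (cL (cR (gn \<phi>))))) (cR (cR (gn \<phi>))))"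
      by (simp add: ex2)
    then show ?thesis unfolding L by blast
  qed
qed

lemma plogical_axiom_sound:
  assumes "eval a xs = gn \<phi>" "0 < eval (plogical_axiom a) xs" shows "logical_axiom \<phi>"
proof -
  note L = logax_eval[OF assms(1)]
  note [simp del] = gn.simps gnt.simps and [simp] = csel cinj2
  note [intro] = logical_axiom.intros
  show ?thesis using assms(2) unfolding L
    apply (elim disjE exE conjE)
    subgoal by (auto simp: cinj)
    subgoal by (auto simp: cinj)
    subgoal by (auto simp: cinj)
    subgoal by (auto simp: cinj)
    subgoal by (auto simp: cinj)
    subgoal by (auto simp: cinj)
    subgoal by (auto simp: cinj)
    subgoal by (auto simp: cinj)
    subgoal by (auto simp: cinj)
    subgoal by (auto simp: cinj)
    subgoal for t
      using eval_pinst[of "pdiv (pfst (pdiv (PProj 1) 8)) 8" "[gnt t, gn \<phi>]" _ "PProj 0" t]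
      by (auto simp: ceval cinj)
    subgoal
      using eval_pfshift[of "pfst (pdiv (psnd (pdiv (PProj 0) 8)) 8)" "[gn \<phi>]"]
      by (auto simp: ceval cinj)
    subgoal for t
      using eval_pinst[of "pdiv (psnd (pdiv (PProj 1) 8)) 8" "[gnt t, gn \<phi>]" _ "PProj 0" t]
      by (auto simp: ceval cinj)
    subgoal
      using eval_pfshift[of "psnd (pdiv (psnd (pdiv (PProj 0) 8)) 8)" "[gn \<phi>]"]
      by (auto simp: ceval cinj)
    subgoal by (auto simp: cinj)
    subgoal by (auto simp: cinj)
    subgoal by (auto simp: cinj)
    subgoal by (auto simp: cinj)
    subgoal by (auto simp: cinj)
    subgoal by (auto simp: cinj)
    done
qed

lemma list_code: "\<exists>L. n = list_encode L" by (metis list_decode_inverse)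

lemma pis_proof_correct:
  assumes tau: "\<And>n. eval \<tau> [n] = 1 \<longleftrightarrow> n \<in> gn ` T"
  shows "eval (pis_proof \<tau> a) xs = of_bool (\<exists>L. eval a xs = list_gn L \<and> is_proof T L)"
proof -
  let ?G = "let y = PProj 0; x = phd y; l = ptl y in
      pite y
        (pand (plook l) (pand (pis_fm x)
          (por (plogical_axiom x) (por (peq (PComp \<tau> [x]) (pnum 1))
          (por (pex (pand (pmem (PProj 0) (PProj 2)) (pmem (pImp (PProj 0) (PProj 1)) (PProj 2)))
                 y [x, l])
               (pex (pand (pmem (PProj 0) (PProj 2)) (peq (PProj 1) (pForall (PProj 0))))
                 y [x, l]))))))
        (pnum 1)"
  define G where "G = ?G"
  have R: "cov G [] n = eval ?G (n # hist G [] n # [])" for n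
    using covE[of G "[]" n] by (simp add: G_def)
  have main: "cov G [] (list_encode K) = of_bool (\<exists>L. K = map gn L \<and> is_proof T L)" for K
  proof (induction K)
    case Nil
    show ?case by (subst R) (simp add: Let_def)
  next
    case (Cons x K)
    have lt: "list_encode K < Suc (prod_encode (x, list_encode K))"
      by (simp add: le_prod_encode_2 less_Suc_eq_le)
    have mem: "y \<in> set K \<Longrightarrow> y < list_encode (x # K)" for y
    proof -
      have "y \<in> set K \<Longrightarrow> y < list_encode K" for y K
        by (induction K) (auto simp: less_Suc_eq_le intro: le_prod_encode_1 order_trans[OF less_imp_le le_prod_encode_2])
      then show "y \<in> set K \<Longrightarrow> y < list_encode (x # K)" using lt by fastforce
    qed
    let ?env = "[Suc (prod_encode (x, list_encode K)), hist G [] (Suc (prod_encode (x, list_encode K)))]"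
    have ax: "0 < eval (plogical_axiom (phd (PProj 0))) ?env \<longleftrightarrow> logical_axiom \<phi>" if "x = gn \<phi>" for \<phi>
      using plogical_axiom_sound[of "phd (PProj 0)" ?env \<phi>] plogical_axiom_complete[of "phd (PProj 0)" ?env \<phi>] that
      by auto
    have 1: "(\<exists>i<Suc (prod_encode (x, list_encode K)). i \<in> set K \<and> cImp i x \<in> set K) \<longleftrightarrow> (\<exists>i\<in>set K. cImp i x \<in> set K)"
      using mem by auto
    have 2: "(\<exists>i<Suc (prod_encode (x, list_encode K)). i \<in> set K \<and> x = cForall i) \<longleftrightarrow> (\<exists>i\<in>set K. x = cForall i)"
      using mem by auto
    have E: "0 < cov G [] (list_encode (x # K)) \<longleftrightarrow> (\<exists>L. K = map gn L \<and> is_proof T L) \<and> (\<exists>\<phi>. x = gn \<phi>) \<and>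
       (0 < eval (plogical_axiom (phd (PProj 0))) ?env \<or> eval \<tau> [x] = 1 \<or> (\<exists>i\<in>set K. cImp i x \<in> set K) \<or> (\<exists>i\<in>set K. x = cForall i))"
      apply (subst R)
      apply (simp add: Let_def eval_plook lt Cons ceval 1 2 del: eval_por flip: of_bool_conj)
      apply (simp add: por_pos pex_pos pand_pos 1 2 ceval del: eval_por eval_pex eval_pand)
      done
    have B: "cov G [] (list_encode (x # K)) \<le> 1"
      by (subst R) (simp add: Let_def)
    have A: "0 < cov G [] (list_encode (x # K)) \<longleftrightarrow> (\<exists>L. x # K = map gn L \<and> is_proof T L)"
    proof -
      have "(\<exists>i\<in>set K. cImp i x \<in> set K) \<longleftrightarrow> (\<exists>\<psi>\<in>set L. Imp \<psi> \<phi> \<in> set L)" 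
           "(\<exists>i\<in>set K. x = cForall i) \<longleftrightarrow> (\<exists>\<psi>\<in>set L. \<phi> = Forall \<psi>)"
        if "x = gn \<phi>" "K = map gn L" for \<phi> L
        unfolding that by (auto simp: cinj2 image_iff simp del: gn.simps)
      note mp = this
      have tau': "eval \<tau> [gn \<phi>] = 1 \<longleftrightarrow> \<phi> \<in> T" for \<phi> unfolding tau by (auto simp: image_iff)
      have "0 < cov G [] (list_encode (x # K)) \<longleftrightarrow> (\<exists>L \<phi>. K = map gn L \<and> x = gn \<phi> \<and> is_proof T (\<phi> # L))"
      proof
        assume "0 < cov G [] (list_encode (x # K))"
        note e = this[unfolded E]
        from e obtain L \<phi> where L: "K = map gn L" "x = gn \<phi>" "is_proof T L" by blast
        from e have "is_proof T (\<phi> # L)" unfolding ax[OF L(2)] mp[OF L(2,1)]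
          using L(3) tau'[of \<phi>] L(2) by auto
        with L show "\<exists>L \<phi>. K = map gn L \<and> x = gn \<phi> \<and> is_proof T (\<phi> # L)" by blast
      next
        assume "\<exists>L \<phi>. K = map gn L \<and> x = gn \<phi> \<and> is_proof T (\<phi> # L)"
        then obtain L \<phi> where L: "K = map gn L" "x = gn \<phi>" "is_proof T (\<phi> # L)" by blast
        show "0 < cov G [] (list_encode (x # K))" unfolding E ax[OF L(2)] mp[OF L(2,1)]
          using L tau'[of \<phi>] by auto
      qed
      also have "\<dots> \<longleftrightarrow> (\<exists>L. x # K = map gn L \<and> is_proof T L)"
        unfolding Cons_eq_map_conv by blast
      finally show ?thesis .
    qed
    have C: "(0 < c \<longleftrightarrow> P) \<Longrightarrow> c \<le> 1 \<Longrightarrow> c = of_bool P" for c :: nat and P by (cases P) auto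
    show ?case by (rule C[OF A B])
  qed
  show ?thesis unfolding pis_proof_def G_def[symmetric] eval_pcov list_gn_def
  proof -
    obtain K where K: "eval a xs = list_encode K" using list_code by blast
    show "cov G (map (\<lambda>b. eval b xs) []) (eval a xs) = of_bool (\<exists>L. eval a xs = list_encode (map gn L) \<and> is_proof T L)"
      unfolding K list_encode_eq using main[of K] by simp
  qed
qed

theorem pproof_correct:
  assumes "pr_axiomatized \<tau> T"
  shows "eval (pproof \<tau>) [gn \<phi>, y] = 1 \<longleftrightarrow> (\<exists>L. y = list_gn (\<phi> # L) \<and> is_proof T (\<phi> # L))"
proof -
  have tau: "eval \<tau> [n] = 1 \<longleftrightarrow> n \<in> gn ` T" for n
    using assms by (simp add: pr_axiomatized_def)
  have "eval (pproof \<tau>) [gn \<phi>, y] = 1 \<longleftrightarrow> y \<noteq> 0 \<and> lhd y = gn \<phi> \<and> (\<exists>L. y = list_gn L \<and> is_proof T L)"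
    by (simp add: pproof_def pis_proof_correct[OF tau])
  also have "\<dots> \<longleftrightarrow> (\<exists>L. y = list_gn (\<phi> # L) \<and> is_proof T (\<phi> # L))" (is "?l \<longleftrightarrow> ?r")
  proof
    assume ?l
    then obtain L where L: "y = list_gn L" "is_proof T L" "y \<noteq> 0" "lhd y = gn \<phi>" by blast
    then obtain \<psi> M where M: "L = \<psi> # M" by (cases L) (auto simp: list_gn_def)
    with L have "\<psi> = \<phi>" by (simp add: list_gn_def)
    with L M show ?r by blast
  next
    assume ?r
    then obtain L where L: "y = list_gn (\<phi> # L)" "is_proof T (\<phi> # L)" by blast
    then have "y \<noteq> 0" "lhd y = gn \<phi>" by (simp_all add: list_gn_def)
    with L show ?l by blast
  qed
  finally show ?thesis .
qed

lemma is_proof_sound: "is_proof T L \<Longrightarrow> \<phi> \<in> set L \<Longrightarrow> T \<turnstile> \<phi>"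
  by (induction L arbitrary: \<phi>) (auto intro: derivable.intros)
lemma is_proof_append: "is_proof T L \<Longrightarrow> is_proof T M \<Longrightarrow> is_proof T (L @ M)"
  by (induction L) auto
lemma is_proof_complete: "T \<turnstile> \<phi> \<Longrightarrow> \<exists>L. is_proof T (\<phi> # L)"
proof (induction rule: derivable.induct)
  case (mp \<psi> \<phi>)
  then obtain L M where "is_proof T (Imp \<psi> \<phi> # L)" "is_proof T (\<psi> # M)" by blast
  then have "is_proof T ((Imp \<psi> \<phi> # L) @ (\<psi> # M))" by (rule is_proof_append)
  then have "is_proof T (\<phi> # (Imp \<psi> \<phi> # L) @ (\<psi> # M))" by auto
  then show ?case by blast
next
  case (gen \<phi>)
  then obtain L where "is_proof T (\<phi> # L)" by blast
  then have "is_proof T (Forall \<phi> # \<phi> # L)" by auto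
  then show ?case by blast
next
  case (logical \<phi>) show ?case by (rule exI[of _ "[]"]) (simp add: logical)
next
  case (nonlogical \<phi>) show ?case by (rule exI[of _ "[]"]) (simp add: nonlogical)
qed
theorem derivable_iff: "T \<turnstile> \<phi> \<longleftrightarrow> (\<exists>L. is_proof T (\<phi> # L))"
  using is_proof_sound[of T "\<phi> # _" \<phi>] is_proof_complete by auto

corollary pproof_derivable:
  "pr_axiomatized \<tau> T \<Longrightarrow> T \<turnstile> \<phi> \<longleftrightarrow> (\<exists>y. eval (pproof \<tau>) [gn \<phi>, y] = 1)"
  unfolding derivable_iff by (simp only: pproof_correct) blast

end

theory Submission
  imports Defs "HOL-Library.Countable_Set" "HOL-Library.Product_Lexorder"
begin

text \<open>
  By the completeness theorem, provability in \<open>PA\<close> is truth in all countable models of \<open>PA\<close>, so all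
  formalised arguments take place inside a model.

  The proof predicate enumerates the theorems of \<open>T\<close> in the order of their proofs until a bell rings. The
  bell rings only if \<open>T\<close> is inconsistent, hence never in the standard model; after the bell every
  formula may be enumerated, in any order. Each number \<open>k\<close> that codes no formula can describe a world:
  a finite list of formulas that is enumerated right after the bell, together with the propositional
  variables that are to be true. The sentence \<open>SF(k)\<close> says that the bell has chosen \<open>k\<close>, and the bell
  rings for \<open>k\<close> as soon as some theorem is found to imply \<open>\<not>SF(k)\<close>; so \<open>T\<close> refutes no \<open>SF(k)\<close>.
  If \<open>A\<close> is not a theorem of \<open>NR4\<close>, some assignment to its boxed subformulas that respects the theorems of
  \<open>NR4\<close> falsifies it, and listing the subformulas and their negations in a suitable order
  makes \<open>\<box>B\<close> true exactly as prescribed in every model of \<open>SF(k)\<close>. Then \<open>PA\<close> proves that the interpretation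
  of \<open>A\<close> implies \<open>\<not>SF(k)\<close>, and \<open>T\<close> cannot prove the interpretation of \<open>A\<close>.

  Before the bell, formulas may already have been enumerated by nonstandard proofs. An induction on
  the box depth shows that such a formula, if it interprets a modal formula, interprets a theorem of
  \<open>NR4\<close>: otherwise its proof would have rung the bell.
\<close>

section \<open>Substitution\<close>

text \<open>Two demands conflict. Axiom \<open>four\<close> constrains the order of enumeration at
  every stage of every model, while completeness wants worlds whose order follows a given
  assignment. Before the bell the axiom is protected by the first clause of the bell: a proof of
  \<open>\<not>RF(x)\<close> without an earlier refutation of \<open>x\<close> rings. After the bell
  a list is used only if it passes the check \<open>valid\<close>. Ringing never disturbs agreement
  with provability: the sentence found refuted, \<open>RF(k)\<close> or \<open>SF(k)\<close>, is a
  true Sigma-1 sentence of the model, hence provable there, so the model regards \<open>T\<close> as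
  inconsistent, and enumerating every formula is correct. A single interpretation has to serve all
  modal formulas; therefore worlds are numbers, and a propositional variable is interpreted by
  reading the number that the bell chose. Because \<open>NR4\<close> does not let equivalents be
  interchanged under the box, boxes are given values formula by formula, and the interpretation has
  to be injective.\<close>

lemma tsubst_tsubst: "tsubst \<sigma> (tsubst \<rho> t) = tsubst (\<lambda>i. tsubst \<sigma> (\<rho> i)) t"
  by (induction t) auto

lemma tsubst_Var [simp]: "tsubst Var t = t"
  by (induction t) auto

lemma up_simps [simp]: "up \<sigma> 0 = Var 0" "up \<sigma> (Suc i) = tlift 1 (\<sigma> i)"
  by (simp_all add: up_def)

lemma tlift_simps [simp]:
  "tlift k (Var i) = Var (i + k)" "tlift k Zero = Zero" "tlift k (Succ t) = Succ (tlift k t)"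
  "tlift k (Plus s t) = Plus (tlift k s) (tlift k t)" "tlift k (Times s t) = Times (tlift k s) (tlift k t)"
  by (simp_all add: tlift_def)

lemma up_Var [simp]: "up Var = Var"
proof
  fix i show "up Var i = Var i" by (cases i) simp_all
qed

lemma tsubst_up_tlift: "tsubst (up \<sigma>) (tlift 1 t) = tlift 1 (tsubst \<sigma> t)"
  by (induction t) auto

lemma up_comp: "(\<lambda>i. tsubst (up \<sigma>) (up \<rho> i)) = up (\<lambda>i. tsubst \<sigma> (\<rho> i))"
proof
  fix i show "tsubst (up \<sigma>) (up \<rho> i) = up (\<lambda>i. tsubst \<sigma> (\<rho> i)) i"
    by (cases i) (simp_all add: tsubst_up_tlift del: One_nat_def)
qed

lemma fsubst_fsubst: "fsubst \<sigma> (fsubst \<rho> \<phi>) = fsubst (\<lambda>i. tsubst \<sigma> (\<rho> i)) \<phi>"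
  by (induction \<phi> arbitrary: \<sigma> \<rho>) (simp_all add: tsubst_tsubst up_comp)

lemma fsubst_Var [simp]: "fsubst Var \<phi> = \<phi>"
  by (induction \<phi>) simp_all

lemma fsubst_inst: "fsubst \<sigma> (inst A t) = inst (fsubst (up \<sigma>) A) (tsubst \<sigma> t)"
proof -
  have "tsubst (case_nat (tsubst \<sigma> t) Var) (up \<sigma> i) = tsubst \<sigma> (case_nat t Var i)" for i
    by (cases i) (simp_all add: tlift_def tsubst_tsubst)
  then show ?thesis by (simp add: inst_def fsubst_fsubst)
qed

lemma fsubst_fshift: "fsubst (up \<sigma>) (fshift A) = fshift (fsubst \<sigma> A)"
  by (simp add: fshift_def fsubst_fsubst tlift_def)

lemma tsubst_cong_below: "tm_below n t \<Longrightarrow> (\<And>i. i < n \<Longrightarrow> \<sigma> i = \<rho> i) \<Longrightarrow> tsubst \<sigma> t = tsubst \<rho> t"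
  by (induction t) auto

lemma fsubst_cong_below: "fm_below n \<phi> \<Longrightarrow> \<forall>i<n. \<sigma> i = \<rho> i \<Longrightarrow> fsubst \<sigma> \<phi> = fsubst \<rho> \<phi>"
proof (induction \<phi> arbitrary: n \<sigma> \<rho>)
  case (Forall \<phi>)
  have "up \<sigma> i = up \<rho> i" if "i < Suc n" for i using Forall.prems that by (cases i) auto
  then show ?case using Forall.IH[of "Suc n" "up \<sigma>" "up \<rho>"] Forall.prems(1) by simp
next
  case (Exists \<phi>)
  have "up \<sigma> i = up \<rho> i" if "i < Suc n" for i using Exists.prems that by (cases i) auto
  then show ?case using Exists.IH[of "Suc n" "up \<sigma>" "up \<rho>"] Exists.prems(1) by simp
next
  case (Eq s t) then show ?case using tsubst_cong_below[of n _ \<sigma> \<rho>] by auto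
next
  case (Less s t) then show ?case using tsubst_cong_below[of n _ \<sigma> \<rho>] by auto
next
  case (Neg \<phi>) show ?case using Neg.IH[of n \<sigma> \<rho>] Neg.prems by simp
next
  case (Conj \<phi> \<psi>) show ?case using Conj.IH(1)[of n \<sigma> \<rho>] Conj.IH(2)[of n \<sigma> \<rho>] Conj.prems by simp
next
  case (Disj \<phi> \<psi>) show ?case using Disj.IH(1)[of n \<sigma> \<rho>] Disj.IH(2)[of n \<sigma> \<rho>] Disj.prems by simp
next
  case (Imp \<phi> \<psi>) show ?case using Imp.IH(1)[of n \<sigma> \<rho>] Imp.IH(2)[of n \<sigma> \<rho>] Imp.prems by simp
qed

lemma fsubst_sentence: "sentence \<phi> \<Longrightarrow> fsubst \<sigma> \<phi> = \<phi>"
  using fsubst_cong_below[of 0 \<phi> \<sigma> Var] by (simp add: sentence_def)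

lemma tm_below_mono: "tm_below n t \<Longrightarrow> n \<le> m \<Longrightarrow> tm_below m t"
  by (induction t) auto

lemma fm_below_mono: "fm_below n \<phi> \<Longrightarrow> n \<le> m \<Longrightarrow> fm_below m \<phi>"
  by (induction \<phi> arbitrary: n m) (auto intro: tm_below_mono)

lemma tm_below_ex: "\<exists>n. tm_below n t"
proof (induction t)
  case (Plus s t)
  then obtain n m where "tm_below n s" "tm_below m t" by blast
  then have "tm_below (max n m) (Plus s t)" by (auto intro: tm_below_mono)
  then show ?case by blast
next
  case (Times s t)
  then obtain n m where "tm_below n s" "tm_below m t" by blast
  then have "tm_below (max n m) (Times s t)" by (auto intro: tm_below_mono)
  then show ?case by blast
qed auto

lemma fm_below_ex: "\<exists>n. fm_below n \<phi>"
proof (induction \<phi>)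
  case (Eq s t)
  obtain n m where "tm_below n s" "tm_below m t" using tm_below_ex by blast
  then have "fm_below (max n m) (Eq s t)" by (auto intro: tm_below_mono)
  then show ?case by blast
next
  case (Less s t)
  obtain n m where "tm_below n s" "tm_below m t" using tm_below_ex by blast
  then have "fm_below (max n m) (Less s t)" by (auto intro: tm_below_mono)
  then show ?case by blast
next
  case (Conj \<phi> \<psi>)
  then obtain n m where "fm_below n \<phi>" "fm_below m \<psi>" by blast
  then have "fm_below (max n m) (Conj \<phi> \<psi>)" by (auto intro: fm_below_mono)
  then show ?case by blast
next
  case (Disj \<phi> \<psi>)
  then obtain n m where "fm_below n \<phi>" "fm_below m \<psi>" by blast
  then have "fm_below (max n m) (Disj \<phi> \<psi>)" by (auto intro: fm_below_mono)
  then show ?case by blast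
next
  case (Imp \<phi> \<psi>)
  then obtain n m where "fm_below n \<phi>" "fm_below m \<psi>" by blast
  then have "fm_below (max n m) (Imp \<phi> \<psi>)" by (auto intro: fm_below_mono)
  then show ?case by blast
next
  case (Forall \<phi>)
  then obtain n where "fm_below n \<phi>" by blast
  then have "fm_below n (Forall \<phi>)" by (auto intro: fm_below_mono)
  then show ?case by blast
next
  case (Exists \<phi>)
  then obtain n where "fm_below n \<phi>" by blast
  then have "fm_below n (Exists \<phi>)" by (auto intro: fm_below_mono)
  then show ?case by blast
qed auto

lemma finite_fm_below: "finite G \<Longrightarrow> \<exists>n. \<forall>\<phi>\<in>G. fm_below n \<phi>"
proof (induction G rule: finite_induct)
  case (insert \<phi> G)
  then obtain n where n: "\<forall>\<phi>\<in>G. fm_below n \<phi>" by blast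
  obtain m where "fm_below m \<phi>" using fm_below_ex by blast
  with n have "\<forall>\<phi>\<in>insert \<phi> G. fm_below (max n m) \<phi>" by (auto intro: fm_below_mono)
  then show ?case by blast
qed simp

lemma tm_below_tsubst: "tm_below n t \<Longrightarrow> (\<And>i. i < n \<Longrightarrow> tm_below m (\<sigma> i)) \<Longrightarrow> tm_below m (tsubst \<sigma> t)"
  by (induction t) auto

lemma tm_below_tlift: "tm_below n t \<Longrightarrow> tm_below (n + k) (tlift k t)"
  by (induction t) auto

lemma fm_below_fsubst: "fm_below n \<phi> \<Longrightarrow> \<forall>i<n. tm_below m (\<sigma> i) \<Longrightarrow> fm_below m (fsubst \<sigma> \<phi>)"
proof (induction \<phi> arbitrary: n m \<sigma>)
  case (Forall \<phi>)
  have "tm_below (Suc m) (up \<sigma> i)" if "i < Suc n" for i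
    using Forall.prems(2) that tm_below_tlift[of m _ 1] by (cases i) auto
  then show ?case using Forall.IH[of "Suc n" "Suc m" "up \<sigma>"] Forall.prems(1) by simp
next
  case (Exists \<phi>)
  have "tm_below (Suc m) (up \<sigma> i)" if "i < Suc n" for i
    using Exists.prems(2) that tm_below_tlift[of m _ 1] by (cases i) auto
  then show ?case using Exists.IH[of "Suc n" "Suc m" "up \<sigma>"] Exists.prems(1) by simp
next
  case (Eq s t) then show ?case using tm_below_tsubst[of n _ m \<sigma>] by auto
next
  case (Less s t) then show ?case using tm_below_tsubst[of n _ m \<sigma>] by auto
next
  case (Neg \<phi>) show ?case using Neg.IH[of n m \<sigma>] Neg.prems by simp
next
  case (Conj \<phi> \<psi>) show ?case using Conj.IH(1)[of n m \<sigma>] Conj.IH(2)[of n m \<sigma>] Conj.prems by simp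
next
  case (Disj \<phi> \<psi>) show ?case using Disj.IH(1)[of n m \<sigma>] Disj.IH(2)[of n m \<sigma>] Disj.prems by simp
next
  case (Imp \<phi> \<psi>) show ?case using Imp.IH(1)[of n m \<sigma>] Imp.IH(2)[of n m \<sigma>] Imp.prems by simp
qed

section \<open>The completeness theorem\<close>

lemma logical_axiom_fsubst: "logical_axiom \<phi> \<Longrightarrow> logical_axiom (fsubst \<sigma> \<phi>)"
  by (erule logical_axiom.cases) (auto simp: fsubst_inst fsubst_fshift intro: logical_axiom.intros)

text \<open>Axioms of \<open>T\<close> are sentences and do not change, and logical axioms are
  closed under substitution, so a derivation can be substituted line by line; \<open>gen\<close>
  uses the induction hypothesis for \<open>up \<sigma>\<close>.\<close>

lemma derivable_fsubst:
  assumes "T \<turnstile> \<phi>" "\<forall>\<phi>\<in>T. sentence \<phi>" shows "T \<turnstile> fsubst \<sigma> \<phi>"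
  using assms(1)
proof (induction arbitrary: \<sigma> rule: derivable.induct)
  case (mp \<psi> \<phi>)
  then show ?case using derivable.mp[of T "fsubst \<sigma> \<psi>" "fsubst \<sigma> \<phi>"] by simp
qed (use assms(2) in \<open>auto simp: fsubst_sentence intro: derivable.intros logical_axiom_fsubst\<close>)

lemma derivable_cut: "T \<turnstile> \<phi> \<Longrightarrow> \<forall>\<psi>\<in>T. U \<turnstile> \<psi> \<Longrightarrow> U \<turnstile> \<phi>"
  by (induction rule: derivable.induct) (auto intro: derivable.intros)

text \<open>Generalization is left out, so that the deduction theorem holds without a proviso on
  free variables; quantifier reasoning enters only through whole theorems of
  \<open>T\<close>.\<close>

inductive pd :: "fm set \<Rightarrow> fm set \<Rightarrow> fm \<Rightarrow> bool" for T G where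
  pd_thm: "T \<turnstile> \<phi> \<Longrightarrow> pd T G \<phi>"
| pd_asm: "\<phi> \<in> G \<Longrightarrow> pd T G \<phi>"
| pd_mp: "pd T G (Imp \<psi> \<phi>) \<Longrightarrow> pd T G \<psi> \<Longrightarrow> pd T G \<phi>"

lemma pd_ax: "logical_axiom \<phi> \<Longrightarrow> pd T G \<phi>"
  by (intro pd_thm derivable.logical)

lemma pd_mono: "pd T G \<phi> \<Longrightarrow> G \<subseteq> H \<Longrightarrow> pd T H \<phi>"
  by (induction rule: pd.induct) (auto intro: pd.intros)

lemma pd_K: "pd T G \<phi> \<Longrightarrow> pd T G (Imp \<psi> \<phi>)"
  by (rule pd_mp[OF pd_ax[OF imp1]])

lemma pd_S: "pd T G (Imp A (Imp B C)) \<Longrightarrow> pd T G (Imp A B) \<Longrightarrow> pd T G (Imp A C)"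
  by (rule pd_mp[OF pd_mp[OF pd_ax[OF imp2]]])

lemma pd_refl: "pd T G (Imp A A)"
  by (rule pd_S[OF pd_ax[OF imp1[of A "Imp A A"]] pd_ax[OF imp1]])

lemma pd_deduct: "pd T (insert A G) \<phi> \<longleftrightarrow> pd T G (Imp A \<phi>)"
proof
  show "pd T (insert A G) \<phi> \<Longrightarrow> pd T G (Imp A \<phi>)"
  proof (induction rule: pd.induct)
    case (pd_asm \<phi>)
    then show ?case using pd_refl pd_K pd.pd_asm by auto
  qed (auto intro: pd_K pd.pd_thm pd_S)
  assume "pd T G (Imp A \<phi>)"
  then have "pd T (insert A G) (Imp A \<phi>)" by (rule pd_mono) blast
  then show "pd T (insert A G) \<phi>" by (rule pd_mp) (simp add: pd_asm)
qed

lemma pd_empty: "pd T {} \<phi> \<longleftrightarrow> T \<turnstile> \<phi>"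
proof
  show "pd T {} \<phi> \<Longrightarrow> T \<turnstile> \<phi>" by (induction rule: pd.induct) (auto intro: derivable.mp)
qed (rule pd_thm)

lemma pd_finite: "pd T G \<phi> \<Longrightarrow> \<exists>F. finite F \<and> F \<subseteq> G \<and> pd T F \<phi>"
proof (induction rule: pd.induct)
  case (pd_mp \<psi> \<phi>)
  then obtain F H where "finite F" "F \<subseteq> G" "pd T F (Imp \<psi> \<phi>)" "finite H" "H \<subseteq> G" "pd T H \<psi>" by blast
  then have "finite (F \<union> H) \<and> F \<union> H \<subseteq> G \<and> pd T (F \<union> H) \<phi>"
    by (auto intro!: pd.pd_mp[of T _ \<psi> \<phi>] intro: pd_mono)
  then show ?case by blast
next
  case (pd_asm \<phi>)
  then show ?case by (intro exI[of _ "{\<phi>}"]) (auto intro: pd.pd_asm)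
next
  case (pd_thm \<phi>)
  then show ?case by (intro exI[of _ "{}"]) (auto intro: pd.pd_thm)
qed

lemma pd_imps: "pd T (set Gs \<union> H) \<phi> \<longleftrightarrow> pd T H (foldr Imp Gs \<phi>)"
proof (induction Gs arbitrary: H)
  case (Cons g Gs)
  have "pd T (set (g # Gs) \<union> H) \<phi> \<longleftrightarrow> pd T (set Gs \<union> insert g H) \<phi>" by simp
  then show ?case by (simp only: Cons pd_deduct) simp
qed simp

lemma pd_exfalso: "pd T G A \<Longrightarrow> pd T G (Neg A) \<Longrightarrow> pd T G B"
  by (rule pd_mp[OF pd_ax[OF neg2]], rule pd_mp[OF pd_mp[OF pd_ax[OF neg1]]]) (erule pd_K, erule pd_K)

lemma pd_notI: "pd T (insert A G) B \<Longrightarrow> pd T (insert A G) (Neg B) \<Longrightarrow> pd T G (Neg A)"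
  unfolding pd_deduct by (rule pd_mp[OF pd_mp[OF pd_ax[OF neg1]]])

lemma pd_ccontr: "pd T (insert (Neg A) G) B \<Longrightarrow> pd T (insert (Neg A) G) (Neg B) \<Longrightarrow> pd T G A"
  by (rule pd_mp[OF pd_ax[OF neg2]], rule pd_notI)

definition bot :: fm where "bot = Neg (Eq Zero Zero)"

lemma pd_bot: "pd T G bot \<Longrightarrow> pd T G A"
  unfolding bot_def by (rule pd_exfalso[OF pd_ax[OF eq1]])

lemma pd_botI: "pd T G A \<Longrightarrow> pd T G (Neg A) \<Longrightarrow> pd T G bot"
  by (rule pd_exfalso)

lemma pd_neg_bot: "pd T (insert A G) bot \<longleftrightarrow> pd T G (Neg A)"
proof
  show "pd T (insert A G) bot \<Longrightarrow> pd T G (Neg A)"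
    by (rule pd_notI[of _ _ _ bot]) (auto intro: pd_bot)
  show "pd T G (Neg A) \<Longrightarrow> pd T (insert A G) bot"
    by (rule pd_botI[of _ _ A]) (auto intro: pd_asm pd_mono)
qed

text \<open>Since \<open>pd\<close> has no generalization, the hypotheses are first moved to the
  right of the turnstile as implications. The variable \<open>c\<close> is free in none of them, so
  it can be generalized in a genuine derivation, and \<open>ex2\<close> discharges the existential
  formula.\<close>

lemma witness:
  assumes T: "\<forall>\<phi>\<in>T. sentence \<phi>" and G: "finite G" "\<forall>\<phi>\<in>G. fm_below c \<phi>" "fm_below c \<phi>" "fm_below c (Exists A)"
    and pd: "pd T (insert (inst A (Var c)) G) \<phi>"
  shows "pd T (insert (Exists A) G) \<phi>"
proof -
  obtain Gs where Gs: "G = set Gs" using G(1) finite_list by blast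
  define \<psi> where "\<psi> = foldr Imp Gs \<phi>"
  have psi: "fm_below c \<psi>"
  proof -
    have "\<forall>\<phi>\<in>set Gs. fm_below c \<phi>" using G(2) Gs by simp
    then show ?thesis unfolding \<psi>_def by (induction Gs) (use G(3) in auto)
  qed
  have H: "pd T (insert B G) \<phi> \<longleftrightarrow> T \<turnstile> Imp B \<psi>" for B
  proof -
    have "pd T (insert B G) \<phi> \<longleftrightarrow> pd T (set Gs \<union> {B}) \<phi>" by (simp add: Gs)
    also have "\<dots> \<longleftrightarrow> pd T {B} \<psi>" by (simp only: pd_imps \<psi>_def)
    also have "\<dots> \<longleftrightarrow> T \<turnstile> Imp B \<psi>" by (simp only: pd_deduct pd_empty)
    finally show ?thesis .
  qed
  \<comment> \<open>Turns the fresh variable into the one that the next quantifier binds and shifts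
    all others, so that the instance becomes \<open>A\<close> and the rest becomes
    \<open>fshift \<psi>\<close>.\<close>
  define \<sigma> where "\<sigma> i = (if i = c then Var 0 else Var (Suc i))" for i
  have "T \<turnstile> Imp (inst A (Var c)) \<psi>" using pd H by blast
  then have "T \<turnstile> fsubst \<sigma> (Imp (inst A (Var c)) \<psi>)" using T by (rule derivable_fsubst)
  moreover have "fsubst \<sigma> \<psi> = fshift \<psi>" unfolding fshift_def
    by (rule fsubst_cong_below[OF psi]) (simp add: \<sigma>_def)
  moreover have "fsubst \<sigma> (inst A (Var c)) = A"
  proof -
    have "fsubst \<sigma> (inst A (Var c)) = fsubst (\<lambda>i. tsubst \<sigma> (case_nat (Var c) Var i)) A"
      by (simp add: inst_def fsubst_fsubst)
    also have "\<dots> = fsubst Var A"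
    proof (rule fsubst_cong_below)
      show "fm_below (Suc c) A" using G(4) by simp
      show "\<forall>i<Suc c. tsubst \<sigma> (case_nat (Var c) Var i) = Var i"
        by (auto simp: \<sigma>_def split: nat.split)
    qed
    finally show ?thesis by simp
  qed
  ultimately have "T \<turnstile> Forall (Imp A (fshift \<psi>))" by (simp add: derivable.gen)
  then have "T \<turnstile> Imp (Exists A) \<psi>"
    by (rule derivable.mp[OF derivable.logical[OF ex2]])
  then show ?thesis using H by blast
qed

text \<open>Witnesses are variables instead of new constants: every stage is finite, so some
  variable lies above all free ones. The language stays the same.\<close>

definition extend :: "fm set \<Rightarrow> fm set \<Rightarrow> fm \<Rightarrow> fm set" where
  "extend T G \<psi> = (if pd T (insert \<psi> G) bot then G else insert \<psi> G \<union>
     (case \<psi> of Exists A \<Rightarrow> {inst A (Var (SOME c. \<forall>\<phi>\<in>insert \<psi> G. fm_below c \<phi>))} | _ \<Rightarrow> {}))"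

text \<open>\<open>inv gn\<close> serves as an enumeration of all formulas; at numbers that code
  nothing it yields some formula, which does no harm.\<close>

primrec henkin :: "fm set \<Rightarrow> fm \<Rightarrow> nat \<Rightarrow> fm set" where
  "henkin T \<phi> 0 = {\<phi>}"
| "henkin T \<phi> (Suc n) = extend T (henkin T \<phi> n) (inv gn n)"

lemma extend_sup: "G \<subseteq> extend T G \<psi>"
  by (auto simp: extend_def)

lemma extend_finite: "finite G \<Longrightarrow> finite (extend T G \<psi>)"
  by (auto simp: extend_def split: fm.split)

lemma extend_con:
  assumes T: "\<forall>\<phi>\<in>T. sentence \<phi>" and G: "finite G" "\<not> pd T G bot" shows "\<not> pd T (extend T G \<psi>) bot"
proof (cases "pd T (insert \<psi> G) bot")
  case True then show ?thesis using G by (simp add: extend_def)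
next
  case False
  show ?thesis
  proof (cases "\<exists>A. \<psi> = Exists A")
    case True
    then obtain A where A: "\<psi> = Exists A" by blast
    define c where "c = (SOME c. \<forall>\<phi>\<in>insert \<psi> G. fm_below c \<phi>)"
    have c: "\<forall>\<phi>\<in>insert \<psi> G. fm_below c \<phi>" unfolding c_def
      by (rule someI_ex) (rule finite_fm_below, simp add: G)
    have "extend T G \<psi> = insert (inst A (Var c)) (insert \<psi> G)" using False by (simp add: extend_def A c_def)
    moreover have "\<not> pd T (insert (inst A (Var c)) (insert \<psi> G)) bot"
    proof
      assume "pd T (insert (inst A (Var c)) (insert \<psi> G)) bot"
      then have "pd T (insert (Exists A) (insert \<psi> G)) bot"
        by (rule witness[OF T, rotated -1]) (use c A G in \<open>auto simp: bot_def\<close>)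
      then show False using False A by simp
    qed
    ultimately show ?thesis by simp
  next
    case no: False
    then have "extend T G \<psi> = insert \<psi> G" using False by (auto simp: extend_def split: fm.split)
    then show ?thesis using False by simp
  qed
qed

text \<open>\<open>D\<close> is the closure of the union of all stages under \<open>pd\<close>. Its
  free variables act as constants, so no closure under generalization is to be expected.\<close>

lemma henkin_set:
  assumes T: "\<forall>\<phi>\<in>T. sentence \<phi>" and \<phi>: "\<not> T \<turnstile> \<phi>"
  obtains D where "\<And>\<psi>. T \<turnstile> \<psi> \<Longrightarrow> \<psi> \<in> D" "\<phi> \<notin> D" "\<And>A B. Imp A B \<in> D \<Longrightarrow> A \<in> D \<Longrightarrow> B \<in> D"
    "\<And>A. Neg A \<in> D \<longleftrightarrow> A \<notin> D" "\<And>A. Exists A \<in> D \<Longrightarrow> \<exists>t. inst A t \<in> D"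
proof -
  let ?H = "henkin T (Neg \<phi>)"
  have fin: "finite (?H n)" for n by (induction n) (simp_all add: extend_finite)
  have con: "\<not> pd T (?H n) bot" for n
  proof (induction n)
    case 0
    show ?case
    proof
      assume "pd T (?H 0) bot"
      then have "pd T {} \<phi>" using pd_ccontr[of T \<phi> "{}" bot] pd_bot[of T "{Neg \<phi>}"] by simp
      then show False using \<phi> by (simp add: pd_empty)
    qed
  qed (use extend_con[OF T] fin in simp)
  have "?H n \<subseteq> ?H (Suc n)" for n using extend_sup by simp
  then have mono: "n \<le> m \<Longrightarrow> ?H n \<subseteq> ?H m" for n m by (rule lift_Suc_mono_le)
  define U where "U = (\<Union>n. ?H n)"
  have conU: "\<not> pd T U bot"
  proof
    assume "pd T U bot"
    then obtain F where F: "finite F" "F \<subseteq> U" "pd T F bot" using pd_finite[of T U bot] by auto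
    have "\<exists>n. F \<subseteq> ?H n" using F(1,2)
    proof (induction F rule: finite_induct)
      case (insert x F)
      then obtain n where n: "F \<subseteq> ?H n" by blast
      obtain m where m: "x \<in> ?H m" using insert.prems unfolding U_def by blast
      have "?H n \<subseteq> ?H (max n m)" "?H m \<subseteq> ?H (max n m)" by (simp_all add: mono)
      then have "insert x F \<subseteq> ?H (max n m)" using n m by blast
      then show ?case by blast
    qed simp
    then obtain n where "F \<subseteq> ?H n" ..
    then have "pd T (?H n) bot" using F(3) pd_mono by simp
    then show False using con by simp
  qed
  have HU: "?H n \<subseteq> U" for n by (auto simp: U_def)
  have gn: "inv gn (gn \<psi>) = \<psi>" for \<psi> by (rule inv_f_f) (auto intro: injI)
  have step: "?H (Suc (gn \<psi>)) = extend T (?H (gn \<psi>)) \<psi>" for \<psi> by (simp add: gn)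
  have comp: "pd T U \<psi> \<or> pd T U (Neg \<psi>)" for \<psi>
  proof (cases "pd T (insert \<psi> (?H (gn \<psi>))) bot")
    case True
    then have "pd T (?H (gn \<psi>)) (Neg \<psi>)" by (simp add: pd_neg_bot)
    then show ?thesis using pd_mono HU by blast
  next
    case False
    then have "\<psi> \<in> ?H (Suc (gn \<psi>))" unfolding step by (simp add: extend_def)
    then show ?thesis using HU pd_asm by blast
  qed
  have ex: "\<exists>t. pd T U (inst A t)" if "pd T U (Exists A)" for A
  proof (cases "pd T (insert (Exists A) (?H (gn (Exists A)))) bot")
    case True
    then have "pd T (?H (gn (Exists A))) (Neg (Exists A))" by (simp add: pd_neg_bot)
    then have "pd T U (Neg (Exists A))" using pd_mono HU by blast
    then show ?thesis using that conU pd_botI by blast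
  next
    case False
    then have "\<exists>t. inst A t \<in> ?H (Suc (gn (Exists A)))" unfolding step by (auto simp: extend_def)
    then show ?thesis using HU pd_asm by blast
  qed
  have neg: "pd T U (Neg A) \<longleftrightarrow> \<not> pd T U A" for A using comp conU pd_botI by blast
  show thesis
  proof (rule that[of "{\<psi>. pd T U \<psi>}"])
    have "Neg \<phi> \<in> U" using HU[of 0] by auto
    then show "\<phi> \<notin> {\<psi>. pd T U \<psi>}" using neg[of \<phi>] by (simp add: pd_asm)
  qed (use neg ex in \<open>auto intro: pd.intros\<close>)
qed

text \<open>Only existential formulas receive witnesses; the truth lemma reaches
  \<open>Forall\<close> through this duality.\<close>

lemma not_all_ex: "T \<turnstile> Imp (Neg (Exists (Neg A))) (Forall A)"
proof -
  \<comment> \<open>\<open>A\<close> with its bound variable kept and the rest shifted: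
    instantiating it with \<open>Var 0\<close> gives \<open>A\<close> back, and it is what
    \<open>fshift\<close> makes of \<open>A\<close> under the quantifier.\<close>
  define A' where "A' = fsubst (up (\<lambda>i. Var (Suc i))) A"
  have "(\<lambda>i. tsubst (case_nat (Var 0) Var) (up (\<lambda>i. Var (Suc i)) i)) = Var"
    by (rule ext, case_tac i) simp_all
  then have i: "inst (Neg A') (Var 0) = Neg A"
    by (simp add: A'_def inst_def fsubst_fsubst)
  have "T \<turnstile> Imp (Neg A) (Exists (Neg A'))" using derivable.logical[OF ex1[of "Neg A'" "Var 0"]] by (simp add: i)
  then have 1: "pd T {Neg (Exists (Neg A'))} (Imp (Neg A) (Exists (Neg A')))" by (rule pd_thm)
  have "pd T {Neg (Exists (Neg A'))} A"
    by (rule pd_ccontr[of _ _ _ "Exists (Neg A')"]) (use 1 in \<open>auto simp: pd_deduct[symmetric] intro: pd_asm\<close>)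
  then have "T \<turnstile> Imp (Neg (Exists (Neg A'))) A" by (simp only: pd_deduct pd_empty)
  then have "T \<turnstile> Forall (Imp (fshift (Neg (Exists (Neg A)))) A)"
    by (simp add: derivable.gen A'_def fshift_def)
  then show ?thesis by (rule derivable.mp[OF derivable.logical[OF all2]])
qed

section \<open>Structures for arithmetic and satisfaction\<close>

record 'm mstr =
  zer :: 'm
  suc :: "'m \<Rightarrow> 'm"
  add :: "'m \<Rightarrow> 'm \<Rightarrow> 'm"
  mul :: "'m \<Rightarrow> 'm \<Rightarrow> 'm"
  les :: "'m \<Rightarrow> 'm \<Rightarrow> bool"

primrec mval :: "'m mstr \<Rightarrow> (nat \<Rightarrow> 'm) \<Rightarrow> tm \<Rightarrow> 'm" where
  "mval M e (Var i) = e i"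
| "mval M e Zero = zer M"
| "mval M e (Succ t) = suc M (mval M e t)"
| "mval M e (Plus s t) = add M (mval M e s) (mval M e t)"
| "mval M e (Times s t) = mul M (mval M e s) (mval M e t)"

primrec msat :: "'m mstr \<Rightarrow> (nat \<Rightarrow> 'm) \<Rightarrow> fm \<Rightarrow> bool" where
  "msat M e (Eq s t) \<longleftrightarrow> mval M e s = mval M e t"
| "msat M e (Less s t) \<longleftrightarrow> les M (mval M e s) (mval M e t)"
| "msat M e (Neg A) \<longleftrightarrow> \<not> msat M e A"
| "msat M e (Conj A B) \<longleftrightarrow> msat M e A \<and> msat M e B"
| "msat M e (Disj A B) \<longleftrightarrow> msat M e A \<or> msat M e B"
| "msat M e (Imp A B) \<longleftrightarrow> (msat M e A \<longrightarrow> msat M e B)"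
| "msat M e (Forall A) \<longleftrightarrow> (\<forall>x. msat M (case_nat x e) A)"
| "msat M e (Exists A) \<longleftrightarrow> (\<exists>x. msat M (case_nat x e) A)"

lemma mval_tsubst: "mval M e (tsubst \<sigma> t) = mval M (\<lambda>i. mval M e (\<sigma> i)) t"
  by (induction t) auto

lemma mval_tlift [simp]: "mval M e (tlift k t) = mval M (\<lambda>i. e (i + k)) t"
  by (simp add: tlift_def mval_tsubst)

lemma mval_up: "(\<lambda>i. mval M (case_nat x e) (up \<sigma> i)) = case_nat x (\<lambda>i. mval M e (\<sigma> i))"
  by (rule ext) (simp split: nat.split)

lemma msat_fsubst: "msat M e (fsubst \<sigma> \<phi>) \<longleftrightarrow> msat M (\<lambda>i. mval M e (\<sigma> i)) \<phi>"
  by (induction \<phi> arbitrary: e \<sigma>) (simp_all add: mval_tsubst mval_up)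

lemma msat_inst: "msat M e (inst A t) \<longleftrightarrow> msat M (case_nat (mval M e t) e) A"
proof -
  have "(\<lambda>i. mval M e (case_nat t Var i)) = case_nat (mval M e t) e" by (rule ext) (simp split: nat.split)
  then show ?thesis by (simp add: inst_def msat_fsubst)
qed

lemma mval_cong_below: "tm_below n t \<Longrightarrow> (\<And>i. i < n \<Longrightarrow> e i = e' i) \<Longrightarrow> mval M e t = mval M e' t"
  by (induction t) auto

lemma msat_cong_below: "fm_below n \<phi> \<Longrightarrow> \<forall>i<n. e i = e' i \<Longrightarrow> msat M e \<phi> \<longleftrightarrow> msat M e' \<phi>"
proof (induction \<phi> arbitrary: n e e')
  case (Forall \<phi>)
  have "case_nat x e i = case_nat x e' i" if "i < Suc n" for i x using Forall.prems that by (cases i) auto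
  then have "msat M (case_nat x e) \<phi> \<longleftrightarrow> msat M (case_nat x e') \<phi>" for x using Forall.IH[of "Suc n" "case_nat x e" "case_nat x e'"] Forall.prems(1) by simp
  then show ?case by simp
next
  case (Exists \<phi>)
  have "case_nat x e i = case_nat x e' i" if "i < Suc n" for i x using Exists.prems that by (cases i) auto
  then have "msat M (case_nat x e) \<phi> \<longleftrightarrow> msat M (case_nat x e') \<phi>" for x using Exists.IH[of "Suc n" "case_nat x e" "case_nat x e'"] Exists.prems(1) by simp
  then show ?case by simp
next
  case (Eq s t) then show ?case using mval_cong_below[of n _ e e' M] by auto
next
  case (Less s t) then show ?case using mval_cong_below[of n _ e e' M] by auto
next
  case (Neg \<phi>) show ?case using Neg.IH[of n e e'] Neg.prems by simp
next
  case (Conj \<phi> \<psi>) show ?case using Conj.IH(1)[of n e e'] Conj.IH(2)[of n e e'] Conj.prems by simp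
next
  case (Disj \<phi> \<psi>) show ?case using Disj.IH(1)[of n e e'] Disj.IH(2)[of n e e'] Disj.prems by simp
next
  case (Imp \<phi> \<psi>) show ?case using Imp.IH(1)[of n e e'] Imp.IH(2)[of n e e'] Imp.prems by simp
qed

lemma size_fsubst [simp]: "size (fsubst \<sigma> \<phi>) = size \<phi>"
  by (induction \<phi> arbitrary: \<sigma>) auto

locale pa_model =
  fixes M :: "'m mstr"
  assumes axioms: "\<phi> \<in> PA \<Longrightarrow> msat M e \<phi>"

lemma PA_sentence: "\<phi> \<in> PA \<Longrightarrow> sentence \<phi>"
  by (erule PA.cases) (auto simp: sentence_def)

text \<open>Makes the term model infinite, so that it can be carried over to the type
  \<open>nat\<close>.\<close>

lemma numerals_distinct:
  assumes PA: "\<forall>\<phi>\<in>PA. T \<turnstile> \<phi>" and "i < j" shows "T \<turnstile> Neg (Eq (numeral_tm i) (numeral_tm j))"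
  using assms(2)
proof (induction i arbitrary: j)
  case 0
  then obtain k where j: "j = Suc k" by (cases j) auto
  have "T \<turnstile> Forall (Neg (Eq (Succ (Var 0)) Zero))" using PA PA.intros(1) by blast
  then have "T \<turnstile> inst (Neg (Eq (Succ (Var 0)) Zero)) (numeral_tm k)"
    by (rule derivable.mp[OF derivable.logical[OF all1]])
  then have 1: "T \<turnstile> Neg (Eq (numeral_tm j) (numeral_tm 0))" by (simp add: j inst_def)
  have "pd T {Eq (numeral_tm 0) (numeral_tm j)} (Eq (numeral_tm j) (numeral_tm 0))"
    by (rule pd_mp[OF pd_mp[OF pd_ax[OF eq2]] pd_ax[OF eq1]]) (simp add: pd_asm)
  then have "pd T {} (Neg (Eq (numeral_tm 0) (numeral_tm j)))"
    by (rule pd_notI) (rule pd_thm[OF 1])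
  then show ?case by (simp add: pd_empty)
next
  case (Suc i)
  then obtain k where j: "j = Suc k" "i < k" by (cases j) auto
  have "T \<turnstile> Forall (Forall (Imp (Eq (Succ (Var 1)) (Succ (Var 0))) (Eq (Var 1) (Var 0))))" using PA PA.intros(2) by blast
  then have "T \<turnstile> inst (Forall (Imp (Eq (Succ (Var 1)) (Succ (Var 0))) (Eq (Var 1) (Var 0)))) (numeral_tm i)"
    by (rule derivable.mp[OF derivable.logical[OF all1]])
  then have "T \<turnstile> Forall (Imp (Eq (Succ (tlift 1 (numeral_tm i))) (Succ (Var 0))) (Eq (tlift 1 (numeral_tm i)) (Var 0)))"
    by (simp add: inst_def)
  then have "T \<turnstile> inst (Imp (Eq (Succ (tlift 1 (numeral_tm i))) (Succ (Var 0))) (Eq (tlift 1 (numeral_tm i)) (Var 0))) (numeral_tm k)"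
    by (rule derivable.mp[OF derivable.logical[OF all1]])
  then have 1: "T \<turnstile> Imp (Eq (numeral_tm (Suc i)) (numeral_tm j)) (Eq (numeral_tm i) (numeral_tm k))"
    by (simp add: inst_def j tlift_def tsubst_tsubst)
  have "pd T {} (Neg (Eq (numeral_tm (Suc i)) (numeral_tm j)))"
    by (rule pd_notI[OF _ pd_thm[OF Suc.IH[OF j(2)]]]) (simp only: pd_deduct pd_thm[OF 1])
  then show ?case by (simp add: pd_empty)
qed

text \<open>All models are put on the one type \<open>nat\<close>, so that completeness can quantify
  over them in a single statement. The elements are classes of terms under provable equality in
  \<open>D\<close>; there are countably and infinitely many, hence the bijection
  \<open>h\<close>.\<close>

lemma countable_model:
  assumes T: "\<forall>\<phi>\<in>T. sentence \<phi>" "\<forall>\<phi>\<in>PA. T \<turnstile> \<phi>" and nd: "\<not> T \<turnstile> \<phi>"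
  obtains M :: "nat mstr" and e where "pa_model M" "\<And>\<psi> e. \<psi> \<in> T \<Longrightarrow> msat M e \<psi>" "\<not> msat M e \<phi>"
proof -
  obtain D where D: "\<And>\<psi>. T \<turnstile> \<psi> \<Longrightarrow> \<psi> \<in> D" "\<phi> \<notin> D" and mp: "\<And>A B. Imp A B \<in> D \<Longrightarrow> A \<in> D \<Longrightarrow> B \<in> D"
    and neg: "\<And>A. Neg A \<in> D \<longleftrightarrow> A \<notin> D" and ex: "\<And>A. Exists A \<in> D \<Longrightarrow> \<exists>t. inst A t \<in> D"
    by (rule henkin_set[OF T(1) nd]) (rule that)
  have ax: "logical_axiom A \<Longrightarrow> A \<in> D" for A by (intro D(1) derivable.logical)
  have refl: "Eq s s \<in> D" for s by (intro ax eq1)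
  have sym: "Eq s t \<in> D \<Longrightarrow> Eq t s \<in> D" for s t using mp[OF mp[OF ax[OF eq2]]] refl by blast
  have trans: "Eq s t \<in> D \<Longrightarrow> Eq t u \<in> D \<Longrightarrow> Eq s u \<in> D" for s t u using mp[OF mp[OF ax[OF eq2]]] sym by blast
  define cls where "cls t = {s. Eq t s \<in> D}" for t
  have cls: "cls s = cls t \<longleftrightarrow> Eq s t \<in> D" for s t
    unfolding cls_def using refl sym trans by blast
  have "numeral_tm i \<noteq> numeral_tm j \<and> cls (numeral_tm i) \<noteq> cls (numeral_tm j)" if "i < j" for i j
    using D(1)[OF numerals_distinct[OF T(2) that]] refl by (auto simp: cls neg)
  then have "inj (\<lambda>i. cls (numeral_tm i))" by (intro injI) (metis linorder_neqE_nat)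
  then have "infinite (range (\<lambda>i. cls (numeral_tm i)))" by (rule range_inj_infinite)
  then have inf: "infinite (range cls)" by (rule contrapos_nn) (erule rev_finite_subset, auto)
  have "inj gnt" by (auto intro: injI)
  then have "countable (UNIV :: tm set)" by (auto simp: countable_def)
  then have "countable (range cls)" by (rule countable_image)
  then obtain h :: "tm set \<Rightarrow> nat" where h: "bij_betw h (range cls) UNIV"
    using countable_infiniteE'[OF _ inf] bij_betw_inv_into bij_betw_from_nat_into inf by (metis to_nat_on_infinite)
  define v where "v t = h (cls t)" for t
  have v_eq: "v s = v t \<longleftrightarrow> Eq s t \<in> D" for s t
    unfolding v_def inj_on_eq_iff[OF bij_betw_imp_inj_on[OF h] rangeI rangeI] by (rule cls)
  have surj: "\<exists>t. v t = n" for n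
  proof -
    have "n \<in> h ` range cls" using bij_betw_imp_surj_on[OF h] by simp
    then show ?thesis by (auto simp: v_def)
  qed
  define r where "r n = (SOME t. v t = n)" for n
  have vr: "v (r n) = n" for n unfolding r_def by (rule someI_ex) (rule surj)
  have rv: "Eq (r (v t)) t \<in> D" for t using vr v_eq by blast
  define M where "M = \<lparr>zer = v Zero, suc = (\<lambda>n. v (Succ (r n))), add = (\<lambda>n m. v (Plus (r n) (r m))),
     mul = (\<lambda>n m. v (Times (r n) (r m))), les = (\<lambda>n m. Less (r n) (r m) \<in> D)\<rparr>"
  have M: "zer M = v Zero" "suc M (v t) = v (Succ t)" "add M (v s) (v t) = v (Plus s t)"
     "mul M (v s) (v t) = v (Times s t)" for s t
  proof -
    show "suc M (v t) = v (Succ t)" unfolding M_def by (simp add: v_eq mp[OF ax[OF eq_Succ] rv])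
    show "add M (v s) (v t) = v (Plus s t)" unfolding M_def by (simp add: v_eq mp[OF mp[OF ax[OF eq_Plus] rv] rv])
    show "mul M (v s) (v t) = v (Times s t)" unfolding M_def by (simp add: v_eq mp[OF mp[OF ax[OF eq_Times] rv] rv])
  qed (simp add: M_def)
  have Ml: "les M (v s) (v t) \<longleftrightarrow> Less s t \<in> D" for s t
  proof -
    have "Less s' t' \<in> D" if "Eq s s' \<in> D" "Eq t t' \<in> D" "Less s t \<in> D" for s s' t t'
      using that by (rule mp[OF mp[OF mp[OF ax[OF eq_Less]]]])
    then have "Less (r (v s)) (r (v t)) \<in> D \<longleftrightarrow> Less s t \<in> D" using rv sym by metis
    then show ?thesis by (simp add: M_def)
  qed
  define e where "e i = v (Var i)" for i
  have val: "mval M e t = v t" for t by (induction t) (simp_all add: M e_def)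
  have truth: "msat M e \<psi> \<longleftrightarrow> \<psi> \<in> D" for \<psi>
  \<comment> \<open>By size, because \<open>inst A t\<close> is not a subformula of the quantified
    formula but is smaller.\<close>
  proof (induction "size \<psi>" arbitrary: \<psi> rule: less_induct)
    case less
    have i: "msat M (case_nat (v t) e) A \<longleftrightarrow> msat M e (inst A t)" for A t by (simp add: msat_inst val)
    have inst: "msat M e (inst A t) \<longleftrightarrow> inst A t \<in> D" if "\<psi> = Forall A \<or> \<psi> = Exists A" for A t
      using that by (intro less.hyps) (auto simp: inst_def)
    have q: "(\<forall>n. P n) \<longleftrightarrow> (\<forall>t. P (v t))" "(\<exists>n. P n) \<longleftrightarrow> (\<exists>t. P (v t))" for P by (metis surj)+
    show ?case
    proof (cases \<psi>)
      case (Conj A B)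
      have "Conj A B \<in> D \<longleftrightarrow> A \<in> D \<and> B \<in> D"
        using mp[OF ax[OF conj1, of A B]] mp[OF ax[OF conj2, of A B]] mp[OF mp[OF ax[OF conj3, of A B]]] by auto
      then show ?thesis using less.hyps[of A] less.hyps[of B] Conj by simp
    next
      case (Disj A B)
      have "Disj A B \<in> D \<longleftrightarrow> A \<in> D \<or> B \<in> D" 
      proof
        assume d: "Disj A B \<in> D"
        show "A \<in> D \<or> B \<in> D"
        proof (rule ccontr)
          assume "\<not> ?thesis"
          then have n: "Neg A \<in> D" "Neg B \<in> D" using neg by auto
          have e: "pd T {Neg C} (Imp C bot)" for C
            unfolding pd_deduct[symmetric] by (rule pd_botI[of _ _ C]) (auto intro: pd_asm)
          have "Imp (Neg C) (Imp C bot) \<in> D" for C using e[of C] by (simp only: pd_deduct pd_empty D(1))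
          then have "Imp A bot \<in> D" "Imp B bot \<in> D" using n mp by metis+
          then have "bot \<in> D" by (rule mp[OF mp[OF mp[OF ax[OF disj3]]]]) (rule d)
          then show False using neg refl by (simp add: bot_def)
        qed
      qed (use mp[OF ax[OF disj1, of A B]] mp[OF ax[OF disj2, of B A]] in auto)
      then show ?thesis using less.hyps[of A] less.hyps[of B] Disj by simp
    next
      case (Imp A B)
      have "Imp A B \<in> D" if "A \<notin> D"
      proof -
        have "pd T {Neg A} (Imp A B)"
          unfolding pd_deduct[symmetric] by (rule pd_exfalso[of _ _ A]) (auto intro: pd_asm)
        then have "Imp (Neg A) (Imp A B) \<in> D" by (simp only: pd_deduct pd_empty D(1))
        then show ?thesis by (rule mp) (use that neg in simp)
      qed
      then have "Imp A B \<in> D \<longleftrightarrow> (A \<in> D \<longrightarrow> B \<in> D)" using mp[of A B] mp[OF ax[OF imp1, of B A]] by auto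
      then show ?thesis using less.hyps[of A] less.hyps[of B] Imp by simp
    next
      case (Forall A)
      have "Forall A \<in> D \<longleftrightarrow> (\<forall>t. inst A t \<in> D)"
      proof
        assume a: "\<forall>t. inst A t \<in> D"
        show "Forall A \<in> D"
        proof (rule ccontr)
          assume "Forall A \<notin> D"
          then have "Neg (Exists (Neg A)) \<notin> D" using mp[OF D(1)[OF not_all_ex]] by metis
          then obtain t where "inst (Neg A) t \<in> D" using ex[of "Neg A"] neg by auto
          then show False using a neg by (simp add: inst_def)
        qed
      qed (use mp[OF ax[OF all1]] in metis)
      then show ?thesis using inst Forall by (simp add: q i)
    next
      case (Exists A)
      have "Exists A \<in> D \<longleftrightarrow> (\<exists>t. inst A t \<in> D)" using ex[of A] mp[OF ax[OF ex1]] by metis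
      then show ?thesis using inst Exists by (simp add: q i)
    qed (use less.hyps neg in \<open>auto simp: val v_eq Ml\<close>)
  qed
  have TM: "msat M e' \<psi>" if "T \<turnstile> \<psi>" "sentence \<psi>" for \<psi> e'
    using truth[of \<psi>] D(1)[OF that(1)] msat_cong_below[of 0 \<psi> e e' M] that(2) by (simp add: sentence_def)
  show thesis
  proof (rule that[of M e])
    show "pa_model M" by standard (rule TM[OF T(2)[rule_format] PA_sentence])
    show "\<psi> \<in> T \<Longrightarrow> msat M e' \<psi>" for \<psi> e' using TM[OF derivable.nonlogical] T(1) by simp
    show "\<not> msat M e \<phi>" using truth D(2) by simp
  qed
qed

theorem PA_complete:
  assumes "\<And>(M :: nat mstr) e. pa_model M \<Longrightarrow> msat M e \<phi>" shows "PA \<turnstile> \<phi>"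
proof (rule ccontr)
  assume "\<not> PA \<turnstile> \<phi>"
  then obtain M :: "nat mstr" and e where "pa_model M" "\<not> msat M e \<phi>"
    by (rule countable_model[rotated 2]) (simp_all add: PA_sentence derivable.nonlogical)
  then show False using assms by simp
qed

section \<open>Models of Peano arithmetic\<close>

lemma case_nat_eta: "case_nat (e 0) (\<lambda>i. e (Suc i)) = e"
  by (rule ext) (simp split: nat.split)

lemma all_funpow: "fm_below (n + k) \<psi> \<Longrightarrow> fm_below k ((Forall ^^ n) \<psi>)"
  by (induction n arbitrary: k) auto

context pa_model begin

abbreviation Z where "Z \<equiv> zer M"
abbreviation S where "S \<equiv> suc M"
abbreviation plus' (infixl \<open>\<oplus>\<close> 65) where "a \<oplus> b \<equiv> add M a b"
abbreviation times' (infixl \<open>\<otimes>\<close> 70) where "a \<otimes> b \<equiv> mul M a b"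
abbreviation less' (infix \<open>\<prec>\<close> 50) where "a \<prec> b \<equiv> les M a b"

lemma S_neq_Z [simp]: "S x \<noteq> Z" "Z \<noteq> S x"
  using axioms[OF PA.intros(1)] by (auto simp: eq_commute)
lemma S_inj [simp]: "S x = S y \<longleftrightarrow> x = y"
  using axioms[OF PA.intros(2)] by auto
lemma add_Z [simp]: "x \<oplus> Z = x"
  using axioms[OF PA.intros(3)] by simp
lemma add_S [simp]: "x \<oplus> S y = S (x \<oplus> y)"
  using axioms[OF PA.intros(4)] by simp
lemma mul_Z [simp]: "x \<otimes> Z = Z"
  using axioms[OF PA.intros(5)] by simp
lemma mul_S [simp]: "x \<otimes> S y = x \<otimes> y \<oplus> x"
  using axioms[OF PA.intros(6)] by simp
lemma not_less_Z [simp]: "\<not> x \<prec> Z"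
  using axioms[OF PA.intros(7)] by simp
lemma less_S: "x \<prec> S y \<longleftrightarrow> x \<prec> y \<or> x = y"
  using axioms[OF PA.intros(8)] by auto

lemma all_funpow_sat: "(\<And>e. msat M e ((Forall ^^ n) \<psi>)) \<Longrightarrow> msat M e \<psi>"
proof (induction n arbitrary: e)
  case (Suc n)
  have "msat M e ((Forall ^^ n) \<psi>)" for e
    using Suc.prems[of "\<lambda>i. e (Suc i)"] case_nat_eta[of e] by simp metis
  then show ?case by (rule Suc.IH)
qed simp

lemma induction_sat: "msat M e (induction_fm \<phi>)"
proof -
  obtain n where "fm_below n (induction_fm \<phi>)" using fm_below_ex by blast
  then have "sentence ((Forall ^^ n) (induction_fm \<phi>))" by (simp add: sentence_def all_funpow)
  then have "(Forall ^^ n) (induction_fm \<phi>) \<in> PA" by (rule PA.intros(9))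
  then show ?thesis using all_funpow_sat axioms by blast
qed

lemma induction_fm_sat:
  assumes "msat M (case_nat Z e) \<phi>" "\<And>x. msat M (case_nat x e) \<phi> \<Longrightarrow> msat M (case_nat (S x) e) \<phi>"
  shows "msat M (case_nat x e) \<phi>"
proof -
  have "(\<lambda>i. mval M (case_nat x e) (case i of 0 \<Rightarrow> Succ (Var 0) | Suc i \<Rightarrow> Var (Suc i))) = case_nat (S x) e" for x
    by (rule ext) (simp split: nat.split)
  then show ?thesis using induction_sat[of e \<phi>] assms by (simp add: induction_fm_def msat_inst msat_fsubst)
qed

subsection \<open>Definable predicates and functions\<close>

definition mix :: "(nat \<Rightarrow> 'm) \<Rightarrow> (nat \<Rightarrow> 'm) \<Rightarrow> nat \<Rightarrow> 'm" where
  "mix e p i = (if even i then e (i div 2) else p (i div 2))"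

text \<open>\<open>Dp P\<close>: the predicate \<open>P\<close> of an environment is definable by a formula with parameters.
  The environment occupies the even variables, the parameters the odd ones.\<close>

definition Dp :: "((nat \<Rightarrow> 'm) \<Rightarrow> bool) \<Rightarrow> bool" where
  "Dp P \<longleftrightarrow> (\<exists>\<phi> p. \<forall>e. P e \<longleftrightarrow> msat M (mix e p) \<phi>)"

lemma DpI: "(\<And>e. P e \<longleftrightarrow> msat M (mix e p) \<phi>) \<Longrightarrow> Dp P"
  unfolding Dp_def by blast

lemma Dp_rename: assumes "Dp P" shows "Dp (\<lambda>e. P (\<lambda>i. e (\<rho> i)))"
proof -
  obtain \<phi> p where P: "\<And>e. P e \<longleftrightarrow> msat M (mix e p) \<phi>" using assms unfolding Dp_def by blast
  define \<sigma> where "\<sigma> i = Var (if even i then 2 * \<rho> (i div 2) else i)" for i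
  have "(\<lambda>i. mval M (mix e p) (\<sigma> i)) = mix (\<lambda>i. e (\<rho> i)) p" for e
    by (rule ext) (simp add: \<sigma>_def mix_def)
  then have "P (\<lambda>i. e (\<rho> i)) \<longleftrightarrow> msat M (mix e p) (fsubst \<sigma> \<phi>)" for e
    by (simp add: P msat_fsubst)
  then show ?thesis by (rule DpI)
qed

lemma Dp_not: assumes "Dp P" shows "Dp (\<lambda>e. \<not> P e)"
proof -
  obtain \<phi> p where P: "\<And>e. P e \<longleftrightarrow> msat M (mix e p) \<phi>" using assms unfolding Dp_def by blast
  show ?thesis by (rule DpI[of _ p "Neg \<phi>"]) (simp add: P)
qed

lemma Dp_conj: assumes "Dp P" "Dp Q" shows "Dp (\<lambda>e. P e \<and> Q e)"
proof -
  obtain \<phi> p where P: "\<And>e. P e \<longleftrightarrow> msat M (mix e p) \<phi>" using assms(1) unfolding Dp_def by blast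
  obtain \<psi> q where Q: "\<And>e. Q e \<longleftrightarrow> msat M (mix e q) \<psi>" using assms(2) unfolding Dp_def by blast
  \<comment> \<open>The parameters of both formulas are interleaved once more: those of
    \<open>\<phi>\<close> move to the variables 4k + 1, those of \<open>\<psi>\<close> to 4k +
    3.\<close>
  define \<sigma> where "\<sigma> i = Var (if even i then i else 2 * i - 1)" for i
  define \<rho> where "\<rho> i = Var (if even i then i else 2 * i + 1)" for i
  have 1: "(\<lambda>i. mval M (mix e (mix p q)) (\<sigma> i)) = mix e p" for e
  proof
    fix i show "mval M (mix e (mix p q)) (\<sigma> i) = mix e p i"
    proof (cases "even i")
      case False
      then obtain k where k: "i = 2 * k + 1" by (elim oddE)
      have "odd (2 * (2 * k + 1) - 1)" "(2 * (2 * k + 1) - 1) div 2 = 2 * k" by simp_all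
      then show ?thesis unfolding k by (simp add: \<sigma>_def mix_def)
    qed (simp add: \<sigma>_def mix_def)
  qed
  have 2: "(\<lambda>i. mval M (mix e (mix p q)) (\<rho> i)) = mix e q" for e
  proof
    fix i show "mval M (mix e (mix p q)) (\<rho> i) = mix e q i"
    proof (cases "even i")
      case False
      then obtain k where k: "i = 2 * k + 1" by (elim oddE)
      have "odd (2 * k + 1)" "(2 * k + 1) div 2 = k" by simp_all
      then show ?thesis unfolding k by (simp add: \<rho>_def mix_def)
    qed (simp add: \<rho>_def mix_def)
  qed
  show ?thesis
    by (rule DpI[of _ "mix p q" "Conj (fsubst \<sigma> \<phi>) (fsubst \<rho> \<psi>)"]) (simp add: P Q msat_fsubst 1 2)
qed

lemma Dp_ex: assumes "Dp (\<lambda>e. P (e 0) (\<lambda>i. e (Suc i)))" shows "Dp (\<lambda>e. \<exists>x. P x e)"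
proof -
  obtain \<phi> p where P: "\<And>e. P (e 0) (\<lambda>i. e (Suc i)) \<longleftrightarrow> msat M (mix e p) \<phi>" using assms unfolding Dp_def by blast
  \<comment> \<open>The bound variable pushes the environment up by one and thereby exchanges the
    parities; \<open>\<sigma>\<close> restores them.\<close>
  define \<sigma> where "\<sigma> i = Var (if i = 0 then 0 else if even i then i - 1 else i + 1)" for i :: nat
  have 1: "(\<lambda>i. mval M (case_nat x (mix e p)) (\<sigma> i)) = mix (case_nat x e) p" for e x
  proof
    fix i show "mval M (case_nat x (mix e p)) (\<sigma> i) = mix (case_nat x e) p i"
    proof (cases "even i")
      case True
      then obtain j where "i = 2 * j" by (elim evenE)
      then show ?thesis by (cases j) (simp_all add: \<sigma>_def mix_def)
    next
      case False then show ?thesis by (auto simp: \<sigma>_def mix_def elim!: oddE)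
    qed
  qed
  have "P x e \<longleftrightarrow> msat M (mix (case_nat x e) p) \<phi>" for x e using P[of "case_nat x e"] by simp
  then show ?thesis
    by (intro DpI[of _ p "Exists (fsubst \<sigma> \<phi>)"]) (simp add: msat_fsubst 1)
qed

named_theorems D_intros

lemma Dp_disj: "Dp P \<Longrightarrow> Dp Q \<Longrightarrow> Dp (\<lambda>e. P e \<or> Q e)"
  using Dp_not[OF Dp_conj[OF Dp_not Dp_not, of P Q]] by simp
lemma Dp_imp: "Dp P \<Longrightarrow> Dp Q \<Longrightarrow> Dp (\<lambda>e. P e \<longrightarrow> Q e)"
  unfolding imp_conv_disj by (intro Dp_disj Dp_not)
lemma Dp_all: "Dp (\<lambda>e. P (e 0) (\<lambda>i. e (Suc i))) \<Longrightarrow> Dp (\<lambda>e. \<forall>x. P x e)"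
  using Dp_not[OF Dp_ex[of "\<lambda>x e. \<not> P x e", OF Dp_not]] by simp
lemma Dp_iff: "Dp P \<Longrightarrow> Dp Q \<Longrightarrow> Dp (\<lambda>e. P e = Q e)"
  unfolding iff_conv_conj_imp by (intro Dp_conj Dp_imp)
lemmas [D_intros] = Dp_not Dp_conj Dp_disj Dp_imp Dp_all Dp_ex Dp_iff

definition DF :: "((nat \<Rightarrow> 'm) \<Rightarrow> 'm) \<Rightarrow> bool" where
  "DF F \<longleftrightarrow> Dp (\<lambda>e. e 0 = F (\<lambda>i. e (Suc i)))"

lemma DF_var [D_intros]: "DF (\<lambda>e. e i)"
  unfolding DF_def
  by (rule DpI[of _ undefined "Eq (Var 0) (Var (2 * Suc i))"]) (simp add: mix_def)

lemma DF_const [D_intros]: "DF (\<lambda>e. c)"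
  unfolding DF_def
  by (rule DpI[of _ "\<lambda>_. c" "Eq (Var 0) (Var 1)"]) (simp add: mix_def)

lemma DF_rename: "DF F \<Longrightarrow> DF (\<lambda>e. F (\<lambda>i. e (\<rho> i)))"
  unfolding DF_def using Dp_rename[of "\<lambda>e. e 0 = F (\<lambda>i. e (Suc i))" "case_nat 0 (\<lambda>i. Suc (\<rho> i))"] by simp

lemma Dp_subst1: assumes "Dp P" "DF F" shows "Dp (\<lambda>e. P (case_nat (F e) e))"
proof -
  have "Dp (\<lambda>e. \<exists>x. x = F e \<and> P (case_nat x e))"
    by (rule Dp_ex, rule Dp_conj) (use assms in \<open>simp_all add: DF_def case_nat_eta\<close>)
  then show ?thesis by simp
qed

lemma Dp_subst:
  assumes "Dp P" "\<forall>F\<in>set Fs. DF F" shows "Dp (\<lambda>e. P (foldr (\<lambda>F. case_nat (F e)) Fs e))"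
  using assms
proof (induction Fs arbitrary: P)
  case (Cons F Fs)
  let ?n = "length Fs"
  have sh: "foldr (\<lambda>F. case_nat (F e)) Gs e (i + length Gs) = e i" for e Gs i
    by (induction Gs) simp_all
  have "Dp (\<lambda>e. P (case_nat (F (\<lambda>i. e (i + ?n))) e))"
    using Dp_subst1[OF Cons.prems(1) DF_rename[of F "\<lambda>i. i + ?n"]] Cons.prems(2) by simp
  from Cons.IH[OF this] Cons.prems(2) show ?case by (simp add: sh)
qed simp

definition DFL :: "((nat \<Rightarrow> 'm) \<Rightarrow> 'm list) \<Rightarrow> bool" where
  "DFL G \<longleftrightarrow> (\<exists>Fs. (\<forall>F\<in>set Fs. DF F) \<and> G = (\<lambda>e. map (\<lambda>F. F e) Fs))"

lemma DFL_Nil [D_intros]: "DFL (\<lambda>e. [])"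
  unfolding DFL_def by (rule exI[of _ "[]"]) simp
lemma DFL_Cons [D_intros]: assumes "DF F" "DFL G" shows "DFL (\<lambda>e. F e # G e)"
proof -
  obtain Fs where "\<forall>F\<in>set Fs. DF F" "G = (\<lambda>e. map (\<lambda>F. F e) Fs)" using assms unfolding DFL_def by blast
  then show ?thesis unfolding DFL_def using assms(1) by (intro exI[of _ "F # Fs"]) simp
qed
lemma DFL_const [D_intros]: "DFL (\<lambda>e. xs)"
  by (induction xs) (auto intro: D_intros)

lemma DF_of_graph:
  assumes g: "\<And>xs y. length xs = n \<Longrightarrow> h xs = y \<longleftrightarrow> msat M (\<lambda>i. if i < n then xs ! i else y) \<phi>" and "DFL G"
    and n: "\<And>e. length (G e) = n"
  shows "DF (\<lambda>e. h (G e))"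
proof -
  obtain Fs where Fs: "\<forall>F\<in>set Fs. DF F" "G = (\<lambda>e. map (\<lambda>F. F e) Fs)" using assms unfolding DFL_def by blast
  have len: "length Fs = n" using n[of undefined] Fs(2) by simp
  obtain m where m: "fm_below m \<phi>" using fm_below_ex by blast
  define P where "P e \<longleftrightarrow> msat M (\<lambda>i. if i < n then e i else e n) \<phi>" for e
  have "Dp P"
  proof (rule DpI[of _ undefined "fsubst (\<lambda>i. Var (if i < n then 2 * i else 2 * n)) \<phi>"])
    fix e show "P e \<longleftrightarrow> msat M (mix e undefined) (fsubst (\<lambda>i. Var (if i < n then 2 * i else 2 * n)) \<phi>)"
      unfolding P_def msat_fsubst by (rule arg_cong2[where f = "\<lambda>e \<phi>. msat M e \<phi>"]) (auto simp: mix_def)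
  qed
  define Gs where "Gs = map (\<lambda>F e. F (\<lambda>i. e (Suc i))) Fs @ [\<lambda>e. e 0]"
  have Gs: "\<forall>F\<in>set Gs. DF F" using Fs(1) by (auto simp: Gs_def intro: DF_rename D_intros)
  have nth: "i < length Gs \<Longrightarrow> foldr (\<lambda>F. case_nat (F e)) Gs e' i = (Gs ! i) e" for i e e' and Gs :: "((nat \<Rightarrow> 'm) \<Rightarrow> 'm) list"
  proof (induction Gs arbitrary: i)
    case (Cons F Gs) then show ?case by (cases i) simp_all
  qed simp
  have "P (foldr (\<lambda>F. case_nat (F e)) Gs e) \<longleftrightarrow> e 0 = h (G (\<lambda>i. e (Suc i)))" for e
  proof -
    have "(\<lambda>i. if i < n then foldr (\<lambda>F. case_nat (F e)) Gs e i else foldr (\<lambda>F. case_nat (F e)) Gs e n)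
      = (\<lambda>i. if i < n then G (\<lambda>i. e (Suc i)) ! i else e 0)"
      using len by (auto simp: nth Gs_def nth_append Fs(2) simp del: foldr_append)
    then have "P (foldr (\<lambda>F. case_nat (F e)) Gs e) \<longleftrightarrow> h (G (\<lambda>i. e (Suc i))) = e 0"
      unfolding P_def using g[of "G (\<lambda>i. e (Suc i))" "e 0"] n by simp
    then show ?thesis by auto
  qed
  then show ?thesis using Dp_subst[OF \<open>Dp P\<close> Gs] by (simp add: DF_def)
qed

lemma DF2: assumes "\<And>x y z. h x y = z \<longleftrightarrow> msat M (case_nat x (case_nat y (\<lambda>_. z))) \<phi>" "DF F" "DF G"
  shows "DF (\<lambda>e. h (F e) (G e))"
proof -
  have "DF (\<lambda>e. (\<lambda>xs. h (xs ! 0) (xs ! 1)) [F e, G e])"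
  proof (rule DF_of_graph[where n = 2 and \<phi> = \<phi> and h = "\<lambda>xs. h (xs ! 0) (xs ! 1)" and G = "\<lambda>e. [F e, G e]"])
    fix xs :: "'m list" and y
    have "(\<lambda>i. if i < 2 then xs ! i else y) = case_nat (xs ! 0) (case_nat (xs ! 1) (\<lambda>_. y))"
      by (rule ext) (simp split: nat.split)
    then show "h (xs ! 0) (xs ! 1) = y \<longleftrightarrow> msat M (\<lambda>i. if i < 2 then xs ! i else y) \<phi>" using assms(1) by metis
  qed (use DFL_Cons[OF assms(2) DFL_Cons[OF assms(3) DFL_Nil]] in simp_all)
  then show ?thesis by simp
qed

lemma DF_S [D_intros]: "DF F \<Longrightarrow> DF (\<lambda>e. S (F e))"
  by (rule DF2[where \<phi> = "Eq (Succ (Var 0)) (Var 2)" and G = F]) (auto)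
lemma DF_add [D_intros]: "DF F \<Longrightarrow> DF G \<Longrightarrow> DF (\<lambda>e. F e \<oplus> G e)"
  by (rule DF2[where \<phi> = "Eq (Plus (Var 0) (Var 1)) (Var 2)"]) (auto)
lemma DF_mul [D_intros]: "DF F \<Longrightarrow> DF G \<Longrightarrow> DF (\<lambda>e. F e \<otimes> G e)"
  by (rule DF2[where \<phi> = "Eq (Times (Var 0) (Var 1)) (Var 2)"]) (auto)

lemma Dp_eq [D_intros]: assumes "DF F" "DF G" shows "Dp (\<lambda>e. F e = G e)"
proof -
  have "Dp (\<lambda>e. \<exists>x. x = F e \<and> x = G e)"
    by (rule Dp_ex, rule Dp_conj) (use assms in \<open>simp_all add: DF_def\<close>)
  then show ?thesis by simp
qed

lemma Dp_less [D_intros]: assumes "DF F" "DF G" shows "Dp (\<lambda>e. F e \<prec> G e)"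
proof -
  have 1: "Dp (\<lambda>e. e 0 \<prec> e 1)"
    by (rule DpI[of _ undefined "Less (Var 0) (Var 2)"]) (simp add: mix_def)
  show ?thesis using Dp_subst[OF 1, of "[F, G]"] assms by simp
qed

text \<open>\<open>P\<close> looks at \<open>e 0\<close> only, so all even variables may be
  identified with the induction variable while the parameters fill the rest; what remains is an
  instance of the induction scheme of \<open>PA\<close>.\<close>

lemma ind: assumes "Dp (\<lambda>e. P (e 0))" "P Z" "\<And>x. P x \<Longrightarrow> P (S x)" shows "P x"
proof -
  obtain \<phi> p where P: "\<And>e. P (e 0) \<longleftrightarrow> msat M (mix e p) \<phi>" using assms(1) unfolding Dp_def by blast
  define \<sigma> where "\<sigma> i = Var (if i = 0 then 0 else i)" for i :: nat
  have "P x \<longleftrightarrow> msat M (mix (\<lambda>_. x) p) \<phi>" for x using P[of "\<lambda>_. x"] by simp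
  moreover have "msat M (mix (\<lambda>_. x) p) \<phi> \<longleftrightarrow> msat M (case_nat x p) (fsubst (\<lambda>i. Var (if even i then 0 else Suc (i div 2))) \<phi>)" for x
    unfolding msat_fsubst by (rule arg_cong2[where f = "\<lambda>e \<phi>. msat M e \<phi>"]) (auto simp: mix_def)
  ultimately have Q: "P x \<longleftrightarrow> msat M (case_nat x p) (fsubst (\<lambda>i. Var (if even i then 0 else Suc (i div 2))) \<phi>)" for x by simp
  show ?thesis unfolding Q by (rule induction_fm_sat) (use assms(2,3) in \<open>simp_all flip: Q\<close>)
qed

subsection \<open>Arithmetic\<close>

lemma Z_add [simp]: "Z \<oplus> a = a"
  by (rule ind[where x = a]) (intro D_intros, simp_all)
lemma S_add [simp]: "S a \<oplus> b = S (a \<oplus> b)"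
  by (rule ind[where x = b]) (intro D_intros, simp_all)
lemma add_comm: "a \<oplus> b = b \<oplus> a"
  by (rule ind[where x = b]) (intro D_intros, simp_all)
lemma add_assoc: "(a \<oplus> b) \<oplus> c = a \<oplus> (b \<oplus> c)"
  by (rule ind[where x = c]) (intro D_intros, simp_all)
lemma add_lcomm: "a \<oplus> (b \<oplus> c) = b \<oplus> (a \<oplus> c)"
  by (metis add_assoc add_comm)
lemma Z_mul [simp]: "Z \<otimes> a = Z"
  by (rule ind[where x = a]) (intro D_intros, simp_all)
lemma S_mul [simp]: "S a \<otimes> b = a \<otimes> b \<oplus> b"
proof (rule ind[where x = b])
  fix x assume "S a \<otimes> x = a \<otimes> x \<oplus> x"
  then show "S a \<otimes> S x = a \<otimes> S x \<oplus> S x" by simp (metis add_assoc add_comm)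
qed (intro D_intros, simp)
lemma mul_comm: "a \<otimes> b = b \<otimes> a"
  by (rule ind[where x = b]) (intro D_intros, simp_all)
lemma add_mul: "(a \<oplus> b) \<otimes> c = a \<otimes> c \<oplus> b \<otimes> c"
proof (rule ind[where x = c])
  fix x assume "(a \<oplus> b) \<otimes> x = a \<otimes> x \<oplus> b \<otimes> x"
  then show "(a \<oplus> b) \<otimes> S x = a \<otimes> S x \<oplus> b \<otimes> S x" by simp (metis add_assoc add_comm)
qed (intro D_intros, simp)
lemma mul_add: "a \<otimes> (b \<oplus> c) = a \<otimes> b \<oplus> a \<otimes> c"
  by (metis add_mul mul_comm)
lemma mul_assoc: "(a \<otimes> b) \<otimes> c = a \<otimes> (b \<otimes> c)"
proof (rule ind[where x = c])
  fix x assume "(a \<otimes> b) \<otimes> x = a \<otimes> (b \<otimes> x)"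
  then show "(a \<otimes> b) \<otimes> S x = a \<otimes> (b \<otimes> S x)" by simp (metis add_mul mul_comm)
qed (intro D_intros, simp)
lemma add_cancel: "c \<oplus> a = c \<oplus> b \<longleftrightarrow> a = b"
proof -
  have "\<forall>a b. c \<oplus> a = c \<oplus> b \<longrightarrow> a = b"
    by (rule ind[where x = c]) (intro D_intros, simp_all)
  then show ?thesis by blast
qed
lemma Z_cases: obtains "x = Z" | y where "x = S y"
proof -
  have "x = Z \<or> (\<exists>y. x = S y)" by (rule ind[where x = x]) (intro D_intros, auto)
  then show thesis using that by blast
qed
lemma less_iff: "x \<prec> y \<longleftrightarrow> (\<exists>d. y = x \<oplus> S d)"
proof (rule ind[where x = y])
  show "x \<prec> Z \<longleftrightarrow> (\<exists>d. Z = x \<oplus> S d)" by simp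
  fix y assume IH: "x \<prec> y \<longleftrightarrow> (\<exists>d. y = x \<oplus> S d)"
  show "x \<prec> S y \<longleftrightarrow> (\<exists>d. S y = x \<oplus> S d)"
    unfolding less_S IH by simp (metis Z_cases add_Z add_S)
qed (intro D_intros)

definition le' (infix \<open>\<preceq>\<close> 50) where "a \<preceq> b \<longleftrightarrow> a \<prec> b \<or> a = b"
definition sub' (infixl \<open>\<ominus>\<close> 65) where "a \<ominus> b = (if b \<preceq> a then (THE d. a = b \<oplus> d) else Z)"

lemma le_iff: "a \<preceq> b \<longleftrightarrow> (\<exists>d. b = a \<oplus> d)"
  unfolding le'_def less_iff by (metis Z_cases add_Z)
lemma add_sub [simp]: "(b \<oplus> d) \<ominus> b = d" "(d \<oplus> b) \<ominus> b = d"
proof -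
  have "(THE d'. b \<oplus> d = b \<oplus> d') = d" by (rule the_equality) (auto simp: add_cancel)
  then show "(b \<oplus> d) \<ominus> b = d" by (auto simp: sub'_def le_iff)
  then show "(d \<oplus> b) \<ominus> b = d" by (simp add: add_comm)
qed
lemma sub_eq: "\<not> b \<preceq> a \<Longrightarrow> a \<ominus> b = Z" by (simp add: sub'_def)

lemma add_eq_Z: "a \<oplus> b = Z \<longleftrightarrow> a = Z \<and> b = Z"
  by (cases b rule: Z_cases) auto
lemma less_irrefl': "\<not> a \<prec> a"
proof
  assume "a \<prec> a"
  then obtain d where "a \<oplus> Z = a \<oplus> S d" unfolding less_iff by auto
  then show False unfolding add_cancel by simp
qed
lemma le_total: "a \<preceq> b \<or> b \<preceq> a"
proof -
  have "a \<prec> b \<or> a = b \<or> b \<prec> a"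
  proof (rule ind[where x = a])
    show "Z \<prec> b \<or> Z = b \<or> b \<prec> Z" by (cases b rule: Z_cases) (auto simp: less_iff)
    fix a assume "a \<prec> b \<or> a = b \<or> b \<prec> a"
    then show "S a \<prec> b \<or> S a = b \<or> b \<prec> S a"
    proof (elim disjE)
      assume "a \<prec> b"
      then obtain d where "b = a \<oplus> S d" unfolding less_iff by blast
      then show ?thesis by (cases d rule: Z_cases) (auto simp: less_iff)
    qed (auto simp: less_S)
  qed (intro D_intros)
  then show ?thesis by (auto simp: le'_def)
qed
lemma mul_eq_Z: "a \<otimes> b = Z \<longleftrightarrow> a = Z \<or> b = Z"
  by (cases a rule: Z_cases; cases b rule: Z_cases) (auto simp: add_eq_Z)

text \<open>Every model becomes an ordered semiring with truncated subtraction, which opens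
  \<open>algebra_simps\<close> and the order lemmas to nonstandard arithmetic.\<close>

sublocale L: linordered_semidom where one = "S Z" and times = "mul M" and plus = "add M" and zero = Z
  and minus = sub' and less_eq = le' and less = "les M"
proof
  fix a b c
  show "a \<otimes> b \<otimes> c = a \<otimes> (b \<otimes> c)" by (rule mul_assoc)
  show "a \<otimes> b = b \<otimes> a" by (rule mul_comm)
  show "a \<oplus> b \<oplus> c = a \<oplus> (b \<oplus> c)" by (rule add_assoc)
  show "a \<oplus> b = b \<oplus> a" by (rule add_comm)
  show "(a \<oplus> b) \<otimes> c = a \<otimes> c \<oplus> b \<otimes> c" by (rule add_mul)
  show "a \<oplus> b \<ominus> a = b" by simp
  show "a \<ominus> b \<ominus> c = a \<ominus> (b \<oplus> c)"
  proof (cases "b \<preceq> a")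
    case True
    then obtain d where d: "a = b \<oplus> d" unfolding le_iff by blast
    show ?thesis
    proof (cases "c \<preceq> d")
      case True
      then obtain f where f: "d = c \<oplus> f" unfolding le_iff by blast
      have "b \<oplus> (c \<oplus> f) \<ominus> (b \<oplus> c) = f" using add_sub(1)[of "b \<oplus> c" f] by (simp only: add_assoc)
      then show ?thesis unfolding d f by simp
    next
      case False
      have "\<not> b \<oplus> c \<preceq> b \<oplus> d" using False by (simp add: le_iff add_assoc add_cancel)
      then show ?thesis unfolding d using False by (simp add: sub_eq)
    qed
  next
    case False
    then have "\<not> b \<oplus> c \<preceq> a" by (auto simp: le_iff add_assoc)
    moreover have "Z \<ominus> c = Z" by (cases c rule: Z_cases) (auto simp: sub'_def le_iff)
    ultimately show ?thesis using False by (simp add: sub_eq)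
  qed
  show "a \<otimes> (b \<ominus> c) = a \<otimes> b \<ominus> a \<otimes> c"
  proof (cases "c \<preceq> b")
    case True
    then obtain d where d: "b = c \<oplus> d" unfolding le_iff by blast
    show ?thesis unfolding d by (simp add: mul_comm[of a] add_mul)
  next
    case False
    then obtain d where d: "c = b \<oplus> d" using le_total[of b c] unfolding le_iff by blast
    have "a \<otimes> b \<ominus> (a \<otimes> b \<oplus> a \<otimes> d) = Z"
    proof (cases "a \<otimes> b \<oplus> a \<otimes> d \<preceq> a \<otimes> b")
      case True
      then obtain f where "a \<otimes> b \<oplus> Z = a \<otimes> b \<oplus> (a \<otimes> d \<oplus> f)" unfolding le_iff by (auto simp: add_assoc)
      then have "a \<otimes> d = Z" unfolding add_cancel by (metis add_eq_Z)
      then show ?thesis using add_sub(1)[of "a \<otimes> b" Z] by simp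
    qed (rule sub_eq)
    then show ?thesis using False sub_eq[OF False] by (simp add: d mul_comm[of a] add_mul)
  qed
  show "(a \<prec> b) = (a \<preceq> b \<and> \<not> b \<preceq> a)"
    unfolding le'_def by (auto simp: less_irrefl') (auto simp: less_iff add_assoc add_cancel, metis add_S add_Z add_cancel S_neq_Z S_add)
  show "a \<preceq> a" by (simp add: le'_def)
  show "a \<preceq> b \<Longrightarrow> b \<preceq> c \<Longrightarrow> a \<preceq> c" unfolding le_iff by (auto simp: add_assoc)
  show "a \<preceq> b \<Longrightarrow> b \<preceq> a \<Longrightarrow> a = b" unfolding le_iff by (auto simp: add_assoc) (metis add_Z add_cancel add_eq_Z)
  show "a \<preceq> b \<or> b \<preceq> a" by (rule le_total)
  show "a \<preceq> b \<Longrightarrow> c \<oplus> a \<preceq> c \<oplus> b" unfolding le_iff by (auto simp: add_assoc)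
  show "a \<prec> b \<Longrightarrow> Z \<prec> c \<Longrightarrow> c \<otimes> a \<prec> c \<otimes> b"
  proof -
    assume "a \<prec> b" "Z \<prec> c"
    then obtain d f where "b = a \<oplus> S d" "c = S f" unfolding less_iff by auto
    then have "c \<otimes> b = c \<otimes> a \<oplus> S (c \<otimes> d \<oplus> f)" by (simp add: mul_comm[of _ "a \<oplus> d"] add_mul) (simp add: add_assoc mul_comm add_comm add_lcomm)
    then show ?thesis unfolding less_iff by blast
  qed
  show "b \<preceq> a \<Longrightarrow> a \<ominus> b \<oplus> b = a" unfolding le_iff by (auto simp: add_comm)
  show "a \<noteq> Z \<Longrightarrow> b \<noteq> Z \<Longrightarrow> a \<otimes> b \<noteq> Z" by (simp add: mul_eq_Z)
  show "Z \<prec> S Z" by (simp add: less_S)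
qed (simp_all add: mul_add)

end

section \<open>Order induction, least elements and numerals\<close>

context pa_model begin

lemma less_ind: assumes "Dp (\<lambda>e. P (e 0))" "\<And>n. (\<And>m. m \<prec> n \<Longrightarrow> P m) \<Longrightarrow> P n" shows "P n"
proof -
  have "\<forall>m. m \<prec> n \<longrightarrow> P m"
  proof (rule ind[where x = n])
    show "Dp (\<lambda>e. \<forall>m. m \<prec> e 0 \<longrightarrow> P m)"
      by (rule Dp_all, rule Dp_imp, intro D_intros, rule assms(1))
    fix n assume "\<forall>m. m \<prec> n \<longrightarrow> P m"
    then show "\<forall>m. m \<prec> S n \<longrightarrow> P m" using assms(2) less_S by auto
  qed simp
  then show ?thesis using assms(2) by blast
qed

lemma ex_least: assumes "Dp (\<lambda>e. P (e 0))" "P x" shows "\<exists>m. P m \<and> (\<forall>k. k \<prec> m \<longrightarrow> \<not> P k)"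
proof (rule ccontr)
  assume a: "\<not> ?thesis"
  have "\<not> P x" by (rule less_ind[where n = x]) (rule Dp_not[OF assms(1)], use a in blast)
  then show False using assms(2) by simp
qed

lemma DF_comp: assumes "DF (\<lambda>e. s (e 0))" "DF F" shows "DF (\<lambda>e. s (F e))"
proof -
  have "Dp (\<lambda>e. e 1 = s (e 0))"
    using Dp_rename[of "\<lambda>e. e 0 = s (e (Suc 0))" "\<lambda>i. if i = 0 then 1 else 0"] assms(1) by (simp add: DF_def)
  from Dp_subst1[OF this DF_rename[OF assms(2), of Suc]] show ?thesis by (simp add: DF_def)
qed

lemma Dp_le [D_intros]: "DF F \<Longrightarrow> DF G \<Longrightarrow> Dp (\<lambda>e. F e \<preceq> G e)"
  unfolding le'_def by (intro Dp_disj Dp_less Dp_eq)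

lemma S_le [simp]: "S a \<preceq> b \<longleftrightarrow> a \<prec> b"
  unfolding le_iff less_iff by simp
lemma less_S_le: "a \<prec> S b \<longleftrightarrow> a \<preceq> b"
  by (auto simp: less_S le'_def)
lemma S_less [simp]: "S a \<prec> S b \<longleftrightarrow> a \<prec> b"
  by (simp add: less_S_le)
lemma less_self [simp]: "a \<prec> S a" by (simp add: less_S)
lemma Z_le [simp]: "Z \<preceq> a" by (auto simp: le_iff)
lemma le_Z [simp]: "a \<preceq> Z \<longleftrightarrow> a = Z" by (simp add: le'_def)
lemma Z_less: "Z \<prec> a \<longleftrightarrow> a \<noteq> Z" by (metis L.leD L.leI le_Z Z_le)
lemma Z_less_S [simp]: "Z \<prec> S a" by (simp add: Z_less)
lemma le_add1 [simp]: "a \<preceq> a \<oplus> b" "a \<preceq> b \<oplus> a" by (auto simp: le_iff add_comm)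
lemma less_add1 [simp]: "a \<prec> S (a \<oplus> b)" "a \<prec> S (b \<oplus> a)" by (simp_all add: less_S_le)
lemma le_mul: "Z \<prec> b \<Longrightarrow> a \<preceq> a \<otimes> b" "Z \<prec> b \<Longrightarrow> a \<preceq> b \<otimes> a"
  by (metis Z_cases le_add1(2) mul_S not_less_Z) (metis Z_cases le_add1(2) S_mul not_less_Z)

primrec nm :: "nat \<Rightarrow> 'm" where
  "nm 0 = Z"
| "nm (Suc n) = S (nm n)"

lemma mval_numeral [simp]: "mval M e (numeral_tm n) = nm n"
  by (induction n) simp_all
lemma nm_add: "nm (a + b) = nm a \<oplus> nm b" by (induction b) simp_all
lemma nm_mult: "nm (a * b) = nm a \<otimes> nm b" by (induction a) (simp_all add: nm_add add_comm)
lemma nm_inj [simp]: "nm a = nm b \<longleftrightarrow> a = b"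
proof (induction a arbitrary: b)
  case 0 then show ?case by (cases b) auto
next
  case (Suc a) then show ?case by (cases b) auto
qed
lemma less_nm: "x \<prec> nm n \<longleftrightarrow> (\<exists>k<n. x = nm k)"
  by (induction n) (auto simp: less_S less_Suc_eq)
lemma nm_less [simp]: "nm a \<prec> nm b \<longleftrightarrow> a < b" by (auto simp: less_nm)
lemma nm_le [simp]: "nm a \<preceq> nm b \<longleftrightarrow> a \<le> b" by (auto simp: le'_def)

subsection \<open>Coding of sequences\<close>

lemma div_ex: "Z \<prec> m \<Longrightarrow> \<exists>q r. a = q \<otimes> m \<oplus> r \<and> r \<prec> m"
proof -
  assume m: "Z \<prec> m"
  show ?thesis
  proof (rule ind[where x = a])
    show "\<exists>q r. Z = q \<otimes> m \<oplus> r \<and> r \<prec> m" using m by (intro exI[of _ Z]) simp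
    fix a assume "\<exists>q r. a = q \<otimes> m \<oplus> r \<and> r \<prec> m"
    then obtain q r where qr: "a = q \<otimes> m \<oplus> r" "r \<prec> m" by blast
    show "\<exists>q r. S a = q \<otimes> m \<oplus> r \<and> r \<prec> m"
    proof (cases "S r = m")
      case True
      then have "S a = S q \<otimes> m \<oplus> Z" using qr by (simp add: add_assoc add_comm add_lcomm flip: True)
      then show ?thesis using m by blast
    next
      case False
      then have "S a = q \<otimes> m \<oplus> S r \<and> S r \<prec> m" using qr by (auto simp: L.less_le)
      then show ?thesis by blast
    qed
  qed (intro D_intros)
qed

lemma rem_unique:
  assumes "q \<otimes> m \<oplus> r = q' \<otimes> m \<oplus> r'" "r \<prec> m" "r' \<prec> m" shows "r = r'" "q = q'"
proof -
  have *: "r = r' \<and> q = q'" if e: "q \<otimes> m \<oplus> r = q' \<otimes> m \<oplus> r'" and r: "r \<prec> m" and q: "q \<preceq> q'" for q q' r r'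
  proof -
    obtain d where d: "q' = q \<oplus> d" using q unfolding le_iff by blast
    then have "r = d \<otimes> m \<oplus> r'" using e by (simp add: add_mul add_assoc add_cancel)
    moreover have "d = Z"
    proof (rule ccontr)
      assume "d \<noteq> Z"
      then have "m \<preceq> d \<otimes> m" by (intro le_mul) (simp add: Z_less)
      then have "m \<preceq> r" using calculation by (metis L.order_trans le_add1(1))
      then show False using r by (simp add: L.leD)
    qed
    ultimately show ?thesis using d by simp
  qed
  have "r = r' \<and> q = q'" using *[OF assms(1,2)] *[OF assms(1)[symmetric] assms(3)] L.linear[of q q'] by auto
  then show "r = r'" "q = q'" by auto
qed

abbreviation md :: "'m \<Rightarrow> 'm \<Rightarrow> 'm" where "md b i \<equiv> S (S i \<otimes> b)"

definition bt :: "'m \<Rightarrow> 'm \<Rightarrow> 'm \<Rightarrow> 'm \<Rightarrow> bool" where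
  "bt a b i w \<longleftrightarrow> w \<prec> md b i \<and> (\<exists>q. a = q \<otimes> md b i \<oplus> w)"

lemma Dp_bt [D_intros]: "DF A \<Longrightarrow> DF B \<Longrightarrow> DF I \<Longrightarrow> DF W \<Longrightarrow> Dp (\<lambda>e. bt (A e) (B e) (I e) (W e))"
  unfolding bt_def using DF_rename[of A Suc] DF_rename[of B Suc] DF_rename[of I Suc] DF_rename[of W Suc]
  by (intro D_intros)

lemma msat_beta [simp]: "msat M e (beta_fm a b i w) \<longleftrightarrow> bt (mval M e a) (mval M e b) (mval M e i) (mval M e w)"
proof -
  have "q \<prec> S (q \<otimes> md y z \<oplus> x)" for q x y z
    using L.order_trans[OF le_mul(1)[of "md y z" q] le_add1(1)] by (simp add: less_S_le)
  then have "(\<exists>q. q \<prec> S a \<and> a = q \<otimes> md y z \<oplus> x) \<longleftrightarrow> (\<exists>q. a = q \<otimes> md y z \<oplus> x)" for a x y z by blast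
  then show ?thesis by (simp add: beta_fm_def bt_def Let_def del: S_mul mul_S)
qed

lemma bt_unique: "bt a b i w \<Longrightarrow> bt a b i w' \<Longrightarrow> w = w'"
  unfolding bt_def using rem_unique(1) by blast
lemma bt_ex: "\<exists>w. bt a b i w"
  unfolding bt_def using div_ex[of "md b i" a] by auto

text \<open>Bezout's identity without negative coefficients: \<open>P\<close> is a unit modulo
  \<open>m\<close>.\<close>

definition inv' :: "'m \<Rightarrow> 'm \<Rightarrow> bool" where
  "inv' P m \<longleftrightarrow> (\<exists>u v w. u \<otimes> P \<oplus> v \<otimes> m = S Z \<oplus> w \<otimes> m)"

lemma inv_mult: assumes "inv' P m" "inv' P' m" shows "inv' (P \<otimes> P') m"
proof -
  obtain u v w where 1: "u \<otimes> P \<oplus> v \<otimes> m = S Z \<oplus> w \<otimes> m" using assms unfolding inv'_def by blast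
  obtain u' v' w' where 2: "u' \<otimes> P' \<oplus> v' \<otimes> m = S Z \<oplus> w' \<otimes> m" using assms unfolding inv'_def by blast
  have "(u \<otimes> P \<oplus> v \<otimes> m) \<otimes> (u' \<otimes> P' \<oplus> v' \<otimes> m) = (S Z \<oplus> w \<otimes> m) \<otimes> (S Z \<oplus> w' \<otimes> m)" unfolding 1 2 ..
  then have "(u \<otimes> u') \<otimes> (P \<otimes> P') \<oplus> (v \<otimes> (u' \<otimes> P') \<oplus> v' \<otimes> (u \<otimes> P) \<oplus> v \<otimes> v' \<otimes> m) \<otimes> m
    = S Z \<oplus> (w \<oplus> w' \<oplus> w \<otimes> w' \<otimes> m) \<otimes> m"
    by (simp add: algebra_simps)
  then show ?thesis unfolding inv'_def by blast
qed

lemma inv_one: "inv' (S Z) m"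
  unfolding inv'_def by (intro exI[of _ "S Z"] exI[of _ Z]) simp

lemma inv_md: assumes "i \<prec> k" and dvd: "\<And>j. j \<prec> k \<Longrightarrow> \<exists>c. b = S j \<otimes> c" shows "inv' (md b i) (md b k)"
proof -
  obtain d where d: "k = i \<oplus> S d" using assms(1) unfolding less_iff by blast
  obtain c where c: "b = S d \<otimes> c" using dvd[of d] d by auto
  \<comment> \<open>Modulo \<open>S q\<close>, which is \<open>md b k\<close>, the number
    \<open>q\<close> is -1, so its square is 1. As \<open>y\<close> times the difference of the two
    moduli equals that square, the inverse of \<open>md b i\<close> is -\<open>y\<close>, that is
    \<open>q \<otimes> y\<close>.\<close>
  define q y where "q = S k \<otimes> b" and "y = S k \<otimes> S k \<otimes> c"
  have k: "md b k = S q" by (simp add: q_def)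
  have mk: "S q = md b i \<oplus> S d \<otimes> b" unfolding q_def d by (simp add: algebra_simps)
  have "y \<otimes> (S d \<otimes> b) = q \<otimes> q" unfolding y_def q_def by (subst (2) c) (simp only: L.mult_ac)
  then have y: "y \<otimes> S q = y \<otimes> md b i \<oplus> q \<otimes> q" unfolding mk by (simp only: mul_add)
  have "(q \<otimes> y) \<otimes> md b i \<oplus> S (q \<otimes> q) \<otimes> S q = S Z \<oplus> (q \<otimes> S y) \<otimes> S q"
  proof -
    have "S Z \<oplus> (q \<otimes> S y) \<otimes> S q = S (q \<otimes> (y \<otimes> S q) \<oplus> q \<otimes> S q)" by (simp add: algebra_simps)
    also have "\<dots> = (q \<otimes> y) \<otimes> md b i \<oplus> S (q \<otimes> q) \<otimes> S q" unfolding y by (simp add: algebra_simps)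
    finally show ?thesis ..
  qed
  then show ?thesis unfolding k inv'_def by blast
qed

text \<open>Chinese remaindering, one congruence at a time: adding a multiple of the earlier moduli
  changes only the new remainder. Long products are not yet available as functions, so an induction
  in the model yields just some common multiple \<open>P\<close> that is a unit modulo the new
  modulus.\<close>

lemma crt_step:
  assumes a: "\<And>i. i \<prec> k \<Longrightarrow> bt a b i (s i)" and sk: "s k \<prec> md b k" and dvd: "\<And>j. j \<prec> k \<Longrightarrow> \<exists>c. b = S j \<otimes> c"
  shows "\<exists>a'. \<forall>i. i \<prec> S k \<longrightarrow> bt a' b i (s i)"
proof -
  have "j \<preceq> k \<longrightarrow> (\<exists>P. (\<forall>i. i \<prec> j \<longrightarrow> (\<exists>t. P = t \<otimes> md b i)) \<and> inv' P (md b k))" for j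
  proof (rule ind[where x = j])
    show "Dp (\<lambda>e. e 0 \<preceq> k \<longrightarrow> (\<exists>P. (\<forall>i. i \<prec> e 0 \<longrightarrow> (\<exists>t. P = t \<otimes> md b i)) \<and> inv' P (md b k)))"
      unfolding inv'_def by (intro D_intros)
    show "Z \<preceq> k \<longrightarrow> (\<exists>P. (\<forall>i. i \<prec> Z \<longrightarrow> (\<exists>t. P = t \<otimes> md b i)) \<and> inv' P (md b k))" using inv_one by auto
    fix j assume IH: "j \<preceq> k \<longrightarrow> (\<exists>P. (\<forall>i. i \<prec> j \<longrightarrow> (\<exists>t. P = t \<otimes> md b i)) \<and> inv' P (md b k))"
    show "S j \<preceq> k \<longrightarrow> (\<exists>P. (\<forall>i. i \<prec> S j \<longrightarrow> (\<exists>t. P = t \<otimes> md b i)) \<and> inv' P (md b k))"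
    proof
      assume "S j \<preceq> k"
      then have j: "j \<prec> k" by simp
      then obtain P where P: "\<And>i. i \<prec> j \<Longrightarrow> \<exists>t. P = t \<otimes> md b i" "inv' P (md b k)" using IH L.less_imp_le[OF j] by blast
      have "\<exists>t. P \<otimes> md b j = t \<otimes> md b i" if "i \<prec> S j" for i
      proof (cases "i = j")
        case False
        then have "i \<prec> j" using that by (simp add: less_S)
        then obtain t where "P = t \<otimes> md b i" using P(1) by blast
        then have "P \<otimes> md b j = (t \<otimes> md b j) \<otimes> md b i" by (simp only: L.mult_ac)
        then show ?thesis by blast
      qed blast
      moreover have "inv' (P \<otimes> md b j) (md b k)" by (rule inv_mult[OF P(2) inv_md[OF j dvd]])
      ultimately show "\<exists>P. (\<forall>i. i \<prec> S j \<longrightarrow> (\<exists>t. P = t \<otimes> md b i)) \<and> inv' P (md b k)" by blast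
    qed
  qed
  from this[of k] obtain P where P: "\<And>i. i \<prec> k \<Longrightarrow> \<exists>t. P = t \<otimes> md b i" "inv' P (md b k)" by auto
  define q where "q = S k \<otimes> b"
  have m: "md b k = S q" by (simp add: q_def)
  obtain u v w where uvw: "u \<otimes> P \<oplus> v \<otimes> S q = S Z \<oplus> w \<otimes> S q" using P(2) unfolding inv'_def m by blast
  \<comment> \<open>Since \<open>q\<close> is -1 modulo \<open>S q\<close>, this is the correction s
    k - a written without subtraction; \<open>u \<otimes> P\<close> is 1 modulo \<open>S q\<close>
    and 0 modulo the earlier moduli.\<close>
  define X where "X = s k \<oplus> a \<otimes> q"
  define a' where "a' = a \<oplus> u \<otimes> P \<otimes> X"
  have "bt a' b i (s i)" if i: "i \<prec> S k" for i
  proof (cases "i = k")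
    case False
    then have ik: "i \<prec> k" using i by (simp add: less_S)
    obtain t where t: "P = t \<otimes> md b i" using P(1)[OF ik] by blast
    obtain p where p: "a = p \<otimes> md b i \<oplus> s i" "s i \<prec> md b i" using a[OF ik] unfolding bt_def by blast
    have "a' = a \<oplus> (u \<otimes> t \<otimes> X) \<otimes> md b i" unfolding a'_def t by (simp only: L.mult_ac)
    also have "\<dots> = (p \<oplus> u \<otimes> t \<otimes> X) \<otimes> md b i \<oplus> s i"
      by (subst p(1)) (simp only: add_mul add_assoc add_comm add_lcomm)
    finally show ?thesis using p(2) unfolding bt_def by blast
  next
    case True
    have "a' \<oplus> (v \<otimes> X) \<otimes> S q = a \<oplus> (u \<otimes> P \<oplus> v \<otimes> S q) \<otimes> X" unfolding a'_def
      by (simp only: add_mul mul_add add_assoc L.mult_ac)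
    also have "\<dots> = a \<oplus> X \<oplus> w \<otimes> X \<otimes> S q" unfolding uvw by (simp add: algebra_simps)
    also have "\<dots> = (a \<oplus> w \<otimes> X) \<otimes> S q \<oplus> s k" unfolding X_def by (simp add: algebra_simps)
    finally have 1: "a' \<oplus> (v \<otimes> X) \<otimes> S q = (a \<oplus> w \<otimes> X) \<otimes> S q \<oplus> s k" .
    obtain Q r where Q: "a' = Q \<otimes> S q \<oplus> r" "r \<prec> S q" using div_ex[of "S q" a'] by auto
    have "(Q \<oplus> v \<otimes> X) \<otimes> S q \<oplus> r = (a \<oplus> w \<otimes> X) \<otimes> S q \<oplus> s k" unfolding 1[symmetric] Q(1)
      by (simp only: add_mul add_assoc add_comm add_lcomm)
    then have "r = s k" by (rule rem_unique) (use Q(2) sk m in simp_all)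
    then show ?thesis using Q unfolding True bt_def m by blast
  qed
  then show ?thesis by blast
qed

text \<open>In \<open>b = c \<otimes> S B\<close> the factor \<open>c\<close> is a common multiple
  of the numbers from 1 to \<open>n\<close> and makes the moduli coprime, while \<open>S B\<close>
  lifts the moduli above all values. Both are obtained by induction in the model, because
  \<open>n\<close> may be nonstandard.\<close>

lemma beta_ex': assumes s: "DF (\<lambda>e. s (e 0))" shows "\<exists>a b. \<forall>i. i \<prec> n \<longrightarrow> bt a b i (s i)"
proof -
  note sD = DF_comp[OF s]
  have "\<exists>B. \<forall>i. i \<prec> n \<longrightarrow> s i \<preceq> B"
  proof (rule ind[where x = n])
    show "Dp (\<lambda>e. \<exists>B. \<forall>i. i \<prec> e 0 \<longrightarrow> s i \<preceq> B)" by (intro D_intros sD)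
    fix n assume "\<exists>B. \<forall>i. i \<prec> n \<longrightarrow> s i \<preceq> B"
    then obtain B where B: "\<And>i. i \<prec> n \<Longrightarrow> s i \<preceq> B" by blast
    have "s i \<preceq> B \<oplus> s n" if "i \<prec> S n" for i
      using that B[of i] L.order_trans[of "s i" B "B \<oplus> s n"] by (auto simp: less_S)
    then show "\<exists>B. \<forall>i. i \<prec> S n \<longrightarrow> s i \<preceq> B" by blast
  qed simp
  then obtain B where B: "\<And>i. i \<prec> n \<Longrightarrow> s i \<preceq> B" by blast
  have "\<exists>c. c \<noteq> Z \<and> (\<forall>j. j \<prec> n \<longrightarrow> (\<exists>d. c = S j \<otimes> d))"
  proof (rule ind[where x = n])
    show "Dp (\<lambda>e. \<exists>c. c \<noteq> Z \<and> (\<forall>j. j \<prec> e 0 \<longrightarrow> (\<exists>d. c = S j \<otimes> d)))" by (intro D_intros)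
    show "\<exists>c. c \<noteq> Z \<and> (\<forall>j. j \<prec> Z \<longrightarrow> (\<exists>d. c = S j \<otimes> d))" by (rule exI[of _ "S Z"]) simp
    fix n assume "\<exists>c. c \<noteq> Z \<and> (\<forall>j. j \<prec> n \<longrightarrow> (\<exists>d. c = S j \<otimes> d))"
    then obtain c where c: "c \<noteq> Z" "\<And>j. j \<prec> n \<Longrightarrow> \<exists>d. c = S j \<otimes> d" by blast
    have "\<exists>d. S n \<otimes> c = S j \<otimes> d" if "j \<prec> S n" for j
    proof (cases "j = n")
      case False
      then have "j \<prec> n" using that by (simp add: less_S)
      then obtain d where "c = S j \<otimes> d" using c(2) by blast
      then have "S n \<otimes> c = S j \<otimes> (S n \<otimes> d)" by (simp only: L.mult_ac)
      then show ?thesis by blast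
    qed blast
    moreover have "S n \<otimes> c \<noteq> Z" using c(1) by (simp add: add_eq_Z)
    ultimately show "\<exists>c. c \<noteq> Z \<and> (\<forall>j. j \<prec> S n \<longrightarrow> (\<exists>d. c = S j \<otimes> d))" by blast
  qed
  then obtain c where c: "c \<noteq> Z" "\<And>j. j \<prec> n \<Longrightarrow> \<exists>d. c = S j \<otimes> d" by blast
  define b where "b = c \<otimes> S B"
  have dvd: "\<exists>d. b = S j \<otimes> d" if j: "j \<prec> n" for j
  proof -
    obtain d where "c = S j \<otimes> d" using c(2)[OF j] by blast
    then have "b = S j \<otimes> (d \<otimes> S B)" unfolding b_def by (simp only: mul_assoc)
    then show ?thesis by blast
  qed
  have sm: "s i \<prec> md b i" if "i \<prec> n" for i
  proof -
    have "S B \<preceq> b" unfolding b_def using c(1) by (intro le_mul) (simp add: Z_less)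
    moreover have "b \<preceq> S i \<otimes> b" by (intro le_mul) simp
    ultimately have "B \<preceq> S i \<otimes> b" unfolding S_le by (metis L.less_imp_le L.less_le_trans)
    then have "s i \<preceq> S i \<otimes> b" using B[OF that] by (rule L.order_trans[rotated])
    then show ?thesis unfolding less_S_le .
  qed
  have "k \<preceq> n \<longrightarrow> (\<exists>a. \<forall>i. i \<prec> k \<longrightarrow> bt a b i (s i))" for k
  proof (rule ind[where x = k])
    show "Dp (\<lambda>e. e 0 \<preceq> n \<longrightarrow> (\<exists>a. \<forall>i. i \<prec> e 0 \<longrightarrow> bt a b i (s i)))" by (intro D_intros sD)
    fix k assume IH: "k \<preceq> n \<longrightarrow> (\<exists>a. \<forall>i. i \<prec> k \<longrightarrow> bt a b i (s i))"
    show "S k \<preceq> n \<longrightarrow> (\<exists>a. \<forall>i. i \<prec> S k \<longrightarrow> bt a b i (s i))"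
    proof
      assume "S k \<preceq> n"
      then have k: "k \<prec> n" by simp
      then obtain a where a: "\<And>i. i \<prec> k \<Longrightarrow> bt a b i (s i)" using IH L.less_imp_le[OF k] by blast
      show "\<exists>a. \<forall>i. i \<prec> S k \<longrightarrow> bt a b i (s i)"
        by (rule crt_step[OF a sm[OF k] dvd]) (use k in \<open>auto intro: L.less_trans\<close>)
    qed
  qed simp
  then show ?thesis using L.order_refl by blast
qed

subsection \<open>Primitive recursive functions\<close>

text \<open>A recursion may have nonstandard length, so \<open>PRec\<close> is read off from a
  beta-coded sequence of values; \<open>mev_PRec\<close> recovers the recursion equations from
  induction in the model.\<close>

fun mev :: "pr \<Rightarrow> 'm list \<Rightarrow> 'm" where
  "mev PZero xs = Z"
| "mev PSucc xs = S (arg Z xs 0)"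
| "mev (PProj i) xs = arg Z xs i"
| "mev (PComp f gs) xs = mev f (map (\<lambda>g. mev g xs) gs)"
| "mev (PRec f g) [] = Z"
| "mev (PRec f g) (n # xs) = (THE t. \<exists>a b. bt a b Z (mev f xs) \<and>
     (\<forall>i. i \<prec> n \<longrightarrow> (\<exists>u. bt a b i u \<and> bt a b (S i) (mev g (i # u # xs)))) \<and> bt a b n t)"

definition graph_ok :: "pr \<Rightarrow> bool" where
  "graph_ok f \<longleftrightarrow> (\<forall>e ts t. msat M e (graph f ts t) \<longleftrightarrow> mval M e t = mev f (map (mval M e) ts))"

lemma DF_mev': assumes "graph_ok f" "DFL G" shows "DF (\<lambda>e. mev f (G e))"
proof -
  obtain Fs where Fs: "\<forall>F\<in>set Fs. DF F" "G = (\<lambda>e. map (\<lambda>F. F e) Fs)" using assms unfolding DFL_def by blast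
  show ?thesis
  proof (rule DF_of_graph[OF _ assms(2)])
    fix xs :: "'m list" and y assume len: "length xs = length Fs"
    let ?e = "\<lambda>i. if i < length Fs then xs ! i else y"
    have 1: "map (mval M ?e) (map Var [0..<length Fs]) = xs" using len by (intro nth_equalityI) auto
    show "mev f xs = y \<longleftrightarrow> msat M ?e (graph f (map Var [0..<length Fs]) (Var (length Fs)))"
      unfolding assms(1)[unfolded graph_ok_def, rule_format] 1 by auto
  qed (simp add: Fs)
qed

lemma mev_PRec:
  assumes "graph_ok f" "graph_ok g"
  shows "mev (PRec f g) (Z # xs) = mev f xs"
    and "mev (PRec f g) (S n # xs) = mev g (n # mev (PRec f g) (n # xs) # xs)"
    and "(\<exists>a b. bt a b Z (mev f xs) \<and>
     (\<forall>i. i \<prec> n \<longrightarrow> (\<exists>u. bt a b i u \<and> bt a b (S i) (mev g (i # u # xs)))) \<and> bt a b n t) \<longleftrightarrow> t = mev (PRec f g) (n # xs)"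
proof -
  define ok where "ok a b n \<longleftrightarrow> bt a b Z (mev f xs) \<and>
     (\<forall>i. i \<prec> n \<longrightarrow> (\<exists>u. bt a b i u \<and> bt a b (S i) (mev g (i # u # xs))))" for a b n
  note gD = DF_mev'[OF assms(2)]
  have ex: "\<exists>a b. ok a b n" for n
  proof (rule ind[where x = n])
    show "Dp (\<lambda>e. \<exists>a b. ok a b (e 0))" unfolding ok_def by (intro D_intros gD)
    show "\<exists>a b. ok a b Z" using beta_ex'[OF DF_const[of "mev f xs"], of "S Z"] by (auto simp: ok_def less_S)
    fix n assume "\<exists>a b. ok a b n"
    then obtain a b where ab: "ok a b n" by blast
    obtain t where t: "bt a b n t" using bt_ex by blast
    \<comment> \<open>The old values followed by the new one. A beta code cannot be prolonged in
      place, so the definable sequence \<open>s\<close> is coded afresh by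
      \<open>beta_ex'\<close>.\<close>
    define s where "s i = (if i \<preceq> n then (THE u. bt a b i u) else mev g (n # t # xs))" for i
    have the: "(THE u. bt a b i u) = u \<longleftrightarrow> bt a b i u" for i u
      using bt_ex[of a b i] bt_unique by (metis the_equality)
    have "DF (\<lambda>e. s (e 0))"
    proof -
      have "Dp (\<lambda>e. (e 1 \<preceq> n \<and> bt a b (e 1) (e 0)) \<or> (\<not> e 1 \<preceq> n \<and> e 0 = mev g (n # t # xs)))"
        by (intro D_intros)
      moreover have "((e 1 \<preceq> n \<and> bt a b (e 1) (e 0)) \<or> (\<not> e 1 \<preceq> n \<and> e 0 = mev g (n # t # xs))) \<longleftrightarrow> e 0 = s (e (Suc 0))" for e
        using the[of "e 1" "e 0"] by (auto simp: s_def)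
      ultimately show ?thesis unfolding DF_def by simp
    qed
    from beta_ex'[OF this, of "S (S n)"] obtain a' b' where "\<And>i. i \<prec> S (S n) \<Longrightarrow> bt a' b' i (s i)" by blast
    then have 1: "bt a' b' i u" if "i \<preceq> n" "bt a b i u" for i u
      using that the[of i u] by (metis s_def less_S less_S_le)
    have 2: "bt a' b' (S n) (mev g (n # t # xs))"
      using \<open>\<And>i. i \<prec> S (S n) \<Longrightarrow> bt a' b' i (s i)\<close>[of "S n"] by (simp add: s_def L.less_irrefl)
    have "ok a' b' (S n)" unfolding ok_def
    proof (intro conjI allI impI)
      show "bt a' b' Z (mev f xs)" using 1 ab by (simp add: ok_def)
      fix i assume i: "i \<prec> S n"
      show "\<exists>u. bt a' b' i u \<and> bt a' b' (S i) (mev g (i # u # xs))"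
      proof (cases "i = n")
        case True then show ?thesis using 1[OF _ t] 2 by auto
      next
        case False
        then have "i \<prec> n" using i by (simp add: less_S)
        then obtain u where "bt a b i u" "bt a b (S i) (mev g (i # u # xs))" using ab unfolding ok_def by blast
        then show ?thesis using 1[of i] 1[of "S i"] \<open>i \<prec> n\<close> by (auto simp: le'_def[of i])
      qed
    qed
    then show "\<exists>a b. ok a b (S n)" by blast
  qed
  have uniq: "\<forall>t t'. bt a b n t \<longrightarrow> bt a' b' n t' \<longrightarrow> t = t'" if okm: "ok a b m" "ok a' b' m" "n \<preceq> m" for a b a' b' n m
  proof -
    have "n \<preceq> m \<longrightarrow> (\<forall>t t'. bt a b n t \<longrightarrow> bt a' b' n t' \<longrightarrow> t = t')"
    proof (rule ind[where x = n])
      show "Dp (\<lambda>e. e 0 \<preceq> m \<longrightarrow> (\<forall>t t'. bt a b (e 0) t \<longrightarrow> bt a' b' (e 0) t' \<longrightarrow> t = t'))" by (intro D_intros)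
      show "Z \<preceq> m \<longrightarrow> (\<forall>t t'. bt a b Z t \<longrightarrow> bt a' b' Z t' \<longrightarrow> t = t')"
        using okm(1,2) bt_unique unfolding ok_def by blast
      fix n assume IH: "n \<preceq> m \<longrightarrow> (\<forall>t t'. bt a b n t \<longrightarrow> bt a' b' n t' \<longrightarrow> t = t')"
      show "S n \<preceq> m \<longrightarrow> (\<forall>t t'. bt a b (S n) t \<longrightarrow> bt a' b' (S n) t' \<longrightarrow> t = t')"
      proof (intro impI allI)
        fix t t' assume n: "S n \<preceq> m" and t: "bt a b (S n) t" "bt a' b' (S n) t'"
        obtain u u' where u: "bt a b n u" "bt a b (S n) (mev g (n # u # xs))" "bt a' b' n u'" "bt a' b' (S n) (mev g (n # u' # xs))"
          using okm(1,2) n unfolding ok_def S_le by blast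
        have "n \<preceq> m" using n by (simp add: L.less_imp_le)
        then have "u = u'" using IH u(1,3) by blast
        then show "t = t'" using bt_unique[OF t(1) u(2)] bt_unique[OF t(2) u(4)] by simp
      qed
    qed
    then show ?thesis using okm(3) by blast
  qed
  have mev: "mev (PRec f g) (n # xs) = (THE t. \<exists>a b. ok a b n \<and> bt a b n t)" for n
    by (simp add: ok_def)
  have mono: "ok a b n" if "ok a b (S n)" for a b n using that by (auto simp: ok_def less_S)
  have val: "mev (PRec f g) (n # xs) = t" if "ok a b n" "bt a b n t" for a b n t
    unfolding mev by (rule the_equality) (use that uniq[of _ _ n _ _ n] in blast)+
  show "mev (PRec f g) (Z # xs) = mev f xs"
    using ex[of Z] val unfolding ok_def by blast
  obtain a b where ab: "ok a b (S n)" using ex by blast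
  then obtain u where u: "bt a b n u" "bt a b (S n) (mev g (n # u # xs))" unfolding ok_def by (metis less_self)
  show "mev (PRec f g) (S n # xs) = mev g (n # mev (PRec f g) (n # xs) # xs)"
    unfolding val[OF ab u(2)] val[OF mono[OF ab] u(1)] ..
  have "(\<exists>a b. ok a b n \<and> bt a b n t) \<longleftrightarrow> t = mev (PRec f g) (n # xs)"
    using ex[of n] bt_ex val by metis
  then show "(\<exists>a b. bt a b Z (mev f xs) \<and>
     (\<forall>i. i \<prec> n \<longrightarrow> (\<exists>u. bt a b i u \<and> bt a b (S i) (mev g (i # u # xs)))) \<and> bt a b n t) \<longleftrightarrow> t = mev (PRec f g) (n # xs)"
    by (simp only: ok_def conj_assoc)
qed

lemma msat_Exs: "msat M e ((Exists ^^ m) a) \<longleftrightarrow> (\<exists>ys. length ys = m \<and> msat M (\<lambda>i. if i < m then ys ! i else e (i - m)) a)"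
proof (induction m arbitrary: e a)
  case (Suc m)
  have f: "(\<lambda>i. if i < Suc m then (y#ys) ! i else e (i - Suc m)) = case_nat y (\<lambda>i. if i < m then ys ! i else e (i - m))"
    for y ys by (auto simp: fun_eq_iff split: nat.split)
  have "msat M e ((Exists ^^ Suc m) a) \<longleftrightarrow> msat M e ((Exists ^^ m) (Exists a))" by (simp add: funpow_swap1)
  also have "\<dots> \<longleftrightarrow> (\<exists>ys y. length ys = m \<and> msat M (\<lambda>i. if i < Suc m then (y#ys) ! i else e (i - Suc m)) a)"
    unfolding Suc f by simp
  also have "\<dots> \<longleftrightarrow> (\<exists>ys. length ys = Suc m \<and> msat M (\<lambda>i. if i < Suc m then ys ! i else e (i - Suc m)) a)"
  proof -
    have "(\<exists>ys. length ys = Suc m \<and> P ys) \<longleftrightarrow> (\<exists>ys y. length ys = m \<and> P (y # ys))" for P :: "'m list \<Rightarrow> bool"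
      by (auto simp: length_Suc_conv)
    from this[of "\<lambda>ys. msat M (\<lambda>i. if i < Suc m then ys ! i else e (i - Suc m)) a"] show ?thesis by blast
  qed
  finally show ?case .
qed auto

lemma msat_conjs: "msat M e (foldr Conj As B) \<longleftrightarrow> (\<forall>A\<in>set As. msat M e A) \<and> msat M e B"
  by (induction As) auto

lemma mval_arg: "mval M e (arg Zero ts i) = arg Z (map (mval M e) ts) i"
  by (auto simp: arg_def)

lemma graph_ok: "graph_ok f"
proof (induction f)
  case (PComp f gs)
  note IHf = PComp(1)[unfolded graph_ok_def, rule_format]
  note IHg = PComp(2)[unfolded graph_ok_def, rule_format]
  show ?case unfolding graph_ok_def
  proof (intro allI)
    fix e ts t
    let ?m = "length gs"
    have *: "msat M (\<lambda>i. if i < ?m then ys ! i else e (i - ?m)) (foldr Conj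
          (map (\<lambda>(i, g). graph g (map (tlift ?m) ts) (Var i)) (zip [0..<?m] gs))
          (graph f (map Var [0..<?m]) (tlift ?m t))) \<longleftrightarrow>
        ys = map (\<lambda>g. mev g (map (mval M e) ts)) gs \<and> mval M e t = mev f ys" if len: "length ys = ?m" for ys
    proof -
      let ?e = "\<lambda>i. if i < ?m then ys ! i else e (i - ?m)"
      have 2: "msat M ?e (graph (gs ! i) (map (tlift ?m) ts) (Var i)) \<longleftrightarrow> ys ! i = mev (gs ! i) (map (mval M e) ts)" if "i < ?m" for i
        using that IHg[of "gs ! i"] by (simp add: comp_def)
      have 3: "map (mval M ?e) (map Var [0..<?m]) = ys" using len by (intro nth_equalityI) auto
      have 4: "msat M ?e (graph f (map Var [0..<?m]) (tlift ?m t)) \<longleftrightarrow> mval M e t = mev f ys"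
        unfolding IHf 3 by simp
      have "(\<forall>A\<in>set (map (\<lambda>(i, g). graph g (map (tlift ?m) ts) (Var i)) (zip [0..<?m] gs)). msat M ?e A) \<longleftrightarrow> (\<forall>i<?m. ys ! i = mev (gs ! i) (map (mval M e) ts))"
      proof -
        have "set (zip [0..<?m] gs) = (\<lambda>i. (i, gs ! i)) ` {..<?m}"
          by (auto simp: set_zip image_iff) (metis add_0 nth_upt)
        then show ?thesis using 2 by auto
      qed
      also have "\<dots> \<longleftrightarrow> ys = map (\<lambda>g. mev g (map (mval M e) ts)) gs" using len by (auto simp: list_eq_iff_nth_eq)
      finally show ?thesis unfolding msat_conjs 4 by blast
    qed
    show "msat M e (graph (PComp f gs) ts t) \<longleftrightarrow> mval M e t = mev (PComp f gs) (map (mval M e) ts)"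
      unfolding graph.simps Let_def msat_Exs using * by (auto intro!: exI[of _ "map (\<lambda>g. mev g (map (mval M e) ts)) gs"])
  qed
next
  case (PRec f g)
  note IHf = PRec(1)[unfolded graph_ok_def, rule_format]
  note IHg = PRec(2)[unfolded graph_ok_def, rule_format]
  show ?case unfolding graph_ok_def
  proof (intro allI)
    fix e ts t
    show "msat M e (graph (PRec f g) ts t) \<longleftrightarrow> mval M e t = mev (PRec f g) (map (mval M e) ts)"
    proof (cases ts)
      case (Cons n ts')
      let ?vs = "map (mval M e) ts'"
      show ?thesis unfolding Cons list.map
        unfolding mev_PRec(3)[OF PRec(1,2), of ?vs "mval M e n" "mval M e t", symmetric]
        unfolding graph.simps msat.simps IHf IHg msat_beta by (simp add: comp_def)
    qed simp
  qed
qed (simp_all add: graph_ok_def mval_arg)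

lemma msat_graph: "msat M e (graph f ts t) \<longleftrightarrow> mval M e t = mev f (map (mval M e) ts)"
  using graph_ok unfolding graph_ok_def by blast

lemmas DF_mev [D_intros] = DF_mev'[OF graph_ok]
lemmas mev_Z = mev_PRec(1)[OF graph_ok graph_ok] and mev_S = mev_PRec(2)[OF graph_ok graph_ok]

declare mev.simps(6) [simp del]
declare mev_Z [simp] mev_S [simp]

end

context pa_model begin

subsection \<open>Arithmetic, pairs and lists in a model\<close>

lemma mev_pnum [simp]: "mev (pnum n) xs = nm n"
  by (induction n) simp_all
lemma mev_psuc [simp]: "mev (psuc a) xs = S (mev a xs)"
  by (simp add: psuc_def)

lemma S_sub_S [simp]: "S a \<ominus> S b = a \<ominus> b"
proof (cases "b \<preceq> a")
  case True
  then obtain d where "a = b \<oplus> d" unfolding le_iff by blast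
  then show ?thesis using add_sub(1)[of "S b" d] by simp
next
  case False
  then have "\<not> S b \<preceq> S a" by (simp add: less_S_le)
  then show ?thesis using False by (simp add: sub_eq del: S_le)
qed
lemma Z_sub [simp]: "Z \<ominus> a = Z"
  by (cases a rule: Z_cases) (simp_all add: sub_eq)
lemma sub_eq_Z: "a \<ominus> b = Z \<longleftrightarrow> a \<preceq> b"
proof (cases "b \<preceq> a")
  case True
  then obtain d where d: "a = b \<oplus> d" unfolding le_iff by blast
  have "b \<oplus> d \<preceq> b \<longleftrightarrow> d = Z"
  proof
    assume "b \<oplus> d \<preceq> b"
    then have "b \<oplus> d = b \<oplus> Z" using L.order.antisym[of "b \<oplus> d" b] by simp
    then show "d = Z" unfolding add_cancel .
  qed simp
  then show ?thesis by (simp add: d)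
next
  case False
  then show ?thesis using L.linear[of a b] by (simp add: sub_eq)
qed

lemma mev_ppred [simp]: "mev (ppred a) xs = mev a xs \<ominus> S Z"
  by (cases "mev a xs" rule: Z_cases) (simp_all add: ppred_def)

lemma mev_padd [simp]: "mev (padd a b) xs = mev a xs \<oplus> mev b xs"
proof -
  have "mev (PRec (PProj 0) (psuc (PProj 1))) [x, y] = x \<oplus> y" for x y
    by (rule ind[where x = x]) (intro D_intros, simp_all)
  then show ?thesis by (simp add: padd_def)
qed
lemma mev_pmult [simp]: "mev (pmult a b) xs = mev a xs \<otimes> mev b xs"
proof -
  have "mev (PRec PZero (padd (PProj 1) (PProj 2))) [x, y] = x \<otimes> y" for x y
    by (rule ind[where x = x]) (intro D_intros, simp_all)
  then show ?thesis by (simp add: pmult_def)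
qed
lemma mev_psub [simp]: "mev (psub a b) xs = mev a xs \<ominus> mev b xs"
proof -
  have "mev (PRec (PProj 0) (ppred (PProj 1))) [y, x] = x \<ominus> y" for x y
  proof -
    have "\<exists>d. mev (PRec (PProj 0) (ppred (PProj 1))) [y, x] = d \<and> (d \<oplus> y = x \<or> d = Z \<and> x \<preceq> y)"
    proof (rule ind[where x = y])
      fix y assume "\<exists>d. mev (PRec (PProj 0) (ppred (PProj 1))) [y, x] = d \<and> (d \<oplus> y = x \<or> d = Z \<and> x \<preceq> y)"
      then obtain d where d: "mev (PRec (PProj 0) (ppred (PProj 1))) [y, x] = d" "d \<oplus> y = x \<or> d = Z \<and> x \<preceq> y" by blast
      show "\<exists>d. mev (PRec (PProj 0) (ppred (PProj 1))) [S y, x] = d \<and> (d \<oplus> S y = x \<or> d = Z \<and> x \<preceq> S y)"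
        using d L.order_trans[of x y "S y"] by (cases d rule: Z_cases) (auto simp: L.less_imp_le)
    qed (intro D_intros, simp)
    then show ?thesis using add_sub(2) sub_eq_Z by metis
  qed
  then show ?thesis by (simp add: psub_def)
qed

lemma DF_sub [D_intros]: assumes "DF F" "DF G" shows "DF (\<lambda>e. F e \<ominus> G e)"
proof -
  have "DF (\<lambda>e. mev (psub (PProj 0) (PProj 1)) [F e, G e])" by (intro DF_mev DFL_Cons DFL_Nil assms)
  then show ?thesis by simp
qed

definition ob :: "bool \<Rightarrow> 'm" where "ob P = (if P then S Z else Z)"
lemma ob_simps [simp]: "ob P = Z \<longleftrightarrow> \<not> P" "ob P = S Z \<longleftrightarrow> P" "ob True = S Z" "ob False = Z" "ob P = ob Q \<longleftrightarrow> P = Q"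
  by (auto simp: ob_def)

lemma mev_pnot [simp]: "mev (pnot a) xs = ob (mev a xs = Z)"
  by (cases "mev a xs" rule: Z_cases) (simp_all add: pnot_def)
lemma mev_por [simp]: "mev (por a b) xs = ob (mev a xs \<noteq> Z \<or> mev b xs \<noteq> Z)"
  by (simp add: por_def add_eq_Z)
lemma mev_pand [simp]: "mev (pand a b) xs = ob (mev a xs \<noteq> Z \<and> mev b xs \<noteq> Z)"
  by (simp add: pand_def add_eq_Z)
lemma mev_ple [simp]: "mev (ple a b) xs = ob (mev a xs \<preceq> mev b xs)"
  by (simp add: ple_def sub_eq_Z)
lemma mev_peq [simp]: "mev (peq a b) xs = ob (mev a xs = mev b xs)"
  using L.order.antisym[of "mev a xs" "mev b xs"] by (auto simp: peq_def)
lemma mev_pite [simp]: "mev (pite c a b) xs = (if mev c xs \<noteq> Z then mev a xs else mev b xs)"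
  by (cases "mev c xs" rule: Z_cases) (simp_all add: pite_def)

lemma divk: assumes "0 < k" shows "\<exists>p r. r < k \<and> x = nm k \<otimes> p \<oplus> nm r"
proof -
  have "Z \<prec> nm k" using assms by (cases k) simp_all
  then obtain q r where "x = q \<otimes> nm k \<oplus> r" "r \<prec> nm k" using div_ex by blast
  then show ?thesis using less_nm mul_comm by metis
qed

lemma pmod_aux: assumes "0 < k" and f: "f = PRec PZero (pite (peq (psuc (PProj 1)) (pnum k)) PZero (psuc (PProj 1)))"
  shows "r < k \<Longrightarrow> mev f [nm k \<otimes> p \<oplus> nm r] = nm r" "mev f [nm k \<otimes> p \<oplus> nm k] = Z"
proof -
  have r: "mev f [nm k \<otimes> p \<oplus> nm r] = nm r" if "r < k" "mev f [nm k \<otimes> p] = Z" for p r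
    using that
  proof (induction r)
    case (Suc r)
    have "S (nm r) \<noteq> nm k" using Suc(2) nm_inj[of "Suc r" k] by auto
    then show ?case using Suc by (simp add: f)
  qed simp
  have k: "mev f [nm k \<otimes> p \<oplus> nm k] = Z" if "mev f [nm k \<otimes> p] = Z" for p
  proof -
    obtain j where j: "k = Suc j" using assms(1) by (cases k) auto
    then show ?thesis using r[of j p] that by (simp add: f)
  qed
  have 0: "mev f [nm k \<otimes> p] = Z" for p
    by (rule ind[where x = p], intro D_intros) (use k in \<open>simp_all add: f\<close>)
  show "r < k \<Longrightarrow> mev f [nm k \<otimes> p \<oplus> nm r] = nm r" "mev f [nm k \<otimes> p \<oplus> nm k] = Z" using r k 0 by auto
qed

lemma pmod_eq: "r < k \<Longrightarrow> mev a xs = nm k \<otimes> p \<oplus> nm r \<Longrightarrow> mev (pmod a k) xs = nm r"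
  using pmod_aux(1)[OF _ refl, of k r p] by (simp add: pmod_def)

lemma pdiv_eq: assumes "r < k" "mev a xs = nm k \<otimes> p \<oplus> nm r" shows "mev (pdiv a k) xs = p"
proof -
  define f where "f = PRec PZero (padd (PProj 1) (pnot (pmod (psuc (PProj 0)) k)))"
  have r: "mev f [nm k \<otimes> p \<oplus> nm r] = p" if "r < k" "mev f [nm k \<otimes> p] = p" for p r
    using that
  proof (induction r)
    case (Suc r)
    have "mev (pmod (psuc (PProj 0)) k) [nm k \<otimes> p \<oplus> nm r, p] = nm (Suc r)"
      by (rule pmod_eq) (use Suc in simp_all)
    then show ?case using Suc by (simp add: f_def)
  qed simp
  have k: "mev f [nm k \<otimes> p \<oplus> nm k] = S p" if "mev f [nm k \<otimes> p] = p" for p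
  proof -
    obtain j where j: "k = Suc j" using assms(1) by (cases k) auto
    have "mev (pmod (psuc (PProj 0)) k) [nm k \<otimes> p \<oplus> nm j, p] = Z"
      using pmod_aux(2)[OF _ refl, of k p] j by (simp add: pmod_def)
    then show ?thesis using r[of j p] that j by (simp add: f_def)
  qed
  have 0: "mev f [nm k \<otimes> p] = p" for p
    by (rule ind[where x = p], intro D_intros) (use k in \<open>simp_all add: f_def\<close>)
  show ?thesis using r[OF assms(1) 0] assms(2) by (simp add: pdiv_def f_def)
qed

lemma mev_pex [simp]: "mev (pex p a bs) xs = ob (\<exists>i. i \<prec> mev a xs \<and> mev p (i # map (\<lambda>b. mev b xs) bs) \<noteq> Z)"
proof -
  define ys where "ys = map (\<lambda>b. mev b xs) bs"
  define f where "f = PRec PZero (por (PProj 1) (PComp p (PProj 0 # map PProj [2..<2 + length bs])))"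
  have m: "map (\<lambda>i. arg Z (x # y # ys) i) [2..<2 + length bs] = ys" for x y
    using map_arg[of Z x y ys] by (simp add: ys_def)
  have Z: "mev f (Z # ys) = Z" by (simp add: f_def)
  have st: "mev f (S n # ys) = ob (mev f (n # ys) \<noteq> Z \<or> mev p (n # ys) \<noteq> Z)" for n
    using m[of n] by (simp add: comp_def f_def del: upt_Suc upt_rec_numeral)
  have *: "(mev f (n # ys) \<noteq> Z \<longleftrightarrow> (\<exists>i. i \<prec> n \<and> mev p (i # ys) \<noteq> Z)) \<and> (mev f (n # ys) = Z \<or> mev f (n # ys) = S Z)" for n
  proof (rule ind[where x = n])
    show "Dp (\<lambda>e. (mev f (e 0 # ys) \<noteq> Z \<longleftrightarrow> (\<exists>i. i \<prec> e 0 \<and> mev p (i # ys) \<noteq> Z)) \<and> (mev f (e 0 # ys) = Z \<or> mev f (e 0 # ys) = S Z))"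
      by (intro D_intros)
    show "(mev f (Z # ys) \<noteq> Z \<longleftrightarrow> (\<exists>i. i \<prec> Z \<and> mev p (i # ys) \<noteq> Z)) \<and> (mev f (Z # ys) = Z \<or> mev f (Z # ys) = S Z)"
      by (simp add: Z)
    fix n assume "(mev f (n # ys) \<noteq> Z \<longleftrightarrow> (\<exists>i. i \<prec> n \<and> mev p (i # ys) \<noteq> Z)) \<and> (mev f (n # ys) = Z \<or> mev f (n # ys) = S Z)"
    then show "(mev f (S n # ys) \<noteq> Z \<longleftrightarrow> (\<exists>i. i \<prec> S n \<and> mev p (i # ys) \<noteq> Z)) \<and> (mev f (S n # ys) = Z \<or> mev f (S n # ys) = S Z)"
      unfolding st by (auto simp: less_S)
  qed
  have "mev f (n # ys) = ob (\<exists>i. i \<prec> n \<and> mev p (i # ys) \<noteq> Z)" for n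
  proof (cases "\<exists>i. i \<prec> n \<and> mev p (i # ys) \<noteq> Z")
    case True
    then have "mev f (n # ys) = S Z" using *[of n] by blast
    then show ?thesis using True by (simp only: ob_simps simp_thms)
  next
    case False
    then have "mev f (n # ys) = Z" using *[of n] by blast
    then show ?thesis using False by (simp only: ob_simps simp_thms)
  qed
  then show ?thesis by (simp add: pex_def comp_def f_def ys_def)
qed

definition tri :: "'m \<Rightarrow> 'm" where "tri n = mev (ptriangle (PProj 0)) [n]"
lemma tri_simps [simp]: "tri Z = Z" "tri (S n) = S (tri n \<oplus> n)"
  by (simp_all add: tri_def ptriangle_def)
lemma mev_ptriangle [simp]: "mev (ptriangle a) xs = tri (mev a xs)"
  by (simp add: tri_def ptriangle_def)
lemma DF_tri [D_intros]: "DF F \<Longrightarrow> DF (\<lambda>e. tri (F e))"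
  unfolding tri_def by (intro DF_mev DFL_Cons DFL_Nil)

lemma tri_mono: assumes "a \<preceq> b" shows "tri a \<preceq> tri b"
proof -
  obtain d where d: "b = a \<oplus> d" using assms unfolding le_iff by blast
  have "tri a \<preceq> tri (a \<oplus> d)"
  proof (rule ind[where x = d])
    show "Dp (\<lambda>e. tri a \<preceq> tri (a \<oplus> e 0))" by (intro D_intros)
    fix d assume "tri a \<preceq> tri (a \<oplus> d)"
    then show "tri a \<preceq> tri (a \<oplus> S d)" using L.order_trans[of "tri a" "tri (a \<oplus> d)" "S (tri (a \<oplus> d) \<oplus> (a \<oplus> d))"]
      by (simp add: L.less_imp_le)
  qed simp
  then show ?thesis by (simp add: d)
qed
lemma le_tri: "n \<preceq> tri n"
  by (cases n rule: Z_cases) (simp_all add: less_S_le)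

definition dg :: "'m \<Rightarrow> 'm" where "dg n = mev (pdiag (PProj 0)) [n]"
lemma mev_pdiag [simp]: "mev (pdiag a) xs = dg (mev a xs)"
  by (simp add: dg_def pdiag_def)
lemma DF_dg [D_intros]: "DF F \<Longrightarrow> DF (\<lambda>e. dg (F e))"
  unfolding dg_def by (intro DF_mev DFL_Cons DFL_Nil)
lemma dg_simps: "dg Z = Z" "dg (S n) = dg n \<oplus> ob (tri (S (dg n)) \<preceq> S n)"
  by (simp_all add: dg_def pdiag_def del: tri_simps)
lemma dg: "tri (dg n) \<preceq> n \<and> n \<prec> tri (S (dg n))"
proof (rule ind[where x = n])
  show "Dp (\<lambda>e. tri (dg (e 0)) \<preceq> e 0 \<and> e 0 \<prec> tri (S (dg (e 0))))" by (intro D_intros)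
  fix n assume IH: "tri (dg n) \<preceq> n \<and> n \<prec> tri (S (dg n))"
  show "tri (dg (S n)) \<preceq> S n \<and> S n \<prec> tri (S (dg (S n)))"
  proof (cases "tri (S (dg n)) \<preceq> S n")
    case True
    then have e: "tri (S (dg n)) = S n" using IH by (metis L.order.antisym S_le)
    have "dg (S n) = S (dg n)" using True by (simp add: dg_simps)
    moreover have "S n \<prec> tri (S (S (dg n)))" unfolding tri_simps(2)[of "S (dg n)"] e by (simp add: less_S_le L.less_imp_le)
    ultimately show ?thesis using e by simp
  next
    case False
    then have "dg (S n) = dg n" by (simp add: dg_simps)
    then show ?thesis using False IH by (metis L.leI L.le_less_trans L.less_imp_le less_self)
  qed
qed (simp add: dg_simps)

definition pair :: "'m \<Rightarrow> 'm \<Rightarrow> 'm" where "pair a b = tri (a \<oplus> b) \<oplus> a"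
definition fs :: "'m \<Rightarrow> 'm" where "fs c = c \<ominus> tri (dg c)"
definition sn :: "'m \<Rightarrow> 'm" where "sn c = dg c \<ominus> fs c"
lemma DF_pair [D_intros]: "DF F \<Longrightarrow> DF G \<Longrightarrow> DF (\<lambda>e. pair (F e) (G e))"
  unfolding pair_def by (intro D_intros)
lemma DF_fs [D_intros]: "DF F \<Longrightarrow> DF (\<lambda>e. fs (F e))"
  unfolding fs_def by (intro D_intros)
lemma DF_sn [D_intros]: "DF F \<Longrightarrow> DF (\<lambda>e. sn (F e))"
  unfolding sn_def by (intro D_intros)
lemma mev_ppair [simp]: "mev (ppair a b) xs = pair (mev a xs) (mev b xs)"
  by (simp add: ppair_def pair_def)
lemma mev_pfst [simp]: "mev (pfst a) xs = fs (mev a xs)"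
  by (simp add: pfst_def fs_def)
lemma mev_psnd [simp]: "mev (psnd a) xs = sn (mev a xs)"
  by (simp add: psnd_def sn_def)

lemma dg_pair: "dg (pair a b) = a \<oplus> b"
proof -
  let ?c = "pair a b"
  have 1: "tri (a \<oplus> b) \<preceq> ?c" "?c \<prec> tri (S (a \<oplus> b))"
    by (simp_all add: pair_def less_S_le L.add_left_mono)
  have "dg ?c \<preceq> a \<oplus> b"
  proof (rule ccontr)
    assume "\<not> dg ?c \<preceq> a \<oplus> b"
    then have "tri (S (a \<oplus> b)) \<preceq> tri (dg ?c)" by (intro tri_mono) (simp add: L.not_le)
    then show False using 1(2) dg[of ?c] by (metis L.leD L.order_trans)
  qed
  moreover have "a \<oplus> b \<preceq> dg ?c"
  proof (rule ccontr)
    assume "\<not> a \<oplus> b \<preceq> dg ?c"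
    then have "tri (S (dg ?c)) \<preceq> tri (a \<oplus> b)" by (intro tri_mono) (simp add: L.not_le)
    then show False using 1(1) dg[of ?c] by (metis L.leD L.order_trans)
  qed
  ultimately show ?thesis by (rule L.order.antisym)
qed
lemma fs_pair [simp]: "fs (pair a b) = a"
  by (simp add: fs_def dg_pair) (simp add: pair_def)
lemma sn_pair [simp]: "sn (pair a b) = b"
  by (simp add: sn_def dg_pair)
lemma pair_fs_sn [simp]: "pair (fs c) (sn c) = c"
proof -
  obtain r where r: "c = tri (dg c) \<oplus> r" using dg[of c] unfolding le_iff by blast
  have fs: "fs c = r" unfolding fs_def by (subst (1) r) simp
  have "tri (dg c) \<oplus> r \<prec> S (tri (dg c) \<oplus> dg c)" using dg[of c] r by simp
  then have "r \<preceq> dg c" by (simp add: less_S_le)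
  then have "r \<oplus> (dg c \<ominus> r) = dg c" by (metis L.le_add_diff_inverse)
  then show ?thesis unfolding pair_def sn_def fs using r by simp
qed
lemma le_pair1: "a \<preceq> pair a b" by (simp add: pair_def)
lemma le_pair2: "b \<preceq> pair a b"
  unfolding pair_def by (metis L.order_trans le_add1(1) le_add1(2) le_tri)
lemma fs_le: "fs c \<preceq> c" and sn_le: "sn c \<preceq> c"
  using le_pair1[of "fs c" "sn c"] le_pair2[of "sn c" "fs c"] by simp_all
lemma pair_less: assumes "a \<oplus> k \<prec> b \<oplus> l" shows "pair a k \<prec> pair b l"
proof -
  have "pair a k \<prec> tri (S (a \<oplus> k))" by (simp add: pair_def less_S_le L.add_left_mono)
  also have "tri (S (a \<oplus> k)) \<preceq> tri (b \<oplus> l)" by (rule tri_mono) (simp add: assms)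
  also have "tri (b \<oplus> l) \<preceq> pair b l" by (simp add: pair_def)
  finally (L.less_le_trans) show ?thesis .
qed

definition cns :: "'m \<Rightarrow> 'm \<Rightarrow> 'm" where "cns a b = S (pair a b)"
definition hd' :: "'m \<Rightarrow> 'm" where "hd' l = fs (l \<ominus> S Z)"
definition tl' :: "'m \<Rightarrow> 'm" where "tl' l = sn (l \<ominus> S Z)"
lemma DF_hd [D_intros]: "DF F \<Longrightarrow> DF (\<lambda>e. hd' (F e))"
  unfolding hd'_def by (intro D_intros)
lemma mev_pcons [simp]: "mev (pcons a b) xs = cns (mev a xs) (mev b xs)"
  by (simp add: pcons_def cns_def)
lemma mev_phd [simp]: "mev (phd a) xs = hd' (mev a xs)"
  by (simp add: phd_def hd'_def)
lemma mev_ptl [simp]: "mev (ptl a) xs = tl' (mev a xs)"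
  by (simp add: ptl_def tl'_def)
lemma list_simps [simp]: "cns a b \<noteq> Z" "hd' (cns a b) = a" "tl' (cns a b) = b"
  by (simp_all add: cns_def hd'_def tl'_def)
lemma fs_Z [simp]: "fs Z = Z" using fs_le[of Z] by simp
lemma sn_Z [simp]: "sn Z = Z" using sn_le[of Z] by simp
lemma tl_Z [simp]: "tl' Z = Z" by (simp add: tl'_def)
lemma cns_hd_tl: "l \<noteq> Z \<Longrightarrow> cns (hd' l) (tl' l) = l"
  by (cases l rule: Z_cases) (simp_all add: cns_def hd'_def tl'_def)
lemma less_cns1: "a \<prec> cns a b" and less_cns2: "b \<prec> cns a b"
  using le_pair1 le_pair2 by (simp_all add: cns_def less_S_le)

definition dr :: "'m \<Rightarrow> 'm \<Rightarrow> 'm" where "dr i l = mev (pdrop (PProj 0) (PProj 1)) [i, l]"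
lemma DF_dr [D_intros]: "DF F \<Longrightarrow> DF G \<Longrightarrow> DF (\<lambda>e. dr (F e) (G e))"
  unfolding dr_def by (intro DF_mev DFL_Cons DFL_Nil)
lemma mev_pdrop [simp]: "mev (pdrop i a) xs = dr (mev i xs) (mev a xs)"
  by (simp add: dr_def pdrop_def)
lemma dr_simps [simp]: "dr Z l = l"
  by (simp add: dr_def pdrop_def)
lemma dr_S': "dr (S i) l = tl' (dr i l)"
  by (simp add: dr_def pdrop_def)
lemma dr_S: "dr (S i) l = dr i (tl' l)"
  by (rule ind[where x = i], intro D_intros) (simp_all add: dr_S')
lemma dr_le: "dr i l = Z \<or> dr i l \<oplus> i \<preceq> l"
proof (rule ind[where x = i])
  show "Dp (\<lambda>e. dr (e 0) l = Z \<or> dr (e 0) l \<oplus> e 0 \<preceq> l)" by (intro D_intros)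
  fix i assume IH: "dr i l = Z \<or> dr i l \<oplus> i \<preceq> l"
  show "dr (S i) l = Z \<or> dr (S i) l \<oplus> S i \<preceq> l"
  proof (cases "dr i l = Z")
    case False
    have "tl' (dr i l) \<prec> dr i l" using less_cns2[of "tl' (dr i l)" "hd' (dr i l)"] cns_hd_tl[OF False] by simp
    then have "S (tl' (dr i l) \<oplus> i) \<preceq> dr i l \<oplus> i" by (simp add: L.add_strict_right_mono)
    moreover have "dr i l \<oplus> i \<preceq> l" using False IH by simp
    ultimately have "S (tl' (dr i l) \<oplus> i) \<preceq> l" by (rule L.order_trans)
    then show ?thesis by (simp add: dr_S')
  qed (simp add: dr_S')
qed simp

definition mem :: "'m \<Rightarrow> 'm \<Rightarrow> bool" where "mem x l \<longleftrightarrow> (\<exists>i. i \<prec> l \<and> dr i l \<noteq> Z \<and> hd' (dr i l) = x)"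
lemma Dp_mem [D_intros]: "DF F \<Longrightarrow> DF G \<Longrightarrow> Dp (\<lambda>e. mem (F e) (G e))"
  unfolding mem_def using DF_rename[of F Suc] DF_rename[of G Suc] by (intro D_intros)
lemma mev_pmem [simp]: "mev (pmem x l) xs = ob (mem (mev x xs) (mev l xs))"
  by (simp add: pmem_def mem_def)
lemma dr_less: "dr i l \<noteq> Z \<Longrightarrow> i \<prec> l"
proof -
  assume "dr i l \<noteq> Z"
  then have "dr i l \<oplus> i \<preceq> l" "Z \<prec> dr i l" using dr_le[of i l] by (auto simp: Z_less)
  then show "i \<prec> l" by (metis L.add_strict_right_mono L.less_le_trans Z_add)
qed
lemma mem_iff: "mem x l \<longleftrightarrow> (\<exists>i. dr i l \<noteq> Z \<and> hd' (dr i l) = x)"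
  unfolding mem_def using dr_less[of _ l] by auto
lemma dr_Z [simp]: "dr i Z = Z"
  by (rule ind[where x = i], intro D_intros) (simp_all add: dr_S')
lemma mem_Z [simp]: "\<not> mem x Z" by (simp add: mem_def)
lemma mem_cns [simp]: "mem x (cns y l) \<longleftrightarrow> x = y \<or> mem x l"
proof
  assume "mem x (cns y l)"
  then obtain i where i: "dr i (cns y l) \<noteq> Z" "hd' (dr i (cns y l)) = x" unfolding mem_iff by blast
  show "x = y \<or> mem x l"
  proof (cases i rule: Z_cases)
    case 2 then show ?thesis using i unfolding mem_iff by (auto simp: dr_S)
  qed (use i in simp)
next
  assume "x = y \<or> mem x l"
  then show "mem x (cns y l)"
  proof
    assume "x = y" then show ?thesis unfolding mem_iff by (intro exI[of _ Z]) simp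
  next
    assume "mem x l"
    then obtain i where "dr i l \<noteq> Z" "hd' (dr i l) = x" unfolding mem_iff by blast
    then show ?thesis unfolding mem_iff by (intro exI[of _ "S i"]) (simp add: dr_S)
  qed
qed
lemma mem_less: "mem x l \<Longrightarrow> x \<prec> l"
proof -
  assume "mem x l"
  then obtain i where i: "dr i l \<noteq> Z" "hd' (dr i l) = x" unfolding mem_iff by blast
  have "x \<prec> dr i l" using less_cns1[of x "tl' (dr i l)"] cns_hd_tl[OF i(1)] i(2) by simp
  moreover have "dr i l \<preceq> l" using dr_le[of i l] i(1) by (metis L.order_trans le_add1(1))
  ultimately show "x \<prec> l" by (rule L.less_le_trans)
qed

definition hst :: "pr \<Rightarrow> 'm list \<Rightarrow> 'm \<Rightarrow> 'm" where "hst G ps n = mev (PRec PZero (pcons G (PProj 1))) (n # ps)"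
definition cv :: "pr \<Rightarrow> 'm list \<Rightarrow> 'm \<Rightarrow> 'm" where "cv G ps n = mev G (n # hst G ps n # ps)"
lemma DF_hst [D_intros]: "DF F \<Longrightarrow> DF (\<lambda>e. hst G ps (F e))"
  unfolding hst_def by (intro DF_mev DFL_Cons DFL_const)
lemma hst_simps [simp]: "hst G ps Z = Z" "hst G ps (S n) = cns (cv G ps n) (hst G ps n)"
  by (simp_all add: hst_def cv_def)
lemma mev_pcov: "mev (pcov G a bs) xs = cv G (map (\<lambda>b. mev b xs) bs) (mev a xs)"
  using hst_simps(2)[of G "map (\<lambda>b. mev b xs) bs" "mev a xs"] by (simp add: pcov_def hst_def comp_def)
lemma mev_plook:
  assumes "mev m (n # hst G ps n # ps) \<prec> n"
  shows "mev (plook m) (n # hst G ps n # ps) = cv G ps (mev m (n # hst G ps n # ps))"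
proof -
  define k where "k = mev m (n # hst G ps n # ps)"
  obtain d where d: "n = k \<oplus> S d" using assms unfolding k_def less_iff by blast
  have "dr d (hst G ps (S (k \<oplus> d))) = hst G ps (S k)"
    by (rule ind[where x = d], intro D_intros) (simp_all add: dr_S)
  then show ?thesis unfolding plook_def k_def[symmetric] by (simp add: k_def[symmetric]) (simp add: d)
qed

text \<open>Values at standard arguments are the same in all models; facts about actual codes and
  actual proofs enter a model this way.\<close>

lemma mev_nm: "mev f (map nm ns) = nm (eval f ns)"
proof (induction f arbitrary: ns)
  case (PComp f gs)
  have "map (\<lambda>g. mev g (map nm ns)) gs = map nm (map (\<lambda>g. eval g ns) gs)" using PComp(2) by simp
  then show ?case using PComp(1) by (simp del: map_map)
next
  case (PRec f g)
  show ?case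
  proof (cases ns)
    case (Cons n ns')
    have "mev (PRec f g) (nm n # map nm ns') = nm (rec_nat (eval f ns') (\<lambda>k r. eval g (k # r # ns')) n)"
    proof (induction n)
      case (Suc n)
      then show ?case using PRec(2)[of "n # rec_nat (eval f ns') (\<lambda>k r. eval g (k # r # ns')) n # ns'"] by simp
    qed (simp add: PRec(1))
    then show ?thesis by (simp add: Cons)
  qed simp
qed (auto simp: arg_def)

lemma nm_pair: "nm (prod_encode (a, b)) = pair (nm a) (nm b)"
  using mev_nm[of "ppair (PProj 0) (PProj 1)" "[a, b]"] by simp

end

section \<open>Arithmetized syntax in a model\<close>

text \<open>The bodies of the course-of-values recursions receive names so that \<open>cv\<close>
  can be unfolded one step at a time.\<close>

definition tmG :: pr where
  "tmG = (let x = PProj 0; p = pdiv x 5; l = plook (pfst p); r = plook (psnd p) in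
      psel (pmod x 5) [pnum 1, pnot p, plook p, pand l r] (pand l r))"

definition fmG :: pr where
  "fmG = (let x = PProj 0; p = pdiv x 8; l = plook (pfst p); r = plook (psnd p);
         at = pand (pis_tm (pfst p)) (pis_tm (psnd p)) in
      psel (pmod x 8) [at, at, plook p, pand l r, pand l r, pand l r, plook p] (plook p))"

definition tsG :: "pr \<Rightarrow> pr" where
  "tsG \<sigma> = (let x = PProj 0; p = pdiv x 5; l = plook (pfst p); r = plook (psnd p) in
      psel (pmod x 5)
        [PComp \<sigma> [p, PProj 2, PProj 3], pnum 1, pSucc (plook p), pPlus l r] (pTimes l r))"

definition fsG :: "pr \<Rightarrow> pr" where
  "fsG \<sigma> = (let x = pfst (PProj 0); k = psnd (PProj 0); s = PProj 2; p = pdiv x 8;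
         l = pfst p; r = psnd p;
         tl = ptsubst \<sigma> l k s; tr = ptsubst \<sigma> r k s;
         p0 = plook (ppair p k); p1 = plook (ppair p (psuc k));
         l0 = plook (ppair l k); r0 = plook (ppair r k) in
      psel (pmod x 8)
        [pEq tl tr, pLess tl tr, pNeg p0, pConj l0 r0, pDisj l0 r0, pImp l0 r0, pForall p1]
        (pExists p1))"

lemma pcov_defs: "pis_tm a = pcov tmG a []" "pis_fm a = pcov fmG a []"
  "ptsubst \<sigma> t k s = pcov (tsG \<sigma>) t [k, s]" "pfsubst \<sigma> x s = pcov (fsG \<sigma>) (ppair x PZero) [s]"
  by (simp_all only: pis_tm_def pis_fm_def ptsubst_def pfsubst_def tmG_def fmG_def tsG_def fsG_def)

definition instS :: pr where
  "instS = (let i = PProj 0; k = PProj 1; s = PProj 2 in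
      pite (peq i k) (ptlift k s) (pVar (pite (ple k i) (ppred i) i)))"

lemma pinst_def': "pinst x t = pfsubst instS x t"
  by (simp only: pinst_def instS_def)

text \<open>The code of a numeral as a function of its value, needed to speak about instances at
  nonstandard numbers.\<close>

definition pnumt :: "pr \<Rightarrow> pr" where "pnumt a = PComp (PRec (pnum 1) (pSucc (PProj 1))) [a]"

lemma eval_pnumt [simp]: "eval (pnumt a) xs = gnt (numeral_tm (eval a xs))"
proof -
  have "eval (PRec (pnum 1) (pSucc (PProj 1))) [n] = gnt (numeral_tm n)" for n
    by (induction n) (simp_all add: pSucc_def)
  then show ?thesis by (simp add: pnumt_def)
qed

lemma less_5: "r < (5::nat) \<longleftrightarrow> r = 0 \<or> r = 1 \<or> r = 2 \<or> r = 3 \<or> r = 4" by auto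
lemma less_8: "r < (8::nat) \<longleftrightarrow> r = 0 \<or> r = 1 \<or> r = 2 \<or> r = 3 \<or> r = 4 \<or> r = 5 \<or> r = 6 \<or> r = 7" by auto

context pa_model begin

lemma mev_pcode1 [simp]: "mev (pcode1 k r a) xs = nm k \<otimes> mev a xs \<oplus> nm r"
  by (simp add: pcode1_def)
lemma mev_pcode2 [simp]: "mev (pcode2 k r a b) xs = nm k \<otimes> pair (mev a xs) (mev b xs) \<oplus> nm r"
  by (simp add: pcode2_def)

lemma psel_aux:
  assumes "mev a xs = nm i"
  shows "mev (foldr (\<lambda>(i, c) r. pite (peq a (pnum i)) c r) (zip [j..<j + length cs] cs) d) xs =
    (if j \<le> i \<and> i < j + length cs then mev (cs ! (i - j)) xs else mev d xs)"
proof (induction cs arbitrary: j)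
  case (Cons c cs)
  have "[j..<j + length (c # cs)] = j # [Suc j..<Suc j + length cs]" by (simp add: upt_conv_Cons del: upt_Suc)
  then show ?case using Cons[of "Suc j"] assms by (auto simp: not_less_eq_eq Suc_diff_Suc nth_Cons' less_eq_Suc_le simp del: upt_Suc)
qed auto

lemma mev_psel: "mev a xs = nm i \<Longrightarrow> mev (psel a cs d) xs = (if i < length cs then mev (cs ! i) xs else mev d xs)"
  using psel_aux[of a xs i 0 cs d] by (simp add: psel_def)

lemma less_code: assumes "q \<preceq> p" "0 < k" "0 < r" shows "q \<prec> nm k \<otimes> p \<oplus> nm r"
proof -
  obtain j where r: "r = Suc j" using assms(3) by (cases r) auto
  have "p \<preceq> nm k \<otimes> p" by (rule le_mul) (use assms(2) in \<open>cases k; simp\<close>)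
  then have "q \<preceq> nm k \<otimes> p \<oplus> nm j" using assms(1) L.order_trans[OF L.order_trans le_add1(1)] by blast
  then show ?thesis by (simp add: r less_S_le)
qed

lemma look: assumes "mev m (n # hst G ps n # ps) = q" "q \<prec> n" shows "mev (plook m) (n # hst G ps n # ps) = cv G ps q"
  using mev_plook[of m n G ps] assms by simp

definition istm :: "'m \<Rightarrow> bool" where "istm x \<longleftrightarrow> cv tmG [] x \<noteq> Z"
definition isfm :: "'m \<Rightarrow> bool" where "isfm x \<longleftrightarrow> cv fmG [] x \<noteq> Z"

lemma DF_cv [D_intros]: "DF F \<Longrightarrow> DF (\<lambda>e. cv G ps (F e))"
  unfolding cv_def by (intro DF_mev DFL_Cons DFL_const DF_hst)
lemma Dp_istm [D_intros]: "DF F \<Longrightarrow> Dp (\<lambda>e. istm (F e))" unfolding istm_def by (intro D_intros)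
lemma Dp_isfm [D_intros]: "DF F \<Longrightarrow> Dp (\<lambda>e. isfm (F e))" unfolding isfm_def by (intro D_intros)

lemma cv_tmG:
  assumes "r < 5" and n: "n = nm 5 \<otimes> p \<oplus> nm r"
  shows "cv tmG [] n = (if r = 0 then S Z else if r = 1 then ob (p = Z) else if r = 2 then cv tmG [] p
    else ob (istm (fs p) \<and> istm (sn p)))"
proof -
  define e c where "e = [n, hst tmG [] n]" and "c = cv tmG []"
  have m: "mev (pmod (PProj 0) 5) e = nm r" unfolding e_def by (rule pmod_eq) (use assms in simp_all)
  have d: "mev (pdiv (PProj 0) 5) e = p" unfolding e_def by (rule pdiv_eq) (use assms in simp_all)
  have l: "0 < r \<Longrightarrow> mev q e \<preceq> p \<Longrightarrow> mev (plook q) e = c (mev q e)" for q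
    unfolding e_def c_def by (rule look[OF refl]) (simp add: n less_code)
  have isc: "istm x \<longleftrightarrow> c x \<noteq> Z" for x by (simp add: istm_def c_def)
  have "cv tmG [] n = mev tmG e" by (simp add: cv_def e_def)
  also have "\<dots> = (if r = 0 then S Z else if r = 1 then ob (p = Z) else if r = 2 then c p
    else ob (istm (fs p) \<and> istm (sn p)))"
    unfolding tmG_def Let_def mev_psel[OF m] using assms(1) unfolding less_5
    by (auto simp: d l fs_le sn_le isc)
finally show ?thesis unfolding c_def .
qed

lemma istm_simps:
  "istm (nm 5 \<otimes> p)" "istm (S Z)" "istm (nm 5 \<otimes> p \<oplus> nm 2) \<longleftrightarrow> istm p"
  "istm (nm 5 \<otimes> p \<oplus> nm 3) \<longleftrightarrow> istm (fs p) \<and> istm (sn p)" "istm (nm 5 \<otimes> p \<oplus> nm 4) \<longleftrightarrow> istm (fs p) \<and> istm (sn p)"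
  using cv_tmG[of 0 "nm 5 \<otimes> p" p] cv_tmG[of 1 "S Z" Z] cv_tmG[of 2 _ p] cv_tmG[of 3 _ p] cv_tmG[of 4 _ p]
  by (simp_all add: istm_def)

lemma mev_pis_tm [simp]: "mev (pis_tm a) xs = ob (istm (mev a xs))"
proof -
  have "cv tmG [] x = Z \<or> cv tmG [] x = S Z" for x
  proof (rule less_ind[where n = x])
    fix n assume IH: "\<And>m. m \<prec> n \<Longrightarrow> cv tmG [] m = Z \<or> cv tmG [] m = S Z"
    obtain p r where r: "r < 5" "n = nm 5 \<otimes> p \<oplus> nm r" using divk[of 5 n] by auto
    have "r = 2 \<Longrightarrow> p \<prec> n" by (simp add: r(2) less_code)
    then show "cv tmG [] n = Z \<or> cv tmG [] n = S Z" unfolding cv_tmG[OF r] using IH[of p] by (auto simp: ob_def)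
  qed (intro D_intros)
  then show ?thesis by (simp add: pcov_defs mev_pcov istm_def) (metis ob_def)
qed

lemma cv_fmG:
  assumes "r < 8" and n: "n = nm 8 \<otimes> p \<oplus> nm r"
  shows "cv fmG [] n = (if r \<le> 1 then ob (istm (fs p) \<and> istm (sn p)) else if r = 2 \<or> 6 \<le> r then cv fmG [] p
    else ob (isfm (fs p) \<and> isfm (sn p)))"
proof -
  define e c where "e = [n, hst fmG [] n]" and "c = cv fmG []"
  have m: "mev (pmod (PProj 0) 8) e = nm r" unfolding e_def by (rule pmod_eq) (use assms in simp_all)
  have d: "mev (pdiv (PProj 0) 8) e = p" unfolding e_def by (rule pdiv_eq) (use assms in simp_all)
  have l: "0 < r \<Longrightarrow> mev q e \<preceq> p \<Longrightarrow> mev (plook q) e = c (mev q e)" for q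
    unfolding e_def c_def by (rule look[OF refl]) (simp add: n less_code)
  have isc: "isfm x \<longleftrightarrow> c x \<noteq> Z" for x by (simp add: isfm_def c_def)
  have "cv fmG [] n = mev fmG e" by (simp add: cv_def e_def)
  also have "\<dots> = (if r \<le> 1 then ob (istm (fs p) \<and> istm (sn p)) else if r = 2 \<or> 6 \<le> r then c p
    else ob (isfm (fs p) \<and> isfm (sn p)))"
    unfolding fmG_def Let_def mev_psel[OF m] using assms(1) unfolding less_8
    by (auto simp: d l fs_le sn_le isc)
finally show ?thesis unfolding c_def .
qed

lemma isfm_simps:
  "isfm (nm 8 \<otimes> p) \<longleftrightarrow> istm (fs p) \<and> istm (sn p)" "isfm (S (nm 8 \<otimes> p)) \<longleftrightarrow> istm (fs p) \<and> istm (sn p)"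
  "isfm (nm 8 \<otimes> p \<oplus> nm 2) \<longleftrightarrow> isfm p"
  "isfm (nm 8 \<otimes> p \<oplus> nm 3) \<longleftrightarrow> isfm (fs p) \<and> isfm (sn p)" "isfm (nm 8 \<otimes> p \<oplus> nm 4) \<longleftrightarrow> isfm (fs p) \<and> isfm (sn p)"
  "isfm (nm 8 \<otimes> p \<oplus> nm 5) \<longleftrightarrow> isfm (fs p) \<and> isfm (sn p)"
  "isfm (nm 8 \<otimes> p \<oplus> nm 6) \<longleftrightarrow> isfm p" "isfm (nm 8 \<otimes> p \<oplus> nm 7) \<longleftrightarrow> isfm p"
  using cv_fmG[of 0 _ p] cv_fmG[of 1 _ p] cv_fmG[of 2 _ p] cv_fmG[of 3 _ p] cv_fmG[of 4 _ p]
    cv_fmG[of 5 _ p] cv_fmG[of 6 _ p] cv_fmG[of 7 _ p]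
  by (simp_all add: isfm_def)

lemma mev_pis_fm [simp]: "mev (pis_fm a) xs = ob (isfm (mev a xs))"
proof -
  have "cv fmG [] x = Z \<or> cv fmG [] x = S Z" for x
  proof (rule less_ind[where n = x])
    fix n assume IH: "\<And>m. m \<prec> n \<Longrightarrow> cv fmG [] m = Z \<or> cv fmG [] m = S Z"
    obtain p r where r: "r < 8" "n = nm 8 \<otimes> p \<oplus> nm r" using divk[of 8 n] by auto
    have "r = 2 \<or> 6 \<le> r \<Longrightarrow> p \<prec> n" unfolding r(2) by (rule less_code) auto
    then show "cv fmG [] n = Z \<or> cv fmG [] n = S Z" unfolding cv_fmG[OF r] using IH[of p] by (auto simp: ob_def)
  qed (intro D_intros)
  then show ?thesis by (simp add: pcov_defs mev_pcov isfm_def) (metis ob_def)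
qed

lemma isfm_gn: "isfm (nm n) \<longleftrightarrow> (\<exists>\<phi>. n = gn \<phi>)"
  using mev_nm[of "pis_fm (PProj 0)" "[n]"] by (auto simp: of_bool_def split: if_splits)

section \<open>Codes of nonstandard numerals and of instances of formulas\<close>

definition ntm :: "'m \<Rightarrow> 'm" where "ntm x = mev (pnumt (PProj 0)) [x]"
lemma ntm_simps [simp]: "ntm Z = S Z" "ntm (S x) = nm 5 \<otimes> ntm x \<oplus> nm 2"
  by (simp_all add: ntm_def pnumt_def pSucc_def)
lemma mev_pnumt [simp]: "mev (pnumt a) xs = ntm (mev a xs)"
  by (simp add: ntm_def pnumt_def)
lemma DF_ntm [D_intros]: "DF F \<Longrightarrow> DF (\<lambda>e. ntm (F e))"
  unfolding ntm_def by (intro DF_mev DFL_Cons DFL_Nil)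
lemma istm_ntm [simp]: "istm (ntm x)"
  by (rule ind[where x = x], intro D_intros) (simp_all add: istm_simps)
lemma ntm_nm: "ntm (nm n) = nm (gnt (numeral_tm n))"
  using mev_nm[of "pnumt (PProj 0)" "[n]"] by simp

text \<open>\<open>fcode k v \<phi>\<close> is the code of the formula obtained from \<open>\<phi>\<close> by putting the closed terms with the
  codes \<open>v 0, v 1, \<dots>\<close> for the free variables; the first \<open>k\<close> variables count as bound.\<close>

definition vm :: "nat \<Rightarrow> (nat \<Rightarrow> 'm) \<Rightarrow> nat \<Rightarrow> 'm" where
  "vm k v i = (if i < k then nm 5 \<otimes> nm i else v (i - k))"

primrec tcode :: "(nat \<Rightarrow> 'm) \<Rightarrow> tm \<Rightarrow> 'm" where
  "tcode v (Var i) = v i"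
| "tcode v Zero = S Z"
| "tcode v (Succ t) = nm 5 \<otimes> tcode v t \<oplus> nm 2"
| "tcode v (Plus s t) = nm 5 \<otimes> pair (tcode v s) (tcode v t) \<oplus> nm 3"
| "tcode v (Times s t) = nm 5 \<otimes> pair (tcode v s) (tcode v t) \<oplus> nm 4"

primrec fcode :: "nat \<Rightarrow> (nat \<Rightarrow> 'm) \<Rightarrow> fm \<Rightarrow> 'm" where
  "fcode k v (Eq s t) = nm 8 \<otimes> pair (tcode (vm k v) s) (tcode (vm k v) t)"
| "fcode k v (Less s t) = S (nm 8 \<otimes> pair (tcode (vm k v) s) (tcode (vm k v) t))"
| "fcode k v (Neg \<phi>) = nm 8 \<otimes> fcode k v \<phi> \<oplus> nm 2"
| "fcode k v (Conj \<phi> \<psi>) = nm 8 \<otimes> pair (fcode k v \<phi>) (fcode k v \<psi>) \<oplus> nm 3"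
| "fcode k v (Disj \<phi> \<psi>) = nm 8 \<otimes> pair (fcode k v \<phi>) (fcode k v \<psi>) \<oplus> nm 4"
| "fcode k v (Imp \<phi> \<psi>) = nm 8 \<otimes> pair (fcode k v \<phi>) (fcode k v \<psi>) \<oplus> nm 5"
| "fcode k v (Forall \<phi>) = nm 8 \<otimes> fcode (Suc k) v \<phi> \<oplus> nm 6"
| "fcode k v (Exists \<phi>) = nm 8 \<otimes> fcode (Suc k) v \<phi> \<oplus> nm 7"

lemma tcode_gnt: "tm_below k t \<Longrightarrow> tcode (vm k v) t = nm (gnt t)"
  by (induction t) (simp_all add: vm_def nm_add nm_mult nm_pair del: add_2_eq_Suc')
lemma fcode_gn: "fm_below k \<phi> \<Longrightarrow> fcode k v \<phi> = nm (gn \<phi>)"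
  by (induction \<phi> arbitrary: k) (simp_all add: tcode_gnt nm_add nm_mult nm_pair del: add_2_eq_Suc')

lemma tcode_cong: "tm_below n t \<Longrightarrow> \<forall>i<n. v i = w i \<Longrightarrow> tcode v t = tcode w t"
  by (induction t) auto
lemma fcode_cong: "fm_below n \<phi> \<Longrightarrow> \<forall>i. i + k < n \<longrightarrow> v i = w i \<Longrightarrow> fcode k v \<phi> = fcode k w \<phi>"
proof (induction \<phi> arbitrary: n k)
  case (Eq s t)
  have "\<forall>i<n. vm k v i = vm k w i" using Eq by (auto simp: vm_def)
  then show ?case using Eq tcode_cong[of n _ "vm k v" "vm k w"] by simp
next
  case (Less s t)
  have "\<forall>i<n. vm k v i = vm k w i" using Less by (auto simp: vm_def)
  then show ?case using Less tcode_cong[of n _ "vm k v" "vm k w"] by simp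
next
  case (Neg \<phi>) then show ?case using Neg.IH[of n k] by simp
next
  case (Conj \<phi> \<psi>) then show ?case using Conj.IH(1)[of n k] Conj.IH(2)[of n k] by simp
next
  case (Disj \<phi> \<psi>) then show ?case using Disj.IH(1)[of n k] Disj.IH(2)[of n k] by simp
next
  case (Imp \<phi> \<psi>) then show ?case using Imp.IH(1)[of n k] Imp.IH(2)[of n k] by simp
next
  case (Forall \<phi>) then show ?case using Forall.IH[of "Suc n" "Suc k"] by simp
next
  case (Exists \<phi>) then show ?case using Exists.IH[of "Suc n" "Suc k"] by simp
qed

lemma tcode_tsubst: "tcode v (tsubst \<rho> t) = tcode (\<lambda>i. tcode v (\<rho> i)) t"
  by (induction t) auto
lemma fcode_fsubst_aux:
  "\<forall>i<k. \<rho>' i = Var i \<Longrightarrow> \<forall>i. \<rho>' (i + k) = tlift k (\<rho> i) \<Longrightarrow> fcode k v (fsubst \<rho>' \<phi>) = fcode k (\<lambda>i. tcode v (\<rho> i)) \<phi>"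
proof (induction \<phi> arbitrary: k \<rho>')
  have t: "(\<lambda>i. tcode (vm k v) (\<rho>' i)) = vm k (\<lambda>i. tcode v (\<rho> i))"
    if "\<forall>i<k. \<rho>' i = Var i" "\<forall>i. \<rho>' (i + k) = tlift k (\<rho> i)" for k \<rho>'
  proof
    fix i
    have "tcode (vm k v) (tlift k u) = tcode v u" for u by (induction u) (simp_all add: vm_def)
    then show "tcode (vm k v) (\<rho>' i) = vm k (\<lambda>i. tcode v (\<rho> i)) i"
      using that(1) that(2)[rule_format, of "i - k"] by (cases "i < k") (simp_all add: vm_def)
  qed
  have u: "\<forall>i<Suc k. up \<rho>' i = Var i" "\<forall>i. up \<rho>' (i + Suc k) = tlift (Suc k) (\<rho> i)"
    if "\<forall>i<k. \<rho>' i = Var i" "\<forall>i. \<rho>' (i + k) = tlift k (\<rho> i)" for k \<rho>'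
  proof -
    show "\<forall>i<Suc k. up \<rho>' i = Var i" using that(1) by (auto simp: less_Suc_eq_0_disj)
    show "\<forall>i. up \<rho>' (i + Suc k) = tlift (Suc k) (\<rho> i)" using that(2) tlift_tlift by simp
  qed
  { case (Eq s t) then show ?case by (simp add: tcode_tsubst t) }
  { case (Less s t) then show ?case by (simp add: tcode_tsubst t) }
  { case (Forall \<phi>) then show ?case using Forall.IH[OF u] by simp }
  { case (Exists \<phi>) then show ?case using Exists.IH[OF u] by simp }
qed simp_all
lemma fcode_fsubst: "fcode 0 v (fsubst \<rho> \<phi>) = fcode 0 (\<lambda>i. tcode v (\<rho> i)) \<phi>"
  by (rule fcode_fsubst_aux) (simp_all add: tlift_def)

lemma DF_tcode: "(\<And>i. DF (V i)) \<Longrightarrow> DF (\<lambda>e. tcode (\<lambda>i. V i e) t)"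
  by (induction t) (simp_all, (intro D_intros; assumption)+)
lemma DF_fcode: assumes "\<And>i. DF (V i)" shows "DF (\<lambda>e. fcode k (\<lambda>i. V i e) \<phi>)"
proof (induction \<phi> arbitrary: k)
  have "DF (\<lambda>e. vm k (\<lambda>i. V i e) i)" for i k
    unfolding vm_def using assms by (cases "i < k") (auto intro: D_intros)
  then have t: "DF (\<lambda>e. tcode (vm k (\<lambda>i. V i e)) t)" for t k
    using DF_tcode[of "\<lambda>i e. vm k (\<lambda>i. V i e) i" t] by simp
  { case (Eq s t) show ?case by (simp, intro D_intros t) }
  { case (Less s t) show ?case by (simp, intro D_intros t) }
  { case (Neg \<phi>) show ?case by (simp, intro D_intros Neg) }
  { case (Conj \<phi> \<psi>) show ?case by (simp, intro D_intros Conj) }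
  { case (Disj \<phi> \<psi>) show ?case by (simp, intro D_intros Disj) }
  { case (Imp \<phi> \<psi>) show ?case by (simp, intro D_intros Imp) }
  { case (Forall \<phi>) show ?case by (simp, intro D_intros Forall) }
  { case (Exists \<phi>) show ?case by (simp, intro D_intros Exists) }
qed

lemma isfm_fcode: assumes "\<And>i. istm (v i)" shows "isfm (fcode k v \<phi>)"
proof (induction \<phi> arbitrary: k)
  have v: "istm (vm k v i)" for k i using assms by (simp add: vm_def istm_simps)
  have t: "istm (tcode (vm k v) t)" for k t
    by (induction t) (use v in \<open>simp_all add: istm_simps\<close>)
  { case (Eq s t) show ?case by (simp add: t isfm_simps) }
  { case (Less s t) show ?case by (simp add: t isfm_simps) }
qed (simp_all add: isfm_simps)

lemma le_code: "a \<preceq> b \<Longrightarrow> 0 < k \<Longrightarrow> a \<preceq> nm k \<otimes> b \<oplus> nm r"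
  using L.order_trans[of a b "nm k \<otimes> b"] le_mul(2)[of "nm k" b] L.order_trans[OF _ le_add1(1), of a "nm k \<otimes> b" "nm r"]
  by (cases k) (simp_all add: Z_less)
lemma le_pairs: "a \<preceq> b \<Longrightarrow> a \<preceq> pair b c" "a \<preceq> c \<Longrightarrow> a \<preceq> pair b c"
  using L.order_trans le_pair1 le_pair2 by blast+

lemma tcode_occurs: "(\<forall>x. tcode (vm k (v(j := x))) t = tcode (vm k v) t) \<or> v j \<preceq> tcode (vm k v) t"
proof (induction t)
  case (Var i) then show ?case by (cases "i < k"; cases "i - k = j") (auto simp: vm_def)
next
  case (Plus s t) then show ?case by (auto intro: le_code le_pairs)
next
  case (Times s t) then show ?case by (auto intro: le_code le_pairs)
qed (auto intro: le_code)
text \<open>The counterpart of \<open>fsubst_bound\<close> in a model: the axiom check looks only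
  for terms not above the formula, and a term larger than the result does not occur in it and may be
  replaced by another.\<close>

lemma fcode_occurs: "(\<forall>x. fcode k (v(j := x)) \<phi> = fcode k v \<phi>) \<or> v j \<preceq> fcode k v \<phi>"
proof (induction \<phi> arbitrary: k)
  case (Eq s t) show ?case using tcode_occurs[of k v j s] tcode_occurs[of k v j t] le_code[of _ _ 8 0] by (auto intro: le_pairs simp del: fun_upd_apply)
next
  case (Less s t)
  have "a \<preceq> b \<Longrightarrow> a \<preceq> S (nm 8 \<otimes> b)" for a b using le_code[of a b 8 1] by simp
  then show ?case using tcode_occurs[of k v j s] tcode_occurs[of k v j t] by (auto intro: le_pairs simp del: fun_upd_apply)
next
  case (Neg \<phi>) show ?case using Neg[of k] by (auto intro: le_code simp del: fun_upd_apply)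
next
  case (Conj \<phi> \<psi>) show ?case using Conj.IH(1)[of k] Conj.IH(2)[of k] by (auto intro: le_code le_pairs simp del: fun_upd_apply)
next
  case (Disj \<phi> \<psi>) show ?case using Disj.IH(1)[of k] Disj.IH(2)[of k] by (auto intro: le_code le_pairs simp del: fun_upd_apply)
next
  case (Imp \<phi> \<psi>) show ?case using Imp.IH(1)[of k] Imp.IH(2)[of k] by (auto intro: le_code le_pairs simp del: fun_upd_apply)
next
  case (Forall \<phi>) show ?case using Forall[of "Suc k"] by (auto intro: le_code simp del: fun_upd_apply)
next
  case (Exists \<phi>) show ?case using Exists[of "Suc k"] by (auto intro: le_code simp del: fun_upd_apply)
qed

subsection \<open>Substitution\<close>

lemma cv_tsG:
  assumes "r < 5" and n: "n = nm 5 \<otimes> p \<oplus> nm r"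
  shows "cv (tsG \<sigma>) [k, s] n = (if r = 0 then mev \<sigma> [p, k, s] else if r = 1 then S Z
    else if r = 2 then nm 5 \<otimes> cv (tsG \<sigma>) [k, s] p \<oplus> nm 2
    else nm 5 \<otimes> pair (cv (tsG \<sigma>) [k, s] (fs p)) (cv (tsG \<sigma>) [k, s] (sn p)) \<oplus> nm r)"
proof -
  define e c where "e = [n, hst (tsG \<sigma>) [k, s] n, k, s]" and "c = cv (tsG \<sigma>) [k, s]"
  have ks: "arg Z e 2 = k" "arg Z e 3 = s" by (simp_all add: e_def)
  have m: "mev (pmod (PProj 0) 5) e = nm r" unfolding e_def by (rule pmod_eq) (use assms in simp_all)
  have d: "mev (pdiv (PProj 0) 5) e = p" unfolding e_def by (rule pdiv_eq) (use assms in simp_all)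
  have l: "0 < r \<Longrightarrow> mev q e \<preceq> p \<Longrightarrow> mev (plook q) e = c (mev q e)" for q
    unfolding e_def c_def by (rule look[OF refl]) (simp add: n less_code)
  have "cv (tsG \<sigma>) [k, s] n = mev (tsG \<sigma>) e" by (simp add: cv_def e_def)
  also have "\<dots> = (if r = 0 then mev \<sigma> [p, k, s] else if r = 1 then S Z
    else if r = 2 then nm 5 \<otimes> c p \<oplus> nm 2
    else nm 5 \<otimes> pair (c (fs p)) (c (sn p)) \<oplus> nm r)"
    unfolding tsG_def Let_def mev_psel[OF m] using assms(1) unfolding less_5
    by (auto simp: d l fs_le sn_le ks pSucc_def pPlus_def pTimes_def)
finally show ?thesis unfolding c_def .
qed

text \<open>A numeral is closed, hence unchanged by every substitution; its length may be
  nonstandard, so this is an induction in the model.\<close>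

lemma cv_tsG_ntm [simp]: "cv (tsG \<sigma>) [k, s] (ntm x) = ntm x"
proof (rule ind[where x = x])
  show "Dp (\<lambda>e. cv (tsG \<sigma>) [k, s] (ntm (e 0)) = ntm (e 0))" by (intro D_intros)
  show "cv (tsG \<sigma>) [k, s] (ntm Z) = ntm Z" using cv_tsG[of 1 "S Z" Z] by simp
  show "cv (tsG \<sigma>) [k, s] (ntm x) = ntm x \<Longrightarrow> cv (tsG \<sigma>) [k, s] (ntm (S x)) = ntm (S x)" for x
    using cv_tsG[of 2 "ntm (S x)" "ntm x"] by simp
qed

lemma mev_ptsubst [simp]: "mev (ptsubst \<sigma> t k s) xs = cv (tsG \<sigma>) [mev k xs, mev s xs] (mev t xs)"
  by (simp add: pcov_defs mev_pcov)

lemma cv_fsG: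
  fixes \<sigma> s k
  assumes "r < 8" and x: "x = nm 8 \<otimes> p \<oplus> nm r"
  defines "C \<equiv> \<lambda>x k. cv (fsG \<sigma>) [s] (pair x k)" and "T \<equiv> \<lambda>t. cv (tsG \<sigma>) [k, s] t"
  shows "C x k = (if r \<le> 1 then nm 8 \<otimes> pair (T (fs p)) (T (sn p)) \<oplus> nm r
    else if r = 2 then nm 8 \<otimes> C p k \<oplus> nm 2 else if 6 \<le> r then nm 8 \<otimes> C p (S k) \<oplus> nm r
    else nm 8 \<otimes> pair (C (fs p) k) (C (sn p) k) \<oplus> nm r)"
proof -
  let ?n = "pair x k"
  define e where "e = [?n, hst (fsG \<sigma>) [s] ?n, s]"
  have ks: "arg Z e 0 = ?n" "arg Z e 2 = s" by (simp_all add: e_def)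
  have m: "mev (pmod (pfst (PProj 0)) 8) e = nm r" by (rule pmod_eq) (use assms in \<open>simp_all add: ks\<close>)
  have d: "mev (pdiv (pfst (PProj 0)) 8) e = p" by (rule pdiv_eq) (use assms in \<open>simp_all add: ks\<close>)
  have l: "mev (plook q) e = C y j" if "mev q e = pair y j" "y \<oplus> j \<prec> x \<oplus> k" for q y j
    using that(1) unfolding C_def e_def by (rule look[OF _ pair_less[OF that(2)]])
  have b: "y \<prec> x" if "0 < r" "y \<preceq> p" for y
    using less_code[OF that(2), of 8 r] that(1) by (simp add: x)
  have b': "p \<oplus> S k \<prec> x \<oplus> k" if r6: "6 \<le> r"
  proof -
    obtain j where j: "r = Suc j" "0 < j" using r6 by (cases r) auto
    have "p \<prec> nm 8 \<otimes> p \<oplus> nm j" by (rule less_code) (use j in simp_all)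
    then have "p \<oplus> k \<prec> nm 8 \<otimes> p \<oplus> nm j \<oplus> k" by (rule L.add_strict_right_mono)
    then show ?thesis by (simp add: x j)
  qed
  have l1: "0 < r \<Longrightarrow> mev (plook (ppair (pdiv (pfst (PProj 0)) 8) (psnd (PProj 0)))) e = C p k"
    by (rule l) (simp_all add: d b ks)
  have l2: "6 \<le> r \<Longrightarrow> mev (plook (ppair (pdiv (pfst (PProj 0)) 8) (psuc (psnd (PProj 0))))) e = C p (S k)"
    by (rule l[OF _ b']) (simp_all add: d ks)
  have l3: "0 < r \<Longrightarrow> mev (plook (ppair (pfst (pdiv (pfst (PProj 0)) 8)) (psnd (PProj 0)))) e = C (fs p) k"
    by (rule l) (simp_all add: d b fs_le ks)
  have l4: "0 < r \<Longrightarrow> mev (plook (ppair (psnd (pdiv (pfst (PProj 0)) 8)) (psnd (PProj 0)))) e = C (sn p) k"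
    by (rule l) (simp_all add: d b sn_le ks)
  have "C x k = mev (fsG \<sigma>) e" by (simp add: cv_def C_def e_def)
  also have "\<dots> = (if r \<le> 1 then nm 8 \<otimes> pair (T (fs p)) (T (sn p)) \<oplus> nm r
    else if r = 2 then nm 8 \<otimes> C p k \<oplus> nm 2 else if 6 \<le> r then nm 8 \<otimes> C p (S k) \<oplus> nm r
    else nm 8 \<otimes> pair (C (fs p) k) (C (sn p) k) \<oplus> nm r)"
    unfolding fsG_def Let_def mev_psel[OF m] using assms(1) unfolding less_8
    by (auto simp: l1 l2 l3 l4 d ks T_def pcons_defs)
  finally show ?thesis .
qed

lemma mev_instS_aux: "mev instS [nm i, nm k, ntm s] = (if i = k then ntm s else if k < i then nm 5 \<otimes> nm (i - 1) else nm 5 \<otimes> nm i)"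
proof -
  have "k < i \<Longrightarrow> nm i \<ominus> S Z = nm (i - 1)" by (cases i) simp_all
  then show ?thesis by (auto simp: instS_def ptlift_def pVar_def Let_def)
qed

lemma inst_tcode:
  assumes v: "\<And>i. \<exists>x. v i = ntm x"
  shows "cv (tsG instS) [nm k, ntm s] (tcode (vm (Suc k) v) t) = tcode (vm k (case_nat (ntm s) v)) t"
proof (induction t)
  case (Var i)
  consider "i < k" | "i = k" | "k < i" by linarith
  then show ?case
  proof cases
    case 1
    then show ?thesis using cv_tsG[of 0 _ "nm i" instS "nm k" "ntm s"] mev_instS_aux[of i k s] by (simp add: vm_def)
  next
    case 2
    then show ?thesis using cv_tsG[of 0 _ "nm i" instS "nm k" "ntm s"] mev_instS_aux[of i k s] by (simp add: vm_def)
  next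
    case 3
    then obtain j where j: "i - k = Suc j" by (metis Suc_diff_Suc)
    then have "i - Suc k = j" by simp
    then show ?thesis using 3 v[of j] j by (auto simp: vm_def)
  qed
next
  case Zero show ?case using cv_tsG[of 1 "S Z" Z] by simp
next
  case (Succ t) then show ?case using cv_tsG[of 2 _ "tcode (vm (Suc k) v) t" instS "nm k" "ntm s"] by simp
next
  case (Plus t u)
  then show ?case using cv_tsG[of 3 _ "pair (tcode (vm (Suc k) v) t) (tcode (vm (Suc k) v) u)" instS "nm k" "ntm s"] by simp
next
  case (Times t u)
  then show ?case using cv_tsG[of 4 _ "pair (tcode (vm (Suc k) v) t) (tcode (vm (Suc k) v) u)" instS "nm k" "ntm s"] by simp
qed

text \<open>The formula and the number of quantifiers passed are standard, only the numerals put in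
  are not. An induction on \<open>\<phi>\<close> outside the model therefore suffices.\<close>

lemma inst_fcode:
  assumes v: "\<And>i. \<exists>x. v i = ntm x"
  shows "cv (fsG instS) [ntm s] (pair (fcode (Suc k) v \<phi>) (nm k)) = fcode k (case_nat (ntm s) v) \<phi>"
proof (induction \<phi> arbitrary: k)
  case (Eq t u)
  show ?case using cv_fsG[of 0 _ "pair (tcode (vm (Suc k) v) t) (tcode (vm (Suc k) v) u)" instS "ntm s" "nm k"]
    by (simp add: inst_tcode[OF v])
next
  case (Less t u)
  show ?case using cv_fsG[of 1 _ "pair (tcode (vm (Suc k) v) t) (tcode (vm (Suc k) v) u)" instS "ntm s" "nm k"]
    by (simp add: inst_tcode[OF v])
next
  case (Neg \<phi>)
  then show ?case using cv_fsG[of 2 _ "fcode (Suc k) v \<phi>" instS "ntm s" "nm k"] by simp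
next
  case (Conj \<phi> \<psi>)
  then show ?case using cv_fsG[of 3 _ "pair (fcode (Suc k) v \<phi>) (fcode (Suc k) v \<psi>)" instS "ntm s" "nm k"] by simp
next
  case (Disj \<phi> \<psi>)
  then show ?case using cv_fsG[of 4 _ "pair (fcode (Suc k) v \<phi>) (fcode (Suc k) v \<psi>)" instS "ntm s" "nm k"] by simp
next
  case (Imp \<phi> \<psi>)
  then show ?case using cv_fsG[of 5 _ "pair (fcode (Suc k) v \<phi>) (fcode (Suc k) v \<psi>)" instS "ntm s" "nm k"] by simp
next
  case (Forall \<phi>)
  show ?case using cv_fsG[of 6 _ "fcode (Suc (Suc k)) v \<phi>" instS "ntm s" "nm k"] Forall[of "Suc k"] by simp
next
  case (Exists \<phi>)
  show ?case using cv_fsG[of 7 _ "fcode (Suc (Suc k)) v \<phi>" instS "ntm s" "nm k"] Exists[of "Suc k"] by simp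
qed

lemma mev_pinst:
  assumes "\<And>i. \<exists>x. v i = ntm x" "mev a xs = fcode (Suc 0) v \<phi>" "mev b xs = ntm s"
  shows "mev (pinst a b) xs = fcode 0 (case_nat (ntm s) v) \<phi>"
  using inst_fcode[OF assms(1), where s = s and k = 0 and \<phi> = \<phi>] assms(2,3) by (simp add: pinst_def' pcov_defs mev_pcov)

end

section \<open>Substitution in the formulas defining primitive recursive functions\<close>

lemma funpow_up: "(up ^^ k) \<rho> i = (if i < k then Var i else tlift k (\<rho> (i - k)))"
proof (induction k arbitrary: i)
  case (Suc k)
  show ?case using Suc tlift_tlift[of k "\<rho> (i - Suc k)"] by (cases i) (auto simp del: One_nat_def)
qed (simp add: tlift_def)

lemma tsubst_funpow_up: "tsubst ((up ^^ k) \<rho>) (tlift k t) = tlift k (tsubst \<rho> t)"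
  by (induction t) (simp_all add: funpow_up)

lemma fsubst_Exs: "fsubst \<rho> ((Exists ^^ k) A) = (Exists ^^ k) (fsubst ((up ^^ k) \<rho>) A)"
  by (induction k arbitrary: \<rho>) (simp_all add: funpow_swap1[of up])

lemma fsubst_conjs: "fsubst \<rho> (foldr Conj As B) = foldr Conj (map (fsubst \<rho>) As) (fsubst \<rho> B)"
  by (induction As) simp_all

lemma fsubst_beta: "fsubst \<rho> (beta_fm a b i w) = beta_fm (tsubst \<rho> a) (tsubst \<rho> b) (tsubst \<rho> i) (tsubst \<rho> w)"
  by (simp add: beta_fm_def Let_def tsubst_up_tlift[unfolded One_nat_def])

lemma graph_fsubst: "fsubst \<rho> (graph f ts t) = graph f (map (tsubst \<rho>) ts) (tsubst \<rho> t)"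
proof (induction f ts t arbitrary: \<rho> rule: graph.induct)
  case (4 f gs ts t)
  let ?m = "length gs" and ?u = "(up ^^ length gs) \<rho>"
  have 1: "fsubst ?u (graph g (map (tlift ?m) ts) (Var i)) = graph g (map (tlift ?m) (map (tsubst \<rho>) ts)) (Var i)"
    if "(i, g) \<in> set (zip [0..<?m] gs)" for i g
  proof -
    have "i < ?m" using that by (auto dest: set_zip_leftD)
    then show ?thesis using 4(2)[OF refl that refl, of ?u] funpow_up[of ?m \<rho> i] by (simp add: comp_def tsubst_funpow_up)
  qed
  have 2: "map (tsubst ?u) (map Var [0..<?m]) = map Var [0..<?m]" by (simp add: funpow_up)
  have "fsubst ?u (graph f (map Var [0..<?m]) (tlift ?m t)) = graph f (map Var [0..<?m]) (tlift ?m (tsubst \<rho> t))"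
    unfolding 4(1)[OF refl] 2 by (simp add: tsubst_funpow_up)
  moreover have "map (fsubst ?u) (map (\<lambda>(i, g). graph g (map (tlift ?m) ts) (Var i)) (zip [0..<?m] gs))
     = map (\<lambda>(i, g). graph g (map (tlift ?m) (map (tsubst \<rho>) ts)) (Var i)) (zip [0..<?m] gs)"
    using 1 by auto
  ultimately show ?case by (simp only: graph.simps Let_def fsubst_Exs fsubst_conjs)
next
  case (6 f g n ts t)
  have u: "up \<rho> = (up ^^ 1) \<rho>" "up (up \<rho>) = (up ^^ 2) \<rho>" "up (up (up \<rho>)) = (up ^^ 3) \<rho>"
    "up (up (up (up \<rho>))) = (up ^^ 4) \<rho>" "up (up (up (up (up \<rho>)))) = (up ^^ 5) \<rho>" by (simp_all add: numeral_eq_Suc)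
  have w: "tsubst (up (up \<rho>)) (tlift 2 x) = tlift 2 (tsubst \<rho> x)" "tsubst (up (up (up \<rho>))) (tlift 3 x) = tlift 3 (tsubst \<rho> x)"
    "tsubst (up (up (up (up (up \<rho>))))) (tlift 5 x) = tlift 5 (tsubst \<rho> x)" for x
    using tsubst_funpow_up[of 2 \<rho> x] tsubst_funpow_up[of 3 \<rho> x] tsubst_funpow_up[of 5 \<rho> x] by (simp_all only: u[symmetric])
  have v: "up (up (up \<rho>)) 2 = Var 2" "up (up (up (up (up \<rho>)))) 4 = Var 4" "up (up (up (up (up \<rho>)))) 3 = Var 3"
    "up (up (up (up (up \<rho>)))) 2 = Var 2" by (simp_all add: numeral_eq_Suc)
  show ?case by (simp add: fsubst_beta 6 6(2)[unfolded One_nat_def] comp_def w v)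
qed (simp_all add: arg_def)

lemma fm_below_Exs: "fm_below n ((Exists ^^ k) A) \<longleftrightarrow> fm_below (n + k) A"
  by (induction k arbitrary: n) simp_all
lemma fm_below_conjs: "fm_below n (foldr Conj As B) \<longleftrightarrow> (\<forall>A\<in>set As. fm_below n A) \<and> fm_below n B"
  by (induction As) auto

lemma tm_below_tlift': "tm_below (n + k) (tlift k t) \<longleftrightarrow> tm_below n t"
  by (induction t) auto

lemma graph_below: "\<forall>t\<in>set ts. tm_below n t \<Longrightarrow> tm_below n t \<Longrightarrow> fm_below n (graph f ts t)"
proof (induction f ts t arbitrary: n rule: graph.induct)
  case (4 f gs ts t)
  let ?m = "length gs"
  have "fm_below (n + ?m) (graph f (map Var [0..<?m]) (tlift ?m t))"
    by (rule 4(1)[OF refl]) (use 4(4) in \<open>auto simp: tm_below_tlift'\<close>)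
  moreover have "fm_below (n + ?m) (graph g (map (tlift ?m) ts) (Var i))" if "(i, g) \<in> set (zip [0..<?m] gs)" for i g
  proof -
    have "i < ?m" using that by (auto dest: set_zip_leftD)
    then show ?thesis by (intro 4(2)[OF refl that refl]) (use 4(3) in \<open>auto simp: tm_below_tlift'\<close>)
  qed
  ultimately show ?case by (auto simp: Let_def fm_below_Exs fm_below_conjs)
next
  case (6 f g n' ts t)
  have l: "tm_below (Suc n) (tlift (Suc 0) u) \<longleftrightarrow> tm_below n u" "tm_below (Suc (Suc n)) (tlift 2 u) \<longleftrightarrow> tm_below n u"
    "tm_below (Suc (Suc (Suc n))) (tlift 3 u) \<longleftrightarrow> tm_below n u"
    "tm_below (Suc (Suc (Suc (Suc (Suc n))))) (tlift 5 u) \<longleftrightarrow> tm_below n u" for u n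
    using tm_below_tlift'[of n 1 u] tm_below_tlift'[of n 2 u] tm_below_tlift'[of n 3 u] tm_below_tlift'[of n 5 u]
    by (simp_all add: numeral_eq_Suc)
  have b: "fm_below n (beta_fm a b i w) \<longleftrightarrow> tm_below n a \<and> tm_below n b \<and> tm_below n i \<and> tm_below n w" for n a b i w
    by (auto simp: beta_fm_def Let_def l)
  have f: "fm_below (Suc (Suc (Suc n))) (graph f (map (tlift 3) ts) (Var 0))"
    by (rule 6(1)) (use 6(3) in \<open>auto simp: l\<close>)
  have g: "fm_below (Suc (Suc (Suc (Suc (Suc n))))) (graph g (Var 2 # Var 1 # map (tlift 5) ts) (Var 0))"
    by (rule 6(2)) (use 6(3) in \<open>auto simp: l\<close>)
  show ?case using f g 6(3,4) by (simp add: b l)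
qed (auto simp: arg_def)

declare graph.simps(4,6) [simp del]

section \<open>Provability in a model\<close>

text \<open>Names the long description inside \<open>plogical_axiom\<close> without writing it out
  again.\<close>

definition axB :: pr where "axB = (THE b. \<forall>a. plogical_axiom a = PComp b [a])"
lemma plogical_axiom_eq: "plogical_axiom a = PComp axB [a]"
proof -
  have "\<exists>b. \<forall>a. plogical_axiom a = PComp b [a]" unfolding plogical_axiom_def by blast
  then obtain b where b: "\<forall>a. plogical_axiom a = PComp b [a]" ..
  then have "axB = b" unfolding axB_def by (intro the_equality) auto
  then show ?thesis using b by simp
qed

definition prfG :: "pr \<Rightarrow> pr" where
  "prfG \<tau> = (let y = PProj 0; x = phd y; l = ptl y in
      pite y
        (pand (plook l) (pand (pis_fm x)
          (por (plogical_axiom x) (por (peq (PComp \<tau> [x]) (pnum 1))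
          (por (pex (pand (pmem (PProj 0) (PProj 2)) (pmem (pImp (PProj 0) (PProj 1)) (PProj 2)))
                 y [x, l])
               (pex (pand (pmem (PProj 0) (PProj 2)) (peq (PProj 1) (pForall (PProj 0))))
                 y [x, l]))))))
        (pnum 1))"

lemma pis_proof_def': "pis_proof \<tau> a = pcov (prfG \<tau>) a []"
  by (simp only: pis_proof_def prfG_def)

context pa_model begin

definition imp :: "'m \<Rightarrow> 'm \<Rightarrow> 'm" where "imp a b = nm 8 \<otimes> pair a b \<oplus> nm 5"
definition ng :: "'m \<Rightarrow> 'm" where "ng a = nm 8 \<otimes> a \<oplus> nm 2"
definition al :: "'m \<Rightarrow> 'm" where "al a = nm 8 \<otimes> a \<oplus> nm 6"
definition dv :: "'m \<Rightarrow> 'm" where "dv x = mev (pdiv (PProj 0) 8) [x]"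
lemma DF_imp [D_intros]: "DF F \<Longrightarrow> DF G \<Longrightarrow> DF (\<lambda>e. imp (F e) (G e))" unfolding imp_def by (intro D_intros)
lemma DF_ng [D_intros]: "DF F \<Longrightarrow> DF (\<lambda>e. ng (F e))" unfolding ng_def by (intro D_intros)
lemma mev_pdiv8: "mev (pdiv a 8) xs = dv (mev a xs)" by (simp add: dv_def pdiv_def)
lemma dv_simps [simp]: "dv (imp a b) = pair a b" "dv (ng a) = a" "dv (al a) = a"
  using pdiv_eq[of 5 8 "PProj 0" "[imp a b]" "pair a b"] pdiv_eq[of 2 8 "PProj 0" "[ng a]" a]
    pdiv_eq[of 6 8 "PProj 0" "[al a]" a] by (simp_all add: dv_def imp_def ng_def al_def)
lemma mev_codes [simp]: "mev (pImp a b) xs = imp (mev a xs) (mev b xs)" "mev (pNeg a) xs = ng (mev a xs)"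
  "mev (pForall a) xs = al (mev a xs)"
  by (simp_all add: pImp_def pNeg_def pForall_def imp_def ng_def al_def)
lemma isfm_codes [simp]: "isfm (imp a b) \<longleftrightarrow> isfm a \<and> isfm b" "isfm (ng a) \<longleftrightarrow> isfm a" "isfm (al a) \<longleftrightarrow> isfm a"
  by (simp_all add: imp_def ng_def al_def isfm_simps)
lemma fcode_codes: "fcode k v (Imp \<phi> \<psi>) = imp (fcode k v \<phi>) (fcode k v \<psi>)" "fcode k v (Neg \<phi>) = ng (fcode k v \<phi>)"
  "fcode k v (Forall \<phi>) = al (fcode (Suc k) v \<phi>)"
  by (simp_all add: imp_def ng_def al_def)
lemma ng_gt: "x \<prec> ng x" unfolding ng_def by (rule less_code) simp_all
lemma ng_nm: "ng (nm (gn \<phi>)) = nm (gn (Neg \<phi>))"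
  using fcode_codes(2)[of n "\<lambda>_. Z" \<phi> for n] fcode_gn fm_below_ex by (metis fm_below.simps(3))

definition isax :: "'m \<Rightarrow> bool" where "isax x \<longleftrightarrow> mev axB [x] \<noteq> Z"
lemma mev_plogical_axiom: "mev (plogical_axiom a) xs = mev axB [mev a xs]"
  by (simp add: plogical_axiom_eq)

lemma mev_pors: "mev (foldr por cs PZero) xs \<noteq> Z \<longleftrightarrow> (\<exists>c\<in>set cs. mev c xs \<noteq> Z)"
  by (induction cs) auto

lemma isax_alt: "isax x \<longleftrightarrow> mev (plogical_axiom (PProj 0)) [x] \<noteq> Z"
  by (simp add: isax_def mev_plogical_axiom)

text \<open>This scheme and the next two are what ex falso inside a model
  (\<open>Pv_exfalso\<close>) is built from.\<close>

lemma isax_imp1: "isax (imp a (imp b a))"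
  unfolding isax_alt plogical_axiom_def Let_def mev.simps mev_pors
  by (rule bexI[of _ "peq (PProj 0) (pImp (pfst (pdiv (PProj 0) 8))
      (pImp (pfst (pdiv (psnd (pdiv (PProj 0) 8)) 8)) (pfst (pdiv (PProj 0) 8))))"]) (simp_all add: mev_pdiv8)

lemma isax_neg1: "isax (imp (imp a b) (imp (imp a (ng b)) (ng a)))"
  unfolding isax_alt plogical_axiom_def Let_def mev.simps mev_pors
  by (rule bexI[of _ "peq (PProj 0) (pImp (pImp (pfst (pdiv (pfst (pdiv (PProj 0) 8)) 8)) (psnd (pdiv (pfst (pdiv (PProj 0) 8)) 8)))
      (pImp (pImp (pfst (pdiv (pfst (pdiv (PProj 0) 8)) 8)) (pNeg (psnd (pdiv (pfst (pdiv (PProj 0) 8)) 8))))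
       (pNeg (pfst (pdiv (pfst (pdiv (PProj 0) 8)) 8)))))"]) (simp_all add: mev_pdiv8)

lemma isax_neg2: "isax (imp (ng (ng a)) a)"
  unfolding isax_alt plogical_axiom_def Let_def mev.simps mev_pors
  by (rule bexI[of _ "peq (PProj 0) (pImp (pNeg (pNeg (psnd (pdiv (PProj 0) 8)))) (psnd (pdiv (PProj 0) 8)))"]) (simp_all add: mev_pdiv8)

text \<open>The bound on \<open>ntm s\<close> keeps the instantiating term within the range of the
  search; for \<open>s = Z\<close> the numeral has code 1, which no implication falls below.\<close>

lemma isax_all1:
  assumes v: "\<And>i. \<exists>x. v i = ntm x" and b: "ntm s \<preceq> fcode 0 (case_nat (ntm s) v) \<phi> \<or> s = Z"
  shows "isax (imp (al (fcode (Suc 0) v \<phi>)) (fcode 0 (case_nat (ntm s) v) \<phi>))"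
proof -
  define x where "x = imp (al (fcode (Suc 0) v \<phi>)) (fcode 0 (case_nat (ntm s) v) \<phi>)"
  define A where "A = pdiv (pfst (pdiv (PProj 1) 8)) 8"
  have A: "mev A [i, x] = fcode (Suc 0) v \<phi>" for i
    by (simp add: A_def mev_pdiv8 x_def)
  have i: "mev (pinst A (PProj 0)) [ntm s, x] = fcode 0 (case_nat (ntm s) v) \<phi>"
    by (rule mev_pinst[OF v A]) simp
  have le: "ntm s \<prec> S x"
  proof -
    have "fcode 0 (case_nat (ntm s) v) \<phi> \<preceq> x" unfolding x_def imp_def by (intro le_code le_pairs(2)) simp_all
    moreover have "S Z \<preceq> x" unfolding x_def imp_def using less_code[of Z _ 8 5] by simp
    ultimately show ?thesis using b L.order_trans by (auto simp: less_S_le)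
  qed
  have 1: "mev (pex (pand (pis_tm (PProj 0)) (peq (PProj 1) (pImp (pForall A) (pinst A (PProj 0))))) (psuc (PProj 0)) [PProj 0]) [x] \<noteq> Z"
    using le by (simp, intro exI[of _ "ntm s"]) (simp add: i A[unfolded mev.simps], simp add: x_def)
  show ?thesis unfolding x_def[symmetric]
    unfolding isax_alt plogical_axiom_def Let_def mev.simps mev_pors
    by (rule bexI[of _ "pex (pand (pis_tm (PProj 0)) (peq (PProj 1) (pImp (pForall A) (pinst A (PProj 0))))) (psuc (PProj 0)) [PProj 0]"])
      (use 1 in simp, simp add: A_def)
qed

end

section \<open>Proofs of the theory as a model sees them\<close>

locale theory_model = pa_model M for M :: "'m mstr" +
  fixes T :: "fm set" and \<tau> :: pr
  assumes T: "pr_axiomatized \<tau> T" and PA_T: "\<forall>\<phi>\<in>PA. T \<turnstile> \<phi>"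
begin

definition isprf :: "'m \<Rightarrow> bool" where "isprf y \<longleftrightarrow> cv (prfG \<tau>) [] y \<noteq> Z"
lemma Dp_isprf [D_intros]: "DF F \<Longrightarrow> Dp (\<lambda>e. isprf (F e))" unfolding isprf_def by (intro D_intros)

lemma cv_prfG: "cv (prfG \<tau>) [] Z = S Z"
  "cv (prfG \<tau>) [] (cns x l) = ob (isprf l \<and> isfm x \<and> (isax x \<or> mev \<tau> [x] = S Z \<or>
     (\<exists>i. mem i l \<and> mem (imp i x) l) \<or> (\<exists>i. mem i l \<and> x = al i)))"
proof -
  show "cv (prfG \<tau>) [] Z = S Z" by (simp add: cv_def) (simp add: prfG_def Let_def)
  define e where "e = [cns x l, hst (prfG \<tau>) [] (cns x l)]"
  have l: "mev (plook (ptl (PProj 0))) e = cv (prfG \<tau>) [] l"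
    unfolding e_def by (rule look) (simp_all add: less_cns2)
  have e: "arg Z e 0 = cns x l" by (simp add: e_def)
  have ex: "(\<exists>i. i \<prec> cns x l \<and> mem i l \<and> P i) \<longleftrightarrow> (\<exists>i. mem i l \<and> P i)" for P
    using L.less_trans[OF mem_less less_cns2, of _ l x] by auto
  have "cv (prfG \<tau>) [] (cns x l) = mev (prfG \<tau>) e" by (simp add: cv_def e_def)
  also have "\<dots> = ob (isprf l \<and> isfm x \<and> (isax x \<or> mev \<tau> [x] = S Z \<or>
     (\<exists>i. mem i l \<and> mem (imp i x) l) \<or> (\<exists>i. mem i l \<and> x = al i)))"
    unfolding isprf_def l[symmetric] unfolding prfG_def Let_def
    by (simp add: e mev_plogical_axiom isax_def[symmetric] ex)
  finally show "cv (prfG \<tau>) [] (cns x l) = ob (isprf l \<and> isfm x \<and> (isax x \<or> mev \<tau> [x] = S Z \<or>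
     (\<exists>i. mem i l \<and> mem (imp i x) l) \<or> (\<exists>i. mem i l \<and> x = al i)))" .
qed

lemma isprf_Z: "isprf Z" by (simp add: isprf_def cv_prfG)
lemma isprf_cns: "isprf (cns x l) \<longleftrightarrow> isprf l \<and> isfm x \<and> (isax x \<or> mev \<tau> [x] = S Z \<or>
     (\<exists>i. mem i l \<and> mem (imp i x) l) \<or> (\<exists>i. mem i l \<and> x = al i))"
  unfolding isprf_def[of "cns x l"] cv_prfG(2) ob_simps(1) by (simp only: not_not)

lemma mev_pis_proof: "mev (pis_proof \<tau> a) xs = ob (isprf (mev a xs))"
proof -
  have "cv (prfG \<tau>) [] y = ob (isprf y)" for y
  proof (cases "y = Z")
    case False
    then obtain x l where "y = cns x l" using cns_hd_tl by metis
    then show ?thesis by (simp only: isprf_cns cv_prfG(2))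
  qed (simp add: cv_prfG isprf_Z)
  then show ?thesis by (simp add: pis_proof_def' mev_pcov)
qed

definition Pf :: "'m \<Rightarrow> 'm \<Rightarrow> bool" where "Pf x y \<longleftrightarrow> y \<noteq> Z \<and> hd' y = x \<and> isprf y"
definition Pv :: "'m \<Rightarrow> bool" where "Pv x \<longleftrightarrow> (\<exists>y. Pf x y)"
lemma Dp_Pf [D_intros]: "DF F \<Longrightarrow> DF G \<Longrightarrow> Dp (\<lambda>e. Pf (F e) (G e))" unfolding Pf_def by (intro D_intros)
lemma Dp_Pv [D_intros]: "DF F \<Longrightarrow> Dp (\<lambda>e. Pv (F e))"
  unfolding Pv_def using DF_rename[of F Suc] by (intro D_intros)
lemma mev_pproof: "mev (pproof \<tau>) [x, y] = ob (Pf x y)"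
  by (auto simp: pproof_def mev_pis_proof Pf_def)

lemma Pf_less: "Pf x y \<Longrightarrow> x \<prec> y"
  using cns_hd_tl[of y] less_cns1[of "hd' y" "tl' y"] by (auto simp: Pf_def)
lemma Pf_isfm: "Pf x y \<Longrightarrow> isfm x"
  unfolding Pf_def using cns_hd_tl[of y] isprf_cns[of "hd' y" "tl' y"] by metis
lemma Pv_isfm: "Pv x \<Longrightarrow> isfm x" unfolding Pv_def using Pf_isfm by blast
lemma Pf_cns: "Pf x (cns x l) \<longleftrightarrow> isprf (cns x l)" by (simp add: Pf_def)

lemma Pf_nm: "Pf (nm (gn \<phi>)) (nm n) \<longleftrightarrow> eval (pproof \<tau>) [gn \<phi>, n] = 1"
proof -
  have "nm (eval (pproof \<tau>) [gn \<phi>, n]) = ob (Pf (nm (gn \<phi>)) (nm n))"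
    using mev_nm[of "pproof \<tau>" "[gn \<phi>, n]"] mev_pproof[of "nm (gn \<phi>)" "nm n"] by simp
  then have "Pf (nm (gn \<phi>)) (nm n) \<longleftrightarrow> nm (eval (pproof \<tau>) [gn \<phi>, n]) = nm 1" by simp
  then show ?thesis unfolding nm_inj .
qed

lemma Pv_thm: "T \<turnstile> \<phi> \<Longrightarrow> \<exists>n. Pf (nm (gn \<phi>)) (nm n)"
  using pproof_derivable[OF T, of \<phi>] Pf_nm by auto

text \<open>The lines of \<open>l1\<close> are replayed on top of \<open>l2\<close>. Justifications
  only ask for membership of earlier lines, so they survive when the list grows.\<close>

lemma isprf_merge: assumes "isprf l2" shows "isprf l1 \<longrightarrow> (\<exists>l. isprf l \<and> (\<forall>x. mem x l1 \<or> mem x l2 \<longrightarrow> mem x l))"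
proof (rule less_ind[where n = l1])
  fix l1 assume IH: "\<And>m. m \<prec> l1 \<Longrightarrow> isprf m \<longrightarrow> (\<exists>l. isprf l \<and> (\<forall>x. mem x m \<or> mem x l2 \<longrightarrow> mem x l))"
  show "isprf l1 \<longrightarrow> (\<exists>l. isprf l \<and> (\<forall>x. mem x l1 \<or> mem x l2 \<longrightarrow> mem x l))"
  proof
    assume l1: "isprf l1"
    show "\<exists>l. isprf l \<and> (\<forall>x. mem x l1 \<or> mem x l2 \<longrightarrow> mem x l)"
    proof (cases "l1 = Z")
      case False
      define y m where "y = hd' l1" and "m = tl' l1"
      have l: "l1 = cns y m" using cns_hd_tl[OF False] by (simp add: y_def m_def)
      then have y: "isprf m" "isfm y" "isax y \<or> mev \<tau> [y] = S Z \<or>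
     (\<exists>i. mem i m \<and> mem (imp i y) m) \<or> (\<exists>i. mem i m \<and> y = al i)" using l1 isprf_cns[of y m] by auto
      obtain k where k: "isprf k" "\<forall>x. mem x m \<or> mem x l2 \<longrightarrow> mem x k" using IH[of m] y(1) less_cns2 l by auto
      then have "isprf (cns y k)" unfolding isprf_cns using y by blast
      moreover have "\<forall>x. mem x l1 \<or> mem x l2 \<longrightarrow> mem x (cns y k)" using k l by auto
      ultimately show ?thesis by blast
    qed (use assms in auto)
  qed
qed (intro D_intros)

lemma Pv_mp: assumes "Pv (imp a b)" "Pv a" shows "Pv b"
proof -
  obtain l1 l2 where l: "Pf (imp a b) l1" "Pf a l2" using assms unfolding Pv_def by blast
  have m: "mem x y" if "Pf x y" for x y
    using that unfolding Pf_def by (metis cns_hd_tl mem_cns)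
  obtain k where k: "isprf k" "\<forall>x. mem x l1 \<or> mem x l2 \<longrightarrow> mem x k" using isprf_merge[of l2 l1] l unfolding Pf_def by blast
  have "isfm b" using Pf_isfm[OF l(1)] by simp
  then have "isprf (cns b k)" unfolding isprf_cns using k m[OF l(1)] m[OF l(2)] by blast
  then show ?thesis unfolding Pv_def using Pf_cns by blast
qed

lemma Pv_ax: "isax x \<Longrightarrow> isfm x \<Longrightarrow> Pv x"
  unfolding Pv_def using Pf_cns[of x Z] isprf_cns[of x Z] isprf_Z by blast

lemma Pv_exfalso: assumes "Pv a" "Pv (ng a)" "isfm b" shows "Pv b"
proof -
  have a: "isfm a" using Pv_isfm[OF assms(1)] .
  have "Pv (imp a (imp (ng b) a))" "Pv (imp (ng a) (imp (ng b) (ng a)))"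
    by (rule Pv_ax[OF isax_imp1], simp add: a assms(3))+
  then have "Pv (imp (ng b) a)" "Pv (imp (ng b) (ng a))" using assms(1,2) Pv_mp by blast+
  moreover have "Pv (imp (imp (ng b) a) (imp (imp (ng b) (ng a)) (ng (ng b))))"
    by (rule Pv_ax[OF isax_neg1]) (simp add: a assms(3))
  ultimately have "Pv (ng (ng b))" using Pv_mp by blast
  moreover have "Pv (imp (ng (ng b)) b)" by (rule Pv_ax[OF isax_neg2]) (simp add: assms(3))
  ultimately show ?thesis using Pv_mp by blast
qed

text \<open>If the numeral is too large for the search of the axiom check, it does not occur in the
  instance, and \<open>Z\<close> gives the same instance.\<close>

lemma Pv_inst:
  assumes v: "\<And>i. \<exists>x. v i = ntm x" and p: "Pv (al (fcode (Suc 0) v \<phi>))"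
  shows "Pv (fcode 0 (case_nat (ntm s) v) \<phi>)"
proof -
  have t: "istm (case_nat (ntm s) v i)" "istm (v i)" for i s using v[of i] v[of "i - 1"] by (auto split: nat.split)
  have *: "Pv (fcode 0 (case_nat (ntm s) v) \<phi>)" if "ntm s \<preceq> fcode 0 (case_nat (ntm s) v) \<phi> \<or> s = Z" for s
    by (rule Pv_mp[OF Pv_ax[OF isax_all1[OF v that]] p]) (simp add: isfm_fcode t)
  show ?thesis
  proof (cases "ntm s \<preceq> fcode 0 (case_nat (ntm s) v) \<phi>")
    case False
    then have "fcode 0 ((case_nat (ntm s) v)(0 := ntm Z)) \<phi> = fcode 0 (case_nat (ntm s) v) \<phi>"
      using fcode_occurs[of 0 "case_nat (ntm s) v" 0 \<phi>] by auto
    moreover have "(case_nat (ntm s) v)(0 := ntm Z) = case_nat (ntm Z) v" by (auto split: nat.split)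
    ultimately show ?thesis using *[of Z] by simp
  qed (use * in blast)
qed

text \<open>\<open>\<phi>\<close> is a genuine formula, but the numbers whose numerals replace its
  free variables may be nonstandard.\<close>

definition Pg :: "(nat \<Rightarrow> 'm) \<Rightarrow> fm \<Rightarrow> bool" where "Pg a \<phi> \<longleftrightarrow> Pv (fcode 0 (\<lambda>i. ntm (a i)) \<phi>)"

text \<open>The universal closure has a standard proof; the model then instantiates its quantifiers
  with arbitrary elements.\<close>

lemma Pg_thm: assumes "T \<turnstile> \<phi>" shows "Pg a \<phi>"
proof -
  obtain n where n: "fm_below n \<phi>" using fm_below_ex by blast
  \<comment> \<open>With \<open>j\<close> quantifiers left, the variables from \<open>j\<close> on
    have been instantiated; the induction runs from the closure at \<open>n\<close> down to
    0.\<close>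
  have "Pv (fcode 0 (\<lambda>i. ntm (a (i + j))) ((Forall ^^ j) \<phi>))" if "j \<le> n" for j
    using that
  proof (induction rule: inc_induct)
    case base
    have "T \<turnstile> (Forall ^^ k) \<phi>" for k by (induction k) (simp_all add: assms derivable.gen)
    then obtain m where "Pf (nm (gn ((Forall ^^ n) \<phi>))) m" using Pv_thm by blast
    moreover have "fm_below 0 ((Forall ^^ n) \<phi>)" using n by (simp add: all_funpow)
    ultimately show ?case unfolding Pv_def using fcode_gn[of 0 "(Forall ^^ n) \<phi>"] by metis
  next
    case (step j)
    have "Pv (al (fcode (Suc 0) (\<lambda>i. ntm (a (i + Suc j))) ((Forall ^^ j) \<phi>)))"
      using step.IH by (simp add: al_def)
    then have "Pv (fcode 0 (case_nat (ntm (a j)) (\<lambda>i. ntm (a (i + Suc j)))) ((Forall ^^ j) \<phi>))"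
      by (rule Pv_inst[rotated]) blast
    moreover have "case_nat (ntm (a j)) (\<lambda>i. ntm (a (i + Suc j))) = (\<lambda>i. ntm (a (i + j)))"
      by (rule ext) (simp split: nat.split)
    ultimately show ?case by simp
  qed
  from this[of 0] show ?thesis by (simp add: Pg_def)
qed

lemma PA_imp_T: "PA \<turnstile> \<phi> \<Longrightarrow> T \<turnstile> \<phi>"
  by (rule derivable_cut[OF _ PA_T])

text \<open>Replaces derivations inside a model: truth in all models gives a derivation by
  completeness, and the model knows every standard derivation.\<close>

lemma Pg_valid: assumes "\<And>(M :: nat mstr) e. pa_model M \<Longrightarrow> msat M e \<phi>" shows "Pg a \<phi>"
  by (rule Pg_thm[OF PA_imp_T[OF PA_complete[OF assms]]])

lemma Pg_mp: "Pg a (Imp \<phi> \<psi>) \<Longrightarrow> Pg a \<phi> \<Longrightarrow> Pg a \<psi>"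
  unfolding Pg_def fcode_codes by (rule Pv_mp)
lemma Pg_mps: "Pg a (foldr Imp As B) \<Longrightarrow> \<forall>A\<in>set As. Pg a A \<Longrightarrow> Pg a B"
  by (induction As) (auto dest: Pg_mp)
lemma vm_0 [simp]: "vm 0 v = v" by (rule ext) (simp add: vm_def)
lemma Pg_subst: "\<forall>i. tcode (\<lambda>i. ntm (a i)) (\<rho> i) = ntm (b i) \<Longrightarrow> Pg a (fsubst \<rho> \<phi>) \<longleftrightarrow> Pg b \<phi>"
  unfolding Pg_def fcode_fsubst by simp
lemma Pg_cong: assumes "fm_below n \<phi>" "\<forall>i<n. a i = b i" shows "Pg a \<phi> \<longleftrightarrow> Pg b \<phi>"
  using fcode_cong[OF assms(1), of 0 "\<lambda>i. ntm (a i)" "\<lambda>i. ntm (b i)"] assms(2) by (simp add: Pg_def)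
lemma Pg_eq: assumes "tcode (\<lambda>i. ntm (a i)) t = ntm (a j)" shows "Pg a (Eq (Var j) t)"
  using Pg_valid[of "Eq (Var j) (Var j)" a] assms by (simp add: Pg_def)

text \<open>Formalized completeness for primitive recursive equations: what the model computes, it
  believes \<open>T\<close> to prove. The induction on the description is external, since
  \<open>f\<close> is standard.\<close>

lemma Pg_graph: "mev f (map a is) = a j \<Longrightarrow> Pg a (graph f (map Var is) (Var j))"
proof (induction f arbitrary: a "is" j)
  case PZero
  then have "a j = Z" by simp
  then show ?case by (simp add: Pg_eq)
next
  case PSucc
  then have "a j = S (arg Z (map a is) 0)" by simp
  then show ?case by (cases "is") (simp_all add: Pg_eq)
next
  case (PProj k)
  then have "a j = arg Z (map a is) k" by simp
  then show ?case by (simp add: Pg_eq arg_def)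
next
  case (PComp f gs)
  define N m where "N = Suc (sum_list is + j)" and "m = length gs"
  have N: "j < N" "\<forall>i\<in>set is. i < N" using member_le_sum_list[of _ "is"] by (auto simp: N_def le_imp_less_Suc trans_le_add1)
  \<comment> \<open>Fresh variables from \<open>N\<close> on hold the values of the inner functions,
    so that each of their graphs becomes a formula with variables as arguments.\<close>
  define b where "b i = (if i < N then a i else if i < N + m then mev (gs ! (i - N)) (map a is) else Z)" for i
  have bs: "map b is = map a is" "b j = a j" using N by (simp_all add: b_def)
  define As where "As = map (\<lambda>k. graph (gs ! k) (map Var is) (Var (N + k))) [0..<m]"
  define B where "B = graph f (map Var [N..<N + m]) (Var j)"
  define C where "C = graph (PComp f gs) (map Var is) (Var j)"
  have lst: "map b [N..<N + m] = map (\<lambda>g. mev g (map a is)) gs"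
    by (rule nth_equalityI) (simp_all add: b_def m_def)
  have "Pg b (foldr Imp As (Imp B C))"
  proof (rule Pg_valid)
    fix M' :: "nat mstr" and e assume "pa_model M'"
    then interpret M': pa_model M' .
    have imps: "msat M' e (foldr Imp As D) \<longleftrightarrow> ((\<forall>A\<in>set As. msat M' e A) \<longrightarrow> msat M' e D)" for D and As
      by (induction As) auto
    have "M'.mev (PComp f gs) (map e is) = M'.mev f (map e [N..<N + m])" if "\<forall>k<m. e (N + k) = M'.mev (gs ! k) (map e is)"
    proof -
      have "map e [N..<N + m] = map (\<lambda>g. M'.mev g (map e is)) gs"
        by (rule nth_equalityI) (use that in \<open>simp_all add: m_def\<close>)
      then show ?thesis by simp
    qed
    then show "msat M' e (foldr Imp As (Imp B C))"
      unfolding imps As_def B_def C_def by (auto simp: M'.msat_graph comp_def)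
  qed
  moreover have "\<forall>A\<in>set As. Pg b A" unfolding As_def
  proof (clarsimp)
    fix k assume "k < m"
    then show "Pg b (graph (gs ! k) (map Var is) (Var (N + k)))"
      by (intro PComp.IH(2)) (simp_all add: m_def bs, simp add: b_def m_def)
  qed
  ultimately have "Pg b (Imp B C)" using Pg_mps by blast
  moreover have "Pg b B" unfolding B_def by (rule PComp.IH(1)) (use PComp.prems bs lst in simp)
  ultimately have "Pg b C" by (rule Pg_mp)
  moreover have "fm_below N C" unfolding C_def by (rule graph_below) (use N in auto)
  ultimately show ?case unfolding C_def[symmetric] using Pg_cong[of N C b a] by (simp add: b_def)
next
  case (PRec f g)
  show ?case
  proof (cases "is")
    case Nil
    then have "a j = Z" using PRec.prems by simp
    then show ?thesis by (simp add: Nil Pg_eq)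
  next
    case (Cons n js)
    define N where "N = Suc (sum_list is + j)"
    have N: "j < N" "n < N" "\<forall>i\<in>set js. i < N"
      using member_le_sum_list[of _ "is"] Cons by (auto simp: N_def le_imp_less_Suc trans_le_add1)
    define xs where "xs = map a js"
    define r where "r v = mev (PRec f g) (v # xs)" for v
    \<comment> \<open>Two fresh variables carry the recursion argument and the value reached
      there.\<close>
    define a' where "a' v = a(N := v, Suc N := r v)" for v
    define G where "G = graph (PRec f g) (Var N # map Var js) (Var (Suc N))"
    have xs: "map b js = xs" if "\<forall>i<N. b i = a i" for b using that N by (simp add: xs_def)
    have xs': "map (a' v) js = xs" for v by (rule xs) (simp add: a'_def)
    have mj: "map (tsubst \<rho>) (map Var js) = map Var js" if "\<forall>i<N. \<rho> i = Var i" for \<rho> using that N by auto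
    have bel: "fm_below (Suc (Suc N)) G" unfolding G_def by (rule graph_below) (use N in auto)
    \<comment> \<open>An induction inside the model, as the number of recursion steps may be
      nonstandard. It is legitimate because provability of the instances of one standard formula is
      a definable property of the numbers put in.\<close>
    have "Pg (a' v) G" for v
    proof (rule ind[where x = v])
      have D: "DF (\<lambda>e. ntm (a' (e 0) i))" for i
        unfolding a'_def r_def by (cases "i = Suc N"; cases "i = N") (auto intro!: D_intros)
      show "Dp (\<lambda>e. Pg (a' (e 0)) G)" unfolding Pg_def by (intro Dp_Pv DF_fcode D)
    next
      have "Pg (a' Z) (Imp (graph f (map Var js) (Var (Suc N))) (graph (PRec f g) (Zero # map Var js) (Var (Suc N))))"
      proof (rule Pg_valid)
        fix M' :: "nat mstr" and e assume "pa_model M'"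
        then interpret M': pa_model M' .
        show "msat M' e (Imp (graph f (map Var js) (Var (Suc N))) (graph (PRec f g) (Zero # map Var js) (Var (Suc N))))"
          by (simp add: M'.msat_graph)
      qed
      moreover have "Pg (a' Z) (graph f (map Var js) (Var (Suc N)))"
        by (rule PRec.IH(1)) (simp only: xs', simp add: a'_def r_def)
      ultimately have "Pg (a' Z) (graph (PRec f g) (Zero # map Var js) (Var (Suc N)))" by (rule Pg_mp)
      moreover have "graph (PRec f g) (Zero # map Var js) (Var (Suc N)) = fsubst (Var(N := Zero)) G"
      proof -
        have e: "map (tsubst (Var(N := Zero))) (map Var js) = map Var js" by (rule mj) simp
        show ?thesis unfolding G_def graph_fsubst list.map e by simp
      qed
      ultimately show "Pg (a' Z) G" using Pg_subst[of "a' Z" "Var(N := Zero)" "a' Z" G] by (simp add: a'_def)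
    next
      fix v assume IH: "Pg (a' v) G"
      define b where "b = (a' v)(Suc (Suc N) := r (S v))"
      have xb: "map b js = xs" by (rule xs) (simp add: b_def a'_def)
      have b: "Pg b G" using IH Pg_cong[OF bel, of "a' v" b] by (simp add: b_def)
      have "Pg b (Imp G (Imp (graph g (Var N # Var (Suc N) # map Var js) (Var (Suc (Suc N))))
         (graph (PRec f g) (Succ (Var N) # map Var js) (Var (Suc (Suc N))))))"
      proof (rule Pg_valid)
        fix M' :: "nat mstr" and e assume "pa_model M'"
        then interpret M': pa_model M' .
        show "msat M' e (Imp G (Imp (graph g (Var N # Var (Suc N) # map Var js) (Var (Suc (Suc N))))
         (graph (PRec f g) (Succ (Var N) # map Var js) (Var (Suc (Suc N))))))"
          by (simp add: M'.msat_graph G_def)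
      qed
      moreover have "Pg b (graph g (map Var (N # Suc N # js)) (Var (Suc (Suc N))))"
        by (rule PRec.IH(2)) (simp only: list.map xb, simp add: b_def a'_def r_def)
      ultimately have "Pg b (graph (PRec f g) (Succ (Var N) # map Var js) (Var (Suc (Suc N))))"
        using b by (auto dest: Pg_mp)
      moreover define \<rho> where "\<rho> = Var(N := Succ (Var N), Suc N := Var (Suc (Suc N)))"
      have "graph (PRec f g) (Succ (Var N) # map Var js) (Var (Suc (Suc N))) = fsubst \<rho> G"
      proof -
        have e: "map (tsubst (\<rho>)) (map Var js) = map Var js" by (rule mj) (simp add: \<rho>_def)
        show ?thesis unfolding G_def graph_fsubst list.map e by (simp add: \<rho>_def)
      qed
      ultimately have "Pg b (fsubst \<rho> G)" by simp
      then have "Pg ((a' (S v))(Suc (Suc N) := r (S v))) G"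
        using Pg_subst[of b \<rho> "(a' (S v))(Suc (Suc N) := r (S v))" G] by (simp add: b_def a'_def \<rho>_def)
      then show "Pg (a' (S v)) G" using Pg_cong[OF bel, of "(a' (S v))(Suc (Suc N) := r (S v))" "a' (S v)"] by simp
    qed
    then have "Pg (a' (a n)) G" .
    moreover have "a j = r (a n)" using PRec.prems by (simp add: Cons r_def xs_def)
    ultimately have "Pg a (fsubst (Var(N := Var n, Suc N := Var j)) G)"
      using Pg_cong[OF bel, of "a' (a n)" "a(N := a n, Suc N := a j)"]
        Pg_subst[of a "Var(N := Var n, Suc N := Var j)" "a(N := a n, Suc N := a j)" G] by (simp add: a'_def)
    moreover have "fsubst (Var(N := Var n, Suc N := Var j)) G = graph (PRec f g) (map Var is) (Var j)"
    proof -
      have e: "map (tsubst (Var(N := Var n, Suc N := Var j))) (map Var js) = map Var js" by (rule mj) simp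
      show ?thesis unfolding G_def graph_fsubst Cons list.map e by simp
    qed
    ultimately show ?thesis by simp
  qed
qed

end

section \<open>The Rosser proof predicate\<close>

text \<open>
  The construction refers to the codes of \<open>RF\<close> and \<open>SF\<close>, which contain it. Instead of the fixed
  point theorem, the descriptions below take as an argument \<open>e\<close> the code of the graph of \<open>pF\<close>;
  the value \<open>e0\<close> is plugged in as a numeral at the end, and \<open>pR\<close>, \<open>pSx\<close> recompute the codes of
  \<open>RF\<close> and \<open>SF\<close> from \<open>e\<close>.
\<close>

definition pPf where "pPf \<tau> x t = peq (PComp (pproof \<tau>) [x, t]) (pnum 1)"
definition pmu where  \<comment> \<open>one more than the least \<open>k < a\<close> with \<open>p k bs\<close>, and \<open>0\<close> if there is none\<close>
  "pmu p a bs = PComp (PRec PZero (pite (PProj 1) (PProj 1)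
     (pite (PComp p (PProj 0 # map PProj [2..<2 + length bs])) (psuc (PProj 0)) PZero))) (a # bs)"

definition pq where  \<comment> \<open>code of the graph of a constant description\<close>
  "pq e = PComp (PRec (pnum (gn (Eq (Var 0) Zero)))
     (pExists (pConj (PProj 1) (pnum (gn (Eq (Var 1) (Succ (Var 0)))))))) [e]"
text \<open>Follows the shape shown in \<open>graph_pf\<close>: three quantified variables for the
  arguments of \<open>pF\<close>, the first fixed by the graph of a constant, the other two by
  equations with codes \<open>c\<close> and \<open>d\<close>.\<close>

definition pprf where
  "pprf e c d = pExists (pExists (pExists (pConj (pq e) (pConj (pnum c) (pConj (pnum d) e)))))"
definition pR where
  "pR e = pExists (pConj (pnum (gn (app Fml [Var 1])))
     (pConj (pprf e (gn (Eq (Var 1) (Var 4))) (gn (Eq (Var 2) (Var 3))))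
       (pForall (pImp (pnum (gn (Less (Var 0) (Var 1))))
         (pNeg (pprf e (gn (Eq (Var 1) (tlift 3 (neg_tm (Var 2))))) (gn (Eq (Var 2) (Var 3)))))))))"
definition pSx where "pSx e = pExists (pprf e (gn (Eq (Var 1) (Var 4))) (gn (Eq (Var 2) (Var 3))))"

definition prc where "prc e x = pinst (PComp (pR (PProj 0)) [e]) (pnumt x)"
definition psc where "psc e x = pinst (PComp (pSx (PProj 0)) [e]) (pnumt x)"

definition pnegP where
  "pnegP \<tau> k t = pex (pand (pPf \<tau> (pNeg (PProj 1)) (PProj 0))
     (pnot (pex (pPf \<tau> (PProj 1) (PProj 0)) (psuc (PProj 0)) [PProj 1]))) t [k]"

definition pcnd where  \<comment> \<open>arguments \<open>k, e, t\<close>\<close>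
  "pcnd \<tau> = por
     (pand (pis_fm (PProj 0)) (pand (pPf \<tau> (pNeg (prc (PProj 1) (PProj 0))) (PProj 2))
       (pnot (pnegP \<tau> (PProj 0) (PProj 2)))))
     (pand (pnot (pis_fm (PProj 0))) (pand (pPf \<tau> (phd (PProj 2)) (PProj 2))
       (pex (pPf \<tau> (pImp (phd (PProj 1)) (pNeg (psc (PProj 2) (PProj 3)))) (PProj 0))
          (PProj 2) [PProj 2, PProj 1, PProj 0])))"

definition pbell where "pbell \<tau> e t = pmu (pcnd \<tau>) (psuc t) [e, t]"
definition pfirst where "pfirst \<tau> e t = pmu (pbell \<tau> (PProj 1) (PProj 0)) t [e]"

definition pL where "pL k = psnd (psnd (pdiv k 8))"

definition pent where "pent l i y = pand (pdrop i l) (peq (phd (pdrop i l)) y)"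
definition pnegL where
  "pnegL x j l = pex (pand (pent (PProj 2) (PProj 0) (pNeg (PProj 1)))
     (pnot (pex (pent (PProj 2) (PProj 0) (PProj 1)) (psuc (PProj 0)) [PProj 1, PProj 2]))) j [x, l]"
definition pvalid where
  "pvalid \<tau> e k m = pnot (pex (pex
       (pand (pis_fm (PProj 0)) (pand (pent (PProj 2) (PProj 1) (pNeg (prc (PProj 3) (PProj 0))))
         (pnot (por (por (pnegP \<tau> (PProj 0) (PProj 4))
             (pex (pent (PProj 1) (PProj 0) (PProj 2)) (PProj 1) [PProj 2, prc (PProj 3) (PProj 0)]))
           (pand (pnot (pex (pPf \<tau> (PProj 1) (PProj 0)) (PProj 4) [PProj 0]))
             (pnegL (PProj 0) (PProj 1) (PProj 2)))))))
       (PProj 1) [PProj 0, PProj 1, PProj 2, PProj 3]) (pL k) [pL k, e, m])"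

definition pF where  \<comment> \<open>arguments \<open>e, x, t\<close>\<close>
  "pF \<tau> = (let e = PProj 0; x = PProj 1; t = PProj 2; s = pfirst \<tau> e t; m = ppred s;
       k = ppred (pbell \<tau> e m); d = psub t s in
     pite (pis_fm x)
       (pite s
         (pite (ple (psuc d) k)
           (pand (pnot (pis_fm k)) (pand (pvalid \<tau> e k m) (pent (pL k) d x)))
           (peq x (psub d k)))
         (pite (pbell \<tau> e t) PZero (pPf \<tau> x t)))
       (pand (pnot s) (peq (pbell \<tau> e t) (psuc x))))"

definition e0 where "e0 \<tau> = gn (graph (pF \<tau>) [Var 0, Var 1, Var 2] (Succ Zero))"
definition pf where "pf \<tau> = PComp (pF \<tau>) [pnum (e0 \<tau>), PProj 0, PProj 1]"
definition PrfF where "PrfF \<tau> = graph (pf \<tau>) [Var 0, Var 1] (Succ Zero)"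
definition RF where
  "RF \<tau> = Exists (Conj (app Fml [Var 1])
                 (Conj (app (PrfF \<tau>) [Var 1, Var 0])
                       (Forall (Imp (Less (Var 0) (Var 1))
                                    (Neg (app (PrfF \<tau>) [neg_tm (Var 2), Var 0]))))))"
definition SF where "SF \<tau> = Exists (app (PrfF \<tau>) [Var 1, Var 0])"

lemma pr_formula_PrfF: "pr_formula 2 (PrfF \<tau>)"
  unfolding pr_formula_def PrfF_def by (rule exI[of _ "pf \<tau>"]) (simp add: upt_rec numeral_2_eq_2)

section \<open>The code of the construction, recomputed from within\<close>

lemma app_PrfF: "app (PrfF \<tau>) [s, t] = graph (pf \<tau>) [s, t] (Succ Zero)"
  by (simp add: app_def PrfF_def graph_fsubst)
lemma app_Fml: "app Fml [s] = graph (pis_fm (PProj 0)) [s] (Succ Zero)"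
  by (simp add: app_def Fml_def graph_fsubst)

text \<open>Only the outer composition is unfolded. Its last conjunct is exactly the formula with
  code \<open>e0\<close>, and this closes the circle of self-reference.\<close>

lemma graph_pf: "graph (pf \<tau>) [s, t] (Succ Zero) = Exists (Exists (Exists (Conj (graph (pnum (e0 \<tau>)) [tlift 3 s, tlift 3 t] (Var 0))
    (Conj (Eq (Var 1) (tlift 3 s)) (Conj (Eq (Var 2) (tlift 3 t)) (graph (pF \<tau>) [Var 0, Var 1, Var 2] (Succ Zero)))))))"
  by (simp add: pf_def graph.simps(4) Let_def numeral_3_eq_3 upt_rec numeral_2_eq_2)

lemma eval_pcodes [simp]: "eval (pExists a) xs = 8 * eval a xs + 7" "eval (pConj a b) xs = 8 * prod_encode (eval a xs, eval b xs) + 3"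
  "eval (pForall a) xs = 8 * eval a xs + 6" "eval (pImp a b) xs = 8 * prod_encode (eval a xs, eval b xs) + 5"
  "eval (pNeg a) xs = 8 * eval a xs + 2"
  by (simp_all add: pcons_defs)

text \<open>The graph of a constant description does not mention the arguments, so its code depends
  on \<open>n\<close> alone and can be computed by recursion.\<close>

lemma gn_graph_pnum: "gn (graph (pnum n) ts (Var 0)) = eval (pq (pnum n)) []"
proof -
  have "gn (graph (pnum n) ts (Var 0)) = eval (PRec (pnum (gn (Eq (Var 0) Zero)))
     (pExists (pConj (PProj 1) (pnum (gn (Eq (Var 1) (Succ (Var 0)))))))) [n]"
  proof (induction n arbitrary: ts)
    case 0 show ?case by simp
  next
    case (Suc n)
    have "graph (pnum (Suc n)) ts (Var 0) = Exists (Conj (graph (pnum n) (map (tlift 1) ts) (Var 0)) (Eq (Var 1) (Succ (Var 0))))"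
      by (simp add: graph.simps(4) Let_def)
    then show ?case using Suc[of "map (tlift 1) ts"] by simp
  qed
  then show ?thesis by (simp add: pq_def)
qed

lemma eval_pq: "eval (pq e) xs = gn (graph (pnum (eval e xs)) ts (Var 0))"
  unfolding gn_graph_pnum by (simp add: pq_def)

lemma eval_pprf:
  assumes "eval e xs = e0 \<tau>"
  shows "eval (pprf e (gn (Eq (Var 1) (tlift 3 s))) (gn (Eq (Var 2) (tlift 3 t)))) xs = gn (graph (pf \<tau>) [s, t] (Succ Zero))"
  unfolding graph_pf gn.simps(8,4) pprf_def eval_pcodes eval_pnum eval_pq[of e xs "[tlift 3 s, tlift 3 t]"]
  using assms by (simp add: e0_def)

lemma eval_pR: "eval e xs = e0 \<tau> \<Longrightarrow> eval (pR e) xs = gn (RF \<tau>)"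
  using eval_pprf[of e xs \<tau> "Var 1" "Var 0"] eval_pprf[of e xs \<tau> "neg_tm (Var 2)" "Var 0"]
  by (simp add: pR_def RF_def app_PrfF)
lemma eval_pSx: "eval e xs = e0 \<tau> \<Longrightarrow> eval (pSx e) xs = gn (SF \<tau>)"
  using eval_pprf[of e xs \<tau> "Var 1" "Var 0"]
  by (simp add: pSx_def SF_def app_PrfF)

lemma below_numeral [simp]: "tm_below n (numeral_tm k)" by (induction k) simp_all
lemma RF_below: "fm_below 1 (RF \<tau>)"
  unfolding RF_def by (simp add: app_PrfF app_Fml) (auto intro!: graph_below simp: neg_tm_def)
lemma SF_below: "fm_below 1 (SF \<tau>)"
  unfolding SF_def by (simp add: app_PrfF) (auto intro!: graph_below)

section \<open>The values of the construction in a model\<close>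

context theory_model begin

lemma ob_sym [simp]: "Z = ob P \<longleftrightarrow> \<not> P" "S Z = ob P \<longleftrightarrow> P" by (auto simp: ob_def)

lemma mev_pPf [simp]: "mev (pPf \<tau> x t) xs = ob (Pf (mev x xs) (mev t xs))"
  using mev_pproof by (simp add: pPf_def)

lemma mev_pmu:
  defines "P \<equiv> \<lambda>p bs xs k. mev p (k # map (\<lambda>b. mev b xs) bs) \<noteq> Z"
  shows "mev (pmu p a bs) xs = Z \<longleftrightarrow> (\<forall>k. k \<prec> mev a xs \<longrightarrow> \<not> P p bs xs k)"
    and "mev (pmu p a bs) xs = S k \<longleftrightarrow> k \<prec> mev a xs \<and> P p bs xs k \<and> (\<forall>k'. k' \<prec> k \<longrightarrow> \<not> P p bs xs k')"
proof -
  define ys where "ys = map (\<lambda>b. mev b xs) bs"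
  define f where "f = PRec PZero (pite (PProj 1) (PProj 1)
     (pite (PComp p (PProj 0 # map PProj [2..<2 + length bs])) (psuc (PProj 0)) PZero))"
  have m: "map (\<lambda>i. arg Z (x # y # ys) i) [2..<2 + length bs] = ys" for x y
    using map_arg[of Z x y ys] by (simp add: ys_def)
  have Z: "mev f (Z # ys) = Z" by (simp add: f_def)
  have st: "mev f (S n # ys) = (if mev f (n # ys) \<noteq> Z then mev f (n # ys) else if mev p (n # ys) \<noteq> Z then S n else Z)" for n
    using m[of n] by (simp add: comp_def f_def del: upt_Suc upt_rec_numeral)
  have *: "(mev f (n # ys) = Z \<and> (\<forall>k. k \<prec> n \<longrightarrow> mev p (k # ys) = Z)) \<or>
     (\<exists>k. mev f (n # ys) = S k \<and> k \<prec> n \<and> mev p (k # ys) \<noteq> Z \<and> (\<forall>k'. k' \<prec> k \<longrightarrow> mev p (k' # ys) = Z))" for n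
  proof (rule ind[where x = n])
    show "Dp (\<lambda>e. (mev f (e 0 # ys) = Z \<and> (\<forall>k. k \<prec> e 0 \<longrightarrow> mev p (k # ys) = Z)) \<or>
     (\<exists>k. mev f (e 0 # ys) = S k \<and> k \<prec> e 0 \<and> mev p (k # ys) \<noteq> Z \<and> (\<forall>k'. k' \<prec> k \<longrightarrow> mev p (k' # ys) = Z)))"
      by (intro D_intros)
    fix n assume "(mev f (n # ys) = Z \<and> (\<forall>k. k \<prec> n \<longrightarrow> mev p (k # ys) = Z)) \<or>
     (\<exists>k. mev f (n # ys) = S k \<and> k \<prec> n \<and> mev p (k # ys) \<noteq> Z \<and> (\<forall>k'. k' \<prec> k \<longrightarrow> mev p (k' # ys) = Z))"
    then show "(mev f (S n # ys) = Z \<and> (\<forall>k. k \<prec> S n \<longrightarrow> mev p (k # ys) = Z)) \<or>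
     (\<exists>k. mev f (S n # ys) = S k \<and> k \<prec> S n \<and> mev p (k # ys) \<noteq> Z \<and> (\<forall>k'. k' \<prec> k \<longrightarrow> mev p (k' # ys) = Z))"
      unfolding st by (elim disjE exE conjE) (auto simp: less_S)
  qed (simp add: Z)
  have f: "mev (pmu p a bs) xs = mev f (mev a xs # ys)" by (simp add: pmu_def f_def ys_def comp_def)
  show "mev (pmu p a bs) xs = Z \<longleftrightarrow> (\<forall>k. k \<prec> mev a xs \<longrightarrow> \<not> P p bs xs k)"
    unfolding f P_def ys_def[symmetric] using *[of "mev a xs"] by auto
  show "mev (pmu p a bs) xs = S k \<longleftrightarrow> k \<prec> mev a xs \<and> P p bs xs k \<and> (\<forall>k'. k' \<prec> k \<longrightarrow> \<not> P p bs xs k')"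
    unfolding f P_def ys_def[symmetric] using *[of "mev a xs"] by (auto, metis L.linorder_cases)
qed

definition RC :: "'m \<Rightarrow> 'm" where "RC x = fcode 0 (\<lambda>_. ntm x) (RF \<tau>)"
definition SC :: "'m \<Rightarrow> 'm" where "SC x = fcode 0 (\<lambda>_. ntm x) (SF \<tau>)"
lemma DF_RC [D_intros]: "DF F \<Longrightarrow> DF (\<lambda>e. RC (F e))" unfolding RC_def by (intro DF_fcode DF_ntm)
lemma DF_SC [D_intros]: "DF F \<Longrightarrow> DF (\<lambda>e. SC (F e))" unfolding SC_def by (intro DF_fcode DF_ntm)

lemma fcode_case: "fm_below 1 \<phi> \<Longrightarrow> fcode 0 (case_nat (ntm x) (\<lambda>_. ntm Z)) \<phi> = fcode 0 (\<lambda>_. ntm x) \<phi>"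
  by (rule fcode_cong[of 1]) auto

lemma mev_prc: assumes "mev e xs = nm (e0 \<tau>)" shows "mev (prc e x) xs = RC (mev x xs)"
proof -
  have "mev (PComp (pR (PProj 0)) [e]) xs = nm (gn (RF \<tau>))"
    using mev_nm[of "pR (PProj 0)" "[e0 \<tau>]"] eval_pR[of "PProj 0" "[e0 \<tau>]" \<tau>] assms by simp
  also have "\<dots> = fcode (Suc 0) (\<lambda>_. ntm Z) (RF \<tau>)" using fcode_gn[OF RF_below] by simp
  finally have a: "mev (PComp (pR (PProj 0)) [e]) xs = fcode (Suc 0) (\<lambda>_. ntm Z) (RF \<tau>)" .
  have "mev (prc e x) xs = fcode 0 (case_nat (ntm (mev x xs)) (\<lambda>_. ntm Z)) (RF \<tau>)"
    unfolding prc_def by (rule mev_pinst[OF _ a]) (blast, simp)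
  then show ?thesis by (simp only: RC_def fcode_case[OF RF_below])
qed
lemma mev_psc: assumes "mev e xs = nm (e0 \<tau>)" shows "mev (psc e x) xs = SC (mev x xs)"
proof -
  have "mev (PComp (pSx (PProj 0)) [e]) xs = nm (gn (SF \<tau>))"
    using mev_nm[of "pSx (PProj 0)" "[e0 \<tau>]"] eval_pSx[of "PProj 0" "[e0 \<tau>]" \<tau>] assms by simp
  also have "\<dots> = fcode (Suc 0) (\<lambda>_. ntm Z) (SF \<tau>)" using fcode_gn[OF SF_below] by simp
  finally have a: "mev (PComp (pSx (PProj 0)) [e]) xs = fcode (Suc 0) (\<lambda>_. ntm Z) (SF \<tau>)" .
  have "mev (psc e x) xs = fcode 0 (case_nat (ntm (mev x xs)) (\<lambda>_. ntm Z)) (SF \<tau>)"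
    unfolding psc_def by (rule mev_pinst[OF _ a]) (blast, simp)
  then show ?thesis by (simp only: SC_def fcode_case[OF SF_below])
qed

text \<open>
  The bell rings at \<open>t\<close> if \<open>t\<close> proves \<open>\<not>RF(k)\<close> although \<open>k\<close> has not been refuted before it was proved,
  or if the formula proved by \<open>t\<close> has already been proved to imply \<open>\<not>SF(k)\<close>, for a number \<open>k\<close> that does not
  code a formula. In the second case \<open>k\<close> codes a world, and its list \<open>Lk k\<close> is enumerated
  after the bell.
\<close>

definition neg1 :: "'m \<Rightarrow> 'm \<Rightarrow> bool" where
  "neg1 k t \<longleftrightarrow> (\<exists>z. z \<prec> t \<and> Pf (ng k) z \<and> \<not> (\<exists>u. u \<prec> S z \<and> Pf k u))"
lemma mev_pnegP [simp]: "mev (pnegP \<tau> k t) xs = ob (neg1 (mev k xs) (mev t xs))"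
  by (simp add: pnegP_def neg1_def)

definition bell_cond :: "'m \<Rightarrow> 'm \<Rightarrow> bool" where
  "bell_cond k t \<longleftrightarrow> isfm k \<and> Pf (ng (RC k)) t \<and> \<not> neg1 k t \<or>
     \<not> isfm k \<and> Pf (hd' t) t \<and> (\<exists>p. p \<prec> t \<and> Pf (imp (hd' t) (ng (SC k))) p)"
lemma mev_pcnd: "mev (pcnd \<tau>) [k, nm (e0 \<tau>), t] = ob (bell_cond k t)"
  by (simp add: pcnd_def bell_cond_def mev_prc mev_psc) blast

text \<open>The bound on \<open>k\<close> keeps the search primitive recursive. A proof of
  \<open>\<not>RF(k)\<close> exceeds \<open>k\<close> anyway, and for worlds every late enough proof
  meets the bound. Taking the least \<open>k\<close> makes the choice unique.\<close>

definition bell :: "'m \<Rightarrow> 'm \<Rightarrow> bool" where "bell t k \<longleftrightarrow> k \<preceq> t \<and> bell_cond k t \<and> (\<forall>k'. k' \<prec> k \<longrightarrow> \<not> bell_cond k' t)"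
definition first_bell :: "'m \<Rightarrow> 'm \<Rightarrow> bool" where "first_bell m k \<longleftrightarrow> bell m k \<and> (\<forall>m' k'. m' \<prec> m \<longrightarrow> \<not> bell m' k')"

lemma Dp_neg1 [D_intros]: "DF F \<Longrightarrow> DF G \<Longrightarrow> Dp (\<lambda>e. neg1 (F e) (G e))"
  unfolding neg1_def using DF_rename[of F Suc] DF_rename[of G Suc] DF_rename[of F "\<lambda>i. Suc (Suc i)"] by (intro D_intros)
lemma Dp_bell_cond [D_intros]: "DF F \<Longrightarrow> DF G \<Longrightarrow> Dp (\<lambda>e. bell_cond (F e) (G e))"
  unfolding bell_cond_def using DF_rename[of F Suc] DF_rename[of G Suc] by (intro D_intros)
lemma Dp_bell [D_intros]: "DF F \<Longrightarrow> DF G \<Longrightarrow> Dp (\<lambda>e. bell (F e) (G e))"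
  unfolding bell_def using DF_rename[of F Suc] DF_rename[of G Suc] by (intro D_intros)

lemma mev_pbell: assumes "mev e xs = nm (e0 \<tau>)"
  shows "mev (pbell \<tau> e t) xs = S k \<longleftrightarrow> bell (mev t xs) k" "mev (pbell \<tau> e t) xs = Z \<longleftrightarrow> (\<forall>k. \<not> bell (mev t xs) k)"
proof -
  show 1: "mev (pbell \<tau> e t) xs = S k \<longleftrightarrow> bell (mev t xs) k" for k
    unfolding pbell_def using mev_pmu(2)[of "pcnd \<tau>" "psuc t" "[e, t]" xs k] assms by (simp add: mev_pcnd bell_def less_S_le)
  show "mev (pbell \<tau> e t) xs = Z \<longleftrightarrow> (\<forall>k. \<not> bell (mev t xs) k)" using 1 Z_cases[of "mev (pbell \<tau> e t) xs"] by (metis S_neq_Z(1))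
qed

lemma bell_unique: "bell m k \<Longrightarrow> bell m k' \<Longrightarrow> k = k'"
  unfolding bell_def using L.linorder_cases by metis
lemma first_bell_unique: "first_bell m k \<Longrightarrow> first_bell m' k' \<Longrightarrow> m = m' \<and> k = k'"
  unfolding first_bell_def using L.linorder_cases bell_unique by metis

lemma mev_pfirst: assumes "mev e xs = nm (e0 \<tau>)"
  shows "mev (pfirst \<tau> e t) xs = S m \<longleftrightarrow> m \<prec> mev t xs \<and> (\<exists>k. first_bell m k)"
    "mev (pfirst \<tau> e t) xs = Z \<longleftrightarrow> (\<forall>m k. m \<prec> mev t xs \<longrightarrow> \<not> bell m k)"
proof -
  have b: "mev (pbell \<tau> (PProj 1) (PProj 0)) [m, nm (e0 \<tau>)] \<noteq> Z \<longleftrightarrow> (\<exists>k. bell m k)" for m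
    using mev_pbell(2)[of "PProj 1" "[m, nm (e0 \<tau>)]" "PProj 0"] by simp
  show "mev (pfirst \<tau> e t) xs = S m \<longleftrightarrow> m \<prec> mev t xs \<and> (\<exists>k. first_bell m k)"
    unfolding pfirst_def mev_pmu(2) using b assms unfolding first_bell_def by simp
  show "mev (pfirst \<tau> e t) xs = Z \<longleftrightarrow> (\<forall>m k. m \<prec> mev t xs \<longrightarrow> \<not> bell m k)"
    unfolding pfirst_def mev_pmu(1) using b assms by simp
qed

definition Lk :: "'m \<Rightarrow> 'm" where "Lk k = sn (sn (dv k))"
lemma mev_pL [simp]: "mev (pL k) xs = Lk (mev k xs)" by (simp add: pL_def Lk_def mev_pdiv8)
definition ent :: "'m \<Rightarrow> 'm \<Rightarrow> 'm \<Rightarrow> bool" where "ent l i y \<longleftrightarrow> dr i l \<noteq> Z \<and> hd' (dr i l) = y"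
lemma mev_pent [simp]: "mev (pent l i y) xs = ob (ent (mev l xs) (mev i xs) (mev y xs))"
  by (simp add: pent_def ent_def)
definition negL :: "'m \<Rightarrow> 'm \<Rightarrow> 'm \<Rightarrow> bool" where
  "negL x j l \<longleftrightarrow> (\<exists>i. i \<prec> j \<and> ent l i (ng x) \<and> \<not> (\<exists>i'. i' \<prec> S i \<and> ent l i' x))"
lemma mev_pnegL [simp]: "mev (pnegL x j l) xs = ob (negL (mev x xs) (mev j xs) (mev l xs))"
  by (simp add: pnegL_def negL_def)

text \<open>Validity is what the axiom \<open>\<box>B \<rightarrow> \<box>\<box>B\<close> needs: \<open>\<not>RF(x)\<close> may be enumerated before \<open>RF(x)\<close> only if
  \<open>RF(x)\<close> is false.\<close>

definition valid :: "'m \<Rightarrow> 'm \<Rightarrow> bool" where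
  "valid k m \<longleftrightarrow> (\<forall>j x. isfm x \<longrightarrow> ent (Lk k) j (ng (RC x)) \<longrightarrow> neg1 x m \<or> (\<exists>i. i \<prec> j \<and> ent (Lk k) i (RC x)) \<or>
     \<not> (\<exists>u. u \<prec> m \<and> Pf x u) \<and> negL x j (Lk k))"

lemma ent_less: assumes "ent l j y" shows "j \<prec> l" "y \<prec> l"
proof -
  show "j \<prec> l" using assms dr_less unfolding ent_def by blast
  have "mem y l" unfolding mem_iff using assms unfolding ent_def by blast
  then show "y \<prec> l" by (rule mem_less)
qed

lemma le_ntm: "x \<preceq> ntm x"
proof (rule ind[where x = x])
  show "Dp (\<lambda>e. e 0 \<preceq> ntm (e 0))" by (intro D_intros)
  fix x assume "x \<preceq> ntm x"
  then have "x \<prec> ntm (S x)" unfolding ntm_simps by (rule less_code) simp_all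
  then show "S x \<preceq> ntm (S x)" by simp
qed simp

text \<open>The numeral of \<open>x\<close> occurs in the instance. This bounds \<open>x\<close>
  wherever codes of the form \<open>RC x\<close> are searched for, and makes \<open>x\<close>
  standard if the code is.\<close>

lemma RC_ge: "x \<preceq> RC x"
proof -
  have c: "a \<preceq> b \<Longrightarrow> a \<preceq> nm 8 \<otimes> b \<oplus> nm r" "a \<preceq> b \<Longrightarrow> a \<preceq> nm 8 \<otimes> b" for a b r
    using le_code[of a b 8] le_code[of a b 8 0] by simp_all
  have "ntm x \<preceq> fcode (Suc 0) (\<lambda>_. ntm x) (graph (pf \<tau>) [Var 1, Var 0] (Succ Zero))"
    unfolding graph_pf fcode.simps
    by (rule c, rule c, rule c, rule c, rule le_pairs(2), rule c, rule le_pairs(1), rule c, rule le_pairs(2)) (simp add: vm_def)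
  then have "ntm x \<preceq> RC x" unfolding RC_def RF_def fcode.simps app_PrfF
    by (intro c(1)[OF c(1)[OF le_pairs(2)[OF c(1)[OF le_pairs(1)]]]])
  then show ?thesis using le_ntm L.order_trans by blast
qed

text \<open>The bounded search misses nothing: positions and entries lie below the code of the list,
  and \<open>x\<close> lies below the entry \<open>ng (RC x)\<close>.\<close>

lemma mev_pvalid: assumes "mev e xs = nm (e0 \<tau>)" shows "mev (pvalid \<tau> e k m) xs = ob (valid (mev k xs) (mev m xs))"
proof -
  have "x \<prec> Lk k" "j \<prec> Lk k" if "ent (Lk k) j (ng (RC x))" for k j x
    using ent_less[OF that] RC_ge[of x] ng_gt[of "RC x"] L.order_trans L.le_less_trans L.less_trans by blast+
  then show ?thesis using assms unfolding pvalid_def valid_def by (simp add: mev_prc) blast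
qed

text \<open>With the first bell at \<open>m\<close> for \<open>k\<close>, the phases are: proofs of
  \<open>T\<close> before \<open>m\<close>; at \<open>m\<close> only the number \<open>k\<close>, if
  it codes no formula, which makes \<open>SF(k)\<close> true; then \<open>k\<close> positions that
  are reserved for a valid list; then every formula in the order of codes, \<open>x\<close> at
  \<open>S m \<oplus> (k \<oplus> x)\<close>. A list is shorter than its code, so it fits when the
  code lies below \<open>k\<close>.\<close>

definition Prf :: "'m \<Rightarrow> 'm \<Rightarrow> bool" where
  "Prf x t \<longleftrightarrow> isfm x \<and> (Pf x t \<and> (\<forall>m k. bell m k \<longrightarrow> t \<prec> m) \<or>
      (\<exists>m k. first_bell m k \<and> m \<prec> t \<and> (if t \<ominus> S m \<prec> k then \<not> isfm k \<and> valid k m \<and> ent (Lk k) (t \<ominus> S m) x else x = t \<ominus> S m \<ominus> k)))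
    \<or> \<not> isfm x \<and> first_bell t x"

lemma mev_pf: "mev (pf \<tau>) [x, t] = ob (Prf x t)"
proof -
  let ?xs = "[nm (e0 \<tau>), x, t]"
  have e: "mev (PProj 0) ?xs = nm (e0 \<tau>)" by simp
  define s where "s = mev (pfirst \<tau> (PProj 0) (PProj 2)) ?xs"
  have pf: "mev (pf \<tau>) [x, t] = mev (pF \<tau>) ?xs" by (simp add: pf_def)
  have bt: "mev (pbell \<tau> (PProj 0) (PProj 2)) ?xs = S k \<longleftrightarrow> bell t k" "mev (pbell \<tau> (PProj 0) (PProj 2)) ?xs = Z \<longleftrightarrow> (\<forall>k. \<not> bell t k)" for k
    using mev_pbell[OF e, of "PProj 2"] by simp_all
  show ?thesis
  proof (cases s rule: Z_cases)
    case 1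
    then have nb: "\<And>m k. m \<prec> t \<Longrightarrow> \<not> bell m k" using mev_pfirst(2)[OF e, of "PProj 2"] by (simp add: s_def)
    then have nF: "\<not> (first_bell m k \<and> m \<prec> t)" for m k unfolding first_bell_def by blast
    have "(\<forall>m k. bell m k \<longrightarrow> t \<prec> m) \<longleftrightarrow> (\<forall>k. \<not> bell t k)" using nb L.linorder_cases L.less_irrefl by metis
    moreover have "first_bell t x \<longleftrightarrow> bell t x" unfolding first_bell_def using nb by blast
    moreover have "\<not> (\<exists>m k. first_bell m k \<and> m \<prec> t \<and> Q m k)" for Q using nF by blast
    note this[of "\<lambda>m k. if t \<ominus> S m \<prec> k then \<not> isfm k \<and> valid k m \<and> ent (Lk k) (t \<ominus> S m) x else x = t \<ominus> S m \<ominus> k"]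
    ultimately have "Prf x t \<longleftrightarrow> (if isfm x then Pf x t \<and> (\<forall>k. \<not> bell t k) else bell t x)"
      unfolding Prf_def by (cases "isfm x") (simp_all only: simp_thms if_True if_False)
    then show ?thesis unfolding pf pF_def Let_def using 1 bt(2) bt(1)[of x]
      by (simp add: s_def[symmetric])
  next
    case (2 m)
    then obtain k where m: "m \<prec> t" "first_bell m k" using mev_pfirst(1)[OF e, of "PProj 2"] by (auto simp: s_def)
    have k: "mev (pbell \<tau> (PProj 0) (ppred (pfirst \<tau> (PProj 0) (PProj 2)))) ?xs = S k"
      using mev_pbell(1)[OF e, of "ppred (pfirst \<tau> (PProj 0) (PProj 2))" k] m(2) 2 by (simp add: s_def[symmetric] first_bell_def)
    have v: "mev (pvalid \<tau> (PProj 0) (ppred (pbell \<tau> (PProj 0) (ppred (pfirst \<tau> (PProj 0) (PProj 2))))) (ppred (pfirst \<tau> (PProj 0) (PProj 2)))) ?xs = ob (valid k m)"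
      using mev_pvalid[OF e] k 2 by (simp add: s_def[symmetric])
    have u: "(\<exists>m' k'. first_bell m' k' \<and> m' \<prec> t \<and> P m' k') \<longleftrightarrow> P m k" for P using first_bell_unique[OF m(2)] m by blast
    have n: "\<not> (\<forall>m k. bell m k \<longrightarrow> t \<prec> m)" using m unfolding first_bell_def by (metis L.less_asym)
    have n2: "\<not> first_bell t x" using first_bell_unique[OF m(2)] m(1) L.less_irrefl by blast
    show ?thesis unfolding pf pF_def Let_def using 2 n n2
      by (simp add: s_def[symmetric] k v Prf_def u) blast
  qed
qed

end

text \<open>The whole matrix of \<open>RF\<close> as one primitive recursive predicate, so that
  \<open>Pg_graph\<close> applies to it.\<close>

definition pH where
  "pH \<tau> = pand (pis_fm (PProj 0)) (pand (peq (PComp (pf \<tau>) [PProj 0, PProj 1]) (pnum 1))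
     (pnot (pex (peq (PComp (pf \<tau>) [pNeg (PProj 1), PProj 0]) (pnum 1)) (PProj 1) [PProj 0])))"

section \<open>Formalized Sigma-1 completeness for \<open>RF\<close> and \<open>SF\<close>\<close>

context theory_model begin

definition Rm :: "'m \<Rightarrow> bool" where
  "Rm x \<longleftrightarrow> (\<exists>y. isfm x \<and> Prf x y \<and> (\<forall>z. z \<prec> y \<longrightarrow> \<not> Prf (ng x) z))"
definition Sm :: "'m \<Rightarrow> bool" where "Sm x \<longleftrightarrow> (\<exists>y. Prf x y)"

lemma msat_Fml: "msat M e (app Fml [t]) \<longleftrightarrow> isfm (mval M e t)"
  by (simp add: app_Fml msat_graph)
lemma msat_PrfF: "msat M e (app (PrfF \<tau>) [s, t]) \<longleftrightarrow> Prf (mval M e s) (mval M e t)"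
  by (simp add: app_PrfF msat_graph mev_pf)
lemma mval_neg_tm: "mval M e (neg_tm t) = ng (mval M e t)"
  by (simp add: neg_tm_def ng_def del: numeral_tm.simps)
lemma msat_RF: "msat M e (RF \<tau>) \<longleftrightarrow> Rm (e 0)"
  by (simp add: RF_def Rm_def msat_Fml msat_PrfF mval_neg_tm)
lemma msat_SF: "msat M e (SF \<tau>) \<longleftrightarrow> Sm (e 0)"
  by (simp add: SF_def Sm_def msat_PrfF)
lemma mev_pH: "mev (pH \<tau>) [x, y] = ob (isfm x \<and> Prf x y \<and> (\<forall>z. z \<prec> y \<longrightarrow> \<not> Prf (ng x) z))"
  by (auto simp: pH_def mev_pf)

lemma Pv_RC: assumes "Rm x" shows "Pv (RC x)"
proof -
  obtain y where y: "isfm x \<and> Prf x y \<and> (\<forall>z. z \<prec> y \<longrightarrow> \<not> Prf (ng x) z)" using assms Rm_def by blast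
  \<comment> \<open>Variable 2 holds the truth value 1, since \<open>Pg_graph\<close> expects a
    variable in the place of the result.\<close>
  define a where "a i = (if i = 0 then x else if i = 1 then y else S Z)" for i :: nat
  have "Pg a (Imp (graph (pH \<tau>) (map Var [0, 1]) (Var 2)) (Imp (Eq (Var 2) (Succ Zero)) (RF \<tau>)))"
  proof (rule Pg_valid)
    fix M' :: "nat mstr" and e assume "pa_model M'"
    then interpret M': theory_model M' T \<tau> by (simp add: theory_model_def theory_model_axioms_def T PA_T)
    show "msat M' e (Imp (graph (pH \<tau>) (map Var [0, 1]) (Var 2)) (Imp (Eq (Var 2) (Succ Zero)) (RF \<tau>)))"
      by (auto simp: M'.msat_graph M'.mev_pH M'.msat_RF M'.Rm_def)
  qed
  moreover have "Pg a (graph (pH \<tau>) (map Var [0, 1]) (Var 2))"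
    by (rule Pg_graph) (use y in \<open>simp add: a_def mev_pH\<close>)
  moreover have "Pg a (Eq (Var 2) (Succ Zero))" by (rule Pg_eq) (simp add: a_def)
  ultimately have "Pg a (RF \<tau>)" using Pg_mp by blast
  then have "Pg (\<lambda>_. x) (RF \<tau>)" using Pg_cong[OF RF_below, of a "\<lambda>_. x"] by (simp add: a_def)
  then show ?thesis by (simp add: Pg_def RC_def)
qed

lemma Pv_SC: assumes "Sm x" shows "Pv (SC x)"
proof -
  obtain y where y: "Prf x y" using assms Sm_def by blast
  define a where "a i = (if i = 0 then x else if i = 1 then y else S Z)" for i :: nat
  have "Pg a (Imp (graph (pf \<tau>) (map Var [0, 1]) (Var 2)) (Imp (Eq (Var 2) (Succ Zero)) (SF \<tau>)))"
  proof (rule Pg_valid)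
    fix M' :: "nat mstr" and e assume "pa_model M'"
    then interpret M': theory_model M' T \<tau> by (simp add: theory_model_def theory_model_axioms_def T PA_T)
    show "msat M' e (Imp (graph (pf \<tau>) (map Var [0, 1]) (Var 2)) (Imp (Eq (Var 2) (Succ Zero)) (SF \<tau>)))"
      by (auto simp: M'.msat_graph M'.mev_pf M'.msat_SF M'.Sm_def)
  qed
  moreover have "Pg a (graph (pf \<tau>) (map Var [0, 1]) (Var 2))"
    by (rule Pg_graph) (use y in \<open>simp add: a_def mev_pf\<close>)
  moreover have "Pg a (Eq (Var 2) (Succ Zero))" by (rule Pg_eq) (simp add: a_def)
  ultimately have "Pg a (SF \<tau>)" using Pg_mp by blast
  then have "Pg (\<lambda>_. x) (SF \<tau>)" using Pg_cong[OF SF_below, of a "\<lambda>_. x"] by (simp add: a_def)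
  then show ?thesis by (simp add: Pg_def SC_def)
qed

section \<open>The phases of the enumeration\<close>

lemma trichotomy: obtains "t \<prec> m" | "t = m" | d where "t = S m \<oplus> d"
proof -
  consider "t \<prec> m" | "t = m" | "m \<prec> t" using L.linorder_cases by blast
  then show thesis using that less_iff[of m t] by (metis S_add add_S)
qed

lemma ex_first_bell: assumes "bell m k" obtains m' k' where "first_bell m' k'" "m' \<preceq> m"
proof -
  have "Dp (\<lambda>e. \<exists>k. bell (e 0) k)" by (intro D_intros)
  from ex_least[OF this, of m] assms obtain m' where m': "\<exists>k. bell m' k" "\<forall>m''. m'' \<prec> m' \<longrightarrow> \<not> (\<exists>k. bell m'' k)" by blast
  then obtain k' where "first_bell m' k'" unfolding first_bell_def by blast
  moreover have "m' \<preceq> m" using m'(2) assms L.not_le by blast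
  ultimately show thesis by (rule that)
qed

lemma Prf_pre: assumes "first_bell m k" "t \<prec> m" shows "Prf y t \<longleftrightarrow> Pf y t"
proof -
  have "bell m' k' \<Longrightarrow> t \<prec> m'" for m' k'
    using assms unfolding first_bell_def by (metis L.less_trans L.linorder_cases)
  moreover have "\<not> (first_bell m' k' \<and> m' \<prec> t)" for m' k' using first_bell_unique[OF assms(1)] assms(2) L.less_asym by blast
  moreover have "\<not> first_bell t y" using first_bell_unique[OF assms(1)] assms(2) L.less_irrefl by blast
  ultimately show ?thesis unfolding Prf_def using Pf_isfm[of y t] by blast
qed

lemma Prf_at: assumes "first_bell m k" shows "Prf y m \<longleftrightarrow> y = k \<and> \<not> isfm k"
proof -
  have "\<not> (\<forall>m' k'. bell m' k' \<longrightarrow> m \<prec> m')" using assms L.less_irrefl unfolding first_bell_def by blast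
  moreover have "\<not> (first_bell m' k' \<and> m' \<prec> m)" for m' k' using first_bell_unique[OF assms(1)] L.less_irrefl by blast
  ultimately show ?thesis unfolding Prf_def using first_bell_unique[OF assms] assms by blast
qed

lemma Prf_post: assumes "first_bell m k" "isfm y"
  shows "Prf y (S m \<oplus> d) \<longleftrightarrow> (if d \<prec> k then \<not> isfm k \<and> valid k m \<and> ent (Lk k) d y else y = d \<ominus> k)"
proof -
  have m: "m \<prec> S m \<oplus> d" by simp
  have 1: "\<not> (\<forall>m' k'. bell m' k' \<longrightarrow> S m \<oplus> d \<prec> m')" using assms(1) m L.less_asym unfolding first_bell_def by blast
  have u: "(\<exists>m' k'. first_bell m' k' \<and> m' \<prec> S m \<oplus> d \<and> P m' k') \<longleftrightarrow> P m k" for P using first_bell_unique[OF assms(1)] m assms(1) by blast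
  show ?thesis unfolding Prf_def u add_sub(1) using 1 assms(2) by blast
qed

lemma Prf_no_bell: assumes "\<And>m k. \<not> bell m k" shows "Prf y t \<longleftrightarrow> Pf y t"
  unfolding Prf_def first_bell_def using assms Pf_isfm[of y t] by blast

definition negd :: "'m \<Rightarrow> bool" where "negd x \<longleftrightarrow> (\<exists>z. Prf (ng x) z \<and> (\<forall>u. u \<preceq> z \<longrightarrow> \<not> Prf x u))"

lemma negd_not_Rm: assumes "negd x" "Rm x" shows False
proof -
  obtain z where z: "Prf (ng x) z" "\<forall>u. u \<preceq> z \<longrightarrow> \<not> Prf x u" using assms(1) negd_def by blast
  obtain y where y: "Prf x y" "\<forall>z. z \<prec> y \<longrightarrow> \<not> Prf (ng x) z" using assms(2) Rm_def by blast
  show False using z y L.not_le by blast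
qed

text \<open>\<open>neg1\<close> speaks of proofs, \<open>negd\<close> of the enumeration; the two
  orders agree as long as the bell has not rung.\<close>

lemma neg1_negd: assumes "neg1 x t" and pre: "\<And>y u. u \<prec> t \<Longrightarrow> Prf y u \<longleftrightarrow> Pf y u" shows "negd x"
proof -
  obtain z where z: "z \<prec> t" "Pf (ng x) z" "\<forall>u. u \<prec> S z \<longrightarrow> \<not> Pf x u" using assms(1) unfolding neg1_def by blast
  have "\<not> Prf x u" if "u \<preceq> z" for u
    using that z(3) pre[of u x] z(1) by (metis L.le_less_trans less_S_le)
  moreover have "Prf (ng x) z" using pre z by blast
  ultimately show ?thesis unfolding negd_def by blast
qed

lemma default_output: assumes "first_bell m k" "isfm y" shows "Prf y (S m \<oplus> (k \<oplus> y))"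
proof -
  have "\<not> k \<oplus> y \<prec> k" by (simp add: L.not_less)
  then show ?thesis unfolding Prf_post[OF assms] by simp
qed

text \<open>The model proves the negation of a Sigma-1 sentence that it makes true, and by
  \<open>Pv_RC\<close> or \<open>Pv_SC\<close> it proves the sentence as well. \<open>SF(k)\<close>
  holds because \<open>k\<close> is enumerated at the bell; \<open>RF(k)\<close> holds because
  \<open>k\<close> was not refuted in time.\<close>

lemma bell_inconsistent: assumes "bell m0 k0" "isfm y" shows "Pv y"
proof -
  obtain m k where mk: "first_bell m k" using ex_first_bell[OF assms(1)] by blast
  then have c: "bell_cond k m" unfolding first_bell_def bell_def by blast
  show ?thesis
  proof (cases "isfm k")
    case False
    then have "Pf (hd' m) m" "\<exists>p. p \<prec> m \<and> Pf (imp (hd' m) (ng (SC k))) p" using c unfolding bell_cond_def by auto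
    then have "Pv (ng (SC k))" using Pv_mp unfolding Pv_def by blast
    moreover have "Sm k" unfolding Sm_def using Prf_at[OF mk, of k] False by blast
    ultimately show ?thesis using Pv_exfalso[OF Pv_SC] assms(2) by blast
  next
    case True
    then have p: "Pf (ng (RC k)) m" "\<not> neg1 k m" using c unfolding bell_cond_def by auto
    have "Rm k"
    proof (cases "\<exists>u. u \<prec> m \<and> Pf k u")
      case u: True
      have "Dp (\<lambda>e. e 0 \<prec> m \<and> Pf k (e 0))" by (intro D_intros)
      from ex_least[OF this] u obtain u where u: "u \<prec> m" "Pf k u" "\<forall>v. v \<prec> u \<longrightarrow> \<not> (v \<prec> m \<and> Pf k v)" by blast
      have "\<not> Prf (ng k) z" if z: "z \<prec> u" for z
      proof
        assume "Prf (ng k) z"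
        then have "Pf (ng k) z" using Prf_pre[OF mk] z u(1) L.less_trans by blast
        moreover have "\<not> (\<exists>v. v \<prec> S z \<and> Pf k v)" using u z by (metis L.le_less_trans L.less_trans less_S_le)
        ultimately show False using p(2) z u(1) L.less_trans unfolding neg1_def by blast
      qed
      moreover have "Prf k u" using Prf_pre[OF mk u(1)] u(2) by blast
      ultimately show ?thesis unfolding Rm_def using True by blast
    next
      \<comment> \<open>Here \<open>k\<close> is neither proved nor refuted before the bell. As
        \<open>k\<close> codes a formula, no list is enumerated, and the order of codes puts
        \<open>k\<close> before \<open>ng k\<close>.\<close>
      case nu: False
      then have nn: "\<not> (z \<prec> m \<and> Pf (ng k) z)" for z
        using p(2) L.le_less_trans unfolding neg1_def less_S_le by blast
      have "\<not> Prf (ng k) z" if z: "z \<prec> S m \<oplus> (k \<oplus> k)" for z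
      proof
        assume P: "Prf (ng k) z"
        show False
        proof (cases z m rule: trichotomy)
          case 1 then show False using Prf_pre[OF mk 1] P nn by blast
        next
          case 2 then show False using Prf_at[OF mk] P True by simp
        next
          case (3 d)
          then have d: "\<not> d \<prec> k" "ng k = d \<ominus> k" using P Prf_post[OF mk, of "ng k" d] True by (auto split: if_splits)
          then obtain c where c: "d = k \<oplus> c" using L.not_less le_iff by blast
          then have "c = ng k" using d(2) by simp
          moreover have "c \<prec> k" using z 3 c by (simp add: L.add_less_cancel_left)
          ultimately show False using ng_gt[of k] L.less_asym by blast
        qed
      qed
      then show ?thesis unfolding Rm_def using default_output[OF mk True] True by blast
    qed
    then have "Pv (RC k)" by (rule Pv_RC)
    moreover have "Pv (ng (RC k))" using p(1) unfolding Pv_def by blast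
    ultimately show ?thesis using Pv_exfalso assms(2) by blast
  qed
qed

text \<open>After a bell both sides hold of every formula; without one the two proof relations
  coincide.\<close>

lemma Pv_iff_Prf: assumes "isfm x" shows "Pv x \<longleftrightarrow> (\<exists>y. Prf x y)"
proof (cases "\<exists>m k. bell m k")
  case False
  then show ?thesis using Prf_no_bell unfolding Pv_def by blast
next
  case True
  then obtain m0 k0 where b: "bell m0 k0" by blast
  then obtain m k where "first_bell m k" using ex_first_bell by blast
  then show ?thesis using default_output[OF _ assms] bell_inconsistent[OF b assms] by blast
qed

lemma bell_cond_bell: assumes "bell_cond k t" "k \<preceq> t" shows "\<exists>k. bell t k"
proof -
  have "Dp (\<lambda>e. bell_cond (e 0) t)" by (intro D_intros)
  from ex_least[OF this, OF assms(1)] obtain k' where k': "bell_cond k' t" "\<forall>j. j \<prec> k' \<longrightarrow> \<not> bell_cond j t" by blast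
  have "k' \<preceq> t" using k' assms L.not_le L.order_trans by blast
  then show ?thesis using k' unfolding bell_def by blast
qed

text \<open>Otherwise the first clause of \<open>bell_cond\<close> would hold at \<open>z\<close>,
  and the proof \<open>z\<close> is larger than \<open>x\<close> because it ends in a formula that
  contains the numeral of \<open>x\<close>.\<close>

lemma no_bell_neg1: assumes "Pf (ng (RC x)) z" "isfm x" "\<And>k. \<not> bell z k" shows "neg1 x z"
proof (rule ccontr)
  assume "\<not> neg1 x z"
  then have "bell_cond x z" unfolding bell_cond_def using assms by blast
  moreover have "x \<preceq> z" using RC_ge[of x] ng_gt[of "RC x"] Pf_less[OF assms(1)]
    by (metis L.less_imp_le L.order_trans)
  ultimately show False using bell_cond_bell assms(3) by blast
qed

text \<open>\<open>RC x\<close> is provable in the model, so only an earlier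
  \<open>ng (RC x)\<close> could spoil it. Before the bell that forces \<open>neg1 x\<close>, in the
  list \<open>valid\<close> forces an early refutation of \<open>x\<close>, and in the final phase
  codes are listed in increasing order. Each refutation contradicts \<open>Rm x\<close>.\<close>

lemma Rm_four: assumes "Rm x" shows "Rm (RC x)"
proof -
  have x: "isfm x" using assms unfolding Rm_def by blast
  have fx: "isfm (RC x)" using Pv_isfm[OF Pv_RC[OF assms]] .
  have nn: "\<not> negd x" using negd_not_Rm assms by blast
  show ?thesis
  proof (cases "\<exists>m k. bell m k")
    case False
    then have nb: "\<And>m k. \<not> bell m k" by blast
    obtain t where t: "Pf (RC x) t" using Pv_RC[OF assms] unfolding Pv_def by blast
    have "\<not> Prf (ng (RC x)) z" for z
    proof
      assume "Prf (ng (RC x)) z"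
      then have "neg1 x z" using no_bell_neg1 Prf_no_bell[OF nb] x nb by blast
      then show False using neg1_negd[of x z] Prf_no_bell[OF nb] nn by blast
    qed
    then show ?thesis unfolding Rm_def using t Prf_no_bell[OF nb] fx by blast
  next
    case True
    then obtain m k where mk: "first_bell m k" using ex_first_bell by blast
    \<comment> \<open>The first time at which \<open>RC x\<close> is enumerated exists, since the
      final phase reaches every formula.\<close>
    have "Dp (\<lambda>e. mev (pf \<tau>) [RC x, e 0] = S Z)" by (intro D_intros)
    then have "Dp (\<lambda>e. Prf (RC x) (e 0))" by (simp add: mev_pf)
    from ex_least[OF this, OF default_output[OF mk fx]] obtain t where
      t: "Prf (RC x) t" "\<forall>s. s \<prec> t \<longrightarrow> \<not> Prf (RC x) s" by blast
    have "\<not> Prf (ng (RC x)) z" if z: "z \<prec> t" for z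
    proof
      assume P: "Prf (ng (RC x)) z"
      show False
      proof (cases z m rule: trichotomy)
        case 1
        then have "Pf (ng (RC x)) z" using P Prf_pre[OF mk] by blast
        moreover have "\<And>k. \<not> bell z k" using mk 1 unfolding first_bell_def by blast
        ultimately have "neg1 x z" using no_bell_neg1 x by blast
        then show False using neg1_negd[of x z] Prf_pre[OF mk] 1 L.less_trans nn by blast
      next
        case 2 then show False using Prf_at[OF mk] P fx by auto
      next
        case (3 d)
        show False
        proof (cases "d \<prec> k")
          case True
          then have v: "\<not> isfm k" "valid k m" "ent (Lk k) d (ng (RC x))" using P 3 Prf_post[OF mk, of "ng (RC x)" d] fx by simp_all
          have "\<not> ent (Lk k) i (RC x)" if "i \<prec> d" for i
          proof
            assume "ent (Lk k) i (RC x)"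
            then have "Prf (RC x) (S m \<oplus> i)" using Prf_post[OF mk fx, of i] v L.less_trans[OF that True] by simp
            moreover have "S m \<oplus> i \<prec> t" using L.less_trans[OF _ z] that 3 by (simp add: L.add_less_cancel_left)
            ultimately show False using t(2) by blast
          qed
          \<comment> \<open>The remaining alternative of \<open>valid\<close> would place
            \<open>RC x\<close> before the time \<open>t\<close> of its first enumeration.\<close>
          then have "neg1 x m \<or> \<not> (\<exists>u. u \<prec> m \<and> Pf x u) \<and> negL x d (Lk k)" using v(2,3) x unfolding valid_def by blast
          then have "negd x"
          proof
            assume "neg1 x m" then show ?thesis using neg1_negd[of x m] Prf_pre[OF mk] by blast
          next
            assume "\<not> (\<exists>u. u \<prec> m \<and> Pf x u) \<and> negL x d (Lk k)"
            then obtain i where i: "\<not> (\<exists>u. u \<prec> m \<and> Pf x u)" "i \<prec> d" "ent (Lk k) i (ng x)" "\<not> (\<exists>i'. i' \<prec> S i \<and> ent (Lk k) i' x)"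
              unfolding negL_def by blast
            have ik: "i \<prec> k" using i(2) True L.less_trans by blast
            have "Prf (ng x) (S m \<oplus> i)" using Prf_post[OF mk, of "ng x" i] x ik v i(3) by simp
            moreover have "\<not> Prf x u" if u: "u \<preceq> S m \<oplus> i" for u
            proof (cases u m rule: trichotomy)
              case 1 then show ?thesis using Prf_pre[OF mk 1] i(1) by blast
            next
              case 2 then show ?thesis using Prf_at[OF mk] x v(1) by auto
            next
              case (3 j)
              then have ji: "j \<preceq> i" using u by (simp add: less_S_le L.add_le_cancel_left)
              then have "j \<prec> k" using ik L.le_less_trans by blast
              then show ?thesis using 3 Prf_post[OF mk x, of j] i(4) ji less_S_le by auto
            qed
            ultimately show ?thesis unfolding negd_def by blast
          qed
          then show False using nn by blast
        next
          case False
          then obtain c where c: "d = k \<oplus> c" using L.not_less le_iff by blast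
          then have "c = ng (RC x)" using P 3 False Prf_post[OF mk, of "ng (RC x)" d] fx by simp
          then have "RC x \<prec> c" using ng_gt by simp
          then have "S m \<oplus> (k \<oplus> RC x) \<prec> z" using 3 c by (simp add: L.add_less_cancel_left)
          then show False using t(2) z default_output[OF mk fx] L.less_trans by blast
        qed
      qed
    qed
    then show ?thesis unfolding Rm_def using t(1) fx by blast
  qed
qed

end

section \<open>Sigma-1 definability of the Rosser predicate\<close>

lemma delta0_fsubst: "delta0 \<phi> \<Longrightarrow> delta0 (fsubst \<rho> \<phi>)"
proof (induction arbitrary: \<rho> rule: delta0.induct)
  case (7 \<phi> t)
  have "fsubst \<rho> (Forall (Imp (Less (Var 0) (tlift 1 t)) \<phi>)) = Forall (Imp (Less (Var 0) (tlift 1 (tsubst \<rho> t))) (fsubst (up \<rho>) \<phi>))"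
    by (simp add: tsubst_up_tlift del: One_nat_def)
  then show ?case using 7 delta0.intros(7) by simp
next
  case (8 \<phi> t)
  have "fsubst \<rho> (Exists (Conj (Less (Var 0) (tlift 1 t)) \<phi>)) = Exists (Conj (Less (Var 0) (tlift 1 (tsubst \<rho> t))) (fsubst (up \<rho>) \<phi>))"
    by (simp add: tsubst_up_tlift del: One_nat_def)
  then show ?case using 8 delta0.intros(8) by simp
qed (auto intro: delta0.intros)

text \<open>By completeness, equivalence in all models is equivalence in \<open>PA\<close>. A single
  unbounded quantifier is kept as normal form.\<close>

definition Sg :: "fm \<Rightarrow> bool" where
  "Sg \<phi> \<longleftrightarrow> (\<exists>\<delta>. delta0 \<delta> \<and> (\<forall>(M :: nat mstr) e. pa_model M \<longrightarrow> (msat M e \<phi> \<longleftrightarrow> (\<exists>x. msat M (case_nat x e) \<delta>))))"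

lemma SgI: "delta0 \<delta> \<Longrightarrow> (\<And>(M :: nat mstr) e. pa_model M \<Longrightarrow> msat M e \<phi> \<longleftrightarrow> (\<exists>x. msat M (case_nat x e) \<delta>)) \<Longrightarrow> Sg \<phi>"
  unfolding Sg_def by blast

lemma Sg_Sigma1: assumes "Sg \<phi>" shows "Sigma1 \<phi>"
proof -
  obtain \<delta> where d: "delta0 \<delta>" "\<And>(M :: nat mstr) e. pa_model M \<Longrightarrow> msat M e \<phi> \<longleftrightarrow> (\<exists>x. msat M (case_nat x e) \<delta>)"
    using assms unfolding Sg_def by blast
  have "PA \<turnstile> Iff \<phi> ((Exists ^^ 1) \<delta>)" by (rule PA_complete) (simp add: d(2))
  then show ?thesis unfolding Sigma1_def using d(1) by blast
qed

lemma Sg_equiv: "(\<And>(M :: nat mstr) e. pa_model M \<Longrightarrow> msat M e \<phi> \<longleftrightarrow> msat M e \<psi>) \<Longrightarrow> Sg \<psi> \<Longrightarrow> Sg \<phi>"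
  unfolding Sg_def by simp

lemma Sg_delta0: "delta0 \<phi> \<Longrightarrow> Sg \<phi>"
  by (rule SgI[of "fshift \<phi>"]) (simp_all add: fshift_def delta0_fsubst msat_fsubst)

text \<open>These make room for a common bound of the witnesses, inserted behind the first variable
  (\<open>sh2\<close>) or behind the first two (\<open>sh3\<close>).\<close>

definition sh2 :: "nat \<Rightarrow> tm" where "sh2 = case_nat (Var 0) (\<lambda>i. Var (i + 2))"
definition sh3 :: "nat \<Rightarrow> tm" where "sh3 = case_nat (Var 0) (case_nat (Var 1) (\<lambda>i. Var (i + 3)))"

lemma msat_sh2: "msat M (case_nat x (case_nat b e)) (fsubst sh2 \<delta>) \<longleftrightarrow> msat M (case_nat x e) \<delta>"
proof -
  have "(\<lambda>i. mval M (case_nat x (case_nat b e)) (sh2 i)) = case_nat x e"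
    by (rule ext) (simp add: sh2_def split: nat.split)
  then show ?thesis by (simp add: msat_fsubst)
qed
lemma msat_sh3: "msat M (case_nat x (case_nat y (case_nat b e))) (fsubst sh3 \<delta>) \<longleftrightarrow> msat M (case_nat x (case_nat y e)) \<delta>"
proof -
  have "(\<lambda>i. mval M (case_nat x (case_nat y (case_nat b e))) (sh3 i)) = case_nat x (case_nat y e)"
    by (rule ext) (simp add: sh3_def split: nat.split)
  then show ?thesis by (simp add: msat_fsubst)
qed

lemma delta0_ex1: "delta0 \<delta> \<Longrightarrow> delta0 (Exists (Conj (Less (Var 0) (Var 1)) \<delta>))"
  using delta0.intros(8)[of \<delta> "Var 0"] by simp
lemma delta0_ex2: "delta0 \<delta> \<Longrightarrow> delta0 (Exists (Conj (Less (Var 0) (Var 2)) \<delta>))"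
  using delta0.intros(8)[of \<delta> "Var 1"] by (simp add: numeral_2_eq_2)

lemma Sg_conj: assumes "Sg \<phi>" "Sg \<psi>" shows "Sg (Conj \<phi> \<psi>)"
proof -
  obtain \<delta> where d: "delta0 \<delta>" "\<And>(M :: nat mstr) e. pa_model M \<Longrightarrow> msat M e \<phi> \<longleftrightarrow> (\<exists>x. msat M (case_nat x e) \<delta>)"
    using assms(1) unfolding Sg_def by blast
  obtain \<eta> where h: "delta0 \<eta>" "\<And>(M :: nat mstr) e. pa_model M \<Longrightarrow> msat M e \<psi> \<longleftrightarrow> (\<exists>x. msat M (case_nat x e) \<eta>)"
    using assms(2) unfolding Sg_def by blast
  show ?thesis
  proof (rule SgI[of "Conj (Exists (Conj (Less (Var 0) (Var 1)) (fsubst sh2 \<delta>))) (Exists (Conj (Less (Var 0) (Var 1)) (fsubst sh2 \<eta>)))"])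
    show "delta0 (Conj (Exists (Conj (Less (Var 0) (Var 1)) (fsubst sh2 \<delta>))) (Exists (Conj (Less (Var 0) (Var 1)) (fsubst sh2 \<eta>))))"
      by (intro delta0.intros(4) delta0_ex1 delta0_fsubst d h)
    fix M :: "nat mstr" and e assume M: "pa_model M"
    interpret pa_model M by fact
    have "(\<exists>b. (\<exists>x. les M x b \<and> P x) \<and> (\<exists>x. les M x b \<and> Q x)) \<longleftrightarrow> (\<exists>x. P x) \<and> (\<exists>x. Q x)" for P Q
      by (metis less_add1(1) less_add1(2))
    then show "msat M e (Conj \<phi> \<psi>) \<longleftrightarrow> (\<exists>x. msat M (case_nat x e) (Conj (Exists (Conj (Less (Var 0) (Var 1)) (fsubst sh2 \<delta>))) (Exists (Conj (Less (Var 0) (Var 1)) (fsubst sh2 \<eta>)))))"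
      by (simp add: d(2)[OF M] h(2)[OF M] msat_sh2)
  qed
qed

lemma Sg_ex: assumes "Sg \<phi>" shows "Sg (Exists \<phi>)"
proof -
  obtain \<delta> where d: "delta0 \<delta>" "\<And>(M :: nat mstr) e. pa_model M \<Longrightarrow> msat M e \<phi> \<longleftrightarrow> (\<exists>x. msat M (case_nat x e) \<delta>)"
    using assms(1) unfolding Sg_def by blast
  show ?thesis
  proof (rule SgI[of "Exists (Conj (Less (Var 0) (Var 1)) (Exists (Conj (Less (Var 0) (Var 2)) (fsubst sh3 \<delta>))))"])
    show "delta0 (Exists (Conj (Less (Var 0) (Var 1)) (Exists (Conj (Less (Var 0) (Var 2)) (fsubst sh3 \<delta>)))))"
      by (intro delta0_ex1 delta0_ex2 delta0_fsubst d)
    fix M :: "nat mstr" and e assume M: "pa_model M"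
    interpret pa_model M by fact
    have "(\<exists>b y. les M y b \<and> (\<exists>x. les M x b \<and> P x y)) \<longleftrightarrow> (\<exists>y x. P x y)" for P
      by (metis less_add1(1) less_add1(2))
    then show "msat M e (Exists \<phi>) \<longleftrightarrow> (\<exists>x. msat M (case_nat x e) (Exists (Conj (Less (Var 0) (Var 1)) (Exists (Conj (Less (Var 0) (Var 2)) (fsubst sh3 \<delta>))))))"
      by (simp add: d(2)[OF M] msat_sh3)
  qed
qed

text \<open>Moves an unbounded quantifier in front of a bounded universal one, as the graph of a
  primitive recursion and the matrix of \<open>RF\<close> require.\<close>

lemma (in pa_model) collection:
  assumes "Dp (\<lambda>e. Q (e 0) (e 1))" "\<forall>y. y \<prec> n \<longrightarrow> (\<exists>x. Q x y)"
  shows "\<exists>b. \<forall>y. y \<prec> n \<longrightarrow> (\<exists>x. x \<prec> b \<and> Q x y)"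
proof -
  have "n' \<preceq> n \<longrightarrow> (\<exists>b. \<forall>y. y \<prec> n' \<longrightarrow> (\<exists>x. x \<prec> b \<and> Q x y))" for n'
  proof (rule ind[where x = n'])
    have "Dp (\<lambda>e. Q (e 0) (e (Suc 0)))" using assms(1) by simp
    then have Q: "Dp (\<lambda>e. Q (e i) (e j))" for i j
      using Dp_rename[of "\<lambda>e. Q (e 0) (e (Suc 0))" "\<lambda>k. if k = 0 then i else j"] by simp
    show "Dp (\<lambda>e. e 0 \<preceq> n \<longrightarrow> (\<exists>b. \<forall>y. y \<prec> e 0 \<longrightarrow> (\<exists>x. x \<prec> b \<and> Q x y)))"
      by (intro D_intros Q)
    fix k assume IH: "k \<preceq> n \<longrightarrow> (\<exists>b. \<forall>y. y \<prec> k \<longrightarrow> (\<exists>x. x \<prec> b \<and> Q x y))"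
    show "S k \<preceq> n \<longrightarrow> (\<exists>b. \<forall>y. y \<prec> S k \<longrightarrow> (\<exists>x. x \<prec> b \<and> Q x y))"
    proof
      assume "S k \<preceq> n"
      then have k: "k \<prec> n" by simp
      then obtain b where b: "\<forall>y. y \<prec> k \<longrightarrow> (\<exists>x. x \<prec> b \<and> Q x y)" using IH L.less_imp_le by blast
      obtain x where x: "Q x k" using assms(2) k by blast
      have "\<exists>x'. x' \<prec> S (b \<oplus> x) \<and> Q x' y" if y: "y \<prec> S k" for y
      proof (cases "y = k")
        case True then show ?thesis using x less_add1(2) by blast
      next
        case False
        then have "y \<prec> k" using y by (simp add: less_S)
        then obtain x' where "x' \<prec> b" "Q x' y" using b by blast
        then show ?thesis using L.less_trans less_add1(1) by blast
      qed
      then show "\<exists>b. \<forall>y. y \<prec> S k \<longrightarrow> (\<exists>x. x \<prec> b \<and> Q x y)" by blast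
    qed
  qed simp
  then show ?thesis using L.order_refl by blast
qed

lemma (in pa_model) Dp_msat: "Dp (\<lambda>e. msat M (case_nat (e 0) (case_nat (e 1) e')) \<delta>)"
proof (rule DpI[of _ e' "fsubst (case_nat (Var 0) (case_nat (Var 2) (\<lambda>i. Var (Suc (2 * i))))) \<delta>"])
  fix e
  have "(\<lambda>i. mval M (mix e e') (case_nat (Var 0) (case_nat (Var 2) (\<lambda>i. Var (Suc (2 * i)))) i)) = case_nat (e 0) (case_nat (e 1) e')"
    by (rule ext) (simp add: mix_def split: nat.split)
  then show "msat M (case_nat (e 0) (case_nat (e 1) e')) \<delta> \<longleftrightarrow> msat M (mix e e') (fsubst (case_nat (Var 0) (case_nat (Var 2) (\<lambda>i. Var (Suc (2 * i))))) \<delta>)"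
    by (simp add: msat_fsubst)
qed

lemma Sg_ball: assumes "Sg \<phi>" shows "Sg (Forall (Imp (Less (Var 0) (tlift 1 t)) \<phi>))"
proof -
  obtain \<delta> where d: "delta0 \<delta>" "\<And>(M :: nat mstr) e. pa_model M \<Longrightarrow> msat M e \<phi> \<longleftrightarrow> (\<exists>x. msat M (case_nat x e) \<delta>)"
    using assms(1) unfolding Sg_def by blast
  show ?thesis
  proof (rule SgI[of "Forall (Imp (Less (Var 0) (tlift 1 (tlift 1 t))) (Exists (Conj (Less (Var 0) (Var 2)) (fsubst sh3 \<delta>))))"])
    show "delta0 (Forall (Imp (Less (Var 0) (tlift 1 (tlift 1 t))) (Exists (Conj (Less (Var 0) (Var 2)) (fsubst sh3 \<delta>)))))"
      by (intro delta0.intros(7) delta0_ex2 delta0_fsubst d)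
    fix M :: "nat mstr" and e assume M: "pa_model M"
    interpret pa_model M by fact
    let ?n = "mval M e t"
    have "(\<forall>y. les M y ?n \<longrightarrow> (\<exists>x. msat M (case_nat x (case_nat y e)) \<delta>)) \<longleftrightarrow>
       (\<exists>b. \<forall>y. les M y ?n \<longrightarrow> (\<exists>x. les M x b \<and> msat M (case_nat x (case_nat y e)) \<delta>))"
      using collection[OF Dp_msat[of e \<delta>], of ?n] by blast
    then show "msat M e (Forall (Imp (Less (Var 0) (tlift 1 t)) \<phi>)) \<longleftrightarrow>
       (\<exists>x. msat M (case_nat x e) (Forall (Imp (Less (Var 0) (tlift 1 (tlift 1 t))) (Exists (Conj (Less (Var 0) (Var 2)) (fsubst sh3 \<delta>))))))"
      by (simp add: d(2)[OF M] msat_sh3)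
  qed
qed

lemma Sg_Exs: "Sg \<phi> \<Longrightarrow> Sg ((Exists ^^ n) \<phi>)"
  by (induction n) (simp_all add: Sg_ex)
lemma Sg_conjs: "\<forall>A\<in>set As. Sg A \<Longrightarrow> Sg B \<Longrightarrow> Sg (foldr Conj As B)"
  by (induction As) (simp_all add: Sg_conj)

lemma Sg_beta: "Sg (beta_fm a b i w)"
  using delta0.intros(8)[of _ "Succ a"] by (auto simp: beta_fm_def Let_def intro!: Sg_delta0 intro: delta0.intros)

lemma Sg_graph: "Sg (graph f ts t)"
proof (induction f ts t rule: graph.induct)
  case (4 f gs ts t)
  show ?case unfolding graph.simps Let_def
  proof (rule Sg_Exs, rule Sg_conjs)
    show "\<forall>A\<in>set (map (\<lambda>(i, g). graph g (map (tlift (length gs)) ts) (Var i)) (zip [0..<length gs] gs)). Sg A"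
      using 4(2)[OF refl _ refl] by auto
  qed (rule 4(1)[OF refl])
next
  case (6 f g n ts t)
  have "tlift 3 n = tlift 1 (tlift 2 n)" by (simp only: tlift_tlift) (simp add: numeral_3_eq_3 numeral_2_eq_2)
  then show ?case unfolding graph.simps
    by (simp only:) (intro Sg_ex Sg_conj Sg_ball Sg_beta 6)
qed (auto intro!: Sg_delta0 intro: delta0.intros)

lemma Sigma1_RF: "Sigma1 (RF \<tau>)"
proof (rule Sg_Sigma1)
  \<comment> \<open>The graph belongs to a total function, so it misses the value 1 exactly if it
    has some other value; this makes the negation Sigma-1 too.\<close>
  have n: "Sg (Neg (graph (pf \<tau>) [s, t] (Succ Zero)))" for s t
  proof (rule Sg_equiv)
    show "Sg (Exists (Conj (graph (pf \<tau>) [tlift 1 s, tlift 1 t] (Var 0)) (Neg (Eq (Var 0) (Succ Zero)))))"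
      by (intro Sg_ex Sg_conj Sg_graph Sg_delta0) (auto intro: delta0.intros)
    fix M :: "nat mstr" and e assume "pa_model M"
    then interpret pa_model M .
    show "msat M e (Neg (graph (pf \<tau>) [s, t] (Succ Zero))) \<longleftrightarrow>
       msat M e (Exists (Conj (graph (pf \<tau>) [tlift 1 s, tlift 1 t] (Var 0)) (Neg (Eq (Var 0) (Succ Zero)))))"
      by (auto simp: msat_graph)
  qed
  have "Sg (Forall (Imp (Less (Var 0) (tlift 1 (Var 0))) (Neg (graph (pf \<tau>) [neg_tm (Var 2), Var 0] (Succ Zero)))))"
    by (intro Sg_ball n)
  then show "Sg (RF \<tau>)" unfolding RF_def app_PrfF app_Fml
    by (intro Sg_ex Sg_conj Sg_graph) simp
qed

section \<open>The standard model\<close>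

definition stdM :: "nat mstr" where
  "stdM = \<lparr>zer = 0, suc = Suc, add = (+), mul = (*), les = (<)\<rparr>"

lemma stdM_simps [simp]: "zer stdM = 0" "suc stdM = Suc" "add stdM = (+)" "mul stdM = (*)" "les stdM = (<)"
  by (simp_all add: stdM_def)

lemma pa_model_stdM: "pa_model stdM"
proof
  fix \<phi> e assume "\<phi> \<in> PA"
  then show "msat stdM e \<phi>"
  proof cases
    case (9 n \<psi>)
    have i: "msat stdM e (induction_fm \<psi>)" for e
    proof -
      have eq: "(\<lambda>i. mval stdM (case_nat x e) (case i of 0 \<Rightarrow> Succ (Var 0) | Suc i \<Rightarrow> Var (Suc i))) = case_nat (Suc x) e" for x
        by (rule ext) (simp split: nat.split)
      show ?thesis unfolding induction_fm_def msat.simps msat_inst msat_fsubst eq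
      proof (intro impI allI)
        fix x assume a: "msat stdM (case_nat (mval stdM e Zero) e) \<psi> \<and> (\<forall>x. msat stdM (case_nat x e) \<psi> \<longrightarrow> msat stdM (case_nat (Suc x) e) \<psi>)"
        show "msat stdM (case_nat x e) \<psi>" by (induction x) (use a in simp_all)
      qed
    qed
    have "msat stdM e ((Forall ^^ n) (induction_fm \<psi>))" for e by (induction n arbitrary: e) (simp_all add: i)
    then show ?thesis using 9 by simp
  qed auto
qed

section \<open>Standard stages and arithmetical soundness\<close>

locale rosser =
  fixes T :: "fm set" and \<tau> :: pr
  assumes T: "pr_axiomatized \<tau> T" and con: "consistent T" and PA_T: "\<forall>\<phi>\<in>PA. T \<turnstile> \<phi>"
begin

lemma tm: "pa_model M \<Longrightarrow> theory_model M T \<tau>"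
  by (simp add: theory_model_def theory_model_axioms_def T PA_T)

sublocale N: theory_model stdM T \<tau>
  by (rule tm[OF pa_model_stdM])

lemma N_nm [simp]: "N.nm n = n" by (induction n) simp_all

text \<open>In the standard model \<open>Pv\<close> is actual provability, so a bell would make
  \<open>T\<close> inconsistent.\<close>

lemma N_no_bell: "\<not> N.bell m k"
proof
  assume b: "N.bell m k"
  have "T \<turnstile> \<phi>" for \<phi>
  proof -
    have "N.Pv (gn \<phi>)" using N.bell_inconsistent[OF b] N.isfm_gn[of "gn \<phi>"] by simp
    then obtain y where "N.Pf (gn \<phi>) y" unfolding N.Pv_def by blast
    then have "eval (pproof \<tau>) [gn \<phi>, y] = 1" using N.Pf_nm[of \<phi> y] by simp
    then show ?thesis using pproof_derivable[OF T, of \<phi>] by blast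
  qed
  then show False using con unfolding consistent_def by blast
qed

lemma eval_pf: "eval (pf \<tau>) [gn \<phi>, n] = 1 \<longleftrightarrow> eval (pproof \<tau>) [gn \<phi>, n] = 1"
proof -
  have e: "eval (pf \<tau>) [gn \<phi>, n] = N.ob (N.Prf (gn \<phi>) n)" using N.mev_nm[of "pf \<tau>" "[gn \<phi>, n]"] N.mev_pf[of "gn \<phi>" n] by simp
  have "eval (pf \<tau>) [gn \<phi>, n] = 1 \<longleftrightarrow> N.Prf (gn \<phi>) n" unfolding e using N.ob_simps(2) by simp
  also have "\<dots> \<longleftrightarrow> N.Pf (gn \<phi>) n" by (rule N.Prf_no_bell[OF N_no_bell])
  also have "\<dots> \<longleftrightarrow> eval (pproof \<tau>) [gn \<phi>, n] = 1" using N.Pf_nm[of \<phi> n] by simp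
  finally show ?thesis .
qed

end

lemma (in pa_model) nm_eq_S_Z: "nm n = S Z \<longleftrightarrow> n = 1"
  using nm_inj[of n 1] by (simp del: nm_inj)

locale rosser_model = rosser T \<tau> + theory_model M T \<tau> for T \<tau> and M :: "'m mstr"
begin

text \<open>The bell is silent in the standard model and values at standard arguments are absolute.
  Hence even a model with a bell enumerates at its standard stages just what \<open>T\<close>
  proves.\<close>

lemma Prf_std: "Prf (nm (gn \<phi>)) (nm n) \<longleftrightarrow> eval (pproof \<tau>) [gn \<phi>, n] = 1"
proof -
  have "ob (Prf (nm (gn \<phi>)) (nm n)) = nm (eval (pf \<tau>) [gn \<phi>, n])"
    using mev_nm[of "pf \<tau>" "[gn \<phi>, n]"] mev_pf by simp
  then have "Prf (nm (gn \<phi>)) (nm n) \<longleftrightarrow> nm (eval (pf \<tau>) [gn \<phi>, n]) = S Z" using ob_simps(2) by metis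
  then show ?thesis by (simp add: nm_eq_S_Z eval_pf del: One_nat_def)
qed

lemma Prf_std_T: "Prf (nm (gn \<phi>)) (nm n) \<Longrightarrow> T \<turnstile> \<phi>"
  using Prf_std pproof_derivable[OF T] by blast
lemma T_Prf: assumes "T \<turnstile> \<phi>" obtains n where "Prf (nm (gn \<phi>)) (nm n)"
  using assms Prf_std pproof_derivable[OF T] by blast

lemma Rm_thm: assumes "T \<turnstile> \<phi>" shows "Rm (nm (gn \<phi>))"
proof -
  obtain n where n: "Prf (nm (gn \<phi>)) (nm n)" using T_Prf[OF assms] .
  have "\<not> Prf (ng (nm (gn \<phi>))) z" if "z \<prec> nm n" for z
  proof
    assume "Prf (ng (nm (gn \<phi>))) z"
    then have "T \<turnstile> Neg \<phi>" using that Prf_std_T unfolding ng_nm less_nm by blast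
    then show False using assms con unfolding consistent_def by blast
  qed
  moreover have "isfm (nm (gn \<phi>))" using isfm_gn by blast
  ultimately show ?thesis unfolding Rm_def using n by blast
qed

text \<open>\<open>Neg \<phi>\<close> has a standard proof. A Rosser proof of \<open>\<phi>\<close>
  could not come after it, would thus be standard, and \<open>T\<close> would prove
  \<open>\<phi>\<close>.\<close>

lemma Rm_refutable: assumes "T \<turnstile> Neg \<phi>" shows "\<not> Rm (nm (gn \<phi>))"
proof
  assume "Rm (nm (gn \<phi>))"
  then obtain y where y: "Prf (nm (gn \<phi>)) y" "\<forall>z. z \<prec> y \<longrightarrow> \<not> Prf (ng (nm (gn \<phi>))) z" unfolding Rm_def by blast
  obtain n where "Prf (nm (gn (Neg \<phi>))) (nm n)" using T_Prf[OF assms] .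
  then have "\<not> nm n \<prec> y" using y(2) ng_nm by metis
  then have "y \<prec> nm (Suc n)" by (simp add: L.not_less less_S_le)
  then have "T \<turnstile> \<phi>" using y(1) Prf_std_T unfolding less_nm by blast
  then show False using assms con unfolding consistent_def by blast
qed

lemma fcode_app: assumes "fm_below 1 A" shows "fcode 0 (\<lambda>_. ntm (nm n)) A = nm (gn (app A [numeral_tm n]))"
proof -
  have "fm_below 0 (app A [numeral_tm n])" unfolding app_def by (rule fm_below_fsubst[OF assms]) simp
  then have "nm (gn (app A [numeral_tm n])) = fcode 0 (\<lambda>_. Z) (app A [numeral_tm n])" by (simp add: fcode_gn)
  also have "\<dots> = fcode 0 (\<lambda>i. tcode (\<lambda>_. Z) (if i < 1 then [numeral_tm n] ! i else Var i)) A"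
    unfolding app_def fcode_fsubst by simp
  also have "\<dots> = fcode 0 (\<lambda>_. ntm (nm n)) A"
  proof (rule fcode_cong[OF assms])
    have "tcode (vm 0 (\<lambda>_. Z)) (numeral_tm n) = ntm (nm n)" unfolding ntm_nm by (rule tcode_gnt) simp
    then show "\<forall>i. i + 0 < 1 \<longrightarrow> tcode (\<lambda>_. Z) (if i < 1 then [numeral_tm n] ! i else Var i) = ntm (nm n)" by simp
  qed
  finally show ?thesis by simp
qed

lemma RC_nm: "RC (nm n) = nm (gn (app (RF \<tau>) [numeral_tm n]))"
  unfolding RC_def by (rule fcode_app[OF RF_below])
lemma SC_nm: "SC (nm n) = nm (gn (app (SF \<tau>) [numeral_tm n]))"
  unfolding SC_def by (rule fcode_app[OF SF_below])

lemma msat_app1: "msat M e (app A [t]) \<longleftrightarrow> msat M (\<lambda>i. if i = 0 then mval M e t else e i) A"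
  unfolding app_def msat_fsubst by (rule arg_cong2[where f = "\<lambda>e \<phi>. msat M e \<phi>"]) auto
lemma msat_app_RF: "msat M e (app (RF \<tau>) [numeral_tm n]) \<longleftrightarrow> Rm (nm n)"
  by (simp add: msat_app1 msat_RF)
lemma msat_app_SF: "msat M e (app (SF \<tau>) [numeral_tm n]) \<longleftrightarrow> Sm (nm n)"
  by (simp add: msat_app1 msat_SF)

end

context rosser begin

lemma rm: "pa_model M \<Longrightarrow> rosser_model T \<tau> M"
  by (simp add: rosser_model_def tm rosser_axioms)

lemma app_Proof: "app (Proof \<tau>) [s, t] = graph (pproof \<tau>) [s, t] (Succ Zero)"
  by (simp add: app_def Proof_def graph_fsubst)

lemma rosser_predicate_RF: "rosser_predicate \<tau> (RF \<tau>)"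
  unfolding rosser_predicate_def
proof (intro conjI exI[of _ "PrfF \<tau>"] allI)
  show "Sigma1 (RF \<tau>)" by (rule Sigma1_RF)
  show "pr_formula 2 (PrfF \<tau>)" by (rule pr_formula_PrfF)
  show "PA \<turnstile> Iff (app (Proof \<tau>) [quot \<phi>, numeral_tm n]) (app (PrfF \<tau>) [quot \<phi>, numeral_tm n])" for \<phi> n
  proof (rule PA_complete)
    fix M :: "nat mstr" and e assume "pa_model M"
    then interpret M: rosser_model T \<tau> M by (rule rm)
    show "msat M e (Iff (app (Proof \<tau>) [quot \<phi>, numeral_tm n]) (app (PrfF \<tau>) [quot \<phi>, numeral_tm n]))"
      using M.Prf_std[of \<phi> n] M.Pf_nm[of \<phi> n] by (simp add: app_Proof M.msat_graph M.msat_PrfF M.mev_pproof)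
  qed
  show "PA \<turnstile> Forall (Imp (app Fml [Var 0]) (Iff (app (Prov \<tau>) [Var 0]) (Exists (app (PrfF \<tau>) [Var 1, Var 0]))))"
  proof (rule PA_complete)
    fix M :: "nat mstr" and e assume "pa_model M"
    then interpret M: rosser_model T \<tau> M by (rule rm)
    show "msat M e (Forall (Imp (app Fml [Var 0]) (Iff (app (Prov \<tau>) [Var 0]) (Exists (app (PrfF \<tau>) [Var 1, Var 0])))))"
    proof -
      have "msat M e (app (Prov \<tau>) [Var 0]) \<longleftrightarrow> M.Pv (e 0)" for e
        unfolding M.msat_app1 by (simp add: Prov_def app_Proof M.msat_graph M.mev_pproof M.Pv_def)
      then show ?thesis using M.Pv_iff_Prf by (simp add: M.msat_Fml M.msat_PrfF)
    qed
  qed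
  show "RF \<tau> = Exists (Conj (app Fml [Var 1]) (Conj (app (PrfF \<tau>) [Var 1, Var 0])
     (Forall (Imp (Less (Var 0) (Var 1)) (Neg (app (PrfF \<tau>) [neg_tm (Var 2), Var 0]))))))" by (rule RF_def)
qed

lemma PA_imp_T: "PA \<turnstile> \<phi> \<Longrightarrow> T \<turnstile> \<phi>" by (rule N.PA_imp_T)

lemma msat_interpretation:
  assumes "arithmetical_interpretation R f" "pa_model M"
  shows "msat M e (f A) \<longleftrightarrow> meval (\<lambda>p. msat M e (f (MVar p))) (\<lambda>B. msat M e (f (Box B))) A"
proof -
  interpret pa_model M by fact
  show ?thesis using assms(1) unfolding arithmetical_interpretation_def by (induction A) simp_all
qed

theorem NR4_sound:
  assumes f: "arithmetical_interpretation (RF \<tau>) f" and "NR4 A" shows "PA \<turnstile> f A"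
  using assms(2)
proof (induction rule: NR4.induct)
  case (taut A)
  show ?case
  proof (rule PA_complete)
    fix M :: "nat mstr" and e assume M: "pa_model M"
    show "msat M e (f A)" using taut unfolding msat_interpretation[OF f M, of e A] tautology_def by blast
  qed
next
  case (four B)
  show ?case
  proof (rule PA_complete)
    fix M :: "nat mstr" and e assume "pa_model M"
    then interpret M: rosser_model T \<tau> M by (rule rm)
    show "msat M e (f (MImp (Box B) (Box (Box B))))"
      using f M.Rm_four[of "M.nm (gn (f B))"] M.RC_nm[of "gn (f B)"]
      by (simp add: arithmetical_interpretation_def M.msat_app_RF)
  qed
next
  case (mp A B)
  have "f (MImp A B) = Imp (f A) (f B)" using f unfolding arithmetical_interpretation_def by blast
  then show ?case using mp.IH derivable.mp by metis
next
  case (nec A)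
  show ?case
  proof (rule PA_complete)
    fix M :: "nat mstr" and e assume "pa_model M"
    then interpret M: rosser_model T \<tau> M by (rule rm)
    show "msat M e (f (Box A))" using f M.Rm_thm[OF PA_imp_T[OF nec.IH]]
      by (simp add: arithmetical_interpretation_def M.msat_app_RF)
  qed
next
  case (ros B)
  show ?case
  proof (rule PA_complete)
    fix M :: "nat mstr" and e assume "pa_model M"
    then interpret M: rosser_model T \<tau> M by (rule rm)
    have "T \<turnstile> Neg (f B)" using PA_imp_T[OF ros.IH] f by (simp add: arithmetical_interpretation_def)
    then show "msat M e (f (MNeg (Box B)))" using f M.Rm_refutable
      by (simp add: arithmetical_interpretation_def M.msat_app_RF)
  qed
qed

end

section \<open>Modal formulas\<close>

primrec subf :: "mfm \<Rightarrow> mfm set" where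
  "subf (MVar p) = {MVar p}"
| "subf MBot = {MBot}"
| "subf (MNeg A) = insert (MNeg A) (subf A)"
| "subf (MConj A B) = insert (MConj A B) (subf A \<union> subf B)"
| "subf (MDisj A B) = insert (MDisj A B) (subf A \<union> subf B)"
| "subf (MImp A B) = insert (MImp A B) (subf A \<union> subf B)"
| "subf (Box A) = insert (Box A) (subf A)"

primrec box_depth :: "mfm \<Rightarrow> nat" where
  "box_depth (MVar p) = 0"
| "box_depth MBot = 0"
| "box_depth (MNeg A) = box_depth A"
| "box_depth (MConj A B) = max (box_depth A) (box_depth B)"
| "box_depth (MDisj A B) = max (box_depth A) (box_depth B)"
| "box_depth (MImp A B) = max (box_depth A) (box_depth B)"
| "box_depth (Box A) = Suc (box_depth A)"

lemma subf_refl [simp]: "A \<in> subf A" by (cases A) simp_all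
lemma finite_subf [simp]: "finite (subf A)" by (induction A) simp_all
lemma subf_trans: "B \<in> subf A \<Longrightarrow> C \<in> subf B \<Longrightarrow> C \<in> subf A"
  by (induction A) auto
lemma box_depth_subf: "B \<in> subf A \<Longrightarrow> box_depth B \<le> box_depth A"
  by (induction A) (auto simp: le_max_iff_disj)
lemma box_depth_box: "Box D \<in> subf A \<Longrightarrow> box_depth D < box_depth A"
  using box_depth_subf[of "Box D" A] by simp

lemma meval_foldr: "meval v w (foldr MImp \<Theta> A) \<longleftrightarrow> ((\<forall>\<theta>\<in>set \<Theta>. meval v w \<theta>) \<longrightarrow> meval v w A)"
  by (induction \<Theta>) auto
lemma NR4_foldr: "NR4 (foldr MImp \<Theta> A) \<Longrightarrow> \<forall>\<theta>\<in>set \<Theta>. NR4 \<theta> \<Longrightarrow> NR4 A"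
  by (induction \<Theta>) (auto intro: NR4.mp)

text \<open>\<open>w B\<close> is the value given to \<open>Box B\<close>, so
  \<open>w (Box B)\<close> belongs to a double box. The three conditions come from necessitation,
  the Rosser rule and axiom \<open>four\<close>.\<close>

definition assignment :: "mfm \<Rightarrow> (mfm \<Rightarrow> bool) \<Rightarrow> bool" where
  "assignment A w \<longleftrightarrow> (\<forall>B. Box B \<in> subf A \<longrightarrow> (NR4 B \<longrightarrow> w B) \<and> (NR4 (MNeg B) \<longrightarrow> \<not> w B) \<and> (w B \<longrightarrow> w (Box B)))"

text \<open>If every valuation satisfying finitely many theorems of \<open>NR4\<close> satisfied
  \<open>A\<close>, the iterated implication from them to \<open>A\<close> would be a tautology and
  \<open>A\<close> a theorem.\<close>

lemma ex_assignment: assumes "\<not> NR4 A" obtains v w where "\<not> meval v w A" "assignment A w"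
proof -
  \<comment> \<open>Large enough to contain, for every box in \<open>A\<close>, the conclusions of
    the two box rules and the instance of axiom \<open>four\<close>.\<close>
  define X where "X = {\<theta> \<in> subf A \<union> MNeg ` subf A \<union> (\<lambda>B. MImp B (Box B)) ` subf A. NR4 \<theta>}"
  have "finite X" unfolding X_def by simp
  then obtain \<Theta> where \<Theta>: "set \<Theta> = X" using finite_list by blast
  have "\<forall>\<theta>\<in>set \<Theta>. NR4 \<theta>" unfolding \<Theta> X_def by simp
  then have "\<not> tautology (foldr MImp \<Theta> A)" using NR4_foldr taut assms by blast
  then obtain v w where vw: "\<forall>\<theta>\<in>X. meval v w \<theta>" "\<not> meval v w A" unfolding tautology_def meval_foldr \<Theta> by blast
  have "assignment A w" unfolding assignment_def
  proof (intro allI impI conjI)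
    fix B assume B: "Box B \<in> subf A"
    show "w B" if "NR4 B"
    proof -
      have "Box B \<in> X" unfolding X_def using B nec[OF that] by simp
      then show ?thesis using vw(1) by fastforce
    qed
    show "\<not> w B" if "NR4 (MNeg B)"
    proof -
      have "MNeg (Box B) \<in> X" unfolding X_def using B ros[OF that] by simp
      then show ?thesis using vw(1) by fastforce
    qed
    show "w (Box B)" if "w B"
    proof -
      have "MImp (Box B) (Box (Box B)) \<in> X" unfolding X_def using B four[of B] by simp
      then show ?thesis using vw(1) that by fastforce
    qed
  qed
  then show thesis using vw(2) by (rule that[rotated])
qed

text \<open>Among the formulas of the same box depth, those that are to be boxed come before their negations,
  the others after them.\<close>

primrec priority :: "(mfm \<Rightarrow> bool) \<Rightarrow> mfm \<Rightarrow> int" where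
  "priority w (MVar p) = 0"
| "priority w MBot = 0"
| "priority w (MNeg A) = priority w A + (if w A then 1 else -1)"
| "priority w (MConj A B) = 0"
| "priority w (MDisj A B) = 0"
| "priority w (MImp A B) = 0"
| "priority w (Box A) = 0"

text \<open>Sorting by box depth first puts \<open>D\<close> and \<open>MNeg D\<close> before
  \<open>MNeg (Box D)\<close>, as \<open>valid\<close> asks when \<open>Box (Box D)\<close> is to be
  false. Within one depth, the integer steps of \<open>priority\<close> order whole chains of
  negations consistently.\<close>

lemma ex_enumeration:
  obtains ys where "set ys = subf A \<union> MNeg ` subf A" "sorted (map (\<lambda>B. (box_depth B, priority w B)) ys)"
proof -
  have "finite (subf A \<union> MNeg ` subf A)" by simp
  from finite_list[OF this] obtain xs where "set xs = subf A \<union> MNeg ` subf A" ..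
  then show thesis using that[of "sort_key (\<lambda>B. (box_depth B, priority w B)) xs"] by simp
qed

lemma enumeration_less:
  assumes "sorted (map (\<lambda>B. (box_depth B, priority w B)) ys)" "i < length ys" "(box_depth (ys ! i), priority w (ys ! i)) < (box_depth (ys ! j), priority w (ys ! j))"
  shows "i < j"
proof (rule ccontr)
  assume "\<not> i < j"
  then have "map (\<lambda>B. (box_depth B, priority w B)) ys ! j \<le> map (\<lambda>B. (box_depth B, priority w B)) ys ! i"
    using sorted_nth_mono[OF assms(1)] assms(2) by simp
  then show False using assms(2,3) \<open>\<not> i < j\<close> by auto
qed

lemma numeral_tm_inj: "numeral_tm m = numeral_tm n \<longleftrightarrow> m = n"
proof (induction m arbitrary: n)
  case 0 show ?case by (cases n) simp_all
next
  case (Suc m) then show ?case by (cases n) simp_all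
qed

section \<open>Worlds and their codes\<close>

text \<open>6 leaves remainder 1 modulo 5, and the only term with that remainder is
  \<open>Zero\<close>, whose code is 1. A number divisible by 8 with 6 as left component is
  therefore no equation, hence no formula.\<close>

lemma gnt_neq_6: "gnt t \<noteq> 6" using gnt_eqs(2)[of 1 t] by auto
lemma gn_neq: "gn \<phi> \<noteq> 8 * prod_encode (6, a)"
proof
  assume "gn \<phi> = 8 * prod_encode (6, a)"
  then show False using gn_eqs(1)[of "prod_encode (6, a)" \<phi>] gnt_neq_6 by auto
qed
text \<open>The tag \<open>3\<close> is that of a conjunction, but the code of its left side is not that of a formula.\<close>

definition world_code :: "nat list \<Rightarrow> nat list \<Rightarrow> nat" where
  "world_code as ls = 8 * prod_encode (8 * prod_encode (6, 0), prod_encode (list_encode as, list_encode ls)) + 3"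
lemma world_code_not_gn: "world_code as ls \<noteq> gn \<phi>"
proof
  assume "world_code as ls = gn \<phi>"
  then show False unfolding world_code_def gn_eqs using gn_neq[of _ 0] by auto metis
qed

definition pval where
  "pval = pand (pnot (pis_fm (PProj 0))) (pmem (PProj 1) (pfst (psnd (pdiv (PProj 0) 8))))"

text \<open>A variable asserts that some enumerated number that codes no formula lists it as true.
  Its three leading quantifiers keep it apart from instances of \<open>RF\<close>, which begin with
  one quantifier before a conjunction; the equation with a numeral keeps different variables
  apart.\<close>

primrec interp :: "pr \<Rightarrow> mfm \<Rightarrow> fm" where
  "interp \<tau> (MVar p) = Exists (Exists (Exists (Conj (Eq (Var 0) (numeral_tm p))
     (Conj (app (PrfF \<tau>) [Var 2, Var 1]) (graph pval [Var 2, Var 0] (Succ Zero))))))"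
| "interp \<tau> MBot = Eq Zero (Succ Zero)"
| "interp \<tau> (MNeg A) = Neg (interp \<tau> A)"
| "interp \<tau> (MConj A B) = Conj (interp \<tau> A) (interp \<tau> B)"
| "interp \<tau> (MDisj A B) = Disj (interp \<tau> A) (interp \<tau> B)"
| "interp \<tau> (MImp A B) = Imp (interp \<tau> A) (interp \<tau> B)"
| "interp \<tau> (Box A) = app (RF \<tau>) [quot (interp \<tau> A)]"

definition cdl :: "pr \<Rightarrow> mfm list \<Rightarrow> nat list" where "cdl \<tau> ys = map (\<lambda>B. gn (interp \<tau> B)) ys"

lemma app_RF_below: "fm_below 0 (app (RF \<tau>) [numeral_tm n])"
  unfolding app_def by (rule fm_below_fsubst[OF RF_below]) simp

lemma interpretation_interp: "arithmetical_interpretation (RF \<tau>) (interp \<tau>)"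
proof -
  have "fm_below 0 (interp \<tau> A)" for A
    by (induction A) (simp_all add: app_RF_below app_PrfF graph_below)
  then show ?thesis unfolding arithmetical_interpretation_def sentence_def by simp
qed

section \<open>Recovering a modal formula from its translation\<close>

lemma tlift_numeral [simp]: "tlift k (numeral_tm n) = numeral_tm n"
  by (induction n) (simp_all add: tlift_def)

lemma app_RF_shape: obtains \<psi> where "app (RF \<tau>) [t] =
  Exists (Conj (app Fml [tlift 1 t]) (Conj (graph (pf \<tau>) [tlift 1 t, Var 0] (Succ Zero)) \<psi>))"
proof -
  have "\<exists>\<psi>. app (RF \<tau>) [t] =
    Exists (Conj (app Fml [tlift 1 t]) (Conj (graph (pf \<tau>) [tlift 1 t, Var 0] (Succ Zero)) \<psi>))"
    unfolding RF_def app_Fml app_PrfF by (simp add: app_def graph_fsubst up_def)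
  then show thesis using that by blast
qed

lemma app_RF_inj: assumes "app (RF \<tau>) [numeral_tm m] = app (RF \<tau>) [numeral_tm n]" shows "m = n"
proof -
  obtain \<phi> where "app (RF \<tau>) [numeral_tm m] = Exists (Conj (app Fml [tlift 1 (numeral_tm m)])
     (Conj (graph (pf \<tau>) [tlift 1 (numeral_tm m), Var 0] (Succ Zero)) \<phi>))" by (rule app_RF_shape)
  moreover obtain \<psi> where "app (RF \<tau>) [numeral_tm n] = Exists (Conj (app Fml [tlift 1 (numeral_tm n)])
     (Conj (graph (pf \<tau>) [tlift 1 (numeral_tm n), Var 0] (Succ Zero)) \<psi>))" by (rule app_RF_shape)
  ultimately have "graph (pf \<tau>) [numeral_tm m, Var 0] (Succ Zero) = graph (pf \<tau>) [numeral_tm n, Var 0] (Succ Zero)"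
    using assms by (simp only: fm.inject tlift_numeral)
  then show ?thesis unfolding graph_pf by (simp only: fm.inject tlift_numeral numeral_tm_inj graph.simps)
qed

lemma app_RF_neq [simp]: "app (RF \<tau>) [t] \<noteq> Exists (Exists \<phi>)" "app (RF \<tau>) [t] \<noteq> Eq r s" "app (RF \<tau>) [t] \<noteq> Neg \<phi>"
  "app (RF \<tau>) [t] \<noteq> Conj \<phi> \<psi>" "app (RF \<tau>) [t] \<noteq> Disj \<phi> \<psi>" "app (RF \<tau>) [t] \<noteq> Imp \<phi> \<psi>"
  by (rule app_RF_shape[of \<tau> t], simp)+
lemmas app_RF_neq' [simp] = app_RF_neq[symmetric]

lemma interp_Neg: assumes "interp \<tau> C = Neg \<phi>" obtains D where "C = MNeg D" "interp \<tau> D = \<phi>"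
  using assms by (cases C) simp_all
lemma interp_app_RF: assumes "interp \<tau> C = app (RF \<tau>) [quot \<phi>]" obtains D where "C = Box D" "interp \<tau> D = \<phi>"
proof (cases C)
  case (Box D)
  then have "app (RF \<tau>) [quot (interp \<tau> D)] = app (RF \<tau>) [quot \<phi>]" using assms by simp
  then have "gn (interp \<tau> D) = gn \<phi>" by (rule app_RF_inj)
  then show thesis using that[OF Box] by simp
qed (use assms in simp_all)

text \<open>Lists contain codes of translations. Two modal formulas with one translation could not
  be given different values under the box.\<close>

lemma interp_inj: "interp \<tau> A = interp \<tau> B \<Longrightarrow> A = B"
proof (induction A arbitrary: B)
  case (Box A)
  then obtain D where "B = Box D" "interp \<tau> D = interp \<tau> A" using interp_app_RF by (metis interp.simps(7))
  then show ?case using Box.IH by metis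
next
  case (MVar p) then show ?case by (cases B) (simp_all add: numeral_tm_inj)
next
  case MBot then show ?case by (cases B) simp_all
next
  case (MNeg A) then show ?case by (cases B) simp_all
next
  case (MConj A1 A2) then show ?case by (cases B) simp_all
next
  case (MDisj A1 A2) then show ?case by (cases B) simp_all
next
  case (MImp A1 A2) then show ?case by (cases B) simp_all
qed


section \<open>Reading a world code inside a model\<close>

context pa_model begin

lemma nm_list: "nm (list_encode (x # L)) = cns (nm x) (nm (list_encode L))"
  by (simp add: cns_def nm_pair)
lemma mem_list: "mem (nm n) (nm (list_encode L)) \<longleftrightarrow> n \<in> set L"
  by (induction L) (simp_all only: nm_list mem_cns nm_inj list.set insert_iff, simp)

end

context theory_model begin

lemma ent_cns: "ent (cns y l) Z x \<longleftrightarrow> x = y" "ent (cns y l) (S i) x \<longleftrightarrow> ent l i x"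
  by (auto simp: ent_def dr_S)
lemma ent_list: "ent (nm (list_encode L)) i y \<longleftrightarrow> (\<exists>j<length L. i = nm j \<and> y = nm (L ! j))"
proof (induction L arbitrary: i)
  case Nil show ?case by (simp add: ent_def)
next
  case (Cons x L)
  show ?case
  proof (cases i rule: Z_cases)
    case 1
    have "(\<exists>j<length (x # L). Z = nm j \<and> y = nm ((x # L) ! j)) \<longleftrightarrow> y = nm x"
    proof
      assume "\<exists>j<length (x # L). Z = nm j \<and> y = nm ((x # L) ! j)"
      then obtain j where j: "Z = nm j" "y = nm ((x # L) ! j)" by blast
      then have "j = 0" using nm_inj[of 0 j] by simp
      then show "y = nm x" using j by simp
    qed (auto intro!: exI[of _ 0])
    then show ?thesis unfolding nm_list 1 ent_cns by blast
  next
    case (2 i')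
    have "(\<exists>j<length (x # L). S i' = nm j \<and> y = nm ((x # L) ! j)) \<longleftrightarrow> (\<exists>j<length L. i' = nm j \<and> y = nm (L ! j))"
    proof
      assume "\<exists>j<length (x # L). S i' = nm j \<and> y = nm ((x # L) ! j)"
      then obtain j where j: "S i' = nm j" "y = nm ((x # L) ! j)" "j < length (x # L)" by blast
      then show "\<exists>j<length L. i' = nm j \<and> y = nm (L ! j)" by (cases j) auto
    next
      assume "\<exists>j<length L. i' = nm j \<and> y = nm (L ! j)"
      then obtain j where "i' = nm j" "y = nm (L ! j)" "j < length L" by blast
      then show "\<exists>j<length (x # L). S i' = nm j \<and> y = nm ((x # L) ! j)" by (intro exI[of _ "Suc j"]) simp
    qed
    then show ?thesis unfolding nm_list 2 ent_cns Cons.IH by blast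
  qed
qed

lemma dv_world_code: "dv (nm (world_code as ls)) = pair (nm (8 * prod_encode (6, 0))) (pair (nm (list_encode as)) (nm (list_encode ls)))"
proof -
  have "dv (nm (world_code as ls)) = nm (world_code as ls div 8)"
    unfolding dv_def using mev_nm[of "pdiv (PProj 0) 8" "[world_code as ls]"] by (simp add: arg_def)
  also have "world_code as ls div 8 = prod_encode (8 * prod_encode (6, 0), prod_encode (list_encode as, list_encode ls))"
    unfolding world_code_def by linarith
  finally show ?thesis by (simp only: nm_pair)
qed
lemma Lk_world_code: "Lk (nm (world_code as ls)) = nm (list_encode ls)"
  by (simp add: Lk_def dv_world_code)
lemma isfm_world_code: "\<not> isfm (nm (world_code as ls))"
  using isfm_gn world_code_not_gn by blast
lemma list_less_world_code: "list_encode ls < world_code as ls"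
proof -
  have "list_encode ls \<le> prod_encode (list_encode as, list_encode ls)" by (rule le_prod_encode_2)
  also have "\<dots> \<le> prod_encode (8 * prod_encode (6, 0), prod_encode (list_encode as, list_encode ls))" by (rule le_prod_encode_2)
  finally show ?thesis unfolding world_code_def by linarith
qed
lemma mev_pval: "mev pval [k, n] = ob (\<not> isfm k \<and> mem n (fs (sn (dv k))))"
  by (simp add: pval_def mev_pdiv8)

lemma Sm_first_bell: assumes "Sm k" "\<not> isfm k" obtains m where "first_bell m k"
  using assms unfolding Sm_def Prf_def by blast

lemma Prf_nonfm: assumes "first_bell m k" "Prf x y" "\<not> isfm x" shows "x = k"
  using assms first_bell_unique unfolding Prf_def by blast

text \<open>The number chosen by the first bell is the only one enumerated without coding a formula,
  so the existential quantifier can only find this world.\<close>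

lemma msat_interp_MVar: assumes "first_bell m (nm (world_code as ls))"
  shows "msat M e (interp \<tau> (MVar p)) \<longleftrightarrow> p \<in> set as"
proof -
  have "msat M e (interp \<tau> (MVar p)) \<longleftrightarrow> (\<exists>k y. Prf k y \<and> \<not> isfm k \<and> mem (nm p) (fs (sn (dv k))))"
    by (simp add: msat_PrfF msat_graph mev_pval)
  also have "\<dots> \<longleftrightarrow> mem (nm p) (fs (sn (dv (nm (world_code as ls)))))"
    using Prf_nonfm[OF assms] Prf_at[OF assms] isfm_world_code by blast
  finally show ?thesis by (simp add: dv_world_code mem_list)
qed

end


lemma meval_cong: "(\<And>p. MVar p \<in> subf A \<Longrightarrow> v p = v' p) \<Longrightarrow> meval v w A = meval v' w A"
  by (induction A) auto

context rosser_model begin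

definition cd :: "mfm \<Rightarrow> 'm" where "cd B = nm (gn (interp \<tau> B))"
lemma ng_cd: "ng (cd B) = cd (MNeg B)" by (simp add: cd_def ng_nm)
lemma RC_cd: "RC (cd B) = cd (Box B)" by (simp add: cd_def RC_nm)
lemma isfm_cd: "isfm (cd B)" unfolding cd_def using isfm_gn by blast
lemma cd_inj: "cd B = cd C \<longleftrightarrow> B = C" unfolding cd_def nm_inj gn_eq using interp_inj by blast

text \<open>\<open>x\<close> is below a standard code, hence standard and the code of an actual
  formula; from there the syntax of translations decides.\<close>

lemma ng_RC_cd: assumes "ng (RC x) = cd Y" "isfm x" obtains D where "Y = MNeg (Box D)" "x = cd D"
proof -
  have "x \<prec> nm (gn (interp \<tau> Y))" using RC_ge[of x] ng_gt[of "RC x"] assms(1) L.le_less_trans unfolding cd_def by metis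
  then obtain n where "x = nm n" unfolding less_nm by blast
  moreover from this obtain \<phi> where "n = gn \<phi>" using assms(2) isfm_gn by metis
  ultimately have x: "x = nm (gn \<phi>)" by simp
  have "interp \<tau> Y = Neg (app (RF \<tau>) [quot \<phi>])" using assms(1) unfolding x RC_nm ng_nm cd_def nm_inj gn_eq by simp
  then obtain Y' where Y: "Y = MNeg Y'" "interp \<tau> Y' = app (RF \<tau>) [quot \<phi>]" by (rule interp_Neg)
  from Y(2) obtain D where "Y' = Box D" "interp \<tau> D = \<phi>" by (rule interp_app_RF)
  then show thesis using that Y(1) x unfolding cd_def by blast
qed

lemma ent_cdl: "ent (nm (list_encode (cdl \<tau> ys))) i y \<longleftrightarrow> (\<exists>j<length ys. i = nm j \<and> y = cd (ys ! j))"
  unfolding ent_list cdl_def cd_def by (intro ex_cong1) auto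

end

section \<open>Truth in a world and completeness\<close>

text \<open>\<open>sound\<close> is the induction hypothesis of \<open>pre_sound\<close> in this
  model. It is applied to bodies of boxes in \<open>A\<close> and their negations, which have
  smaller box depth than \<open>A\<close>.\<close>

locale world = rosser_model T \<tau> M for T \<tau> and M :: "'m mstr" +
  fixes A :: mfm and w :: "mfm \<Rightarrow> bool" and ys :: "mfm list" and vs :: "nat list" and m :: 'm
  assumes sound: "box_depth B < box_depth A \<Longrightarrow> t \<prec> m \<Longrightarrow> Pf (cd B) t \<Longrightarrow> NR4 B"
    and assignment: "assignment A w"
    and ys: "set ys = subf A \<union> MNeg ` subf A" "sorted (map (\<lambda>B. (box_depth B, priority w B)) ys)"
    and first_bell: "first_bell m (nm (world_code vs (cdl \<tau> ys)))"
begin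

abbreviation "l \<equiv> nm (list_encode (cdl \<tau> ys))"

lemma ent_before:
  assumes "C \<in> set ys"
  obtains i where "ent l i (cd C)" "\<And>C' j. (box_depth C, priority w C) < (box_depth C', priority w C') \<Longrightarrow> ent l j (cd C') \<Longrightarrow> i \<prec> j"
proof -
  obtain i where i: "i < length ys" "ys ! i = C" using assms(1) unfolding in_set_conv_nth by blast
  show thesis
  proof (rule that[of "nm i"])
    show "ent l (nm i) (cd C)" unfolding ent_cdl using i by blast
    fix C' j assume k: "(box_depth C, priority w C) < (box_depth C', priority w C')" and "ent l j (cd C')"
    then obtain j' where "j = nm j'" "C' = ys ! j'" unfolding ent_cdl cd_inj by blast
    then show "nm i \<prec> j" using enumeration_less[OF ys(2) i(1)] k i(2) by simp
  qed
qed

lemma box_ys: assumes "Box D \<in> subf A" shows "D \<in> set ys" "MNeg D \<in> set ys" "Box D \<in> set ys" "box_depth D < box_depth A"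
proof -
  have "D \<in> subf A" by (rule subf_trans[OF assms]) simp
  then show "D \<in> set ys" "MNeg D \<in> set ys" "Box D \<in> set ys" "box_depth D < box_depth A"
    using assms box_depth_box unfolding ys(1) by blast+
qed

text \<open>An entry of the form \<open>ng (RC x)\<close> translates some
  \<open>MNeg (Box D)\<close>. If \<open>w (Box D)\<close> holds, \<open>Box D\<close> has the lower
  priority and comes first; if not, \<open>w D\<close> fails too, and \<open>MNeg D\<close> is
  listed before both \<open>D\<close> and \<open>MNeg (Box D)\<close>.\<close>

lemma valid: "valid (nm (world_code vs (cdl \<tau> ys))) m"
  unfolding valid_def Lk_world_code
proof (intro allI impI)
  fix j x assume x: "isfm x" and j: "ent l j (ng (RC x))"
  then obtain Y where Y: "ng (RC x) = cd Y" "Y \<in> set ys" unfolding ent_cdl by force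
  obtain D where D: "Y = MNeg (Box D)" "x = cd D" using ng_RC_cd[OF Y(1) x] .
  have "Box D \<in> subf A" using Y(2) D(1) subf_trans[of "MNeg (Box D)" A "Box D"] unfolding ys(1) by auto
  note b = box_ys[OF this] and a = assignment[unfolded assignment_def, rule_format, OF this]
  have j': "ent l j (cd (MNeg (Box D)))" using j Y(1) D(1) by simp
  show "neg1 x m \<or> (\<exists>i. i \<prec> j \<and> ent l i (RC x)) \<or> \<not> (\<exists>u. u \<prec> m \<and> Pf x u) \<and> negL x j l"
  proof (cases "w (Box D)")
    case True
    then have "(box_depth (Box D), priority w (Box D)) < (box_depth (MNeg (Box D)), priority w (MNeg (Box D)))" by simp
    moreover obtain i where "ent l i (cd (Box D))"
      "\<And>C' j. (box_depth (Box D), priority w (Box D)) < (box_depth C', priority w C') \<Longrightarrow> ent l j (cd C') \<Longrightarrow> i \<prec> j" by (rule ent_before[OF b(3)]) blast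
    ultimately have "ent l i (cd (Box D))" "i \<prec> j" using j' by blast+
    then show ?thesis unfolding D(2) RC_cd by blast
  next
    case False
    then have w: "\<not> w D" using a by blast
    \<comment> \<open>A proof of \<open>D\<close> before the bell would make \<open>D\<close> a
      theorem of \<open>NR4\<close>, and then \<open>w D\<close> would hold.\<close>
    then have "\<not> Pf x u" if "u \<prec> m" for u using sound[OF b(4) that] a unfolding D(2) by blast
    moreover have "negL x j l"
    proof -
      obtain i where i: "ent l i (cd (MNeg D))"
        "\<And>C' j. (box_depth (MNeg D), priority w (MNeg D)) < (box_depth C', priority w C') \<Longrightarrow> ent l j (cd C') \<Longrightarrow> i \<prec> j"
        by (rule ent_before[OF b(2)]) blast
      have "(box_depth (MNeg D), priority w (MNeg D)) < (box_depth (MNeg (Box D)), priority w (MNeg (Box D)))" by simp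
      then have "i \<prec> j" using i(2) j' by blast
      moreover have "(box_depth (MNeg D), priority w (MNeg D)) < (box_depth D, priority w D)" using w by simp
      then have "\<not> ent l i' (cd D)" if "i' \<prec> S i" for i' using i(2) that L.not_less less_S_le by metis
      ultimately show ?thesis unfolding negL_def D(2) ng_cd using i(1) by blast
    qed
    ultimately show ?thesis by blast
  qed
qed


lemma ent_less_world_code: assumes "ent l i y" shows "i \<prec> nm (world_code vs (cdl \<tau> ys))"
proof -
  have "l \<prec> nm (world_code vs (cdl \<tau> ys))" using list_less_world_code by simp
  then show ?thesis using ent_less(1)[OF assms] L.less_trans by blast
qed

lemma Prf_ent: assumes "d \<prec> nm (world_code vs (cdl \<tau> ys))" shows "Prf (cd B) (S m \<oplus> d) \<longleftrightarrow> ent l d (cd B)"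
  unfolding Prf_post[OF first_bell isfm_cd] Lk_world_code using assms valid isfm_world_code by simp

lemma Prf_first:
  assumes "z \<prec> S m \<oplus> i" "i \<prec> nm (world_code vs (cdl \<tau> ys))" "Prf (cd B) z" "box_depth B < box_depth A"
  shows "NR4 B \<or> (\<exists>j. j \<prec> i \<and> ent l j (cd B))"
proof (cases z m rule: trichotomy)
  case 1 then show ?thesis using sound[OF assms(4)] assms(3) Prf_pre[OF first_bell] by blast
next
  case 2 then show ?thesis using assms(3) Prf_at[OF first_bell] isfm_cd[of B] by metis
next
  case (3 d)
  then have "d \<prec> i" using assms(1) by simp
  moreover from this have "ent l d (cd B)" using assms(2,3) Prf_ent 3 L.less_trans by blast
  ultimately show ?thesis by blast
qed

text \<open>The list puts \<open>D\<close> and \<open>MNeg D\<close> in the order that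
  \<open>w D\<close> prescribes. Earlier enumeration cannot reverse it: what appears before the bell
  is a theorem, and \<open>w\<close> respects theorems and refutable formulas.\<close>

lemma Rm_cd: assumes "Box D \<in> subf A" shows "Rm (cd D) \<longleftrightarrow> w D"
proof -
  note b = box_ys[OF assms] and a = assignment[unfolded assignment_def, rule_format, OF assms]
  show ?thesis
  proof (cases "w D")
    case True
    obtain i where i: "ent l i (cd D)"
      "\<And>C' j. (box_depth D, priority w D) < (box_depth C', priority w C') \<Longrightarrow> ent l j (cd C') \<Longrightarrow> i \<prec> j" by (rule ent_before[OF b(1)]) blast
    have "(box_depth D, priority w D) < (box_depth (MNeg D), priority w (MNeg D))" using True by simp
    then have n: "\<not> ent l j (cd (MNeg D))" if "j \<prec> i" for j using i(2) that L.less_asym by blast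
    have "\<not> Prf (ng (cd D)) z" if "z \<prec> S m \<oplus> i" for z
      using Prf_first[OF that ent_less_world_code[OF i(1)], of "MNeg D"] n a True b(4) unfolding ng_cd by auto
    moreover have "Prf (cd D) (S m \<oplus> i)" using Prf_ent[OF ent_less_world_code[OF i(1)]] i(1) by blast
    ultimately show ?thesis unfolding Rm_def using isfm_cd True by blast
  next
    case False
    obtain i where i: "ent l i (cd (MNeg D))"
      "\<And>C' j. (box_depth (MNeg D), priority w (MNeg D)) < (box_depth C', priority w C') \<Longrightarrow> ent l j (cd C') \<Longrightarrow> i \<prec> j" by (rule ent_before[OF b(2)]) blast
    have "(box_depth (MNeg D), priority w (MNeg D)) < (box_depth D, priority w D)" using False by simp
    then have n: "\<not> ent l j (cd D)" if "j \<preceq> i" for j using i(2) that L.not_less by blast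
    have "\<not> Prf (cd D) z" if z: "z \<preceq> S m \<oplus> i" for z
    proof (cases "z = S m \<oplus> i")
      case True then show ?thesis using Prf_ent[OF ent_less_world_code[OF i(1)]] n by simp
    next
      case False
      then have "z \<prec> S m \<oplus> i" using z by (simp add: L.less_le)
      then show ?thesis
        using Prf_first[OF _ ent_less_world_code[OF i(1)], of z D] n a \<open>\<not> w D\<close> b(4) L.less_imp_le by blast
    qed
    moreover have "Prf (cd (MNeg D)) (S m \<oplus> i)" using Prf_ent[OF ent_less_world_code[OF i(1)]] i(1) by blast
    ultimately have "negd (cd D)" unfolding negd_def ng_cd by blast
    then show ?thesis using negd_not_Rm False by blast
  qed
qed

lemma truth: "C \<in> subf A \<Longrightarrow> msat M e (interp \<tau> C) \<longleftrightarrow> meval (\<lambda>p. p \<in> set vs) w C"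
proof (induction C)
  case (MVar p) show ?case using msat_interp_MVar[OF first_bell] by simp
next
  case (Box D)
  then show ?case using Rm_cd[of D] by (simp add: msat_app_RF cd_def)
next
  case (MNeg B)
  have "B \<in> subf A" by (rule subf_trans[OF MNeg.prems]) simp
  then show ?case using MNeg.IH by simp
next
  case (MConj B C)
  have "B \<in> subf A" "C \<in> subf A" by (rule subf_trans[OF MConj.prems], simp)+
  then show ?case using MConj.IH by simp
next
  case (MDisj B C)
  have "B \<in> subf A" "C \<in> subf A" by (rule subf_trans[OF MDisj.prems], simp)+
  then show ?case using MDisj.IH by simp
next
  case (MImp B C)
  have "B \<in> subf A" "C \<in> subf A" by (rule subf_trans[OF MImp.prems], simp)+
  then show ?case using MImp.IH by simp
qed simp

end


section \<open>What can be proved before the bell\<close>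

context rosser_model begin

lemma imp_nm: "imp (nm (gn \<phi>)) (nm (gn \<psi>)) = nm (gn (Imp \<phi> \<psi>))"
  by (simp add: imp_def nm_add nm_mult nm_pair del: nm.simps)

text \<open>The implication has a standard proof, so from some standard stage on every proof of
  \<open>\<phi>\<close> satisfies the second clause of the bell.\<close>

lemma late_bell:
  assumes "T \<turnstile> Imp \<phi> (Neg (app (SF \<tau>) [numeral_tm k]))" "\<not> isfm (nm k)"
  obtains b where "\<And>t. nm b \<preceq> t \<Longrightarrow> Pf (nm (gn \<phi>)) t \<Longrightarrow> \<exists>k. bell t k"
proof -
  obtain p where p: "Pf (nm (gn (Imp \<phi> (Neg (app (SF \<tau>) [numeral_tm k]))))) (nm p)" using Pv_thm[OF assms(1)] by blast
  \<comment> \<open>Late enough to come after the proof \<open>p\<close> of the implication and to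
    satisfy the bound \<open>k \<preceq> t\<close>.\<close>
  have "\<exists>k. bell t k" if t: "nm (Suc p + k) \<preceq> t" "Pf (nm (gn \<phi>)) t" for t
  proof -
    have "nm k \<preceq> nm (Suc p + k)" "nm p \<prec> nm (Suc p + k)" unfolding nm_le nm_less by simp_all
    then have "nm k \<preceq> t" and l: "nm p \<prec> t" using t(1) L.order_trans L.less_le_trans by blast+
    have h: "hd' t = nm (gn \<phi>)" using t(2) unfolding Pf_def by blast
    have "Pf (imp (hd' t) (ng (SC (nm k)))) (nm p)" unfolding h SC_nm ng_nm imp_nm by (rule p)
    then have "bell_cond (nm k) t" unfolding bell_cond_def using l t(2) h assms(2) by metis
    then show ?thesis using \<open>nm k \<preceq> t\<close> by (rule bell_cond_bell)
  qed
  then show thesis by (rule that)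
qed

text \<open>A proof before the bell is either standard or late enough to ring the bell itself.\<close>

definition pre_sound :: "mfm \<Rightarrow> bool" where
  "pre_sound B \<longleftrightarrow> (\<forall>m k t. first_bell m k \<longrightarrow> t \<prec> m \<longrightarrow> Pf (cd B) t \<longrightarrow> NR4 B)"

end

context rosser begin

text \<open>Proofs can be padded by repetition, so every theorem is proved again at arbitrarily late
  stages.\<close>

lemma long_proof: assumes "T \<turnstile> \<phi>" shows "\<exists>t\<ge>b. eval (pproof \<tau>) [gn \<phi>, t] = 1"
proof -
  have "\<exists>L. is_proof T (\<phi> # L) \<and> b \<le> length L"
  proof (induction b)
    case 0 show ?case using assms unfolding derivable_iff by simp
  next
    case (Suc b)
    then obtain L where L: "is_proof T (\<phi> # L)" "b \<le> length L" by blast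
    then have "is_proof T ((\<phi> # L) @ (\<phi> # L))" using is_proof_append by blast
    then show ?case using L(2) by (intro exI[of _ "L @ \<phi> # L"]) simp
  qed
  then obtain L where L: "is_proof T (\<phi> # L)" "b \<le> length L" by blast
  have "eval (pproof \<tau>) [gn \<phi>, list_gn (\<phi> # L)] = 1" unfolding pproof_correct[OF T] using L(1) by blast
  moreover have "b \<le> list_gn (\<phi> # L)"
    using L(2) length_le_list_encode[of "map gn (\<phi> # L)"] unfolding list_gn_def by simp
  ultimately show ?thesis by blast
qed

text \<open>Otherwise a sufficiently late proof of \<open>\<phi>\<close> would ring the bell in the
  standard model.\<close>

lemma not_refute_SF:
  assumes "T \<turnstile> Imp \<phi> (Neg (app (SF \<tau>) [numeral_tm k]))" "\<forall>\<psi>. k \<noteq> gn \<psi>" shows "\<not> T \<turnstile> \<phi>"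
proof
  assume "T \<turnstile> \<phi>"
  interpret S: rosser_model T \<tau> stdM by (rule rm[OF pa_model_stdM])
  have "\<not> N.isfm (N.nm k)" using N.isfm_gn assms(2) by blast
  from S.late_bell[OF assms(1) this] obtain b where
    b: "\<And>t. N.le' (N.nm b) t \<Longrightarrow> N.Pf (N.nm (gn \<phi>)) t \<Longrightarrow> \<exists>k. N.bell t k" by blast
  obtain t where t: "b \<le> t" "eval (pproof \<tau>) [gn \<phi>, t] = 1" using long_proof[OF \<open>T \<turnstile> \<phi>\<close>] by blast
  have "N.le' (N.nm b) (N.nm t)" using t(1) by (simp only: N.nm_le)
  moreover have "N.Pf (N.nm (gn \<phi>)) (N.nm t)" using t(2) by (simp only: N.Pf_nm)
  ultimately show False using b N_no_bell by blast
qed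

lemma ex_separating:
  assumes "\<not> NR4 A" and IH: "\<And>B (M :: nat mstr). box_depth B < box_depth A \<Longrightarrow> pa_model M \<Longrightarrow> rosser_model.pre_sound \<tau> M B"
  obtains k where "\<forall>\<psi>. k \<noteq> gn \<psi>" "T \<turnstile> Imp (interp \<tau> A) (Neg (app (SF \<tau>) [numeral_tm k]))"
proof -
  obtain v w where vw: "\<not> meval v w A" "assignment A w" using ex_assignment[OF assms(1)] .
  obtain ys where ys: "set ys = subf A \<union> MNeg ` subf A" "sorted (map (\<lambda>B. (box_depth B, priority w B)) ys)"
    using ex_enumeration .
  \<comment> \<open>A world code has room for finitely many true variables; the variables that occur
    in \<open>A\<close> are enough for its value.\<close>
  have "finite (MVar -` subf A)" by (rule finite_vimageI) (simp_all add: inj_def)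
  then have "finite {p. MVar p \<in> subf A \<and> v p}" by (rule rev_finite_subset) auto
  from finite_list[OF this] obtain vs where vs: "set vs = {p. MVar p \<in> subf A \<and> v p}" ..
  have "meval (\<lambda>p. p \<in> set vs) w A = meval v w A" by (rule meval_cong) (simp add: vs)
  then have nA: "\<not> meval (\<lambda>p. p \<in> set vs) w A" using vw(1) by simp
  let ?k = "world_code vs (cdl \<tau> ys)"
  have "PA \<turnstile> Imp (interp \<tau> A) (Neg (app (SF \<tau>) [numeral_tm ?k]))"
  proof (rule PA_complete)
    fix M :: "nat mstr" and e assume M: "pa_model M"
    then interpret M: rosser_model T \<tau> M by (rule rm)
    have "\<not> msat M e (interp \<tau> A)" if S: "M.Sm (M.nm ?k)"
    proof -
      obtain m where m: "M.first_bell m (M.nm ?k)" using M.Sm_first_bell[OF S M.isfm_world_code] .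
      interpret W: world T \<tau> M A w ys vs m
      proof
        show "NR4 B" if "box_depth B < box_depth A" "les M t m" "M.Pf (M.cd B) t" for B t
          using IH[OF that(1) M] m that unfolding M.pre_sound_def by blast
      qed (use vw(2) ys m in blast)+
      show ?thesis using W.truth[of A] nA by simp
    qed
    then show "msat M e (Imp (interp \<tau> A) (Neg (app (SF \<tau>) [numeral_tm ?k])))" by (auto simp: M.msat_app_SF)
  qed
  then have "T \<turnstile> Imp (interp \<tau> A) (Neg (app (SF \<tau>) [numeral_tm ?k]))" by (rule PA_imp_T)
  moreover have "\<forall>\<psi>. ?k \<noteq> gn \<psi>" using world_code_not_gn by blast
  ultimately show thesis by (rule that[rotated])
qed

lemma pre_sound: "pa_model (M :: nat mstr) \<Longrightarrow> rosser_model.pre_sound \<tau> M B"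
proof (induction "box_depth B" arbitrary: M B rule: less_induct)
  case less
  interpret M: rosser_model T \<tau> M by (rule rm[OF less.prems])
  show ?case unfolding M.pre_sound_def
  proof (intro allI impI)
    fix m k t assume m: "M.first_bell m k" and t: "les M t m" "M.Pf (M.cd B) t"
    show "NR4 B"
    proof (rule ccontr)
      assume "\<not> NR4 B"
      then obtain k where k: "\<forall>\<psi>. k \<noteq> gn \<psi>" "T \<turnstile> Imp (interp \<tau> B) (Neg (app (SF \<tau>) [numeral_tm k]))"
        using ex_separating less.hyps by metis
      have "\<not> M.isfm (M.nm k)" using M.isfm_gn k(1) by blast
      from M.late_bell[OF k(2) this] obtain b where
        b: "\<And>t. M.le' (M.nm b) t \<Longrightarrow> M.Pf (M.nm (gn (interp \<tau> B))) t \<Longrightarrow> \<exists>k. M.bell t k" by blast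
      show False
      \<comment> \<open>Below the standard bound \<open>b\<close> the proof is standard and
        \<open>T\<close> itself proves the translation, against \<open>not_refute_SF\<close>; from
        \<open>b\<close> on it rings a bell before the first one.\<close>
      proof (cases "les M t (M.nm b)")
        case True
        then obtain n where "t = M.nm n" unfolding M.less_nm by blast
        then have "T \<turnstile> interp \<tau> B" using t(2) unfolding M.cd_def using M.Pf_nm pproof_derivable[OF T] by blast
        then show False using not_refute_SF[OF k(2,1)] by blast
      next
        case False
        then have "M.le' (M.nm b) t" by (simp add: M.L.not_less)
        then have "\<exists>k. M.bell t k" using b t(2) unfolding M.cd_def by blast
        then show False using m t(1) unfolding M.first_bell_def by blast
      qed
    qed
  qed
qed

lemma NR4_complete: assumes "T \<turnstile> interp \<tau> A" shows "NR4 A"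
proof (rule ccontr)
  assume "\<not> NR4 A"
  then obtain k where "\<forall>\<psi>. k \<noteq> gn \<psi>" "T \<turnstile> Imp (interp \<tau> A) (Neg (app (SF \<tau>) [numeral_tm k]))"
    using ex_separating pre_sound by metis
  then show False using not_refute_SF assms by blast
qed

end

theorem theorem7p1:
  fixes T :: "fm set" and \<tau> :: pr
  assumes "pr_axiomatized \<tau> T"
    and "consistent T"
    and "\<forall>\<phi>\<in>PA. T \<turnstile> \<phi>"
  shows "\<exists>R. rosser_predicate \<tau> R \<and>
    (\<forall>A f. arithmetical_interpretation R f \<longrightarrow> NR4 A \<longrightarrow> PA \<turnstile> f A) \<and>
    (\<exists>f. arithmetical_interpretation R f \<and> (\<forall>A. NR4 A \<longleftrightarrow> T \<turnstile> f A))"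
proof -
  interpret rosser T \<tau> using assms by unfold_locales
  show ?thesis
    using rosser_predicate_RF NR4_sound interpretation_interp[of \<tau>] NR4_complete PA_imp_T by blast
qed

end
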